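(* Let $G$ be a network with controlled stationary measure such that $\|P\|_{\mathrm{bub}}<\infty$, and let $\mathfrak F$ be the (oriented) wired uniform spanning forest of $G$, with $\mathfrak P(v)$ denoting the past of $v$ in $\mathfrak F$. Then there exist constants $0<c\le C<\infty$, depending only on $G$, such that for every $v\in V$ and every $R\ge 1$, $$ c\,q(v)R^{-1}\le \mathbb P\bigl(\mathrm{diam}_{\mathrm{int}}(\mathfrak P(v))\ge R\bigr)\le C R^{-1}$$ and $$ c\,q(v)^{5/2}R^{-1/2}\le \mathbb P\bigl(|\mathfrak P(v)|\ge R\bigr)\le C R^{-1/2}.$$
   Context: A network is a connected graph $G=(V,E)$ (loops and multiple edges allowed) together with conductances $c:E\to(0,\infty)$ such that the vertex conductance $c(v)$, the sum of $c(e)$ over edges $e$ incident to $v$, is finite for every $v\in V$. It has controlled stationary measure if there is a constant $A>0$ with $A^{-1}\le c(v)\le A$ for every $v\in V$. The random walk on $G$ at each step crosses an edge emanating from its current position chosen with probability proportional to its conductance; $P$ is its Markov operator and $p_n(u,v)$ is the probability that the walk started at $u$ is at $v$ at time $n$. Set $\|P^n\|_{1\to\infty}=\sup_{u,v\in V}p_n(u,v)$ and $\|P\|_{\mathrm{bub}}=\sum_{n\ge0}(n+1)\|P^n\|_{1\to\infty}$. (If it is finite then $G$ is infinite and transient.) $q(v)$ is the probability that two independent random walks $X,Y$ started at $v$ never return to $v$ or intersect each other after time zero, i.e. that $\{X_i:i>0\}$, $\{Y_i:i>0\}$ and $\{v\}$ are mutually disjoint. Wired uniform spanning forest (WUSF):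 the uniform spanning tree of a finite network is the random spanning tree chosen with probability proportional to the product of the conductances of its edges. Let $(V_n)$ be an increasing sequence of finite sets with union $V$, and let $G_n^*$ be obtained from $G$ by contracting $V\setminus V_n$ to a single vertex $\partial_n$ and deleting the resulting self-loops at $\partial_n$. Orient the uniform spanning tree of $G_n^*$ towards $\partial_n$. For transient $G$, the oriented WUSF of $G$ is the weak limit of these random oriented trees (it exists and does not depend on the exhaustion); almost surely every vertex has exactly one outgoing edge in it. The past $\mathfrak P(v)$ of $v$ is the subgraph of $\mathfrak F$ induced by $v$ together with all vertices $u$ in the same tree as $v$ such that every edge of the path from $u$ to $v$ in $\mathfrak F$ is oriented in the direction of $v$. $\mathrm{diam}_{\mathrm{int}}(K)$ is the diameter of the graph $K$ in its own graph metric, and $|K|$ is its number of vertices. *)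

theory Defs
  imports "HOL-Probability.Probability"
begin

text \<open>
  Graphs may have loops and multiple edges, and vertices may be incident to infinitely many edges:
  an edge \<open>e\<close> has the set \<open>ends G e\<close> of its one (loop) or two endpoints.
\<close>

record ('v, 'e) mgraph =
  verts :: "'v set"
  edges :: "'e set"
  ends :: "'e \<Rightarrow> 'v set"

record ('v, 'e) network = "('v, 'e) mgraph" +
  cond :: "'e \<Rightarrow> real"

definition wf_graph :: "('v, 'e, 'z) mgraph_scheme \<Rightarrow> bool" where
  "wf_graph G \<longleftrightarrow> (\<forall>e\<in>edges G. \<exists>u\<in>verts G. \<exists>w\<in>verts G. ends G e = {u, w})"

definition adj :: "('v, 'e, 'z) mgraph_scheme \<Rightarrow> 'v rel" where
  "adj G = {(u, w). \<exists>e\<in>edges G. ends G e = {u, w}}"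

definition connected_graph :: "('v, 'e, 'z) mgraph_scheme \<Rightarrow> bool" where
  "connected_graph G \<longleftrightarrow> verts G \<noteq> {} \<and> (\<forall>u\<in>verts G. \<forall>w\<in>verts G. (u, w) \<in> (adj G)\<^sup>*)"

text \<open>Loops are cycles of length one, and two parallel edges form a cycle of length two.\<close>

definition is_cycle :: "('v, 'e, 'z) mgraph_scheme \<Rightarrow> 'v list \<Rightarrow> 'e list \<Rightarrow> bool" where
  "is_cycle G vs es \<longleftrightarrow>
     es \<noteq> [] \<and> length vs = length es \<and> distinct vs \<and> distinct es \<and> set es \<subseteq> edges G \<and>
     (\<forall>i<length es. ends G (es ! i) = {vs ! i, vs ! (Suc i mod length es)})"

definition is_tree :: "('v, 'e, 'z) mgraph_scheme \<Rightarrow> bool" where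
  "is_tree G \<longleftrightarrow> connected_graph G \<and> (\<nexists>vs es. is_cycle G vs es)"

definition graph_dist :: "('v, 'e, 'z) mgraph_scheme \<Rightarrow> 'v \<Rightarrow> 'v \<Rightarrow> enat" where
  "graph_dist G u w = (INF n\<in>{n. (u, w) \<in> adj G ^^ n}. enat n)"

definition graph_diam :: "('v, 'e, 'z) mgraph_scheme \<Rightarrow> enat" where
  "graph_diam G = (SUP u\<in>verts G. SUP w\<in>verts G. graph_dist G u w)"

definition num_verts :: "('v, 'e, 'z) mgraph_scheme \<Rightarrow> enat" where
  "num_verts G = (if finite (verts G) then enat (card (verts G)) else \<infinity>)"


section \<open>Networks and random walk\<close>

definition incident :: "('v, 'e, 'z) mgraph_scheme \<Rightarrow> 'v \<Rightarrow> 'e set" where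
  "incident G v = {e \<in> edges G. v \<in> ends G e}"

definition is_network :: "('v, 'e) network \<Rightarrow> bool" where
  "is_network G \<longleftrightarrow> wf_graph G \<and> connected_graph G \<and> (\<forall>e\<in>edges G. 0 < cond G e) \<and>
     (\<forall>v\<in>verts G. cond G summable_on incident G v)"

text \<open>A loop at \<open>v\<close> is a single edge incident to \<open>v\<close>, so it is counted once.\<close>

definition vcond :: "('v, 'e) network \<Rightarrow> 'v \<Rightarrow> real" where
  "vcond G v = (\<Sum>\<^sub>\<infinity>e\<in>incident G v. cond G e)"

definition controlled_stationary_measure :: "('v, 'e) network \<Rightarrow> bool" where
  "controlled_stationary_measure G \<longleftrightarrow>
     (\<exists>A>0. \<forall>v\<in>verts G. inverse A \<le> vcond G v \<and> vcond G v \<le> A)"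

definition other_end :: "('v, 'e, 'z) mgraph_scheme \<Rightarrow> 'v \<Rightarrow> 'e \<Rightarrow> 'v" where
  "other_end G u e = (THE w. ends G e = {u, w})"

definition walk_edge :: "('v, 'e) network \<Rightarrow> 'v \<Rightarrow> 'e pmf" where
  "walk_edge G u = embed_pmf (\<lambda>e. if e \<in> incident G u then cond G e / vcond G u else 0)"

definition walk_step :: "('v, 'e) network \<Rightarrow> 'v \<Rightarrow> 'v pmf" where
  "walk_step G u = map_pmf (other_end G u) (walk_edge G u)"

text \<open>
  The law of the random walk \<open>(X\<^sub>0, X\<^sub>1, \<dots>)\<close> started at \<open>v\<close>, as a measure on \<open>\<nat> \<rightarrow> verts G\<close>: the
  Ionescu-Tulcea measure in which the \<open>i\<close>-th coordinate, given the earlier ones, is drawn from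
  \<open>walk_kernel G v i\<close>.
\<close>

definition walk_kernel :: "('v, 'e) network \<Rightarrow> 'v \<Rightarrow> nat \<Rightarrow> (nat \<Rightarrow> 'v) \<Rightarrow> 'v measure" where
  "walk_kernel G v i X =
     (case i of
        0 \<Rightarrow> return (count_space (verts G)) v
      | Suc j \<Rightarrow> restrict_space (measure_pmf (walk_step G (X j))) (verts G))"

definition walk_law :: "('v, 'e) network \<Rightarrow> 'v \<Rightarrow> (nat \<Rightarrow> 'v) measure" where
  "walk_law G v =
     projective_family.lim UNIV
       (Ionescu_Tulcea.CI (walk_kernel G v) (\<lambda>_. count_space (verts G)))
       (\<lambda>_. count_space (verts G))"

definition trans_prob :: "('v, 'e) network \<Rightarrow> nat \<Rightarrow> 'v \<Rightarrow> 'v \<Rightarrow> real" where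
  "trans_prob G n u v = \<P>(X in walk_law G u. X n = v)"

definition norm_1_inf :: "('v, 'e) network \<Rightarrow> nat \<Rightarrow> ennreal" where
  "norm_1_inf G n = (SUP u\<in>verts G. SUP v\<in>verts G. ennreal (trans_prob G n u v))"

definition bubble_norm :: "('v, 'e) network \<Rightarrow> ennreal" where
  "bubble_norm G = (\<Sum>n. of_nat (n + 1) * norm_1_inf G n)"

definition q_prob :: "('v, 'e) network \<Rightarrow> 'v \<Rightarrow> real" where
  "q_prob G v =
     \<P>((X, Y) in walk_law G v \<Otimes>\<^sub>M walk_law G v.
        {X i |i. i > 0} \<inter> {Y i |i. i > 0} = {} \<and> v \<notin> {X i |i. i > 0} \<and> v \<notin> {Y i |i. i > 0})"


section \<open>Uniform spanning trees and the oriented wired uniform spanning forest\<close>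

definition spanning_trees :: "('v, 'e) network \<Rightarrow> 'e set set" where
  "spanning_trees G = {T. T \<subseteq> edges G \<and> is_tree (G\<lparr>edges := T\<rparr>)}"

text \<open>
  Used for networks with finitely many vertices.  Contracting the complement of a finite set may
  produce infinitely many parallel edges (with summable conductances), so that there may be
  countably many spanning trees; hence the infinite sum in the normalisation.
\<close>

definition ust :: "('v, 'e) network \<Rightarrow> 'e set pmf" where
  "ust G = embed_pmf (\<lambda>T. if T \<in> spanning_trees G
     then (\<Prod>e\<in>T. cond G e) / (\<Sum>\<^sub>\<infinity>S\<in>spanning_trees G. \<Prod>e\<in>S. cond G e) else 0)"

text \<open>
  An oriented edge is a pair \<open>(u, e)\<close>: the edge \<open>e\<close>, oriented away from its endpoint \<open>u\<close>.
  The edges of the tree \<open>T\<close> are oriented so as to decrease the distance in \<open>T\<close> to the root \<open>r\<close>.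
\<close>

definition orient_towards :: "('v, 'e, 'z) mgraph_scheme \<Rightarrow> 'v \<Rightarrow> 'e set \<Rightarrow> ('v \<times> 'e) set" where
  "orient_towards G r T = {(u, e). e \<in> T \<and> (\<exists>w. ends G e = {u, w} \<and>
     graph_dist (G\<lparr>edges := T\<rparr>) w r < graph_dist (G\<lparr>edges := T\<rparr>) u r)}"

text \<open>
  The vertices outside \<open>W\<close> are contracted to the single vertex \<open>None\<close>.  Edges keep their names;
  those with no endpoint in \<open>W\<close> are exactly the ones that would become loops at \<open>None\<close>.
\<close>

definition wired :: "('v, 'e) network \<Rightarrow> 'v set \<Rightarrow> ('v option, 'e) network" where
  "wired G W =
     \<lparr> verts = insert None (Some ` W),
       edges = {e \<in> edges G. ends G e \<inter> W \<noteq> {}},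
       ends = (\<lambda>e. (\<lambda>u. if u \<in> W then Some u else None) ` ends G e),
       cond = cond G \<rparr>"

text \<open>
  Random oriented subgraphs are identified with their indicator functions on oriented edges, and
  their laws are Borel measures for the product topology.  No oriented edge of the wired spanning
  tree starts at \<open>None\<close>, so the tree is faithfully represented by oriented edges of \<open>G\<close>.
\<close>

definition wired_ust_law :: "('v, 'e) network \<Rightarrow> 'v set \<Rightarrow> ('v \<times> 'e \<Rightarrow> bool) measure" where
  "wired_ust_law G W = distr (measure_pmf (ust (wired G W))) borel
     (\<lambda>T (u, e). (Some u, e) \<in> orient_towards (wired G W) None T)"

definition weakly_converges :: "(nat \<Rightarrow> 'a::topological_space measure) \<Rightarrow> 'a measure \<Rightarrow> bool" where
  "weakly_converges M L \<longleftrightarrow> (\<forall>f::'a \<Rightarrow> real. continuous_on UNIV f \<and> bounded (range f) \<longrightarrow>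
     (\<lambda>n. integral\<^sup>L (M n) f) \<longlonglongrightarrow> integral\<^sup>L L f)"

definition exhaustion :: "('v, 'e, 'z) mgraph_scheme \<Rightarrow> (nat \<Rightarrow> 'v set) \<Rightarrow> bool" where
  "exhaustion G W \<longleftrightarrow> incseq W \<and> (\<forall>n. finite (W n)) \<and> (\<Union>n. W n) = verts G"

definition is_oriented_wusf :: "('v, 'e) network \<Rightarrow> ('v \<times> 'e \<Rightarrow> bool) measure \<Rightarrow> bool" where
  "is_oriented_wusf G \<mu> \<longleftrightarrow> prob_space \<mu> \<and> sets \<mu> = sets borel \<and>
     (\<exists>W. exhaustion G W \<and> weakly_converges (\<lambda>n. wired_ust_law G (W n)) \<mu>)"


section \<open>The past of a vertex\<close>

definition forest_arcs :: "('v, 'e, 'z) mgraph_scheme \<Rightarrow> ('v \<times> 'e \<Rightarrow> bool) \<Rightarrow> 'v rel" where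
  "forest_arcs G F = {(u, w). \<exists>e\<in>edges G. F (u, e) \<and> ends G e = {u, w}}"

text \<open>
  A vertex \<open>u\<close> is in the past of \<open>v\<close> iff some, possibly empty, directed path of the forest \<open>F\<close>
  leads from \<open>u\<close> to \<open>v\<close>.
\<close>

definition past :: "('v, 'e, 'z) mgraph_scheme \<Rightarrow> ('v \<times> 'e \<Rightarrow> bool) \<Rightarrow> 'v \<Rightarrow> ('v, 'e) mgraph" where
  "past G F v = (let K = {u. (u, v) \<in> (forest_arcs G F)\<^sup>*} in
     \<lparr> verts = K,
       edges = {e \<in> edges G. ends G e \<subseteq> K \<and> (\<exists>u\<in>ends G e. F (u, e))},
       ends = ends G \<rparr>)"

end

(*
  A rooted forest on a finite set of vertices is a function whose orbits all leave the set; its weight is a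
  product of transition probabilities, and the wired spanning tree of a finite network, oriented towards
  the root, is such a forest with the law of independent out-edges conditioned on acyclicity.  Resampling a
  single out-edge gives Wilson's algorithm in the form of partition function identities: hitting
  probabilities, Green functions and escape probabilities are quotients of partition functions of forests.

  Upper bounds.  The Aldous-Broder chain started at v preserves the law of the forest, so over an excursion
  from v the expected number of deep past paths of v destroyed is at most the expected number created.
  A past path of length N typically has capacity of order N because the bubble sum is finite, so an excursion
  hits it often; atypical paths below a vertex whose past has depth N contribute Q(N)/8 by the Markov
  property of the forest along a path.  This yields a recursion of the form
  Q(4N) <= c/N + Q(N)/8 for the probability Q(N) that the past of a vertex has depth N, uniformly over
  networks with killing, whence Q(N) <= C/N.  The volume bound follows from this and the linear bound on
  the expected number of past vertices at distance at most sqrt R.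

  Lower bounds.  By Wilson's algorithm and reversibility the expected number of past vertices at distance j is
  at least a constant times q(v), since the future of v is a subset of the range of a random walk.  The
  second moment of the number of past vertices at distance between r and 2r is at most C r^2 times its mean.
  With r = R this bounds the diameter from below; with r of order (sqrt R)/q(v), after discarding
  small values with the upper volume tail, it bounds the volume from below by q(v)^2 (sqrt R)^(-1).

  All bounds are uniform in the exhaustion, and pass to the limit through events depending on
  finitely many oriented edges.
*)
theory Submission
  imports Defs
begin

section \<open>Rooted forests, Green functions and escape probabilities\<close>

text \<open>Up to the limit every statement is about finite sums over maps, so that no random
  stacks, coupled walks or conditional laws have to be constructed: forests are compared with the
  walk only through harmonic functions, and uniqueness for the Dirichlet problem does the work of
  path decompositions. Two obstacles shape the recursion for the depth. Conditioning on a past path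
  turns its start into a root, while the recursion speaks of vertices that are not roots. A vertex
  killed with probability at least 1/2 is comparable with a root, so the recursion is run for all
  walks with additional killing at once; one bubble bound serves them all, because killing only
  lowers transition weights. And the bubble sum bounds the past paths of length up to
  \<open>N\<close> only in total, not length by length, which forces an average over lengths.
  Vertices may have infinitely many edges, so the path counts in the lower bounds are restricted to
  finitely many vertices and edges before the limit is taken. The volume bound obtained has the
  factor q^2, which is at least q^(5/2) because q is at most 1.\<close>

lemma funpow_upd_avoid:
  assumes "\<And>k. k < n \<Longrightarrow> (f ^^ k) y \<noteq> x"
  shows "(f(x := z) ^^ n) y = (f ^^ n) y"
  using assms by (induction n) auto

lemma funpow_fixed: "f x = x \<Longrightarrow> (f ^^ n) x = x"
  by (induction n) auto

lemma funpow_add_apply: "(f ^^ (m + n)) x = (f ^^ m) ((f ^^ n) x)"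
  by (simp add: funpow_add)

lemma funpow_Suc_right_apply: "(f ^^ Suc n) x = (f ^^ n) (f x)"
  by (simp add: funpow_swap1)

definition reach :: "('a \<Rightarrow> 'a) \<Rightarrow> 'a \<Rightarrow> 'a \<Rightarrow> bool" where
  "reach f x y \<longleftrightarrow> (\<exists>n. (f ^^ n) x = y)"

lemma reach_refl [simp]: "reach f x x"
  unfolding reach_def by (rule exI[of _ 0]) simp

lemma reach_step: "reach f (f x) y \<Longrightarrow> reach f x y"
  unfolding reach_def using funpow_Suc_right_apply by metis

lemma reach_trans: "reach f x y \<Longrightarrow> reach f y z \<Longrightarrow> reach f x z"
  unfolding reach_def by (metis funpow_add_apply)

lemma reach_fixed: "f x = x \<Longrightarrow> reach f x y \<longleftrightarrow> x = y"
  unfolding reach_def by (auto simp: funpow_fixed)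

lemma reach_cases: "reach f x y \<longleftrightarrow> x = y \<or> reach f (f x) y"
proof
  assume "reach f x y"
  then obtain n where "(f ^^ n) x = y" by (auto simp: reach_def)
  then show "x = y \<or> reach f (f x) y"
    by (cases n) (auto simp: reach_def funpow_swap1)
qed (auto intro: reach_step)

lemma funpow_upd_not_reach: "\<not> reach f y x \<Longrightarrow> (f(x := z) ^^ n) y = (f ^^ n) y"
  by (rule funpow_upd_avoid) (auto simp: reach_def)

lemma reach_upd_not_reach: "\<not> reach f y x \<Longrightarrow> reach (f(x := z)) y w \<longleftrightarrow> reach f y w"
  by (simp add: reach_def funpow_upd_not_reach)

lemma reach_least:
  assumes "reach f y x"
  obtains n where "(f ^^ n) y = x" "\<And>k. k < n \<Longrightarrow> (f ^^ k) y \<noteq> x"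
proof -
  obtain n0 where "(f ^^ n0) y = x" using assms by (auto simp: reach_def)
  then have "(f ^^ (LEAST n. (f ^^ n) y = x)) y = x" by (rule LeastI)
  moreover have "(f ^^ k) y \<noteq> x" if "k < (LEAST n. (f ^^ n) y = x)" for k
    using not_less_Least[OF that] .
  ultimately show thesis by (rule that)
qed

lemma reach_upd_reach: "reach f y x \<Longrightarrow> reach (f(x := z)) y x"
proof -
  assume "reach f y x"
  then obtain n where n: "(f ^^ n) y = x" "\<And>k. k < n \<Longrightarrow> (f ^^ k) y \<noteq> x" by (rule reach_least) blast
  then have "(f(x := z) ^^ n) y = x" by (simp add: funpow_upd_avoid)
  then show ?thesis by (auto simp: reach_def)
qed

lemma reach_upd_iff: "reach (f(x := z)) y x \<longleftrightarrow> reach f y x"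
  by (metis reach_upd_reach reach_upd_not_reach)

lemma reach_linear:
  assumes "reach f y a" "reach f y c"
  shows "reach f a c \<or> reach f c a"
proof -
  obtain i j where ij: "(f ^^ i) y = a" "(f ^^ j) y = c" using assms by (auto simp: reach_def)
  show ?thesis
  proof (cases "i \<le> j")
    case True
    then have "(f ^^ (j - i)) a = c" using ij by (metis funpow_add_apply le_add_diff_inverse2)
    then show ?thesis by (auto simp: reach_def)
  next
    case False
    then have "(f ^^ (i - j)) c = a" using ij by (metis funpow_add_apply le_add_diff_inverse2 nat_le_linear)
    then show ?thesis by (auto simp: reach_def)
  qed
qed

text \<open>
  The vertices outside \<open>W\<close> are roots and are represented as fixed points.
\<close>

definition forests :: "'a set \<Rightarrow> 'a set \<Rightarrow> ('a \<Rightarrow> 'a) set" where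
  "forests S W = {f. (\<forall>x\<in>W. f x \<in> S) \<and> (\<forall>x. x \<notin> W \<longrightarrow> f x = x) \<and> (\<forall>x\<in>W. \<exists>n. (f ^^ n) x \<notin> W)}"

lemma forests_in: "f \<in> forests S W \<Longrightarrow> x \<in> W \<Longrightarrow> f x \<in> S"
  and forests_out: "f \<in> forests S W \<Longrightarrow> x \<notin> W \<Longrightarrow> f x = x"
  by (auto simp: forests_def)

lemma forests_exit: "f \<in> forests S W \<Longrightarrow> \<exists>n. (f ^^ n) x \<notin> W"
  by (cases "x \<in> W") (auto simp: forests_def intro: exI[of _ "0::nat"])

lemma forests_funpow_in: "f \<in> forests S W \<Longrightarrow> x \<in> S \<Longrightarrow> (f ^^ n) x \<in> S"
  by (induction n) (auto, metis forests_in forests_out)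

lemma forests_stay: 
  assumes f: "f \<in> forests S W" and "(f ^^ n) x \<notin> W" "n \<le> m"
  shows "(f ^^ m) x = (f ^^ n) x"
proof -
  have "(f ^^ m) x = (f ^^ (m - n)) ((f ^^ n) x)" using assms by (metis funpow_add_apply le_add_diff_inverse2)
  then show ?thesis using assms by (simp add: funpow_fixed forests_out[OF f])
qed

lemma forests_no_cycle:
  assumes f: "f \<in> forests S W" and x: "x \<in> W"
  shows "(f ^^ Suc n) x \<noteq> x"
proof
  assume c: "(f ^^ Suc n) x = x"
  have per: "(f ^^ (k * Suc n)) x = x" for k
    by (induction k) (simp, metis c funpow_add_apply mult_Suc)
  obtain N where N: "(f ^^ N) x \<notin> W" using forests_exit[OF f] by blast
  have "(f ^^ (N * Suc n)) x = (f ^^ N) x" by (rule forests_stay[OF f N]) simp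
  then show False using per[of N] N x by simp
qed

lemma forests_ne: "f \<in> forests S W \<Longrightarrow> x \<in> W \<Longrightarrow> f x \<noteq> x"
  using forests_no_cycle[of f S W x 0] by simp

lemma forests_antisym:
  assumes f: "f \<in> forests S W" and "reach f x y" "reach f y x"
  shows "x = y"
proof (rule ccontr)
  assume ne: "x \<noteq> y"
  obtain i j where ij: "(f ^^ i) x = y" "(f ^^ j) y = x" using assms by (auto simp: reach_def)
  have "i \<noteq> 0" using ij ne by (cases i) auto
  then obtain k where k: "j + i = Suc k" by (cases "j + i") auto
  have "(f ^^ (j + i)) x = x" using ij by (simp add: funpow_add_apply)
  then have "x \<notin> W" using forests_no_cycle[OF f] k by metis
  then show False using ij ne funpow_fixed[of f x i] forests_out[OF f] by auto
qed

lemma finite_forests: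
  assumes "finite S" "finite W" shows "finite (forests S W)"
proof (rule finite_subset)
  show "forests S W \<subseteq> (\<lambda>g x. if x \<in> W then g x else x) ` (W \<rightarrow>\<^sub>E S)"
  proof
    fix f assume f: "f \<in> forests S W"
    have "f = (\<lambda>x. if x \<in> W then (restrict f W) x else x)"
      using forests_out[OF f] by auto
    moreover have "restrict f W \<in> W \<rightarrow>\<^sub>E S" using forests_in[OF f] by auto
    ultimately show "f \<in> (\<lambda>g x. if x \<in> W then g x else x) ` (W \<rightarrow>\<^sub>E S)" by blast
  qed
  show "finite ((\<lambda>g x. if x \<in> W then g x else x) ` (W \<rightarrow>\<^sub>E S))"
    using assms by (intro finite_imageI finite_PiE) auto
qed

text \<open>Cutting the arc of \<open>x\<close> makes \<open>x\<close> a root, and the old target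
  cannot lead back to it. With \<open>forests_upd\<close> this is a bijection between forests on
  \<open>W\<close> and pairs of a forest on \<open>W - {x}\<close> and a target not leading to
  \<open>x\<close>; every recursion for partition functions comes from it.\<close>

lemma forests_reset:
  assumes f: "f \<in> forests S W" and x: "x \<in> W"
  shows "f(x := x) \<in> forests S (W - {x})" "\<not> reach (f(x := x)) (f x) x"
proof -
  let ?g = "f(x := x)"
  have "\<exists>n. (?g ^^ n) y \<notin> W - {x}" for y
  proof -
    have ex: "\<exists>k. (f ^^ k) y \<notin> W - {x}" using forests_exit[OF f] by blast
    define k where "k = (LEAST k. (f ^^ k) y \<notin> W - {x})"
    have k: "(f ^^ k) y \<notin> W - {x}" unfolding k_def using ex by (rule LeastI_ex)
    have "(f ^^ j) y \<noteq> x" if "j < k" for j using not_less_Least[of j "\<lambda>k. (f ^^ k) y \<notin> W - {x}"] that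
      unfolding k_def[symmetric] by auto
    then have "(?g ^^ k) y = (f ^^ k) y" by (rule funpow_upd_avoid)
    then show ?thesis using k by metis
  qed
  then show "?g \<in> forests S (W - {x})"
    using f by (auto simp: forests_def)
  show "\<not> reach ?g (f x) x"
  proof
    assume "reach ?g (f x) x"
    then have "reach f (f x) x" by (simp add: reach_upd_iff)
    then obtain n where "(f ^^ n) (f x) = x" by (auto simp: reach_def)
    then have "(f ^^ Suc n) x = x" by (simp add: funpow_swap1)
    then show False using forests_no_cycle[OF f x] by blast
  qed
qed

lemma forests_upd:
  assumes g: "g \<in> forests S (W - {x})" and x: "x \<in> W" and y: "y \<in> S" and nr: "\<not> reach g y x"
  shows "g(x := y) \<in> forests S W"
proof -
  let ?f = "g(x := y)"
  have xe: "\<exists>n. (?f ^^ n) x \<notin> W"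
  proof -
    obtain n where n: "(g ^^ n) y \<notin> W - {x}" using forests_exit[OF g] by blast
    have "(g ^^ n) y \<noteq> x" using nr by (auto simp: reach_def)
    then have "(?f ^^ n) y \<notin> W" using n funpow_upd_not_reach[OF nr] by auto
    moreover have "(?f ^^ Suc n) x = (?f ^^ n) y" by (simp add: funpow_swap1)
    ultimately show ?thesis by metis
  qed
  have "\<exists>n. (?f ^^ n) z \<notin> W" for z
  proof (cases "reach g z x")
    case True
    then obtain k where "(?f ^^ k) z = x" using reach_upd_reach[of g z x y] by (auto simp: reach_def)
    moreover obtain n where "(?f ^^ n) x \<notin> W" using xe by blast
    ultimately have "(?f ^^ (n + k)) z \<notin> W" by (simp add: funpow_add_apply)
    then show ?thesis by blast
  next
    case False
    obtain n where n: "(g ^^ n) z \<notin> W - {x}" using forests_exit[OF g] by blast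
    have "(g ^^ n) z \<noteq> x" using False by (auto simp: reach_def)
    then show ?thesis using n funpow_upd_not_reach[OF False] by (intro exI[of _ n]) auto
  qed
  then show ?thesis using g x y by (auto simp: forests_def)
qed

section \<open>Killed transition weights and partition functions of forests\<close>

fun pw :: "('a \<Rightarrow> 'a \<Rightarrow> real) \<Rightarrow> 'a set \<Rightarrow> nat \<Rightarrow> 'a \<Rightarrow> 'a \<Rightarrow> real" where
  "pw P W 0 x y = (if x \<in> W \<and> x = y then 1 else 0)"
| "pw P W (Suc n) x y = (if x \<in> W then (\<Sum>z\<in>W. P x z * pw P W n z y) else 0)"

text \<open>\<open>bd\<close> is the root. The bound by \<open>b\<close> is imposed on the largest
  domain only and passes to subdomains by monotonicity of \<open>pw\<close>. The weight
  \<open>real n + 1\<close> is that of the bubble sum; summability also forces the chain to leave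
  every domain.\<close>

locale chain =
  fixes S :: "'a set" and bd :: 'a and P :: "'a \<Rightarrow> 'a \<Rightarrow> real" and b :: "nat \<Rightarrow> real"
  assumes fin_S: "finite S" and bd_S: "bd \<in> S"
    and P_nonneg: "\<And>x y. 0 \<le> P x y"
    and row: "\<And>x. x \<in> S \<Longrightarrow> x \<noteq> bd \<Longrightarrow> (\<Sum>y\<in>S. P x y) = 1"
    and pw_le_b: "\<And>n x y. pw P (S - {bd}) n x y \<le> b n"
    and b_summable: "summable (\<lambda>n. (real n + 1) * b n)"
begin

definition wt :: "'a set \<Rightarrow> ('a \<Rightarrow> 'a) \<Rightarrow> real" where "wt W f = (\<Prod>x\<in>W. P x (f x))"

text \<open>Expectation under the forest law, left unnormalised because the recursions relate
  different domains linearly; the expectation itself is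
  \<open>ZZ W \<Phi> / ZZ W (\<lambda>_. 1)\<close>.\<close>

definition ZZ :: "'a set \<Rightarrow> (('a \<Rightarrow> 'a) \<Rightarrow> real) \<Rightarrow> real" where
  "ZZ W \<Phi> = (\<Sum>f\<in>forests S W. wt W f * \<Phi> f)"

abbreviation Z :: "'a set \<Rightarrow> real" where "Z W \<equiv> ZZ W (\<lambda>_. 1)"

abbreviation I :: "'a set" where "I \<equiv> S - {bd}"

lemma fin_sub: "W \<subseteq> I \<Longrightarrow> finite W"
  using fin_S by (meson finite_Diff finite_subset)

lemma Diff_sub [simp]: "W \<subseteq> I \<Longrightarrow> W - K \<subseteq> I"
  by blast

lemma fin_forests: "W \<subseteq> I \<Longrightarrow> finite (forests S W)"
  by (intro finite_forests fin_S fin_sub)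

lemma wt_nonneg: "0 \<le> wt W f"
  unfolding wt_def by (intro prod_nonneg) (auto simp: P_nonneg)

lemma ZZ_nonneg: "(\<And>f. f \<in> forests S W \<Longrightarrow> 0 \<le> \<Phi> f) \<Longrightarrow> 0 \<le> ZZ W \<Phi>"
  unfolding ZZ_def by (intro sum_nonneg mult_nonneg_nonneg wt_nonneg) auto

lemma ZZ_mono: "(\<And>f. f \<in> forests S W \<Longrightarrow> \<Phi> f \<le> \<Psi> f) \<Longrightarrow> ZZ W \<Phi> \<le> ZZ W \<Psi>"
  unfolding ZZ_def by (intro sum_mono mult_left_mono wt_nonneg) auto

lemma ZZ_cong: "(\<And>f. f \<in> forests S W \<Longrightarrow> \<Phi> f = \<Psi> f) \<Longrightarrow> ZZ W \<Phi> = ZZ W \<Psi>"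
  unfolding ZZ_def by (intro sum.cong) auto

lemma ZZ_add: "ZZ W (\<lambda>f. \<Phi> f + \<Psi> f) = ZZ W \<Phi> + ZZ W \<Psi>"
  unfolding ZZ_def by (simp add: algebra_simps sum.distrib)

lemma ZZ_diff: "ZZ W (\<lambda>f. \<Phi> f - \<Psi> f) = ZZ W \<Phi> - ZZ W \<Psi>"
  unfolding ZZ_def by (simp add: algebra_simps sum_subtractf)

lemma ZZ_cmult: "ZZ W (\<lambda>f. c * \<Phi> f) = c * ZZ W \<Phi>"
  unfolding ZZ_def by (simp add: sum_distrib_left mult_ac)

lemma ZZ_const: "ZZ W (\<lambda>f. c) = c * Z W"
  using ZZ_cmult[of W c "\<lambda>_. 1"] by simp

lemma ZZ_sum: "ZZ W (\<lambda>f. \<Sum>i\<in>A. \<Phi> i f) = (\<Sum>i\<in>A. ZZ W (\<Phi> i))"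
  unfolding ZZ_def sum_distrib_left by (rule sum.swap)

lemma ZZ_empty: "ZZ {} \<Phi> = \<Phi> (\<lambda>x. x)"
proof -
  have "forests S {} = {\<lambda>x. x}" by (auto simp: forests_def)
  then show ?thesis by (simp add: ZZ_def wt_def)
qed

lemma ZZ_split:
  assumes W: "W \<subseteq> I" and x: "x \<in> W"
  shows "ZZ W \<Phi> = (\<Sum>g\<in>forests S (W - {x}). \<Sum>y\<in>{y\<in>S. \<not> reach g y x}. wt (W - {x}) g * P x y * \<Phi> (g(x := y)))"
proof -
  have finW: "finite W" by (rule fin_sub[OF W])
  have wt: "wt W (g(x := y)) = wt (W - {x}) g * P x y" for g y
    unfolding wt_def using finW x by (subst prod.remove[of W x]) (auto intro: prod.cong)
  have "(\<Sum>g\<in>forests S (W - {x}). \<Sum>y\<in>{y\<in>S. \<not> reach g y x}. wt (W - {x}) g * P x y * \<Phi> (g(x := y)))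
    = (\<Sum>(g,y)\<in>(SIGMA g:forests S (W - {x}). {y\<in>S. \<not> reach g y x}). wt (W - {x}) g * P x y * \<Phi> (g(x := y)))"
    using W fin_S by (intro sum.Sigma fin_forests ballI) auto
  also have "\<dots> = (\<Sum>f\<in>forests S W. wt W f * \<Phi> f)"
    using x
    by (intro sum.reindex_bij_witness[where i = "\<lambda>f. (f(x := x), f x)" and j = "\<lambda>(g,y). g(x := y)"])
       (auto simp: wt forests_reset forests_in forests_upd forests_out fun_upd_idem)
  finally show ?thesis by (simp add: ZZ_def)
qed

lemma ZZ_eq_step:
  assumes W: "W \<subseteq> I" and x: "x \<in> W" and y: "y \<in> S"
  shows "ZZ W (\<lambda>f. of_bool (f x = y) * \<Phi> f) = P x y * ZZ (W - {x}) (\<lambda>g. of_bool (\<not> reach g y x) * \<Phi> (g(x := y)))"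
proof -
  have "ZZ W (\<lambda>f. of_bool (f x = y) * \<Phi> f) = (\<Sum>g\<in>forests S (W - {x}). wt (W - {x}) g * (P x y * (of_bool (\<not> reach g y x) * \<Phi> (g(x := y)))))"
    unfolding ZZ_split[OF W x]
  proof (rule sum.cong[OF refl])
    fix g
    have "(\<Sum>z\<in>{z\<in>S. \<not> reach g z x}. wt (W - {x}) g * P x z * (of_bool ((g(x := z)) x = y) * \<Phi> (g(x := z))))
       = (\<Sum>z\<in>{z\<in>S. \<not> reach g z x}. if z = y then wt (W - {x}) g * P x y * \<Phi> (g(x := y)) else 0)"
      by (rule sum.cong) auto
    also have "\<dots> = wt (W - {x}) g * (P x y * (of_bool (\<not> reach g y x) * \<Phi> (g(x := y))))"
      using y fin_S by (simp add: sum.delta')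
    finally show "(\<Sum>z\<in>{z\<in>S. \<not> reach g z x}. wt (W - {x}) g * P x z * (of_bool ((g(x := z)) x = y) * \<Phi> (g(x := z))))
       = wt (W - {x}) g * (P x y * (of_bool (\<not> reach g y x) * \<Phi> (g(x := y))))" .
  qed
  then show ?thesis by (simp add: ZZ_def sum_distrib_left mult_ac)
qed

text \<open>
  Choosing the successor of \<open>x\<close> independently a second time is a reversible operation; this yields the
  (super)harmonicity of every quantity that only improves when the loop through \<open>x\<close> is erased.
\<close>

lemma ZZ_superharmonic:
  assumes W: "W \<subseteq> I" and x: "x \<in> W"
    and A: "\<And>g y. g \<in> forests S (W - {x}) \<Longrightarrow> y \<in> S \<Longrightarrow> \<not> reach g y x \<Longrightarrow> \<Psi> (g(x := y)) x = \<psi> g y"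
    and B: "\<And>g y z. g \<in> forests S (W - {x}) \<Longrightarrow> y \<in> S \<Longrightarrow> z \<in> S \<Longrightarrow> \<not> reach g y x \<Longrightarrow> \<not> reach g z x \<Longrightarrow> \<Psi> (g(x := y)) z = \<psi> g z"
    and C: "\<And>g y z. g \<in> forests S (W - {x}) \<Longrightarrow> y \<in> S \<Longrightarrow> z \<in> S \<Longrightarrow> \<not> reach g y x \<Longrightarrow> reach g z x \<Longrightarrow> \<Psi> (g(x := y)) z \<le> \<psi> g y"
  shows "(\<Sum>z\<in>S. P x z * ZZ W (\<lambda>f. \<Psi> f z)) \<le> ZZ W (\<lambda>f. \<Psi> f x)"
proof -
  let ?W = "W - {x}"
  have "(\<Sum>z\<in>S. P x z * ZZ W (\<lambda>f. \<Psi> f z)) = ZZ W (\<lambda>f. \<Sum>z\<in>S. P x z * \<Psi> f z)"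
    by (simp add: ZZ_sum ZZ_cmult)
  also have "\<dots> = (\<Sum>g\<in>forests S ?W. wt ?W g * (\<Sum>y\<in>{y\<in>S. \<not> reach g y x}. P x y * (\<Sum>z\<in>S. P x z * \<Psi> (g(x := y)) z)))"
    unfolding ZZ_split[OF W x] by (simp add: sum_distrib_left mult_ac)
  also have "\<dots> \<le> (\<Sum>g\<in>forests S ?W. wt ?W g * (\<Sum>y\<in>{y\<in>S. \<not> reach g y x}. P x y * \<psi> g y))"
  proof (rule sum_mono, rule mult_left_mono[OF _ wt_nonneg])
    fix g assume g: "g \<in> forests S ?W"
    let ?N = "{y\<in>S. \<not> reach g y x}" and ?R = "{y\<in>S. reach g y x}"
    have fin: "finite ?N" "finite ?R" using fin_S by auto
    have one: "(\<Sum>y\<in>?N. P x y) + (\<Sum>y\<in>?R. P x y) = 1"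
    proof -
      have "(\<Sum>y\<in>S. P x y) = (\<Sum>y\<in>?N \<union> ?R. P x y)" by (rule sum.cong) auto
      also have "\<dots> = (\<Sum>y\<in>?N. P x y) + (\<Sum>y\<in>?R. P x y)" using fin by (intro sum.union_disjoint) auto
      finally show ?thesis using row[of x] W x by auto
    qed
    \<comment> \<open>If the second choice \<open>z\<close> can be attached, the value forgets
      \<open>y\<close> and the two choices decouple; if \<open>z\<close> leads back to
      \<open>x\<close>, the value is at most that of \<open>y\<close>. The two contributions carry
      the weights of \<open>?N\<close> and \<open>?R\<close>, which add up to 1.\<close>
    have "(\<Sum>y\<in>?N. P x y * (\<Sum>z\<in>S. P x z * \<Psi> (g(x := y)) z)) \<le> (\<Sum>y\<in>?N. P x y * ((\<Sum>z\<in>?N. P x z * \<psi> g z) + (\<Sum>z\<in>?R. P x z * \<psi> g y)))"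
    proof (intro sum_mono mult_left_mono P_nonneg)
      fix y assume y: "y \<in> ?N"
      have "(\<Sum>z\<in>S. P x z * \<Psi> (g(x := y)) z) = (\<Sum>z\<in>?N \<union> ?R. P x z * \<Psi> (g(x := y)) z)" by (rule sum.cong) auto
      also have "\<dots> = (\<Sum>z\<in>?N. P x z * \<Psi> (g(x := y)) z) + (\<Sum>z\<in>?R. P x z * \<Psi> (g(x := y)) z)"
        using fin by (intro sum.union_disjoint) auto
      also have "\<dots> \<le> (\<Sum>z\<in>?N. P x z * \<psi> g z) + (\<Sum>z\<in>?R. P x z * \<psi> g y)"
        using B[OF g] C[OF g] y by (intro add_mono sum_mono mult_left_mono P_nonneg) auto
      finally show "(\<Sum>z\<in>S. P x z * \<Psi> (g(x := y)) z) \<le> (\<Sum>z\<in>?N. P x z * \<psi> g z) + (\<Sum>z\<in>?R. P x z * \<psi> g y)" .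
    qed
    also have "\<dots> = (\<Sum>y\<in>?N. P x y * (\<Sum>z\<in>?N. P x z * \<psi> g z)) + (\<Sum>y\<in>?N. (\<Sum>z\<in>?R. P x z) * (P x y * \<psi> g y))"
      by (simp add: distrib_left sum.distrib sum_distrib_right[symmetric] mult_ac)
    also have "\<dots> = (\<Sum>y\<in>?N. P x y) * (\<Sum>z\<in>?N. P x z * \<psi> g z) + (\<Sum>z\<in>?R. P x z) * (\<Sum>y\<in>?N. P x y * \<psi> g y)"
      by (simp only: sum_distrib_right[symmetric] sum_distrib_left[symmetric])
    also have "\<dots> = ((\<Sum>y\<in>?N. P x y) + (\<Sum>y\<in>?R. P x y)) * (\<Sum>y\<in>?N. P x y * \<psi> g y)"
      by (simp only: distrib_right)
    finally show "(\<Sum>y\<in>?N. P x y * (\<Sum>z\<in>S. P x z * \<Psi> (g(x := y)) z)) \<le> (\<Sum>y\<in>?N. P x y * \<psi> g y)"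
      using one by simp
  qed
  also have "\<dots> = ZZ W (\<lambda>f. \<Psi> f x)"
    unfolding ZZ_split[OF W x] by (auto intro!: sum.cong simp: A sum_distrib_left mult_ac)
  finally show ?thesis .
qed

text \<open>The root at the end of a path is not changed by erasing a loop through \<open>x\<close>:
  if \<open>z\<close> leads to \<open>x\<close>, then \<open>z\<close> and the target
  \<open>y\<close> of \<open>x\<close> end at the same root. Superharmonicity therefore applies to
  the indicator and to its negative.\<close>

lemma ZZ_harmonic:
  assumes W: "W \<subseteq> I" and x: "x \<in> W" and U: "U \<inter> W = {}"
  shows "ZZ W (\<lambda>f. of_bool (\<exists>u\<in>U. reach f x u)) = (\<Sum>z\<in>S. P x z * ZZ W (\<lambda>f. of_bool (\<exists>u\<in>U. reach f z u)))"
proof -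
  have xU: "x \<notin> U" using x U by auto
  have A: "(\<exists>u\<in>U. reach (g(x := y)) x u) = (\<exists>u\<in>U. reach g y u)"
    if "\<not> reach g y x" for g y
  proof -
    have "reach (g(x := y)) x u \<longleftrightarrow> reach g y u" if "u \<in> U" for u
      using reach_cases[of "g(x := y)" x u] that xU reach_upd_not_reach[OF \<open>\<not> reach g y x\<close>] by auto
    then show ?thesis by auto
  qed
  have B: "(\<exists>u\<in>U. reach (g(x := y)) z u) = (\<exists>u\<in>U. reach g z u)" if "\<not> reach g z x" for g y z
    using reach_upd_not_reach[OF that] by simp
  have C: "(\<exists>u\<in>U. reach (g(x := y)) z u) = (\<exists>u\<in>U. reach g y u)"
    if "g \<in> forests S (W - {x})" "\<not> reach g y x" "reach g z x" "y \<in> S" for g y z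
  proof -
    let ?f = "g(x := y)"
    have f: "?f \<in> forests S W" using that x by (intro forests_upd)
    have zx: "reach ?f z x" using that by (simp add: reach_upd_iff)
    have "reach ?f z u \<longleftrightarrow> reach ?f x u" if "u \<in> U" for u
    proof
      assume "reach ?f z u"
      then have "reach ?f x u \<or> reach ?f u x" using reach_linear[OF zx] by blast
      moreover have "?f u = u" using that U forests_out[OF f, of u] by blast
      ultimately show "reach ?f x u" using reach_fixed[of ?f u x] that xU by blast
    qed (use zx in \<open>auto intro: reach_trans\<close>)
    then show ?thesis using A[OF that(2)] by auto
  qed
  have le: "(\<Sum>z\<in>S. P x z * ZZ W (\<lambda>f. of_bool (\<exists>u\<in>U. reach f z u))) \<le> ZZ W (\<lambda>f. of_bool (\<exists>u\<in>U. reach f x u))"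
    by (rule ZZ_superharmonic[OF W x, where \<psi> = "\<lambda>g y. of_bool (\<exists>u\<in>U. reach g y u)"]) (simp_all add: A B C)
  have ge: "(\<Sum>z\<in>S. P x z * ZZ W (\<lambda>f. - of_bool (\<exists>u\<in>U. reach f z u))) \<le> ZZ W (\<lambda>f. - of_bool (\<exists>u\<in>U. reach f x u))"
    by (rule ZZ_superharmonic[OF W x, where \<psi> = "\<lambda>g y. - of_bool (\<exists>u\<in>U. reach g y u)"]) (simp_all add: A B C)
  have neg: "ZZ W (\<lambda>f. - \<Phi> f) = - ZZ W \<Phi>" for \<Phi> using ZZ_cmult[of W "-1" \<Phi>] by simp
  show ?thesis using le ge by (simp add: neg sum_negf)
qed

section \<open>The maximum principle and positivity of the partition function\<close>

lemma b_nonneg: "0 \<le> b n"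
proof -
  have nn: "0 \<le> pw P (S - {bd}) n x y" for x y
    by (induction n arbitrary: x) (auto intro!: sum_nonneg mult_nonneg_nonneg P_nonneg)
  show ?thesis using nn pw_le_b order_trans by blast
qed

lemma summable_b: "summable b"
  using b_summable b_nonneg
  by (intro summable_comparison_test'[OF b_summable, of 0 b]) (auto simp: algebra_simps mult_nonneg_nonneg)

lemma pw_nonneg: "0 \<le> pw P W n x y"
  by (induction n arbitrary: x) (auto intro!: sum_nonneg mult_nonneg_nonneg P_nonneg)

lemma pw_mono: "W \<subseteq> W' \<Longrightarrow> finite W' \<Longrightarrow> pw P W n x y \<le> pw P W' n x y"
proof (induction n arbitrary: x)
  case (Suc n)
  show ?case
  proof (cases "x \<in> W")
    case True
    have "(\<Sum>z\<in>W. P x z * pw P W n z y) \<le> (\<Sum>z\<in>W. P x z * pw P W' n z y)"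
      using Suc by (intro sum_mono mult_left_mono P_nonneg) auto
    also have "\<dots> \<le> (\<Sum>z\<in>W'. P x z * pw P W' n z y)"
      using Suc.prems by (intro sum_mono2) (auto intro!: mult_nonneg_nonneg P_nonneg pw_nonneg)
    finally show ?thesis using True Suc.prems by auto
  qed (use pw_nonneg in \<open>auto intro!: sum_nonneg mult_nonneg_nonneg P_nonneg\<close>)
qed auto

lemma pw_le: "W \<subseteq> I \<Longrightarrow> pw P W n x y \<le> b n"
  using pw_mono[of W I n x y] pw_le_b[of n x y] fin_S by (meson finite_Diff order_trans)

lemma pw_summable: "W \<subseteq> I \<Longrightarrow> summable (\<lambda>n. pw P W n x y)"
  by (rule summable_comparison_test'[OF summable_b, of 0]) (auto simp: pw_nonneg pw_le)

text \<open>Iterating the inequality \<open>n\<close> times leaves a constant times the probability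
  of still being in \<open>W\<close> at time \<open>n\<close>, which tends to 0 because the killed
  transition weights are summable in \<open>n\<close>.\<close>

lemma max_principle:
  assumes W: "W \<subseteq> I" and sub: "\<And>x. x \<in> W \<Longrightarrow> h x \<le> (\<Sum>y\<in>S. P x y * h y)"
    and out: "\<And>x. x \<in> S \<Longrightarrow> x \<notin> W \<Longrightarrow> h x \<le> 0" and x: "x \<in> W"
  shows "h x \<le> 0"
proof -
  have finW: "finite W" by (rule fin_sub[OF W])
  define M where "M = (\<Sum>x\<in>W. \<bar>h x\<bar>)"
  have M: "h x \<le> M" "0 \<le> M" if "x \<in> W" for x
    unfolding M_def using member_le_sum[of x W "\<lambda>x. \<bar>h x\<bar>"] that finW
    by (auto intro: sum_nonneg order_trans[OF abs_ge_self])
  have bound: "h x \<le> M * (\<Sum>y\<in>W. pw P W n x y)" if "x \<in> W" for n x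
    using that
  proof (induction n arbitrary: x)
    case 0
    then show ?case using M[OF 0] finW by (simp add: sum.delta)
  next
    case (Suc n)
    have "h x \<le> (\<Sum>y\<in>S. P x y * h y)" by (rule sub[OF Suc.prems])
    also have "\<dots> = (\<Sum>y\<in>W. P x y * h y) + (\<Sum>y\<in>S - W. P x y * h y)"
      using W fin_S by (metis (no_types, lifting) Diff_subset add.commute subset_trans sum.subset_diff)
    also have "\<dots> \<le> (\<Sum>y\<in>W. P x y * (M * (\<Sum>z\<in>W. pw P W n y z))) + 0"
      using Suc.IH out by (intro add_mono sum_mono mult_left_mono P_nonneg sum_nonpos)
         (auto simp: mult_nonneg_nonpos P_nonneg)
    also have "\<dots> = M * (\<Sum>z\<in>W. pw P W (Suc n) x z)"
      using Suc.prems by (simp add: sum_distrib_left mult_ac) (rule sum.swap)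
    finally show ?case .
  qed
  have "(\<lambda>n. pw P W n x y) \<longlonglongrightarrow> 0" for y
    by (rule summable_LIMSEQ_zero[OF pw_summable[OF W]])
  then have "(\<lambda>n. M * (\<Sum>y\<in>W. pw P W n x y)) \<longlonglongrightarrow> M * (\<Sum>y\<in>W. 0)"
    by (intro tendsto_intros)
  then show ?thesis using bound[OF x] by (intro LIMSEQ_le_const) (auto simp: eventually_sequentially)
qed

lemma harmonic_unique:
  assumes W: "W \<subseteq> I" and x: "x \<in> W"
    and "\<And>x. x \<in> W \<Longrightarrow> h x - (\<Sum>y\<in>S. P x y * h y) = k x - (\<Sum>y\<in>S. P x y * k y)"
    and "\<And>x. x \<in> S \<Longrightarrow> x \<notin> W \<Longrightarrow> h x = k x"
  shows "h x = k x"
proof -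
  have "h x - k x \<le> 0"
    by (rule max_principle[OF W _ _ x, of "\<lambda>x. h x - k x"]) (use assms in \<open>auto simp: algebra_simps sum_subtractf\<close>)
  moreover have "k x - h x \<le> 0"
    by (rule max_principle[OF W _ _ x, of "\<lambda>x. k x - h x"]) (use assms in \<open>auto simp: algebra_simps sum_subtractf\<close>)
  ultimately show ?thesis by simp
qed

lemma Z_split:
  assumes W: "W \<subseteq> I" and x: "x \<in> W"
  shows "ZZ W \<Phi> = (\<Sum>y\<in>S. P x y * ZZ (W - {x}) (\<lambda>g. of_bool (\<not> reach g y x) * \<Phi> (g(x := y))))"
proof -
  have "ZZ W \<Phi> = ZZ W (\<lambda>f. \<Sum>y\<in>S. of_bool (f x = y) * \<Phi> f)"
    using fin_S x W by (intro ZZ_cong) (simp add: sum_distrib_right[symmetric] forests_in sum.delta')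
  then show ?thesis by (simp add: ZZ_sum ZZ_eq_step[OF W x])
qed

text \<open>The successor of \<open>x\<close> may be anything that does not lead back to
  \<open>x\<close>. In terms of the walk, \<open>Z W / Z (W - {x})\<close> is the probability of
  leaving \<open>W\<close> from \<open>x\<close> without a return to \<open>x\<close>.\<close>

lemma Z_rec:
  assumes W: "W \<subseteq> I" and x: "x \<in> W"
  shows "Z W = Z (W - {x}) - (\<Sum>y\<in>S. P x y * ZZ (W - {x}) (\<lambda>g. of_bool (reach g y x)))"
proof -
  have "Z W = (\<Sum>y\<in>S. P x y * (Z (W - {x}) - ZZ (W - {x}) (\<lambda>g. of_bool (reach g y x))))"
    unfolding Z_split[OF W x] by (simp add: ZZ_diff[symmetric] of_bool_not_iff)
  also have "\<dots> = (\<Sum>y\<in>S. P x y) * Z (W - {x}) - (\<Sum>y\<in>S. P x y * ZZ (W - {x}) (\<lambda>g. of_bool (reach g y x)))"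
    by (simp add: right_diff_distrib sum_subtractf sum_distrib_right)
  finally show ?thesis using row[of x] W x by auto
qed

lemma Z_mono_remove:
  assumes W: "W \<subseteq> I" and x: "x \<in> W"
  shows "Z W \<le> Z (W - {x})"
  unfolding Z_rec[OF assms] by (auto intro!: sum_nonneg mult_nonneg_nonneg P_nonneg ZZ_nonneg)

lemma ZZ_reach_root:
  "x \<in> S - W \<Longrightarrow> ZZ W (\<lambda>f. of_bool (\<exists>u\<in>U. reach f x u)) = of_bool (x \<in> U) * Z W"
proof -
  assume "x \<in> S - W"
  then have "ZZ W (\<lambda>f. of_bool (\<exists>u\<in>U. reach f x u)) = ZZ W (\<lambda>f. of_bool (x \<in> U))"
    by (intro ZZ_cong) (auto simp: reach_fixed[OF forests_out])
  then show ?thesis using ZZ_const[of W "of_bool (x \<in> U)"] by simp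
qed

text \<open>If adding \<open>x\<close> to the domain made the partition function vanish, the weight
  of being led to \<open>x\<close> would be harmonic at \<open>x\<close> too and zero outside the
  enlarged domain. The maximum principle would make it nonpositive at \<open>x\<close>, where it is
  \<open>Z W\<close>.\<close>

lemma Z_pos: "W \<subseteq> I \<Longrightarrow> 0 < Z W"
proof -
  assume W: "W \<subseteq> I"
  have "finite W" by (rule fin_sub[OF W])
  then show ?thesis using W
  proof (induction W rule: finite_induct)
    case empty
    then show ?case by (simp add: ZZ_empty)
  next
    case (insert x W)
    let ?W = "insert x W"
    have rem: "?W - {x} = W" using insert by auto
    let ?h = "\<lambda>y. ZZ W (\<lambda>g. of_bool (\<exists>u\<in>{x}. reach g y u))"
    have nn: "0 \<le> Z ?W" by (rule ZZ_nonneg) simp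
    show ?case
    proof (rule ccontr)
      assume "\<not> 0 < Z ?W"
      then have z: "Z ?W = 0" using nn by simp
      have hx: "?h x = Z W" using ZZ_reach_root[of x W "{x}"] insert by auto
      have hh: "?h y \<le> (\<Sum>z\<in>S. P y z * ?h z)" if "y \<in> ?W" for y
      proof (cases "y = x")
        case True
        then show ?thesis using hx z Z_rec[of ?W x] insert.prems rem by simp
      next
        case False
        then show ?thesis using ZZ_harmonic[of W y "{x}"] insert that by simp
      qed
      have "?h x \<le> 0"
        by (rule max_principle[of ?W ?h, OF insert.prems hh]) (use insert ZZ_reach_root[of _ W "{x}"] in auto)
      then show False using hx insert by auto
    qed
  qed
qed

section \<open>Hitting, Green and escape functions as quotients of partition functions\<close>

text \<open>Wilson's algorithm taken as a definition: the path from \<open>x\<close> in a forest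
  with \<open>K\<close> and the complement of \<open>W\<close> as roots ends in \<open>K\<close>
  with the probability that the walk enters \<open>K\<close> before leaving \<open>W\<close>.
  Harmonicity, boundary values and uniqueness characterise this quantity.\<close>

definition hit :: "'a set \<Rightarrow> 'a set \<Rightarrow> 'a \<Rightarrow> real" where
  "hit W K x = ZZ (W - K) (\<lambda>f. of_bool (\<exists>u\<in>K. reach f x u)) / Z (W - K)"

lemma hit_harmonic:
  assumes "W \<subseteq> I" "x \<in> W" "x \<notin> K"
  shows "hit W K x = (\<Sum>z\<in>S. P x z * hit W K z)"
  unfolding hit_def using ZZ_harmonic[of "W - K" x K] assms by (auto simp: sum_divide_distrib)

lemma hit_in: "W \<subseteq> I \<Longrightarrow> x \<in> S \<Longrightarrow> x \<in> K \<Longrightarrow> hit W K x = 1"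
  unfolding hit_def using ZZ_reach_root[of x "W - K" K] Z_pos[of "W - K"] by auto

lemma hit_out: "x \<in> S \<Longrightarrow> x \<notin> W \<Longrightarrow> x \<notin> K \<Longrightarrow> hit W K x = 0"
  unfolding hit_def using ZZ_reach_root[of x "W - K" K] by auto

lemma hit_nonneg: "W \<subseteq> I \<Longrightarrow> 0 \<le> hit W K x"
  unfolding hit_def using Z_pos[of "W - K"] by (intro divide_nonneg_pos ZZ_nonneg) auto

lemma hit_le_1: "W \<subseteq> I \<Longrightarrow> hit W K x \<le> 1"
  unfolding hit_def using Z_pos[of "W - K"] by (subst divide_le_eq_1_pos) (auto intro: ZZ_mono)

definition G :: "'a set \<Rightarrow> 'a \<Rightarrow> 'a \<Rightarrow> real" where
  "G W x y = (\<Sum>n. pw P W n x y)"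

lemma G_nonneg: "W \<subseteq> I \<Longrightarrow> 0 \<le> G W x y"
  unfolding G_def by (intro suminf_nonneg pw_summable pw_nonneg)

lemma G_mono: "W \<subseteq> W' \<Longrightarrow> W' \<subseteq> I \<Longrightarrow> G W x y \<le> G W' x y"
  unfolding G_def by (intro suminf_le pw_summable pw_mono fin_sub) auto

lemma pw_out: "x \<notin> W \<Longrightarrow> pw P W n x y = 0"
  by (cases n) auto

lemma pw_out2: "y \<notin> W \<Longrightarrow> pw P W n x y = 0"
  by (induction n arbitrary: x) auto

lemma G_out: "x \<notin> W \<Longrightarrow> G W x y = 0" and G_out2: "y \<notin> W \<Longrightarrow> G W x y = 0"
  by (simp_all add: G_def pw_out pw_out2)

lemma sum_out:
  assumes W: "W \<subseteq> I" and "\<And>z. z \<notin> W \<Longrightarrow> h z = 0"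
  shows "(\<Sum>z\<in>S. P x z * h z) = (\<Sum>z\<in>W. P x z * h z)"
  by (rule sum.mono_neutral_right) (use assms fin_S in auto)

lemma G_rec:
  assumes W: "W \<subseteq> I" and x: "x \<in> W"
  shows "G W x y = of_bool (x = y) + (\<Sum>z\<in>S. P x z * G W z y)"
proof -
  have "G W x y = pw P W 0 x y + (\<Sum>n. pw P W (Suc n) x y)"
    unfolding G_def using suminf_split_head[OF pw_summable[OF W, of x y]] by simp
  also have "(\<Sum>n. pw P W (Suc n) x y) = (\<Sum>n. \<Sum>z\<in>W. P x z * pw P W n z y)"
    using x by simp
  also have "\<dots> = (\<Sum>z\<in>W. \<Sum>n. P x z * pw P W n z y)"
    by (rule suminf_sum) (intro summable_mult pw_summable[OF W])
  also have "\<dots> = (\<Sum>z\<in>W. P x z * G W z y)"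
    unfolding G_def by (intro sum.cong refl suminf_mult pw_summable[OF W])
  finally show ?thesis using x sum_out[OF W, of "\<lambda>z. G W z y" x] by (simp add: G_out)
qed

text \<open>Both sides have the point mass at \<open>y\<close> as Laplacian in \<open>W\<close> and
  vanish outside \<open>W\<close>. At \<open>y\<close> this is \<open>Z_rec\<close>, elsewhere
  harmonicity of the end point of the path.\<close>

lemma G_eq:
  assumes W: "W \<subseteq> I" and y: "y \<in> W" and x: "x \<in> S"
  shows "G W x y = ZZ (W - {y}) (\<lambda>f. of_bool (reach f x y)) / Z W"
proof (cases "x \<in> W")
  case xW: True
  let ?k = "\<lambda>x. ZZ (W - {y}) (\<lambda>f. of_bool (\<exists>u\<in>{y}. reach f x u)) / Z W"
  have Zp: "Z W > 0" by (rule Z_pos[OF W])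
  have root: "ZZ (W - {y}) (\<lambda>f. of_bool (\<exists>u\<in>{y}. reach f x u)) = of_bool (x = y) * Z (W - {y})" if "x \<in> S" "x \<notin> W - {y}" for x
    using ZZ_reach_root[of x "W - {y}" "{y}"] that by auto
  have "G W x y = ?k x"
  proof (rule harmonic_unique[OF W xW])
    fix x assume xx: "x \<in> W"
    have "?k x - (\<Sum>z\<in>S. P x z * ?k z) = of_bool (x = y)"
    proof (cases "x = y")
      case True
      have "Z (W - {y}) - (\<Sum>z\<in>S. P y z * ZZ (W - {y}) (\<lambda>f. of_bool (reach f z y))) = Z W"
        using Z_rec[OF W y] by simp
      then have "(Z (W - {y}) - (\<Sum>z\<in>S. P y z * ZZ (W - {y}) (\<lambda>f. of_bool (reach f z y)))) / Z W = 1" using Zp by simp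
      then show ?thesis using True root[of y] y W by (auto simp: diff_divide_distrib sum_divide_distrib)
    next
      case False
      then show ?thesis using ZZ_harmonic[of "W - {y}" x "{y}"] xx W
        by (auto simp: sum_divide_distrib)
    qed
    then show "G W x y - (\<Sum>z\<in>S. P x z * G W z y) = ?k x - (\<Sum>z\<in>S. P x z * ?k z)"
      using G_rec[OF W xx, of y] by simp
  next
    fix x assume "x \<in> S" "x \<notin> W"
    then show "G W x y = ?k x" using root[of x] y G_out[of x W y] by auto
  qed
  then show ?thesis by simp
next
  case False
  have "ZZ (W - {y}) (\<lambda>f. of_bool (\<exists>u\<in>{y}. reach f x u)) = 0"
    using ZZ_reach_root[of x "W - {y}" "{y}"] False x y by auto
  then show ?thesis using G_out[OF False] by simp
qed

lemma G_diag: "W \<subseteq> I \<Longrightarrow> y \<in> W \<Longrightarrow> G W y y = Z (W - {y}) / Z W"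
  using G_eq[of W y y] by auto

lemma G_hit:
  assumes W: "W \<subseteq> I" and y: "y \<in> W" and x: "x \<in> S"
  shows "G W x y = hit W {y} x * G W y y"
  using G_eq[OF assms] G_diag[OF W y] Z_pos[of "W - {y}"] W unfolding hit_def by auto

lemma G_diag_ge_1: "W \<subseteq> I \<Longrightarrow> y \<in> W \<Longrightarrow> 1 \<le> G W y y"
  using Z_mono_remove[of W y] Z_pos[of W] by (simp add: G_diag)

lemma hit_le_G: "W \<subseteq> I \<Longrightarrow> y \<in> W \<Longrightarrow> x \<in> S \<Longrightarrow> hit W {y} x \<le> G W x y"
  using G_hit[of W y x] G_diag_ge_1[of W y] hit_nonneg[of W "{y}" x]
  by (metis mult.right_neutral mult_left_mono)

text \<open>Probability of leaving \<open>W\<close> without visiting \<open>K\<close> after the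
  first step; the starting point \<open>x\<close> may itself lie in \<open>K\<close>.\<close>

definition esc :: "'a set \<Rightarrow> 'a set \<Rightarrow> 'a \<Rightarrow> real" where
  "esc W K x = 1 - (\<Sum>z\<in>S. P x z * hit W K z)"

lemma esc_nonneg: "W \<subseteq> I \<Longrightarrow> x \<in> I \<Longrightarrow> 0 \<le> esc W K x"
proof -
  assume a: "W \<subseteq> I" "x \<in> I"
  have "(\<Sum>z\<in>S. P x z * hit W K z) \<le> (\<Sum>z\<in>S. P x z * 1)"
    using a by (intro sum_mono mult_left_mono hit_le_1 P_nonneg)
  then show ?thesis using row[of x] a by (simp add: esc_def)
qed

lemma hit_mono:
  assumes W: "W \<subseteq> I" and K: "K \<subseteq> K'" and K': "K' \<subseteq> W" and x: "x \<in> S"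
  shows "hit W K x \<le> hit W K' x"
proof (cases "x \<in> W - K'")
  case True
  have "hit W K x - hit W K' x \<le> 0"
  proof (rule max_principle[of "W - K'" "\<lambda>x. hit W K x - hit W K' x"])
    show "W - K' \<subseteq> I" using W by auto
    show "hit W K x - hit W K' x \<le> (\<Sum>y\<in>S. P x y * (hit W K y - hit W K' y))" if "x \<in> W - K'" for x
    proof -
      have "x \<in> W" "x \<notin> K" "x \<notin> K'" using that K by auto
      then show ?thesis using hit_harmonic[OF W, of x K] hit_harmonic[OF W, of x K'] by (simp add: right_diff_distrib sum_subtractf)
    qed
    show "hit W K x - hit W K' x \<le> 0" if "x \<in> S" "x \<notin> W - K'" for x
    proof (cases "x \<in> K'")
      case True then show ?thesis using hit_in[OF W that(1) True] hit_le_1[OF W] by simp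
    next
      case False
      then have "x \<notin> W" "x \<notin> K" using that K by auto
      then show ?thesis using hit_out[OF that(1)] False by simp
    qed
  qed (use True in auto)
  then show ?thesis by simp
next
  case False
  show ?thesis
  proof (cases "x \<in> K'")
    case True then show ?thesis using hit_in[OF W x True] hit_le_1[OF W] by simp
  next
    case F: False
    then have "x \<notin> W" "x \<notin> K" using False K by auto
    then show ?thesis using hit_out[OF x] F by simp
  qed
qed

lemma esc_antimono:
  assumes "W \<subseteq> I" "K \<subseteq> K'" "K' \<subseteq> W"
  shows "esc W K' x \<le> esc W K x"
  unfolding esc_def using assms by (auto intro!: sum_mono mult_left_mono P_nonneg hit_mono)

lemma esc_le_1: "W \<subseteq> I \<Longrightarrow> esc W K x \<le> 1"
  unfolding esc_def by (auto intro!: sum_nonneg mult_nonneg_nonneg P_nonneg hit_nonneg)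

text \<open>Decomposition at the last visit to \<open>K\<close>. The sum and \<open>hit W K\<close>
  have the same Laplacian in \<open>W\<close>, namely \<open>esc\<close> on \<open>K\<close> and 0
  elsewhere, and both vanish outside \<open>W\<close>; on \<open>K\<close> the hitting probability
  is 1.\<close>

lemma last_exit:
  assumes W: "W \<subseteq> I" and K: "K \<subseteq> W" and x: "x \<in> K"
  shows "(\<Sum>y\<in>K. G W x y * esc W K y) = 1"
proof -
  have finK: "finite K" using K fin_sub[OF W] finite_subset by blast
  let ?u = "\<lambda>x. \<Sum>y\<in>K. G W x y * esc W K y"
  have "?u x = hit W K x"
  proof (rule harmonic_unique[OF W])
    show "x \<in> W" using x K by auto
    fix x assume xW: "x \<in> W"
    have "?u x = (\<Sum>y\<in>K. of_bool (x = y) * esc W K y) + (\<Sum>y\<in>K. (\<Sum>z\<in>S. P x z * G W z y) * esc W K y)"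
      using G_rec[OF W xW] by (simp add: algebra_simps sum.distrib)
    also have "(\<Sum>y\<in>K. (\<Sum>z\<in>S. P x z * G W z y) * esc W K y) = (\<Sum>z\<in>S. P x z * ?u z)"
      unfolding sum_distrib_right sum_distrib_left by (subst sum.swap) (simp add: mult_ac)
    also have "(\<Sum>y\<in>K. of_bool (x = y) * esc W K y) = of_bool (x \<in> K) * esc W K x"
      using finK by (simp add: of_bool_def if_distrib[of "\<lambda>t. t * _"] sum.delta cong: if_cong)
    finally have 1: "?u x - (\<Sum>z\<in>S. P x z * ?u z) = of_bool (x \<in> K) * esc W K x" by simp
    have 2: "hit W K x - (\<Sum>z\<in>S. P x z * hit W K z) = of_bool (x \<in> K) * esc W K x"
      using hit_harmonic[OF W xW, of K] hit_in[OF W, of x K] xW W by (cases "x \<in> K") (auto simp: esc_def)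
    show "?u x - (\<Sum>z\<in>S. P x z * ?u z) = hit W K x - (\<Sum>z\<in>S. P x z * hit W K z)" using 1 2 by simp
  next
    fix x assume "x \<in> S" "x \<notin> W"
    then show "?u x = hit W K x" using hit_out[of x W K] K by (auto simp: G_out)
  qed
  then show ?thesis using hit_in[OF W, of x K] x K W by auto
qed

end

section \<open>Forests following a prescribed path\<close>

fun follows :: "('a \<Rightarrow> 'a) \<Rightarrow> 'a list \<Rightarrow> bool" where
  "follows f (x # y # ys) \<longleftrightarrow> f x = y \<and> follows f (y # ys)"
| "follows f _ \<longleftrightarrow> True"

primrec upd_path :: "('a \<Rightarrow> 'a) \<Rightarrow> 'a list \<Rightarrow> ('a \<Rightarrow> 'a)" where
  "upd_path g [] = g"
| "upd_path g (x # xs) = (case xs of [] \<Rightarrow> g | y # ys \<Rightarrow> fun_upd (upd_path g xs) x y)"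

fun pp :: "('a \<Rightarrow> 'a \<Rightarrow> real) \<Rightarrow> 'a list \<Rightarrow> real" where
  "pp P (x # y # ys) = P x y * pp P (y # ys)"
| "pp P _ = 1"

lemma upd_path_Cons: "upd_path g (x # y # ys) = (upd_path g (y # ys))(x := y)"
  by simp

lemma upd_path_single: "upd_path g [x] = g"
  by simp

declare upd_path.simps(2) [simp del]

lemma follows_upd: "x \<notin> set (butlast ys) \<Longrightarrow> follows (f(x := y)) ys \<longleftrightarrow> follows f ys"
  by (induction f ys rule: follows.induct) auto

lemma reach_upd_path:
  assumes "distinct (y # ys)" "x \<notin> set (butlast (y # ys))"
    and "\<forall>a\<in>set (butlast (y # ys)). \<not> reach g (last (y # ys)) a"
  shows "reach (upd_path g (y # ys)) y x \<longleftrightarrow> reach g (last (y # ys)) x"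
  using assms
proof (induction ys arbitrary: y x)
  case (Cons z zs)
  let ?h = "upd_path g (z # zs)"
  have IH: "reach ?h z w \<longleftrightarrow> reach g (last (z # zs)) w" if "w \<notin> set (butlast (z # zs))" for w
    using Cons that by (intro Cons.IH) auto
  have y: "y \<notin> set (butlast (z # zs))" using Cons.prems(1) by (metis distinct.simps(2) in_set_butlastD)
  have nr: "\<not> reach ?h z y" using IH[OF y] Cons.prems by auto
  have "reach (?h(y := z)) y x \<longleftrightarrow> reach (?h(y := z)) z x"
    using reach_cases[of "?h(y := z)" y x] Cons.prems by auto
  also have "\<dots> \<longleftrightarrow> reach ?h z x" by (rule reach_upd_not_reach[OF nr])
  finally have "reach (upd_path g (y # z # zs)) y x \<longleftrightarrow> reach ?h z x" unfolding upd_path_Cons .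
  then show ?case using IH[of x] Cons.prems by auto
qed (simp add: upd_path_single)

lemma follows_unique_length:
  "follows f (y # zs) \<Longrightarrow> follows f (y # zs') \<Longrightarrow> length zs = length zs' \<Longrightarrow> zs = zs'"
proof (induction zs arbitrary: y zs')
  case (Cons a zs)
  then show ?case by (cases zs') auto
qed simp

lemma follows_unique_root:
  assumes "follows f (y # zs)" "follows f (y # zs')" "distinct (y # zs)" "distinct (y # zs')"
    "last (y # zs) = z" "last (y # zs') = z" "f z = z"
  shows "zs = zs'"
  using assms
proof (induction zs arbitrary: y zs')
  case Nil
  then show ?case by (cases zs') auto
next
  case (Cons a zs)
  show ?case
  proof (cases zs')
    case Nil
    then show ?thesis using Cons.prems by auto
  next
    case (Cons a' zs'')
    then show ?thesis using Cons.prems Cons.IH[of a zs''] by auto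
  qed
qed

lemma follows_reach: "follows f (y # zs) \<Longrightarrow> reach f y (last (y # zs))"
  by (induction zs arbitrary: y) (auto intro: reach_step)

lemma pp_append: "xs \<noteq> [] \<Longrightarrow> pp P (xs @ ys) = pp P xs * pp P (last xs # ys)"
proof (induction xs)
  case (Cons x xs)
  then show ?case by (cases xs) auto
qed simp

lemma last_take_Cons: "i \<le> length zs \<Longrightarrow> last (y # take i zs) = (y # zs) ! i"
  by (cases i) (auto simp: last_conv_nth)

definition TL :: "'a set \<Rightarrow> nat \<Rightarrow> 'a list set" where
  "TL W M = {zs. distinct zs \<and> set zs \<subseteq> W \<and> length zs \<le> M}"

lemma finite_TL: "finite W \<Longrightarrow> finite (TL W M)"
  unfolding TL_def using finite_lists_length_le[of W M] by (rule rev_finite_subset) auto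

lemma TL_Nil [simp]: "[] \<in> TL W M"
  by (simp add: TL_def)

text \<open>Cutting a list at a position is injective. The only loss is the constraint that the two
  pieces together, and not just each of them, have length at most \<open>M\<close>.\<close>

lemma sum_TL_split:
  fixes t :: "'a list \<Rightarrow> 'a list \<Rightarrow> real"
  assumes fin: "finite W" and nn: "\<And>as bs. as \<in> TL W M \<Longrightarrow> bs \<in> TL (W - set as) M \<Longrightarrow> 0 \<le> t as bs"
  shows "(\<Sum>zs\<in>TL W M. \<Sum>i\<le>length zs. t (take i zs) (drop i zs)) \<le> (\<Sum>as\<in>TL W M. \<Sum>bs\<in>TL (W - set as) M. t as bs)"
proof -
  let ?A = "SIGMA zs:TL W M. {..length zs}" and ?B = "SIGMA as:TL W M. TL (W - set as) M"
  let ?g = "\<lambda>(zs, i). (take i zs, drop i zs)"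
  have inj: "inj_on ?g ?A"
    by (intro inj_onI) (auto, metis append_take_drop_id, metis length_take min.absorb2)
  have sub: "?g ` ?A \<subseteq> ?B"
  proof safe
    fix zs i assume zs: "zs \<in> TL W M"
    have "set (take i zs) \<inter> set (drop i zs) = {}" using zs by (auto simp: TL_def set_take_disj_set_drop_if_distinct)
    then show "take i zs \<in> TL W M" "drop i zs \<in> TL (W - set (take i zs)) M"
      using zs by (auto simp: TL_def dest: in_set_takeD in_set_dropD)
  qed
  have finB: "finite ?B" using fin by (intro finite_SigmaI finite_TL) auto
  have "(\<Sum>zs\<in>TL W M. \<Sum>i\<le>length zs. t (take i zs) (drop i zs)) = (\<Sum>(zs, i)\<in>?A. t (take i zs) (drop i zs))"
    using fin by (intro sum.Sigma finite_TL) auto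
  also have "\<dots> = (\<Sum>(as, bs)\<in>?g ` ?A. t as bs)"
    by (subst sum.reindex[OF inj]) (auto intro!: sum.cong)
  also have "\<dots> \<le> (\<Sum>(as, bs)\<in>?B. t as bs)"
    using nn by (intro sum_mono2 finB sub) auto
  also have "\<dots> = (\<Sum>as\<in>TL W M. \<Sum>bs\<in>TL (W - set as) M. t as bs)"
    using fin by (intro sum.Sigma[symmetric] finite_TL ballI) auto
  finally show ?thesis .
qed

lemma sum_set_nth: "distinct xs \<Longrightarrow> (\<Sum>a\<in>set xs. h a) = (\<Sum>i<length xs. h (xs ! i) :: real)"
  by (rule sum.reindex_bij_betw[symmetric, OF bij_betw_nth]) auto

context chain
begin

lemma pp_nonneg: "0 \<le> pp P xs"
  by (induction P\<equiv>P xs rule: pp.induct) (auto simp: P_nonneg)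

text \<open>The arcs of the path are split off from its start. The conditions that none of them
  closes a cycle combine into one condition: the end of the path does not lead back to the
  path.\<close>

lemma ZZ_follows:
  assumes "xs \<noteq> []" "distinct xs" "set (butlast xs) \<subseteq> W" "set xs \<subseteq> S" "W \<subseteq> I"
  shows "ZZ W (\<lambda>f. of_bool (follows f xs) * \<Phi> f) =
    pp P xs * ZZ (W - set (butlast xs)) (\<lambda>g. of_bool (\<forall>a\<in>set (butlast xs). \<not> reach g (last xs) a) * \<Phi> (upd_path g xs))"
  using assms
proof (induction xs arbitrary: W \<Phi>)
  case (Cons x xs)
  show ?case
  proof (cases xs)
    case Nil
    then show ?thesis by (simp add: upd_path_single)
  next
    case (Cons y ys)
    let ?b = "set (butlast (y # ys))"
    have x: "x \<in> W" "y \<in> S" "x \<notin> ?b" "x \<notin> set (y # ys)" "x \<noteq> y"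
      using Cons.prems Cons by (auto dest: in_set_butlastD)
    have "ZZ W (\<lambda>f. of_bool (follows f (x # xs)) * \<Phi> f) = ZZ W (\<lambda>f. of_bool (f x = y) * (of_bool (follows f (y # ys)) * \<Phi> f))"
      by (intro ZZ_cong) (auto simp: Cons)
    also have "\<dots> = P x y * ZZ (W - {x}) (\<lambda>g. of_bool (\<not> reach g y x) * (of_bool (follows (g(x := y)) (y # ys)) * \<Phi> (g(x := y))))"
      by (rule ZZ_eq_step) (use x Cons.prems in auto)
    also have "\<dots> = P x y * ZZ (W - {x}) (\<lambda>g. of_bool (follows g (y # ys)) * (of_bool (\<not> reach g y x) * \<Phi> (g(x := y))))"
      using follows_upd[OF x(3)] by (simp add: mult_ac)
    also have "ZZ (W - {x}) (\<lambda>g. of_bool (follows g (y # ys)) * (of_bool (\<not> reach g y x) * \<Phi> (g(x := y)))) =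
       pp P (y # ys) * ZZ (W - {x} - ?b) (\<lambda>g. of_bool (\<forall>a\<in>?b. \<not> reach g (last (y # ys)) a) *
         (of_bool (\<not> reach (upd_path g (y # ys)) y x) * \<Phi> ((upd_path g (y # ys))(x := y))))"
      unfolding Cons[symmetric] by (rule Cons.IH) (use Cons.prems x Cons in auto)
    also have "\<dots> = pp P (y # ys) * ZZ (W - set (butlast (x # xs))) (\<lambda>g. of_bool (\<forall>a\<in>set (butlast (x # xs)). \<not> reach g (last (x # xs)) a) * \<Phi> (upd_path g (x # xs)))"
    proof -
      have e: "W - {x} - ?b = W - set (butlast (x # xs))" using Cons by auto
      have "of_bool (\<forall>a\<in>?b. \<not> reach g (last (y # ys)) a) * (of_bool (\<not> reach (upd_path g (y # ys)) y x) * \<Phi> ((upd_path g (y # ys))(x := y)))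
        = of_bool (\<forall>a\<in>set (butlast (x # xs)). \<not> reach g (last (x # xs)) a) * \<Phi> (upd_path g (x # xs))" for g
        using reach_upd_path[of y ys x g] Cons.prems x unfolding Cons upd_path_Cons by auto
      then show ?thesis unfolding e by (intro arg_cong[where f = "\<lambda>t. pp P (y # ys) * t"] ZZ_cong)
    qed
    finally show ?thesis unfolding Cons pp.simps(1) by (simp only: mult.assoc)
  qed
qed simp

lemma ZZ_follows_root:
  assumes xs: "xs \<noteq> []" "distinct xs" "set (butlast xs) \<subseteq> W" "set xs \<subseteq> S" "W \<subseteq> I" and l: "last xs \<notin> W"
  shows "ZZ W (\<lambda>f. of_bool (follows f xs) * \<Phi> f) = pp P xs * ZZ (W - set xs) (\<lambda>g. \<Phi> (upd_path g xs))"
proof -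
  have s: "set xs = insert (last xs) (set (butlast xs))" using xs(1) by (metis append_butlast_last_id list.set(1,2) set_append Un_insert_right Un_empty_right)
  have e: "W - set (butlast xs) = W - set xs" using l s by auto
  have nl: "last xs \<notin> set (butlast xs)" using xs l by auto
  have "\<forall>a\<in>set (butlast xs). \<not> reach g (last xs) a" if "g \<in> forests S (W - set xs)" for g
  proof -
    have "g (last xs) = last xs" using forests_out[OF that] s by auto
    then show ?thesis using reach_fixed[of g "last xs"] nl by auto
  qed
  then have "ZZ (W - set xs) (\<lambda>g. of_bool (\<forall>a\<in>set (butlast xs). \<not> reach g (last xs) a) * \<Phi> (upd_path g xs))
     = ZZ (W - set xs) (\<lambda>g. \<Phi> (upd_path g xs))"
    by (intro ZZ_cong) auto
  then show ?thesis using ZZ_follows[OF xs, of \<Phi>] by (simp only: e)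
qed

text \<open>Once the path is removed, the last arc to choose is that of its end. Its target must
  lead to no vertex of the path, which is the escape event written as a forest quotient.\<close>

lemma ZZ_follows_esc:
  assumes xs: "xs \<noteq> []" "distinct xs" "set xs \<subseteq> W" and W: "W \<subseteq> I"
  shows "ZZ W (\<lambda>f. of_bool (follows f xs)) = pp P xs * (Z (W - set xs) * esc W (set xs) (last xs))"
proof -
  let ?b = "set (butlast xs)" and ?l = "last xs" and ?K = "set xs"
  have s: "?K = insert ?l ?b" using xs(1) by (metis append_butlast_last_id list.set(1,2) set_append Un_insert_right Un_empty_right)
  have lb: "?l \<notin> ?b" using xs by (metis append_butlast_last_id distinct_append disjoint_iff list.set_intros(1))
  have l: "?l \<in> W - ?b" using lb xs by auto
  have e: "W - ?b - {?l} = W - ?K" using s by auto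
  have Zp: "Z (W - ?K) > 0" using Z_pos W by simp
  have "ZZ W (\<lambda>f. of_bool (follows f xs)) = pp P xs * ZZ (W - ?b) (\<lambda>g. of_bool (\<forall>a\<in>?b. \<not> reach g ?l a))"
    using ZZ_follows[of xs W "\<lambda>_. 1"] xs W s by auto
  also have "ZZ (W - ?b) (\<lambda>g. of_bool (\<forall>a\<in>?b. \<not> reach g ?l a)) =
     (\<Sum>z\<in>S. P ?l z * ZZ (W - ?K) (\<lambda>g. of_bool (\<not> reach g z ?l) * of_bool (\<forall>a\<in>?b. \<not> reach (g(?l := z)) ?l a)))"
    using Z_split[of "W - ?b" ?l] l W by (simp only: e Diff_sub)
  also have "\<dots> = (\<Sum>z\<in>S. P ?l z * (Z (W - ?K) * (1 - hit W ?K z)))"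
  proof (intro sum.cong refl arg_cong2[where f = "(*)"])
    fix z
    have "of_bool (\<not> reach g z ?l) * of_bool (\<forall>a\<in>?b. \<not> reach (g(?l := z)) ?l a) = 1 - (of_bool (\<exists>u\<in>?K. reach g z u) :: real)" for g
    proof (cases "reach g z ?l")
      case False
      have "reach (g(?l := z)) ?l a \<longleftrightarrow> reach g z a" if "a \<in> ?b" for a
        using reach_cases[of "g(?l := z)" ?l a] reach_upd_not_reach[OF False, of z a] that lb by auto
      then show ?thesis using False unfolding s by auto
    qed (use s in auto)
    then have "ZZ (W - ?K) (\<lambda>g. of_bool (\<not> reach g z ?l) * of_bool (\<forall>a\<in>?b. \<not> reach (g(?l := z)) ?l a)) = Z (W - ?K) - ZZ (W - ?K) (\<lambda>g. of_bool (\<exists>u\<in>?K. reach g z u))"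
      by (simp add: ZZ_diff)
    then show "ZZ (W - ?K) (\<lambda>g. of_bool (\<not> reach g z ?l) * of_bool (\<forall>a\<in>?b. \<not> reach (g(?l := z)) ?l a)) = Z (W - ?K) * (1 - hit W ?K z)"
      using Zp by (simp add: hit_def right_diff_distrib)
  qed
  also have "\<dots> = Z (W - ?K) * ((\<Sum>z\<in>S. P ?l z) - (\<Sum>z\<in>S. P ?l z * hit W ?K z))"
  proof -
    have "P ?l z * (Z (W - ?K) * (1 - hit W ?K z)) = Z (W - ?K) * (P ?l z - P ?l z * hit W ?K z)" for z
      by (simp add: algebra_simps)
    then show ?thesis by (simp only: sum_distrib_left[symmetric] sum_subtractf)
  qed
  also have "(\<Sum>z\<in>S. P ?l z) = 1" using l W by (intro row) auto
  finally show ?thesis by (simp add: esc_def)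
qed

section \<open>Weights of loop-erased paths and the bubble sum\<close>

definition B :: real where "B = (\<Sum>n. (real n + 1) * b n)"

text \<open>For distinct \<open>zs\<close> inside \<open>W\<close> and \<open>y\<close> outside, the
  quotient of partition functions is the product of the diagonal Green functions along
  \<open>zs\<close> in successively smaller domains. So \<open>tw\<close> is the total weight of the
  walks from \<open>y\<close>, never returning to \<open>y\<close>, whose loop erasure is
  \<open>y # zs\<close>. It is multiplicative and can be cut at any vertex.\<close>

definition tw :: "'a set \<Rightarrow> 'a \<Rightarrow> 'a list \<Rightarrow> real" where
  "tw W y zs = pp P (y # zs) * Z (W - set zs) / Z W"

lemma tw_nonneg: "W \<subseteq> I \<Longrightarrow> 0 \<le> tw W y zs"
  unfolding tw_def using Z_pos[of W] Z_pos[of "W - set zs"] by (simp add: pp_nonneg)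

lemma tw_append:
  assumes "W \<subseteq> I" shows "tw W y (as @ bs) = tw W y as * tw (W - set as) (last (y # as)) bs"
proof -
  have "pp P (y # as @ bs) = pp P (y # as) * pp P (last (y # as) # bs)"
    using pp_append[of "y # as" P bs] by simp
  moreover have "W - set (as @ bs) = W - set as - set bs" by auto
  ultimately show ?thesis unfolding tw_def using Z_pos[of "W - set as"] assms by simp
qed

lemma tw_Nil: "W \<subseteq> I \<Longrightarrow> tw W y [] = 1"
  unfolding tw_def using Z_pos[of W] by simp

lemma pw_add:
  assumes "finite W"
  shows "pw P W (k + n) x y = (\<Sum>z\<in>W. pw P W k x z * pw P W n z y)"
proof (induction k arbitrary: x)
  case 0
  show ?case
  proof (cases "x \<in> W")
    case True
    then have "(\<Sum>z\<in>W. pw P W 0 x z * pw P W n z y) = (\<Sum>z\<in>W. if x = z then pw P W n z y else 0)"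
      by (intro sum.cong) auto
    then show ?thesis using True assms by (simp add: sum.delta)
  qed (auto simp: pw_out)
next
  case (Suc k)
  show ?case
  proof (cases "x \<in> W")
    case True
    have "pw P W (Suc k + n) x y = (\<Sum>w\<in>W. \<Sum>z\<in>W. P x w * (pw P W k w z * pw P W n z y))"
      using True Suc by (simp add: sum_distrib_left)
    also have "\<dots> = (\<Sum>z\<in>W. \<Sum>w\<in>W. P x w * (pw P W k w z * pw P W n z y))" by (rule sum.swap)
    also have "\<dots> = (\<Sum>z\<in>W. pw P W (Suc k) x z * pw P W n z y)"
      using True by (simp add: sum_distrib_right mult.assoc)
    finally show ?thesis .
  qed (auto simp: pw_out)
qed

text \<open>A walk from \<open>a\<close> to \<open>z\<close> followed by one from \<open>z\<close>
  to \<open>a\<close> is a closed walk of some length \<open>k\<close> with one of its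
  \<open>k + 1\<close> times marked. This is the origin of the factor in the bubble sum.\<close>

lemma sum_G_G_le:
  assumes W: "W \<subseteq> I"
  shows "(\<Sum>z\<in>W. G W a z * G W z a) \<le> B"
proof -
  have fin: "finite W" by (rule fin_sub[OF W])
  have abs: "summable (\<lambda>n. norm (pw P W n x y))" for x y
    using pw_summable[OF W] pw_nonneg by simp
  have "G W a z * G W z a = (\<Sum>k. \<Sum>i\<le>k. pw P W i a z * pw P W (k - i) z a)" for z
    unfolding G_def by (rule Cauchy_product[OF abs abs])
  then have "(\<Sum>z\<in>W. G W a z * G W z a) = (\<Sum>z\<in>W. \<Sum>k. \<Sum>i\<le>k. pw P W i a z * pw P W (k - i) z a)" by simp
  also have "\<dots> = (\<Sum>k. \<Sum>z\<in>W. \<Sum>i\<le>k. pw P W i a z * pw P W (k - i) z a)"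
    by (rule suminf_sum[symmetric]) (rule summable_Cauchy_product[OF abs abs])
  also have "(\<lambda>k. \<Sum>z\<in>W. \<Sum>i\<le>k. pw P W i a z * pw P W (k - i) z a) = (\<lambda>k. (real k + 1) * pw P W k a a)"
  proof
    fix k
    have "(\<Sum>z\<in>W. \<Sum>i\<le>k. pw P W i a z * pw P W (k - i) z a) = (\<Sum>i\<le>k. \<Sum>z\<in>W. pw P W i a z * pw P W (k - i) z a)"
      by (rule sum.swap)
    also have "\<dots> = (\<Sum>i\<le>k. pw P W k a a)"
      using pw_add[OF fin] by (intro sum.cong refl) (metis atMost_iff le_add_diff_inverse)
    finally show "(\<Sum>z\<in>W. \<Sum>i\<le>k. pw P W i a z * pw P W (k - i) z a) = (real k + 1) * pw P W k a a" by simp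
  qed
  also have "(\<Sum>k. (real k + 1) * pw P W k a a) \<le> B"
    unfolding B_def
  proof (rule suminf_le)
    show le: "(real k + 1) * pw P W k a a \<le> (real k + 1) * b k" for k
      by (intro mult_left_mono pw_le[OF W]) auto
    show "summable (\<lambda>k. (real k + 1) * pw P W k a a)"
      by (rule summable_comparison_test'[OF b_summable, of 0]) (use le in \<open>auto simp: pw_nonneg\<close>)
  qed (rule b_summable)
  finally show ?thesis .
qed

lemma G_le_B: "W \<subseteq> I \<Longrightarrow> G W x y \<le> B"
  unfolding G_def B_def
proof (rule suminf_le)
  assume W: "W \<subseteq> I"
  show "pw P W n x y \<le> (real n + 1) * b n" for n
  proof -
    have "0 \<le> real n * b n" using b_nonneg[of n] by simp
    then show ?thesis using pw_le[OF W, of n x y] by (simp add: distrib_right)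
  qed
  show "summable (\<lambda>n. pw P W n x y)" by (rule pw_summable[OF W])
qed (rule b_summable)

lemma Z_remove_le:
  assumes W: "W \<subseteq> I" and x: "x \<in> W" shows "Z (W - {x}) \<le> B * Z W"
  using G_le_B[OF W, of x x] G_diag[OF W x] Z_pos[OF W] by (simp add: divide_le_eq)

lemma B_nonneg: "0 \<le> B"
  unfolding B_def by (intro suminf_nonneg b_summable mult_nonneg_nonneg b_nonneg) auto

text \<open>Up to a quotient of partition functions that is at most 1, a summand is the probability
  that the forest path from \<open>y\<close> begins with \<open>y # zs\<close>. For a fixed length
  these events are disjoint.\<close>

lemma sum_tw_esc_le_1:
  assumes W: "insert y W \<subseteq> I" and y: "y \<notin> W"
  shows "(\<Sum>zs\<in>{zs\<in>TL W M. length zs = i}. tw W y zs * esc (insert y W) (insert y (set zs)) (last (y # zs))) \<le> 1"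
proof -
  let ?A = "{zs\<in>TL W M. length zs = i}" and ?V = "insert y W"
  have WI: "W \<subseteq> I" using W by auto
  have fin: "finite ?A" using finite_TL[OF fin_sub[OF WI]] by auto
  have rem: "?V - {y} = W" using y by auto
  have ZV: "Z ?V > 0" "Z ?V \<le> Z W" using Z_pos[OF W] Z_mono_remove[OF W, of y] rem by auto
  have "(\<Sum>zs\<in>?A. tw W y zs * esc ?V (insert y (set zs)) (last (y # zs))) = (\<Sum>zs\<in>?A. ZZ ?V (\<lambda>f. of_bool (follows f (y # zs)))) / Z W"
    unfolding sum_divide_distrib
  proof (rule sum.cong[OF refl])
    fix zs assume zs: "zs \<in> ?A"
    have e: "W - set zs = ?V - set (y # zs)" using y by auto
    have "ZZ ?V (\<lambda>f. of_bool (follows f (y # zs))) = pp P (y # zs) * (Z (?V - set (y # zs)) * esc ?V (set (y # zs)) (last (y # zs)))"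
      by (rule ZZ_follows_esc) (use zs y W in \<open>auto simp: TL_def\<close>)
    then show "tw W y zs * esc ?V (insert y (set zs)) (last (y # zs)) = ZZ ?V (\<lambda>f. of_bool (follows f (y # zs))) / Z W"
      unfolding tw_def e by simp
  qed
  also have "(\<Sum>zs\<in>?A. ZZ ?V (\<lambda>f. of_bool (follows f (y # zs)))) = ZZ ?V (\<lambda>f. \<Sum>zs\<in>?A. of_bool (follows f (y # zs)))"
    by (simp add: ZZ_sum)
  also have "\<dots> \<le> Z ?V"
  proof (rule ZZ_mono)
    fix f
    have "card {zs\<in>?A. follows f (y # zs)} \<le> 1"
      by (subst card_le_Suc0_iff_eq[unfolded One_nat_def[symmetric]])
         (auto intro: follows_unique_length finite_subset[OF _ fin])
    moreover have "(\<Sum>zs\<in>?A. of_bool (follows f (y # zs))) = real (card {zs\<in>?A. follows f (y # zs)})"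
      using fin by (simp add: of_bool_def sum.If_cases Int_def)
    ultimately show "(\<Sum>zs\<in>?A. of_bool (follows f (y # zs))) \<le> (1::real)" by simp
  qed
  also have "Z ?V / Z W \<le> 1" using ZV by simp
  finally show ?thesis using ZV by (simp add: divide_right_mono)
qed

text \<open>With \<open>z\<close> as an additional root a forest has at most one path from
  \<open>y\<close> to \<open>z\<close>, so the sum is at most the probability of being led to
  \<open>z\<close>, which is a Green function by \<open>G_eq\<close>. For \<open>z = y\<close> there
  is only the empty list.\<close>

lemma sum_tw_last_le:
  assumes W: "insert y W \<subseteq> I" and y: "y \<notin> W"
  shows "(\<Sum>zs\<in>{zs\<in>TL W M. last (y # zs) = z}. tw W y zs) \<le> G (insert y W) y z"
proof -
  let ?A = "{zs\<in>TL W M. last (y # zs) = z}" and ?V = "insert y W"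
  have WI: "W \<subseteq> I" using W by auto
  have fin: "finite ?A" using finite_TL[OF fin_sub[OF WI]] by auto
  have rem: "?V - {y} = W" using y by auto
  have ZV: "Z ?V > 0" "Z ?V \<le> Z W" using Z_pos[OF W] Z_mono_remove[OF W, of y] rem by auto
  consider "z = y" | "z \<in> W" "z \<noteq> y" | "z \<notin> ?V" by auto
  then show ?thesis
  proof cases
    case 1
    have "?A \<subseteq> {[]}"
    proof
      fix zs assume "zs \<in> ?A"
      then show "zs \<in> {[]}" using 1 y last_in_set[of zs] by (cases "zs = []") (auto simp: TL_def)
    qed
    then have "(\<Sum>zs\<in>?A. tw W y zs) \<le> (\<Sum>zs\<in>{[]}. tw W y zs)"
      by (intro sum_mono2) (auto simp: tw_nonneg[OF WI])
    also have "\<dots> \<le> G ?V y z" using 1 G_diag_ge_1[OF W, of y] by (simp add: tw_Nil[OF WI])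
    finally show ?thesis .
  next
    case 2
    have "(\<Sum>zs\<in>?A. tw W y zs) = (\<Sum>zs\<in>?A. ZZ (?V - {z}) (\<lambda>f. of_bool (follows f (y # zs)))) / Z W"
      unfolding sum_divide_distrib
    proof (rule sum.cong[OF refl])
      fix zs assume zs: "zs \<in> ?A"
      then have zse: "zs \<noteq> []" using 2 by auto
      have lz: "last (y # zs) = z" using zs by simp
      have d: "distinct (y # zs)" using zs y by (auto simp: TL_def)
      have bl: "z \<notin> set (butlast (y # zs))" using d lz
        by (metis append_butlast_last_id distinct_append disjoint_iff list.set_intros(1) list.discI)
      have "ZZ (?V - {z}) (\<lambda>f. of_bool (follows f (y # zs)) * 1) = pp P (y # zs) * ZZ (?V - {z} - set (y # zs)) (\<lambda>g. 1)"
      proof (rule ZZ_follows_root)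
        have "set (butlast (y # zs)) \<subseteq> set (y # zs)" by (auto dest: in_set_butlastD simp del: butlast.simps)
        also have "\<dots> \<subseteq> ?V" using zs by (auto simp: TL_def)
        finally show "set (butlast (y # zs)) \<subseteq> ?V - {z}" using bl by blast
        show "last (y # zs) \<notin> ?V - {z}" using lz by simp
      qed (use zs y W d in \<open>auto simp: TL_def\<close>)
      moreover have "z \<in> set zs" using lz zse last_in_set[OF zse] by simp
      then have "?V - {z} - set (y # zs) = W - set zs" using y by (simp only: list.set) blast
      ultimately show "tw W y zs = ZZ (?V - {z}) (\<lambda>f. of_bool (follows f (y # zs))) / Z W"
        unfolding tw_def by simp
    qed
    also have "(\<Sum>zs\<in>?A. ZZ (?V - {z}) (\<lambda>f. of_bool (follows f (y # zs)))) = ZZ (?V - {z}) (\<lambda>f. \<Sum>zs\<in>?A. of_bool (follows f (y # zs)))"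
      by (simp add: ZZ_sum)
    also have "\<dots> \<le> ZZ (?V - {z}) (\<lambda>f. of_bool (reach f y z))"
    proof (rule ZZ_mono)
      fix f assume f: "f \<in> forests S (?V - {z})"
      have fz: "f z = z" using forests_out[OF f] by auto
      have eq: "(\<Sum>zs\<in>?A. of_bool (follows f (y # zs))) = real (card {zs\<in>?A. follows f (y # zs)})"
        using fin by (simp add: of_bool_def sum.If_cases Int_def)
      have "zs = zs'" if "zs \<in> {zs\<in>?A. follows f (y # zs)}" "zs' \<in> {zs\<in>?A. follows f (y # zs)}" for zs zs'
        using that y fz by (intro follows_unique_root[of f y zs zs' z]) (auto simp: TL_def)
      then have "card {zs\<in>?A. follows f (y # zs)} \<le> 1"
        by (subst card_le_Suc0_iff_eq[unfolded One_nat_def[symmetric]]) (blast intro: finite_subset[OF _ fin])+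
      moreover have "card {zs\<in>?A. follows f (y # zs)} = 0" if "\<not> reach f y z"
      proof -
        have "\<not> follows f (y # zs)" if "zs \<in> ?A" for zs
        proof -
          have "last (y # zs) = z" using that by blast
          then show ?thesis using \<open>\<not> reach f y z\<close> follows_reach[of f y zs] by metis
        qed
        then have "{zs\<in>?A. follows f (y # zs)} = {}" by blast
        then show ?thesis by (simp only: card.empty)
      qed
      ultimately show "(\<Sum>zs\<in>?A. of_bool (follows f (y # zs))) \<le> (of_bool (reach f y z) :: real)"
        unfolding eq by (cases "reach f y z") auto
    qed
    also have "ZZ (?V - {z}) (\<lambda>f. of_bool (reach f y z)) / Z W \<le> G ?V y z"
    proof -
      have "ZZ (?V - {z}) (\<lambda>f. of_bool (reach f y z)) = G ?V y z * Z ?V"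
        using G_eq[OF W, of z y] 2 W ZV by auto
      also have "\<dots> \<le> G ?V y z * Z W" using ZV G_nonneg[OF W] by (intro mult_left_mono) auto
      finally show ?thesis using ZV by (simp add: divide_le_eq)
    qed
    finally show ?thesis using ZV by (simp add: divide_right_mono)
  next
    case 3
    have "?A = {}"
    proof -
      { fix zs assume "zs \<in> ?A"
        then have False using 3 last_in_set[of zs] by (cases "zs = []") (auto simp: TL_def) }
      then show ?thesis by blast
    qed
    then have "(\<Sum>zs\<in>?A. tw W y zs) = 0" by (simp only: sum.empty)
    then show ?thesis using G_nonneg[OF W, of y z] by (simp only:)
  qed
qed

lemma tail_props:
  assumes "zs \<in> TL W M" "y \<notin> W"
  shows "last (y # zs) \<in> insert y W" "last (y # zs) \<notin> W - set zs" "insert (last (y # zs)) (W - set zs) \<subseteq> insert y W"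
proof -
  have "last (y # zs) \<in> insert y (set zs)" using last_in_set[of "y # zs"] by auto
  then show "last (y # zs) \<in> insert y W" "last (y # zs) \<notin> W - set zs" "insert (last (y # zs)) (W - set zs) \<subseteq> insert y W"
    using assms by (auto simp: TL_def)
qed

lemma sum_tw_G_le:
  assumes V: "V \<subseteq> I" and W: "insert a W \<subseteq> V" and a: "a \<notin> W"
  shows "(\<Sum>zs\<in>TL W M. tw W a zs * G V (last (a # zs)) a) \<le> B"
proof -
  have WI: "insert a W \<subseteq> I" "W \<subseteq> I" using V W by auto
  have finV: "finite V" by (rule fin_sub[OF V])
  have fin: "finite (TL W M)" by (rule finite_TL[OF fin_sub[OF WI(2)]])
  have l: "last (a # zs) \<in> V" if "zs \<in> TL W M" for zs
    using tail_props(1)[OF that a] W by auto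
  have "(\<Sum>zs\<in>TL W M. tw W a zs * G V (last (a # zs)) a) = (\<Sum>z\<in>V. \<Sum>zs\<in>{zs\<in>TL W M. last (a # zs) = z}. tw W a zs * G V (last (a # zs)) a)"
    by (rule sum.group[symmetric]) (use fin finV in \<open>auto simp del: last.simps intro: l\<close>)
  also have "\<dots> = (\<Sum>z\<in>V. (\<Sum>zs\<in>{zs\<in>TL W M. last (a # zs) = z}. tw W a zs) * G V z a)"
    by (simp add: sum_distrib_right)
  also have "\<dots> \<le> (\<Sum>z\<in>V. G V a z * G V z a)"
  proof (intro sum_mono mult_right_mono G_nonneg[OF V])
    fix z
    show "(\<Sum>zs\<in>{zs\<in>TL W M. last (a # zs) = z}. tw W a zs) \<le> G V a z"
      using sum_tw_last_le[OF WI(1) a, of M z] G_mono[OF W V, of a z] by linarith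
  qed
  also have "\<dots> \<le> B" by (rule sum_G_G_le[OF V])
  finally show ?thesis .
qed

text \<open>The weight \<open>tw\<close> lacks the escape factor, so paths of one length are not
  disjoint events. Last exit spreads a total weight 1 over the vertices of the path. Cut at such a
  vertex, the initial piece carries an escape factor and sums to at most 1 for each of the
  \<open>M + 1\<close> lengths; the final piece carries a Green function back to its start and sums
  to at most the bubble \<open>B\<close>.\<close>

lemma sum_tw_le:
  assumes W: "insert y W \<subseteq> I" and y: "y \<notin> W"
  shows "(\<Sum>zs\<in>TL W M. tw W y zs) \<le> B * (real M + 1)"
proof -
  let ?V = "insert y W"
  have WI: "W \<subseteq> I" using W by auto
  have finW: "finite W" by (rule fin_sub[OF WI])
  define t where "t as bs = tw W y as * esc ?V (insert y (set as)) (last (y # as)) * (tw (W - set as) (last (y # as)) bs * G ?V (last (last (y # as) # bs)) (last (y # as)))" for as bs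
  have en: "0 \<le> esc ?V K (last (y # as))" if "as \<in> TL W M" for as K
    using tail_props(1)[OF that y] W by (intro esc_nonneg[OF W]) auto
  have "(\<Sum>zs\<in>TL W M. tw W y zs) \<le> (\<Sum>zs\<in>TL W M. \<Sum>i\<le>length zs. t (take i zs) (drop i zs))"
  proof (rule sum_mono)
    fix zs assume zs: "zs \<in> TL W M"
    let ?K = "insert y (set zs)"
    have d: "distinct (y # zs)" and K: "?K \<subseteq> ?V" using zs y by (auto simp: TL_def)
    have lK: "last (y # zs) \<in> ?K" using last_in_set[of "y # zs"] by auto
    have "tw W y zs = tw W y zs * (\<Sum>a\<in>?K. G ?V (last (y # zs)) a * esc ?V ?K a)"
      using last_exit[OF W K lK] by simp
    also have "(\<Sum>a\<in>?K. G ?V (last (y # zs)) a * esc ?V ?K a) = (\<Sum>i<length (y # zs). G ?V (last (y # zs)) ((y # zs) ! i) * esc ?V ?K ((y # zs) ! i))"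
      using sum_set_nth[OF d] by simp
    also have "{..<length (y # zs)} = {..length zs}" by auto
    also have "tw W y zs * (\<Sum>i\<le>length zs. G ?V (last (y # zs)) ((y # zs) ! i) * esc ?V ?K ((y # zs) ! i)) \<le> (\<Sum>i\<le>length zs. t (take i zs) (drop i zs))"
      unfolding sum_distrib_left
    proof (rule sum_mono)
      fix i assume i: "i \<in> {..length zs}"
      let ?as = "take i zs" and ?bs = "drop i zs"
      have as: "?as \<in> TL W M" using zs by (auto simp: TL_def dest: in_set_takeD)
      have n: "(y # zs) ! i = last (y # ?as)" using last_take_Cons[of i zs y] i by simp
      have l: "last (y # zs) = last (last (y # ?as) # ?bs)"
        by (metis append_Cons append_take_drop_id last_append last_ConsL last_ConsR append_Nil2)
      let ?c = "tw W y ?as * tw (W - set ?as) (last (y # ?as)) ?bs * G ?V (last (y # zs)) (last (y # ?as))"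
      have tw: "tw W y zs = tw W y ?as * tw (W - set ?as) (last (y # ?as)) ?bs"
        using tw_append[OF WI, of y ?as ?bs] by simp
      \<comment> \<open>Only the initial piece is kept as an obstacle. This enlarges the escape
        probability and makes the two pieces independent of each other.\<close>
      have e: "esc ?V ?K (last (y # ?as)) \<le> esc ?V (insert y (set ?as)) (last (y # ?as))"
        using K by (intro esc_antimono[OF W]) (auto dest: in_set_takeD)
      have c: "0 \<le> ?c"
        using WI by (intro mult_nonneg_nonneg tw_nonneg G_nonneg[OF W]) auto
      show "tw W y zs * (G ?V (last (y # zs)) ((y # zs) ! i) * esc ?V ?K ((y # zs) ! i)) \<le> t ?as ?bs"
        unfolding t_def n l[symmetric] tw using mult_left_mono[OF e c] by (simp only: mult_ac)
    qed
    finally show "tw W y zs \<le> (\<Sum>i\<le>length zs. t (take i zs) (drop i zs))" .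
  qed
  also have "\<dots> \<le> (\<Sum>as\<in>TL W M. \<Sum>bs\<in>TL (W - set as) M. t as bs)"
    using en WI by (intro sum_TL_split[OF finW]) (auto simp: t_def simp del: last.simps intro!: mult_nonneg_nonneg tw_nonneg G_nonneg[OF W])
  also have "\<dots> \<le> (\<Sum>as\<in>TL W M. tw W y as * esc ?V (insert y (set as)) (last (y # as)) * B)"
  proof (rule sum_mono)
    fix as assume as: "as \<in> TL W M"
    have "(\<Sum>bs\<in>TL (W - set as) M. tw (W - set as) (last (y # as)) bs * G ?V (last (last (y # as) # bs)) (last (y # as))) \<le> B"
      using tail_props[OF as y] by (intro sum_tw_G_le[OF W])
    then show "(\<Sum>bs\<in>TL (W - set as) M. t as bs) \<le> tw W y as * esc ?V (insert y (set as)) (last (y # as)) * B"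
      unfolding t_def sum_distrib_left[symmetric] using en[OF as] tw_nonneg[OF WI] by (intro mult_left_mono) auto
  qed
  also have "\<dots> = (\<Sum>i\<le>M. \<Sum>as\<in>{as\<in>TL W M. length as = i}. tw W y as * esc ?V (insert y (set as)) (last (y # as))) * B"
    unfolding sum_distrib_right[symmetric]
    by (rule arg_cong[where f = "\<lambda>t. t * B"], rule sum.group[symmetric]) (use finite_TL[OF finW] in \<open>auto simp: TL_def\<close>)
  also have "\<dots> \<le> (\<Sum>i\<le>M. 1) * B"
    by (intro mult_right_mono sum_mono sum_tw_esc_le_1 W y B_nonneg)
  finally show ?thesis by (simp add: mult.commute add.commute)
qed

lemma sum_tw_G_tail_le:
  assumes V: "V \<subseteq> I" and W: "insert a W \<subseteq> V" and a: "a \<notin> W"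
  shows "(\<Sum>zs\<in>TL W M. tw W a zs * (\<Sum>j\<le>length zs. G V ((a # zs) ! j) a)) \<le> B * (B * (real M + 1))"
proof -
  have WI: "insert a W \<subseteq> I" "W \<subseteq> I" using V W by auto
  have finW: "finite W" by (rule fin_sub[OF WI(2)])
  define t where "t as bs = tw W a as * G V (last (a # as)) a * tw (W - set as) (last (a # as)) bs" for as bs
  have "(\<Sum>zs\<in>TL W M. tw W a zs * (\<Sum>j\<le>length zs. G V ((a # zs) ! j) a)) = (\<Sum>zs\<in>TL W M. \<Sum>i\<le>length zs. t (take i zs) (drop i zs))"
    unfolding sum_distrib_left
  proof (intro sum.cong refl)
    fix zs :: "'a list" and i assume "i \<in> {..length zs}"
    then show "tw W a zs * G V ((a # zs) ! i) a = t (take i zs) (drop i zs)"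
      using tw_append[OF WI(2), of a "take i zs" "drop i zs"] last_take_Cons[of i zs a] by (simp add: t_def)
  qed
  also have "\<dots> \<le> (\<Sum>as\<in>TL W M. \<Sum>bs\<in>TL (W - set as) M. t as bs)"
    using WI by (intro sum_TL_split[OF finW]) (auto simp: t_def simp del: last.simps intro!: mult_nonneg_nonneg tw_nonneg G_nonneg[OF V])
  also have "\<dots> \<le> (\<Sum>as\<in>TL W M. tw W a as * G V (last (a # as)) a * (B * (real M + 1)))"
  proof (rule sum_mono)
    fix as assume as: "as \<in> TL W M"
    have "(\<Sum>bs\<in>TL (W - set as) M. tw (W - set as) (last (a # as)) bs) \<le> B * (real M + 1)"
      using tail_props[OF as a] WI by (intro sum_tw_le) blast+
    then show "(\<Sum>bs\<in>TL (W - set as) M. t as bs) \<le> tw W a as * G V (last (a # as)) a * (B * (real M + 1))"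
      unfolding t_def sum_distrib_left[symmetric] using tw_nonneg[OF WI(2)] G_nonneg[OF V] by (intro mult_left_mono) auto
  qed
  also have "\<dots> \<le> B * (B * (real M + 1))"
    unfolding sum_distrib_right[symmetric] using B_nonneg
    by (intro mult_right_mono sum_tw_G_le[OF V W a]) auto
  finally show ?thesis .
qed

text \<open>The path is cut at the earlier of the two vertices. The bound is quadratic in
  \<open>M\<close> while the total weight of the paths is bounded linearly; Markov's inequality then
  makes energy far above order \<open>M\<close> rare.\<close>

lemma sum_tw_energy_le:
  assumes W: "insert y W \<subseteq> I" and y: "y \<notin> W"
  shows "(\<Sum>zs\<in>TL W M. tw W y zs * (\<Sum>i\<le>length zs. \<Sum>j\<le>length zs - i. G (insert y W) ((y # zs) ! (i + j)) ((y # zs) ! i)))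
     \<le> B * (real M + 1) * (B * (B * (real M + 1)))"
proof -
  let ?V = "insert y W"
  have WI: "W \<subseteq> I" using W by auto
  have finW: "finite W" by (rule fin_sub[OF WI])
  define t where "t as bs = tw W y as * (tw (W - set as) (last (y # as)) bs * (\<Sum>j\<le>length bs. G ?V ((last (y # as) # bs) ! j) (last (y # as))))" for as bs
  have "(\<Sum>zs\<in>TL W M. tw W y zs * (\<Sum>i\<le>length zs. \<Sum>j\<le>length zs - i. G ?V ((y # zs) ! (i + j)) ((y # zs) ! i))) = (\<Sum>zs\<in>TL W M. \<Sum>i\<le>length zs. t (take i zs) (drop i zs))"
    unfolding sum_distrib_left[of "tw _ _ _" _ "{..length _}"]
  proof (intro sum.cong refl)
    fix zs :: "'a list" and i assume i: "i \<in> {..length zs}"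
    have n: "((y # zs) ! i # drop i zs) ! j = (y # zs) ! (i + j)" if "j \<le> length zs - i" for j
      using that i by (cases j) auto
    show "tw W y zs * (\<Sum>j\<le>length zs - i. G ?V ((y # zs) ! (i + j)) ((y # zs) ! i)) = t (take i zs) (drop i zs)"
      using tw_append[OF WI, of y "take i zs" "drop i zs"] last_take_Cons[of i zs y] i by (simp add: t_def n)
  qed
  also have "\<dots> \<le> (\<Sum>as\<in>TL W M. \<Sum>bs\<in>TL (W - set as) M. t as bs)"
    using WI by (intro sum_TL_split[OF finW]) (auto simp: t_def simp del: last.simps intro!: mult_nonneg_nonneg tw_nonneg sum_nonneg G_nonneg[OF W])
  also have "\<dots> \<le> (\<Sum>as\<in>TL W M. tw W y as * (B * (B * (real M + 1))))"
  proof (rule sum_mono)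
    fix as assume as: "as \<in> TL W M"
    have "(\<Sum>bs\<in>TL (W - set as) M. tw (W - set as) (last (y # as)) bs * (\<Sum>j\<le>length bs. G ?V ((last (y # as) # bs) ! j) (last (y # as)))) \<le> B * (B * (real M + 1))"
      using tail_props[OF as y] by (intro sum_tw_G_tail_le[OF W])
    then show "(\<Sum>bs\<in>TL (W - set as) M. t as bs) \<le> tw W y as * (B * (B * (real M + 1)))"
      unfolding t_def sum_distrib_left[symmetric] using tw_nonneg[OF WI] by (intro mult_left_mono) auto
  qed
  also have "\<dots> \<le> B * (real M + 1) * (B * (B * (real M + 1)))"
    unfolding sum_distrib_right[symmetric] using B_nonneg
    by (intro mult_right_mono sum_tw_le[OF W y]) auto
  finally show ?thesis .
qed

end

section \<open>Excursions of the Aldous--Broder chain\<close>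

lemma reach_fixed_unique: "reach f y a \<Longrightarrow> reach f y c \<Longrightarrow> f a = a \<Longrightarrow> f c = c \<Longrightarrow> a = c"
  using reach_linear[of f y a c] reach_fixed[of f a c] reach_fixed[of f c a] by auto

section \<open>Tree structure seen from the root and past paths of a vertex\<close>

text \<open>For a root \<open>z\<close> and a vertex \<open>y\<close> other than \<open>z\<close> in
  its tree: the last vertex before \<open>z\<close> on the path from \<open>y\<close>. It recovers
  the previous position of the walker when a move is undone.\<close>

definition child :: "('a \<Rightarrow> 'a) \<Rightarrow> 'a \<Rightarrow> 'a \<Rightarrow> 'a" where
  "child g y z = (THE x. x \<noteq> z \<and> g x = z \<and> reach g y x)"

lemma child_eqI:
  assumes "g z = z" "x \<noteq> z" "g x = z" "reach g y x"
  shows "child g y z = x"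
  unfolding child_def
proof (rule the_equality)
  fix x' assume x': "x' \<noteq> z \<and> g x' = z \<and> reach g y x'"
  have "reach g x x' \<or> reach g x' x" using reach_linear[of g y x x'] x' assms by auto
  then show "x' = x"
    using reach_cases[of g x x'] reach_cases[of g x' x] reach_fixed[of g z] x' assms by auto
qed (use assms in auto)

lemma child_props:
  assumes "reach g y z" "y \<noteq> z" "g z = z"
  shows "child g y z \<noteq> z" "g (child g y z) = z" "reach g y (child g y z)"
proof -
  obtain n where n: "(g ^^ n) y = z" "\<And>k. k < n \<Longrightarrow> (g ^^ k) y \<noteq> z" using assms(1) by (rule reach_least) blast
  obtain k where k: "n = Suc k" using n(1) assms(2) by (cases n) auto
  have "child g y z = (g ^^ k) y"
    using n k assms(3) by (intro child_eqI) (auto simp: reach_def)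
  then show "child g y z \<noteq> z" "g (child g y z) = z" "reach g y (child g y z)"
    using n k by (auto simp: reach_def)
qed

definition deep :: "('a \<Rightarrow> 'a) \<Rightarrow> 'a \<Rightarrow> nat \<Rightarrow> bool" where
  "deep f u N \<longleftrightarrow> (\<exists>y. (f ^^ N) y = u \<and> (\<forall>j<N. (f ^^ j) y \<noteq> u))"

text \<open>Recorded as vertex sets, since the excursion argument only asks whether a path is hit.
  That a path extends \<open>N\<close> further steps into the past is the source of the small factor
  in the recursion.\<close>

definition deep_paths :: "('a \<Rightarrow> 'a) \<Rightarrow> 'a \<Rightarrow> nat \<Rightarrow> nat \<Rightarrow> 'a set set" where
  "deep_paths f v n N = {(\<lambda>j. (f ^^ j) u) ` {..n} |u. (f ^^ n) u = v \<and> (\<forall>j<n. (f ^^ j) u \<noteq> v) \<and> deep f u N}"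

lemma funpow_eq_off:
  assumes "\<And>a. a \<notin> X \<Longrightarrow> f' a = f a" "\<And>a. a \<in> X \<Longrightarrow> \<not> reach f' a v" "(f' ^^ M) y = v" "i \<le> M"
  shows "(f' ^^ i) y = (f ^^ i) y"
  using assms(4)
proof (induction i)
  case (Suc i)
  have "(f' ^^ (M - i)) ((f' ^^ i) y) = v" using assms(3) Suc.prems by (metis Suc_leD funpow_add_apply le_add_diff_inverse2)
  then have "reach f' ((f' ^^ i) y) v" by (auto simp: reach_def)
  then have "(f' ^^ i) y \<notin> X" using assms(2) by blast
  then show ?case using Suc assms(1) by simp
qed simp

text \<open>A path of \<open>f'\<close> into \<open>v\<close> avoids \<open>X\<close>, hence is a
  path of \<open>f\<close> already. In an excursion \<open>X\<close> consists of the vertices whose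
  arcs have just changed; as long as they do not lead to \<open>v\<close>, past paths of
  \<open>v\<close> can only be destroyed.\<close>

lemma deep_paths_mono:
  assumes "\<And>a. a \<notin> X \<Longrightarrow> f' a = f a" "\<And>a. a \<in> X \<Longrightarrow> \<not> reach f' a v"
  shows "deep_paths f' v n N \<subseteq> deep_paths f v n N"
proof
  fix K assume "K \<in> deep_paths f' v n N"
  then obtain u y where K: "K = (\<lambda>j. (f' ^^ j) u) ` {..n}" and u: "(f' ^^ n) u = v" "\<forall>j<n. (f' ^^ j) u \<noteq> v"
    and y: "(f' ^^ N) y = u" "\<forall>j<N. (f' ^^ j) y \<noteq> u"
    by (auto simp: deep_paths_def deep_def)
  have eu: "(f' ^^ j) u = (f ^^ j) u" if "j \<le> n" for j using that by (intro funpow_eq_off[where X = X and v = v and M = n] assms u(1))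
  have yv: "(f' ^^ (n + N)) y = v" using u y by (simp add: funpow_add_apply)
  have ey: "(f' ^^ j) y = (f ^^ j) y" if "j \<le> N" for j
  proof -
    have "j \<le> n + N" using that by simp
    then show ?thesis by (intro funpow_eq_off[where X = X and v = v and M = "n + N"] assms yv)
  qed
  have "K = (\<lambda>j. (f ^^ j) u) ` {..n}" unfolding K using eu by (intro image_cong) auto
  moreover have "(f ^^ n) u = v" "\<forall>j<n. (f ^^ j) u \<noteq> v" using u eu by auto
  moreover have "deep f u N" unfolding deep_def using y ey by (intro exI[of _ y]) auto
  ultimately show "K \<in> deep_paths f v n N" unfolding deep_paths_def by blast
qed

lemma deep_paths_in: "K \<in> deep_paths f v n N \<Longrightarrow> a \<in> K \<Longrightarrow> reach f a v"
proof -
  assume K: "K \<in> deep_paths f v n N" and a: "a \<in> K"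
  then obtain u j where u: "(f ^^ n) u = v" "a = (f ^^ j) u" "j \<le> n"
    by (auto simp: deep_paths_def)
  then have "(f ^^ (n - j)) a = v" by (metis funpow_add_apply le_add_diff_inverse2)
  then show ?thesis by (auto simp: reach_def)
qed

context chain
begin

text \<open>In each forest exactly one vertex on the path from \<open>x0\<close> has its arc leaving
  \<open>W\<close>. Summing over the final step therefore produces every forest exactly once, with
  its own weight.\<close>

lemma excursion_terminal:
  assumes W: "W \<subseteq> I" and x0: "x0 \<in> W"
  shows "(\<Sum>x\<in>W. ZZ (W - {x}) (\<lambda>f. of_bool (reach f x0 x) * (\<Sum>r\<in>S - W. P x r * \<Phi> (f(x := r))))) = ZZ W \<Phi>"
proof -
  have finW: "finite W" by (rule fin_sub[OF W])
  have "(\<Sum>x\<in>W. ZZ (W - {x}) (\<lambda>f. of_bool (reach f x0 x) * (\<Sum>r\<in>S - W. P x r * \<Phi> (f(x := r)))))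
      = (\<Sum>x\<in>W. \<Sum>r\<in>S - W. ZZ W (\<lambda>f. of_bool (f x = r) * (of_bool (reach f x0 x) * \<Phi> f)))"
  proof (rule sum.cong[OF refl])
    fix x assume x: "x \<in> W"
    have "ZZ W (\<lambda>f. of_bool (f x = r) * (of_bool (reach f x0 x) * \<Phi> f)) = P x r * ZZ (W - {x}) (\<lambda>f. of_bool (reach f x0 x) * \<Phi> (f(x := r)))"
      if r: "r \<in> S - W" for r
    proof -
      have "\<not> reach g r x" if "g \<in> forests S (W - {x})" for g
        using reach_fixed[of g r x] forests_out[OF that, of r] r x by auto
      then have "ZZ (W - {x}) (\<lambda>g. of_bool (\<not> reach g r x) * (of_bool (reach (g(x := r)) x0 x) * \<Phi> (g(x := r))))
        = ZZ (W - {x}) (\<lambda>f. of_bool (reach f x0 x) * \<Phi> (f(x := r)))"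
        by (intro ZZ_cong) (auto simp: reach_upd_iff)
      then show ?thesis using ZZ_eq_step[OF W x, of r] r by auto
    qed
    then show "ZZ (W - {x}) (\<lambda>f. of_bool (reach f x0 x) * (\<Sum>r\<in>S - W. P x r * \<Phi> (f(x := r))))
      = (\<Sum>r\<in>S - W. ZZ W (\<lambda>f. of_bool (f x = r) * (of_bool (reach f x0 x) * \<Phi> f)))"
      by (simp add: sum_distrib_left ZZ_sum ZZ_cmult[symmetric] mult_ac)
  qed
  also have "\<dots> = ZZ W (\<lambda>f. (\<Sum>x\<in>W. \<Sum>r\<in>S - W. of_bool (f x = r) * of_bool (reach f x0 x)) * \<Phi> f)"
    by (simp add: ZZ_sum sum_distrib_right mult.assoc)
  also have "\<dots> = ZZ W \<Phi>"
  proof (rule ZZ_cong)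
    fix f assume f: "f \<in> forests S W"
    obtain n where n: "(f ^^ n) x0 \<notin> W" "\<And>k. k < n \<Longrightarrow> (f ^^ k) x0 \<in> W"
      using LeastI_ex[OF forests_exit[OF f, of x0]] not_less_Least[of _ "\<lambda>n. (f ^^ n) x0 \<notin> W"] by blast
    obtain k where k: "n = Suc k" using n(1) x0 by (cases n) auto
    define l where "l = (f ^^ k) x0"
    have l: "l \<in> W" "f l \<notin> W" "reach f x0 l" using n k by (auto simp: l_def reach_def)
    have uniq: "x = l" if "x \<in> W" "f x \<notin> W" "reach f x0 x" for x
    proof -
      have "reach f x l \<or> reach f l x" using reach_linear[OF that(3) l(3)] .
      then show ?thesis
        using reach_cases[of f x l] reach_cases[of f l x] reach_fixed[of f "f x" l] reach_fixed[of f "f l" x]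
          forests_out[OF f, of "f x"] forests_out[OF f, of "f l"] that l by auto
    qed
    have "(\<Sum>r\<in>S - W. of_bool (f x = r) * of_bool (reach f x0 x)) = (of_bool (x = l) :: real)" if x: "x \<in> W" for x
    proof -
      have "(\<Sum>r\<in>S - W. of_bool (f x = r) * of_bool (reach f x0 x)) = (\<Sum>r\<in>S - W. if f x = r then of_bool (reach f x0 x) else (0::real))"
        by (rule sum.cong) auto
      also have "\<dots> = (if f x \<in> S - W then of_bool (reach f x0 x) else 0)"
        using fin_S by (simp add: sum.delta)
      also have "\<dots> = of_bool (x = l)"
      proof (cases "x = l")
        case True
        then show ?thesis using l forests_in[OF f x] by simp
      next
        case False
        then have "\<not> (f x \<in> S - W \<and> reach f x0 x)" using uniq[OF x] by blast
        then show ?thesis using False by auto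
      qed
      finally show ?thesis .
    qed
    then have "(\<Sum>x\<in>W. \<Sum>r\<in>S - W. of_bool (f x = r) * of_bool (reach f x0 x)) = (\<Sum>x\<in>W. of_bool (x = l) :: real)"
      by (intro sum.cong) auto
    also have "\<dots> = 1" using finW l by (simp add: of_bool_def)
    finally show "(\<Sum>x\<in>W. \<Sum>r\<in>S - W. of_bool (f x = r) * of_bool (reach f x0 x)) * \<Phi> f = \<Phi> f" by simp
  qed
  finally show ?thesis .
qed

text \<open>
  The measure giving weight \<open>wt (W - {x}) f\<close> to the pairs \<open>(x, f)\<close> with \<open>reach f x0 x\<close> is the occupation
  measure of the Aldous--Broder chain: a walker moves from \<open>x0\<close> until it leaves \<open>W\<close>, and the forest always
  records the last exit from each visited vertex.
\<close>

lemma excursion_occupation: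
  assumes W: "W \<subseteq> I" and x0: "x0 \<in> W"
  shows "(\<Sum>x\<in>W. ZZ (W - {x}) (\<lambda>f. of_bool (reach f x0 x) * \<Psi> x f)) =
     ZZ W (\<lambda>F. \<Psi> x0 (F(x0 := x0))) +
     (\<Sum>x\<in>W. ZZ (W - {x}) (\<lambda>f. of_bool (reach f x0 x) * (\<Sum>z\<in>W. P x z * \<Psi> z ((f(x := z))(z := z)))))"
proof -
  have finW: "finite W" by (rule fin_sub[OF W])
  let ?F = "\<lambda>x. {f\<in>forests S (W - {x}). reach f x0 x}"
  let ?E = "SIGMA z:W. ?F z \<times> S" and ?B = "SIGMA x:W. ?F x \<times> W"
  \<comment> \<open>The initial states. Attaching \<open>x0\<close> to such a \<open>y\<close> gives
    a forest without walker, and cutting the arc of \<open>x0\<close> starts the excursion.\<close>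
  let ?N = "{(z, g, y) \<in> ?E. z = x0 \<and> \<not> reach g y z}"
  let ?w = "\<lambda>(z, g, y). wt (W - {z}) g * P z y * \<Psi> z g"
  let ?w' = "\<lambda>(x, f, z). wt (W - {x}) f * P x z * \<Psi> z ((f(x := z))(z := z))"
  let ?j = "\<lambda>(x, f, z). (z, (f(x := z))(z := z), f z)"
  \<comment> \<open>A move from \<open>x\<close> to \<open>z\<close> adds the arc from
    \<open>x\<close> to \<open>z\<close> and forgets the arc of \<open>z\<close> to
    \<open>y\<close>. To undo it, the previous position is the child of \<open>z\<close> towards
    \<open>y\<close> if \<open>y\<close> lies in the tree of \<open>z\<close>, and otherwise the
    child towards \<open>x0\<close>. The case \<open>y = z\<close> encodes a step that stays at
    \<open>z\<close>.\<close>
  let ?s = "\<lambda>z g y. if reach g y z then y else x0"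
  let ?i = "\<lambda>(z, g, y). if y = z then (z, g, z) else (child g (?s z g y) z, (g(child g (?s z g y) z := child g (?s z g y) z))(z := y), z)"
  have finF: "finite (?F x)" for x
    using fin_forests[of "W - {x}"] W by auto
  have finE: "finite ?E" using finW fin_S finF by (intro finite_SigmaI finite_cartesian_product) auto
  have ZF: "ZZ (W - {x}) (\<lambda>f. of_bool (reach f x0 x) * \<Phi> f) = (\<Sum>f\<in>?F x. wt (W - {x}) f * \<Phi> f)" for x \<Phi>
    unfolding ZZ_def using fin_forests[of "W - {x}"] W
    by (simp add: sum.inter_filter) (intro sum.cong, auto)
  \<comment> \<open>Since rows sum to 1, a state can be decorated with a further arc
    \<open>y\<close> of weight \<open>P z y\<close>; it stands for the arc that the last move
    erased.\<close>
  have L: "(\<Sum>x\<in>W. ZZ (W - {x}) (\<lambda>f. of_bool (reach f x0 x) * \<Psi> x f)) = sum ?w ?E"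
  proof -
    have "(\<Sum>f\<in>?F x. wt (W - {x}) f * \<Psi> x f) = (\<Sum>(f, y)\<in>?F x \<times> S. wt (W - {x}) f * P x y * \<Psi> x f)" if "x \<in> W" for x
    proof -
      have "(\<Sum>y\<in>S. P x y) = 1" using that W by (intro row) auto
      then have "(\<Sum>f\<in>?F x. wt (W - {x}) f * \<Psi> x f) = (\<Sum>f\<in>?F x. wt (W - {x}) f * (\<Sum>y\<in>S. P x y) * \<Psi> x f)" by simp
      also have "\<dots> = (\<Sum>f\<in>?F x. \<Sum>y\<in>S. wt (W - {x}) f * P x y * \<Psi> x f)"
        by (simp add: sum_distrib_left sum_distrib_right)
      also have "\<dots> = (\<Sum>(f, y)\<in>?F x \<times> S. wt (W - {x}) f * P x y * \<Psi> x f)" by (rule sum.cartesian_product)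
      finally show ?thesis .
    qed
    then show ?thesis unfolding ZF using finW finF fin_S
      by (subst sum.Sigma[symmetric]) auto
  qed
  have R: "(\<Sum>x\<in>W. ZZ (W - {x}) (\<lambda>f. of_bool (reach f x0 x) * (\<Sum>z\<in>W. P x z * \<Psi> z ((f(x := z))(z := z))))) = sum ?w' ?B"
  proof -
    have "(\<Sum>f\<in>?F x. wt (W - {x}) f * (\<Sum>z\<in>W. P x z * \<Psi> z ((f(x := z))(z := z)))) = (\<Sum>(f, z)\<in>?F x \<times> W. wt (W - {x}) f * P x z * \<Psi> z ((f(x := z))(z := z)))" for x
      by (simp add: sum_distrib_left mult.assoc sum.cartesian_product)
    then show ?thesis unfolding ZF using finW finF
      by (subst sum.Sigma[symmetric]) auto
  qed
  have Zst: "ZZ W (\<lambda>F. \<Psi> x0 (F(x0 := x0))) = sum ?w ?N"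
  proof -
    let ?D = "SIGMA g:forests S (W - {x0}). {y\<in>S. \<not> reach g y x0}"
    have "ZZ W (\<lambda>F. \<Psi> x0 (F(x0 := x0))) = (\<Sum>g\<in>forests S (W - {x0}). \<Sum>y\<in>{y\<in>S. \<not> reach g y x0}. wt (W - {x0}) g * P x0 y * \<Psi> x0 g)"
      unfolding ZZ_split[OF W x0]
      by (intro sum.cong refl) (auto simp: fun_upd_idem forests_out)
    also have "\<dots> = (\<Sum>(g, y)\<in>?D. wt (W - {x0}) g * P x0 y * \<Psi> x0 g)"
      using W fin_S by (intro sum.Sigma fin_forests ballI) auto
    also have "\<dots> = sum ?w ?N"
      by (rule sum.reindex_bij_witness[where i = "\<lambda>(z, g, y). (g, y)" and j = "\<lambda>(g, y). (x0, g, y)"]) (use x0 in auto)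
    finally show ?thesis .
  qed
  have jB: "?j p \<in> ?E - ?N \<and> ?i (?j p) = p \<and> ?w (?j p) = ?w' p" if p: "p \<in> ?B" for p
  proof -
    obtain x f z where pe: "p = (x, f, z)" by (cases p) auto
    have x: "x \<in> W" and f: "f \<in> forests S (W - {x})" and rx: "reach f x0 x" and z: "z \<in> W"
      using p pe by auto
    have fx: "f x = x" using forests_out[OF f] by auto
    show ?thesis
    proof (cases "z = x")
      case True
      then show ?thesis using pe x f rx fx W by (auto simp: fun_upd_idem)
    next
      case zx: False
      define f' where "f' = f(z := z)"
      define g where "g = (f(x := z))(z := z)"
      have gf': "g = f'(x := z)" unfolding g_def f'_def using zx by (simp add: fun_upd_twist)
      have zW: "z \<in> W - {x}" using z zx by auto
      have f': "f' \<in> forests S (W - {z} - {x})" unfolding f'_def using forests_reset(1)[OF f zW]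
        by (simp add: Diff_insert[symmetric] insert_commute)
      have f'z: "f' z = z" by (simp add: f'_def)
      have f'x: "f' x = x" using zx fx by (simp add: f'_def)
      have gF: "g \<in> forests S (W - {z})" unfolding gf'
        by (rule forests_upd[OF f']) (use x zx W z f'z reach_fixed[of f' z x] in auto)
      have gz: "g z = z" and gx: "g x = z" using zx by (auto simp: g_def)
      have yS: "f z \<in> S" "f z \<noteq> z" using forests_in[OF f zW] forests_ne[OF f zW] by auto
      have nyz: "\<not> reach f (f z) z"
      proof
        assume "reach f (f z) z"
        then have "z = f z" using forests_antisym[OF f, of z "f z"] reach_step[of f z "f z"] by auto
        then show False using yS by simp
      qed
      have gto: "reach g w z" if "reach f' w x \<or> reach f' w z" for w
      proof (cases "reach f' w x")
        case True
        then have "reach g w x" unfolding gf' by (simp add: reach_upd_iff)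
        then show ?thesis using reach_trans[of g w x z] reach_step[of g x z] gx gz by auto
      next
        case False
        then show ?thesis using that reach_upd_not_reach[OF False] unfolding gf' by auto
      qed
      have rg: "reach g x0 z"
        using gto[of x0] reach_upd_reach[of f x0 z z] reach_upd_not_reach[of f x0 z z x] rx unfolding f'_def by blast
      have yx: "reach g (f z) x" if "reach f z x"
      proof -
        have "reach f (f z) x" using that zx reach_cases[of f z x] by auto
        then have "reach f' (f z) x" unfolding f'_def using reach_upd_not_reach[OF nyz] by simp
        then show ?thesis unfolding gf' by (simp add: reach_upd_iff)
      qed
      have "child g (?s z g (f z)) z = x"
      proof (cases "reach f z x")
        case True
        have "reach g (f z) z" using yx[OF True] reach_trans[of g "f z" x z] reach_step[of g x z] gx by auto
        then show ?thesis using child_eqI[OF gz _ gx, of "f z"] yx[OF True] zx by auto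
      next
        case False
        have nyx: "\<not> reach f (f z) x" using False reach_step[of f z x] by auto
        have nyx': "\<not> reach f' (f z) x" unfolding f'_def using reach_upd_not_reach[OF nyz] nyx by simp
        have "reach g (f z) z \<longleftrightarrow> reach f' (f z) z"
          unfolding gf' by (rule reach_upd_not_reach[OF nyx'])
        also have "\<dots> \<longleftrightarrow> reach f (f z) z" unfolding f'_def by (rule reach_upd_not_reach[OF nyz])
        finally have n1: "\<not> reach g (f z) z" using nyz by simp
        have "\<not> reach f x0 z" using reach_linear[OF rx, of z] False reach_fixed[of f x z] fx zx by auto
        then have "reach f' x0 x" unfolding f'_def using rx reach_upd_not_reach[of f x0 z z x] by simp
        then have "reach g x0 x" unfolding gf' by (simp add: reach_upd_iff)
        then show ?thesis using n1 child_eqI[OF gz _ gx, of x0] zx by auto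
      qed
      moreover have "(g(x := x))(z := f z) = f" unfolding g_def using fx zx by (auto simp: fun_eq_iff)
      ultimately have ij: "?i (z, g, f z) = (x, f, z)" using yS by (simp only: case_prod_conv if_False)
      have notE0: "\<not> (z = x0 \<and> \<not> reach g (f z) z)"
      proof
        assume a: "z = x0 \<and> \<not> reach g (f z) z"
        then have "reach g (f z) x" using yx rx by auto
        then show False using a reach_trans[of g "f z" x z] reach_step[of g x z] gx by auto
      qed
      have "wt (W - {z}) g * P z (f z) = wt (W - {x}) f * P x z"
      proof -
        have "wt (W - {z}) g = P x z * (\<Prod>a\<in>W - {z} - {x}. P a (g a))"
          unfolding wt_def using finW x zx gx by (subst prod.remove[of _ x]) auto
        moreover have "wt (W - {x}) f = P z (f z) * (\<Prod>a\<in>W - {x} - {z}. P a (f a))"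
          unfolding wt_def using finW zW by (subst prod.remove[of _ z]) auto
        moreover have "(\<Prod>a\<in>W - {z} - {x}. P a (g a)) = (\<Prod>a\<in>W - {x} - {z}. P a (f a))"
          by (rule prod.cong) (auto simp: g_def)
        ultimately show ?thesis by simp
      qed
      then have we: "?w (z, g, f z) = ?w' (x, f, z)" unfolding g_def by simp
      have jp: "?j p = (z, g, f z)" unfolding pe g_def by simp
      have m: "(z, g, f z) \<in> ?E - ?N" using gF rg z yS notE0 by blast
      show ?thesis unfolding jp using m ij we unfolding pe by (simp only: simp_thms)
    qed
  qed
  have iE: "?i q \<in> ?B \<and> ?j (?i q) = q" if q: "q \<in> ?E - ?N" for q
  proof -
    obtain z g y where qe: "q = (z, g, y)" by (cases q) auto
    have z: "z \<in> W" and g: "g \<in> forests S (W - {z})" and rz: "reach g x0 z" and y: "y \<in> S"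
      and n0: "z = x0 \<Longrightarrow> reach g y z"
      using q qe by auto
    have gz: "g z = z" using forests_out[OF g] by auto
    show ?thesis
    proof (cases "y = z")
      case True
      then show ?thesis using qe z g rz gz by (auto simp: fun_upd_idem)
    next
      case yz: False
      define s where "s = ?s z g y"
      have s: "reach g s z" "s \<noteq> z" unfolding s_def using yz n0 rz by auto
      define x where "x = child g s z"
      have x: "x \<noteq> z" "g x = z" "reach g s x" unfolding x_def using child_props[OF s gz] by auto
      have xW: "x \<in> W - {z}" using x forests_out[OF g, of x] by metis
      define g0 where "g0 = g(x := x)"
      define f where "f = g0(z := y)"
      have g0F: "g0 \<in> forests S (W - {x} - {z})" unfolding g0_def using forests_reset(1)[OF g xW]
        by (simp add: Diff_insert[symmetric] insert_commute)
      have g0x: "g0 x = x" and g0z: "g0 z = z" using x gz by (auto simp: g0_def)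
      have xz: "reach g x z" using reach_step[of g x z] x by auto
      have disj: "\<not> reach g0 w z" if "reach g w x" for w
      proof
        assume "reach g0 w z"
        moreover have "reach g0 w x" unfolding g0_def using that by (simp add: reach_upd_iff)
        ultimately show False using reach_fixed_unique[of g0 w z x] g0x g0z x by auto
      qed
      have ny: "\<not> reach g0 y z"
      proof (cases "reach g y z")
        case True
        then have "s = y" by (simp add: s_def)
        then show ?thesis using disj x by auto
      next
        case False
        then have "\<not> reach g y x" using reach_trans[OF _ xz] by blast
        then show ?thesis unfolding g0_def using False reach_upd_not_reach[of g y x x z] by simp
      qed
      have fF: "f \<in> forests S (W - {x})" unfolding f_def
        by (rule forests_upd[OF g0F]) (use z x y ny in auto)
      have to_x: "reach f w x" if "reach g w x" for w
      proof -
        have "reach g0 w x" unfolding g0_def using that by (simp add: reach_upd_iff)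
        then show ?thesis unfolding f_def using reach_upd_not_reach[OF disj[OF that]] by simp
      qed
      have rf: "reach f x0 x"
      proof (cases "reach g x0 x")
        case True then show ?thesis by (rule to_x)
      next
        case False
        then have "s \<noteq> x0" using x by auto
        then have sy: "s = y" unfolding s_def by (auto split: if_splits)
        have "reach g0 x0 z" unfolding g0_def using reach_upd_not_reach[OF False] rz by simp
        then have "reach f x0 z" unfolding f_def by (simp add: reach_upd_iff)
        moreover have "reach f y x" using to_x x sy by auto
        then have "reach f z x" using reach_step[of f z x] by (simp add: f_def)
        ultimately show ?thesis by (rule reach_trans)
      qed
      have iq: "?i q = (x, f, z)" unfolding qe using yz by (simp add: x_def s_def f_def g0_def)
      have "(f(x := z))(z := z) = g" unfolding f_def g0_def using x gz by (auto simp: fun_eq_iff)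
      moreover have "f z = y" by (simp add: f_def)
      ultimately have "?j (x, f, z) = q" by (simp add: qe)
      moreover have "(x, f, z) \<in> ?B" using fF rf z xW by blast
      ultimately show ?thesis unfolding iq by (simp only: simp_thms)
    qed
  qed
  have "sum ?w ?E = sum ?w (?E - ?N) + sum ?w ?N"
    using finE by (intro sum.subset_diff) auto
  moreover have "sum ?w' ?B = sum ?w (?E - ?N)"
  proof (rule sum.reindex_bij_witness[where i = ?i and j = ?j])
    show "?i (?j p) = p" if "p \<in> ?B" for p by (rule jB[OF that, THEN conjunct2, THEN conjunct1])
    show "?j p \<in> ?E - ?N" if "p \<in> ?B" for p by (rule jB[OF that, THEN conjunct1])
    show "?j (?i q) = q" if "q \<in> ?E - ?N" for q by (rule iE[OF that, THEN conjunct2])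
    show "?i q \<in> ?B" if "q \<in> ?E - ?N" for q by (rule iE[OF that, THEN conjunct1])
    show "?w (?j p) = ?w' p" if "p \<in> ?B" for p by (rule jB[OF that, THEN conjunct2, THEN conjunct2])
  qed
  ultimately show ?thesis unfolding L R Zst by simp
qed

text \<open>\<open>\<Psi>\<close> is a Lyapunov function. Summed against the occupation measure the
  drift inequality telescopes, and only the initial value and the exit value remain.\<close>

lemma excursion_superharmonic:
  assumes W: "W \<subseteq> I" and x0: "x0 \<in> W"
    and super: "\<And>x f. x \<in> W \<Longrightarrow> f \<in> forests S (W - {x}) \<Longrightarrow>
      (\<Sum>z\<in>W. P x z * \<Psi> z ((f(x := z))(z := z))) + (\<Sum>r\<in>S - W. P x r * \<Phi> (f(x := r))) \<le> \<Psi> x f"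
  shows "ZZ W \<Phi> \<le> ZZ W (\<lambda>F. \<Psi> x0 (F(x0 := x0)))"
proof -
  have "(\<Sum>x\<in>W. ZZ (W - {x}) (\<lambda>f. of_bool (reach f x0 x) * (\<Sum>z\<in>W. P x z * \<Psi> z ((f(x := z))(z := z))))) +
      (\<Sum>x\<in>W. ZZ (W - {x}) (\<lambda>f. of_bool (reach f x0 x) * (\<Sum>r\<in>S - W. P x r * \<Phi> (f(x := r)))))
    \<le> (\<Sum>x\<in>W. ZZ (W - {x}) (\<lambda>f. of_bool (reach f x0 x) * \<Psi> x f))"
    unfolding sum.distrib[symmetric] ZZ_add[symmetric] distrib_left[symmetric]
    by (intro sum_mono ZZ_mono mult_left_mono super) auto
  then show ?thesis unfolding excursion_terminal[OF W x0] excursion_occupation[OF W x0, of \<Psi>] by simp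
qed

end

section \<open>Capacity of past paths\<close>

text \<open>The cap \<open>k\<close> belongs to the event: below the cap the loss of a path is
  visible in \<open>min (card D) k\<close>, while a visit to \<open>v\<close> may create any number
  of paths and is charged \<open>k\<close> at most.\<close>

definition sel :: "nat \<Rightarrow> ('a set \<Rightarrow> bool) \<Rightarrow> 'a set set \<Rightarrow> bool" where
  "sel k Q D \<longleftrightarrow> card D \<le> k \<and> (\<exists>K\<in>D. Q K)"

definition chosen :: "('a set \<Rightarrow> bool) \<Rightarrow> 'a set set \<Rightarrow> 'a set" where
  "chosen Q D = (SOME K. K \<in> D \<and> Q K)"

lemma chosen: "sel k Q D \<Longrightarrow> chosen Q D \<in> D \<and> Q (chosen Q D)"
  unfolding sel_def chosen_def by (metis (mono_tags, lifting) someI_ex)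

context chain
begin

definition loss :: "'a set \<Rightarrow> nat \<Rightarrow> ('a set \<Rightarrow> bool) \<Rightarrow> 'a set set \<Rightarrow> 'a \<Rightarrow> real" where
  "loss W k Q D x = (if sel k Q D then hit W (chosen Q D) x else 0)"

lemma loss_bounds: "W \<subseteq> I \<Longrightarrow> 0 \<le> loss W k Q D x" "W \<subseteq> I \<Longrightarrow> loss W k Q D x \<le> 1"
  by (auto simp: loss_def hit_nonneg hit_le_1)

text \<open>If a path of a selected family disappears, the capped count drops by at least 1, which
  outweighs any change of the hitting probability. Otherwise the family is the same or nothing was
  selected.\<close>

lemma loss_mono:
  assumes W: "W \<subseteq> I" and D: "finite D" "D' \<subseteq> D"
  shows "real (min (card D') k) - loss W k Q D' x \<le> real (min (card D) k) - loss W k Q D x"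
proof (cases "D' = D \<or> \<not> sel k Q D")
  case True
  then show ?thesis
  proof
    assume "\<not> sel k Q D"
    then have "loss W k Q D x = 0" by (simp add: loss_def)
    moreover have "card D' \<le> card D" using D by (intro card_mono)
    ultimately show ?thesis using loss_bounds(1)[OF W, of k Q D' x] by simp
  qed simp
next
  case False
  then have "card D' < card D" "card D \<le> k" using D by (auto simp: sel_def intro: psubset_card_mono)
  then have "real (min (card D') k) + 1 \<le> real (min (card D) k)" by auto
  then show ?thesis using loss_bounds[OF W, of k Q D x] loss_bounds[OF W, of k Q D' x] by linarith
qed

text \<open>
  \<open>min (card (D f)) k\<close> is bounded by \<open>k\<close> and an excursion increases it only by visiting \<open>v\<close>, while it loses
  at least one if \<open>sel k Q (D f)\<close> and the excursion hits the chosen path before visiting \<open>v\<close>.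
\<close>

lemma excursion_hit:
  fixes D :: "('a \<Rightarrow> 'a) \<Rightarrow> 'a set set"
  assumes W: "W \<subseteq> I" and x0: "x0 \<in> W" and v: "v \<in> W"
    and fin: "\<And>f. finite (D f)"
    and step: "\<And>x z f. x \<in> W \<Longrightarrow> x \<noteq> v \<Longrightarrow> z \<in> W \<Longrightarrow> z \<noteq> v \<Longrightarrow> f \<in> forests S (W - {x}) \<Longrightarrow> D ((f(x := z))(z := z)) \<subseteq> D f"
    and exit: "\<And>x r f. x \<in> W \<Longrightarrow> x \<noteq> v \<Longrightarrow> r \<in> S - W \<Longrightarrow> f \<in> forests S (W - {x}) \<Longrightarrow> D (f(x := r)) \<subseteq> D f"
    and start: "\<And>F. F \<in> forests S W \<Longrightarrow> x0 \<noteq> v \<Longrightarrow> D (F(x0 := x0)) \<subseteq> D F"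
    and K: "\<And>x f K. x \<in> W \<Longrightarrow> x \<noteq> v \<Longrightarrow> f \<in> forests S (W - {x}) \<Longrightarrow> K \<in> D f \<Longrightarrow> K \<subseteq> W - {x}"
  shows "ZZ W (\<lambda>F. loss W k Q (D F) x0) \<le> real k * hit W {v} x0 * Z W"
proof -
  let ?c = "\<lambda>f. real (min (card (D f)) k)"
  let ?\<Phi> = "\<lambda>f. ?c f"
  let ?h = "hit W {v}"
  let ?\<Psi>1 = "\<lambda>x f. ?c f - loss W k Q (D f) x + real k * ?h x"
  \<comment> \<open>Before \<open>v\<close> is visited the count only falls, and the expected fall
    is at least the chance of hitting the chosen path. The multiple of \<open>?h\<close> pays for
    visits to \<open>v\<close>, after which the trivial bound \<open>k\<close> is used.\<close>
  let ?\<Psi> = "\<lambda>x f. if x = v then real k else min (real k) (?\<Psi>1 x f)"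
  have hv: "?h v = 1" using hit_in[OF W, of v "{v}"] v W by auto
  have ck: "?c f \<le> real k" for f by simp
  have \<Psi>k: "?\<Psi> x f \<le> real k" for x f by auto
  have c1: "loss W k Q (D f) x \<le> ?c f" for f x
  proof (cases "sel k Q (D f)")
    case True
    then have "card (D f) \<ge> 1" "card (D f) \<le> k" using fin[of f] by (auto simp: sel_def Suc_le_eq card_gt_0_iff)
    then show ?thesis using loss_bounds(2)[OF W, of k Q "D f" x] by auto
  qed (simp add: loss_def)
  have main: "ZZ W ?\<Phi> \<le> ZZ W (\<lambda>F. ?\<Psi> x0 (F(x0 := x0)))"
  proof (rule excursion_superharmonic[OF W x0])
    fix x f assume x: "x \<in> W" and f: "f \<in> forests S (W - {x})"
    have rows: "(\<Sum>z\<in>S. P x z) = 1" using x W by (intro row) auto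
    have spl: "(\<Sum>z\<in>W. P x z * h z) + (\<Sum>r\<in>S - W. P x r * h r) = (\<Sum>z\<in>S. P x z * h z)" for h
      using W fin_S by (metis (no_types, lifting) Diff_subset add.commute subset_trans sum.subset_diff)
    have lek: "(\<Sum>z\<in>W. P x z * ?\<Psi> z ((f(x := z))(z := z))) + (\<Sum>r\<in>S - W. P x r * ?\<Phi> (f(x := r))) \<le> real k"
    proof -
      have "(\<Sum>z\<in>W. P x z * ?\<Psi> z ((f(x := z))(z := z))) + (\<Sum>r\<in>S - W. P x r * ?\<Phi> (f(x := r)))
        \<le> (\<Sum>z\<in>W. P x z * real k) + (\<Sum>r\<in>S - W. P x r * real k)"
        by (intro add_mono sum_mono mult_left_mono P_nonneg) auto
      also have "\<dots> = real k" using spl[of "\<lambda>_. real k"] rows by (simp add: sum_distrib_right[symmetric])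
      finally show ?thesis .
    qed
    show "(\<Sum>z\<in>W. P x z * ?\<Psi> z ((f(x := z))(z := z))) + (\<Sum>r\<in>S - W. P x r * ?\<Phi> (f(x := r))) \<le> ?\<Psi> x f"
    proof (cases "x = v")
      case True
      then show ?thesis using lek by simp
    next
      case xv: False
      let ?g = "\<lambda>z. ?c f - loss W k Q (D f) z + real k * ?h z"
      have lossx: "loss W k Q (D f) x = (\<Sum>z\<in>S. P x z * loss W k Q (D f) z)"
      proof (cases "sel k Q (D f)")
        case True
        then have "x \<notin> chosen Q (D f)" using K[OF x xv f] chosen[OF True] by blast
        then show ?thesis using True hit_harmonic[OF W x] by (simp add: loss_def)
      qed (simp add: loss_def)
      have hx: "?h x = (\<Sum>z\<in>S. P x z * ?h z)" using hit_harmonic[OF W x, of "{v}"] xv by auto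
      have "?\<Psi>1 x f = ?c f * (\<Sum>z\<in>S. P x z) - (\<Sum>z\<in>S. P x z * loss W k Q (D f) z) + real k * (\<Sum>z\<in>S. P x z * ?h z)"
        unfolding rows lossx[symmetric] hx[symmetric] by simp
      also have "\<dots> = (\<Sum>z\<in>S. P x z * ?g z)"
        by (simp add: algebra_simps sum.distrib sum_subtractf sum_distrib_left sum_distrib_right)
      finally have e: "?\<Psi>1 x f = (\<Sum>z\<in>S. P x z * ?g z)" .
      have a: "?\<Psi> z ((f(x := z))(z := z)) \<le> ?g z" if z: "z \<in> W" for z
      proof (cases "z = v")
        case True
        then show ?thesis using c1[of f v] hv by simp
      next
        case False
        have "?\<Psi> z ((f(x := z))(z := z)) \<le> ?\<Psi>1 z ((f(x := z))(z := z))" using False by simp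
        also have "\<dots> \<le> ?g z" using loss_mono[OF W fin step[OF x xv z False f], of k Q z] by simp
        finally show ?thesis .
      qed
      have b: "?\<Phi> (f(x := r)) \<le> ?g r" if r: "r \<in> S - W" for r
      proof -
        have "loss W k Q (D f) r = 0"
        proof (cases "sel k Q (D f)")
          case True
          then have "r \<notin> chosen Q (D f)" using K[OF x xv f] chosen[OF True] r by blast
          then show ?thesis using r hit_out[of r W] by (simp add: loss_def)
        qed (simp add: loss_def)
        moreover have "card (D (f(x := r))) \<le> card (D f)" by (intro card_mono fin exit[OF x xv r f])
        then have "?c (f(x := r)) \<le> ?c f" by simp
        moreover have "0 \<le> real k * ?h r" using hit_nonneg[OF W, of "{v}" r] by simp
        ultimately show ?thesis by linarith
      qed
      have "(\<Sum>z\<in>W. P x z * ?\<Psi> z ((f(x := z))(z := z))) + (\<Sum>r\<in>S - W. P x r * ?\<Phi> (f(x := r)))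
        \<le> (\<Sum>z\<in>W. P x z * ?g z) + (\<Sum>r\<in>S - W. P x r * ?g r)"
        using a b by (intro add_mono sum_mono mult_left_mono P_nonneg)
      also have "\<dots> = ?\<Psi>1 x f" unfolding e by (rule spl)
      finally show ?thesis using lek xv by simp
    qed
  qed
  also have "\<dots> \<le> ZZ W (\<lambda>F. ?\<Phi> F - loss W k Q (D F) x0 + real k * ?h x0)"
  proof (rule ZZ_mono)
    fix F assume F: "F \<in> forests S W"
    show "?\<Psi> x0 (F(x0 := x0)) \<le> ?\<Phi> F - loss W k Q (D F) x0 + real k * ?h x0"
    proof (cases "x0 = v")
      case True
      then show ?thesis using c1[of F v] hv by simp
    next
      case False
      then show ?thesis using loss_mono[OF W fin start[OF F False], of k Q x0] by simp
    qed
  qed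
  also have "\<dots> = ZZ W ?\<Phi> - ZZ W (\<lambda>F. loss W k Q (D F) x0) + real k * ?h x0 * Z W"
    using ZZ_const[of W "real k * ?h x0"] by (simp add: ZZ_add ZZ_diff)
  finally show ?thesis by simp
qed

definition kap :: "'a set \<Rightarrow> 'a \<Rightarrow> real" where
  "kap W x = (\<Sum>r\<in>S - W. P x r)"

lemma kap_nonneg: "0 \<le> kap W x"
  unfolding kap_def by (intro sum_nonneg P_nonneg)

text \<open>Last exit with \<open>K = W\<close>: escaping from all of \<open>W\<close> after one
  step means stepping out of \<open>W\<close>.\<close>

lemma sum_G_kap:
  assumes W: "W \<subseteq> I" and y: "y \<in> W"
  shows "(\<Sum>x\<in>W. G W y x * kap W x) = 1"
proof -
  have "esc W W x = kap W x" if "x \<in> W" for x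
  proof -
    have "(\<Sum>z\<in>S. P x z * hit W W z) = (\<Sum>z\<in>W. P x z)"
    proof -
      have "(\<Sum>z\<in>S. P x z * hit W W z) = (\<Sum>z\<in>S. if z \<in> W then P x z else 0)"
        using hit_in[OF W] hit_out[of _ W W] by (intro sum.cong) auto
      also have "\<dots> = (\<Sum>z\<in>W. P x z)"
        using W fin_S by (simp add: sum.If_cases) (intro sum.cong, auto)
      finally show ?thesis .
    qed
    moreover have "(\<Sum>z\<in>S. P x z) = (\<Sum>z\<in>W. P x z) + kap W x"
      unfolding kap_def using W fin_S by (metis (no_types, lifting) Diff_subset add.commute subset_trans sum.subset_diff)
    moreover have "(\<Sum>z\<in>S. P x z) = 1" using that W by (intro row) auto
    ultimately show ?thesis by (simp add: esc_def)
  qed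
  then show ?thesis using last_exit[OF W order_refl y] by simp
qed

end

section \<open>Reversible chains and capacity\<close>

locale rev_chain = chain +
  fixes m :: "'a \<Rightarrow> real" and A :: real
  assumes m_rev: "\<And>x y. x \<in> I \<Longrightarrow> y \<in> I \<Longrightarrow> m x * P x y = m y * P y x"
    and m_lower: "\<And>x. x \<in> I \<Longrightarrow> inverse A \<le> m x" and m_upper: "\<And>x. x \<in> I \<Longrightarrow> m x \<le> A"
    and A_pos: "0 < A"
begin

lemma m_pos: "x \<in> I \<Longrightarrow> 0 < m x"
  using m_lower[of x] A_pos by (meson less_le_trans positive_imp_inverse_positive)

lemma m_ratio: "x \<in> I \<Longrightarrow> y \<in> I \<Longrightarrow> m x / m y \<le> A\<^sup>2"
proof -
  assume a: "x \<in> I" "y \<in> I"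
  have "m x \<le> A * 1" using m_upper a by simp
  also have "\<dots> \<le> A * (A * m y)"
    using m_lower[OF a(2)] A_pos by (intro mult_left_mono) (auto simp: field_simps)
  finally show ?thesis using m_pos[OF a(2)] by (simp add: divide_le_eq power2_eq_square mult_ac)
qed

lemma pw_rev:
  assumes W: "W \<subseteq> I"
  shows "x \<in> W \<Longrightarrow> y \<in> W \<Longrightarrow> m x * pw P W n x y = m y * pw P W n y x"
proof (induction n arbitrary: x y)
  case (Suc n)
  have fin: "finite W" by (rule fin_sub[OF W])
  have "m x * pw P W (Suc n) x y = (\<Sum>z\<in>W. (m x * P x z) * pw P W n z y)"
    using Suc.prems by (simp add: sum_distrib_left mult_ac)
  also have "\<dots> = (\<Sum>z\<in>W. P z x * (m z * pw P W n z y))"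
    using m_rev Suc.prems W by (intro sum.cong refl) (auto simp: mult_ac)
  also have "\<dots> = (\<Sum>z\<in>W. P z x * (m y * pw P W n y z))"
    using Suc by (intro sum.cong refl) auto
  also have "\<dots> = m y * (\<Sum>z\<in>W. pw P W n y z * pw P W 1 z x)"
  proof -
    have "pw P W 1 z x = P z x" if "z \<in> W" for z
    proof -
      have "(\<Sum>w\<in>W. P z w * pw P W 0 w x) = (\<Sum>w\<in>W. if w = x then P z w else 0)" by (intro sum.cong) auto
      then show ?thesis using that Suc.prems fin by (simp add: sum.delta)
    qed
    then show ?thesis by (simp add: sum_distrib_left mult_ac)
  qed
  also have "\<dots> = m y * pw P W (n + 1) y x" by (simp only: pw_add[OF fin])
  finally show ?case by simp
qed auto

lemma G_rev:
  assumes W: "W \<subseteq> I" and "x \<in> W" "y \<in> W"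
  shows "m x * G W x y = m y * G W y x"
  unfolding G_def using pw_rev[OF assms]
  by (simp add: suminf_mult[OF pw_summable[OF W], symmetric])

text \<open>The right side is the capacity of \<open>K\<close>, seen from the flow
  \<open>m x * kap W x\<close> that enters \<open>W\<close>. The potential of \<open>g\<close> is at
  most \<open>L\<close> on \<open>g\<close>, hence at most \<open>L\<close> times the hitting
  probability of \<open>g\<close> everywhere by the maximum principle. Integrated against the flow
  and reversed, the potential gives the mass of \<open>g\<close>, because every walk leaves
  \<open>W\<close>.\<close>

lemma capacity_ge:
  assumes W: "W \<subseteq> I" and g: "g \<subseteq> K" "K \<subseteq> W" and L: "0 < L" "\<And>z. z \<in> g \<Longrightarrow> (\<Sum>y\<in>g. G W z y) \<le> L"
  shows "(\<Sum>y\<in>g. m y) / L \<le> (\<Sum>x\<in>W. m x * kap W x * hit W K x)"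
proof -
  have fin: "finite W" by (rule fin_sub[OF W])
  have gW: "g \<subseteq> W" using g by auto
  let ?U = "\<lambda>x. \<Sum>y\<in>g. G W x y"
  have le: "?U x \<le> L * hit W g x" if x: "x \<in> W" for x
  proof (cases "x \<in> g")
    case True
    then show ?thesis using L(2)[OF True] hit_in[OF W _ True] x W by auto
  next
    case False
    have "?U x - L * hit W g x \<le> 0"
    proof (rule max_principle[of "W - g" "\<lambda>x. ?U x - L * hit W g x"])
      fix x assume "x \<in> W - g"
      then have xx: "x \<in> W" "x \<notin> g" by auto
      have "?U x = (\<Sum>y\<in>g. \<Sum>z\<in>S. P x z * G W z y)"
        using G_rec[OF W xx(1)] xx(2) by (intro sum.cong) auto
      also have "\<dots> = (\<Sum>z\<in>S. P x z * ?U z)" by (subst sum.swap) (simp add: sum_distrib_left)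
      finally show "?U x - L * hit W g x \<le> (\<Sum>y\<in>S. P x y * (?U y - L * hit W g y))"
        using hit_harmonic[OF W xx] by (simp add: right_diff_distrib sum_subtractf sum_distrib_left mult_ac)
    next
      fix x assume x: "x \<in> S" "x \<notin> W - g"
      show "?U x - L * hit W g x \<le> 0"
      proof (cases "x \<in> g")
        case True
        then show ?thesis using L(2)[OF True] hit_in[OF W x(1) True] by simp
      next
        case F: False
        then have "?U x = 0" using x by (simp add: G_out)
        then show ?thesis using hit_nonneg[OF W, of g x] L(1) by simp
      qed
    qed (use W x False in auto)
    then show ?thesis by simp
  qed
  have "(\<Sum>y\<in>g. m y) = (\<Sum>y\<in>g. m y * (\<Sum>x\<in>W. G W y x * kap W x))"
    using sum_G_kap[OF W] gW by (intro sum.cong) auto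
  also have "\<dots> = (\<Sum>y\<in>g. \<Sum>x\<in>W. (m y * G W y x) * kap W x)"
    by (simp add: sum_distrib_left mult_ac)
  also have "\<dots> = (\<Sum>y\<in>g. \<Sum>x\<in>W. (m x * G W x y) * kap W x)"
    using G_rev[OF W] gW by (intro sum.cong refl) (metis subsetD)
  also have "\<dots> = (\<Sum>x\<in>W. m x * kap W x * ?U x)"
    by (subst sum.swap) (simp add: sum_distrib_left mult_ac)
  also have "\<dots> \<le> (\<Sum>x\<in>W. m x * kap W x * (L * hit W K x))"
  proof (rule sum_mono)
    fix x assume x: "x \<in> W"
    have "hit W g x \<le> hit W K x" using x W g by (intro hit_mono) auto
    then have "?U x \<le> L * hit W K x" using le[OF x] L(1) by (meson mult_left_mono less_imp_le order_trans)
    then show "m x * kap W x * ?U x \<le> m x * kap W x * (L * hit W K x)"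
      using less_imp_le[OF m_pos[of x]] kap_nonneg[of W x] x W by (intro mult_left_mono mult_nonneg_nonneg) auto
  qed
  also have "\<dots> = L * (\<Sum>x\<in>W. m x * kap W x * hit W K x)" by (simp add: sum_distrib_left mult_ac)
  finally show ?thesis using L(1) by (simp add: divide_le_eq mult.commute)
qed

text \<open>The excursion inequality is averaged over starting points \<open>x\<close> with weight
  \<open>m x * kap W x\<close>. The hitting mass of the chosen path then is its capacity, at least
  \<open>c\<close>, and the hitting mass of \<open>v\<close> is at most the same average of
  \<open>G W x v\<close>, which reversibility evaluates to \<open>m v\<close>.\<close>

lemma deep_paths_excursion:
  assumes W: "W \<subseteq> I" and v: "v \<in> W" and c: "0 \<le> c"
    and Q: "\<And>K. Q K \<Longrightarrow> K \<subseteq> W \<Longrightarrow> c \<le> (\<Sum>x\<in>W. m x * kap W x * hit W K x)"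
  shows "c * ZZ W (\<lambda>F. of_bool (sel k Q (deep_paths F v n N \<inter> Pow W))) \<le> real k * A * Z W"
proof -
  have fin: "finite W" by (rule fin_sub[OF W])
  let ?D = "\<lambda>F. deep_paths F v n N \<inter> Pow W"
  have one: "ZZ W (\<lambda>F. loss W k Q (?D F) x0) \<le> real k * hit W {v} x0 * Z W" if x0: "x0 \<in> W" for x0
  proof (rule excursion_hit[OF W x0 v])
    show "finite (?D f)" for f using fin by auto
  next
    fix x z f assume a: "x \<in> W" "x \<noteq> v" "z \<in> W" "z \<noteq> v" "f \<in> forests S (W - {x})"
    let ?f = "(f(x := z))(z := z)"
    have z: "?f z = z" "?f x = z" by auto
    have "\<not> reach ?f z v" using reach_fixed[of ?f z v] z a by auto
    moreover have "\<not> reach ?f x v" using reach_cases[of ?f x v] z a calculation by auto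
    ultimately have "deep_paths ?f v n N \<subseteq> deep_paths f v n N"
      by (intro deep_paths_mono[of "{x, z}"]) auto
    then show "?D ?f \<subseteq> ?D f" by blast
  next
    fix x r f assume a: "x \<in> W" "x \<noteq> v" "r \<in> S - W" "f \<in> forests S (W - {x})"
    let ?f = "f(x := r)"
    have "?f r = r" using forests_out[OF a(4), of r] a by auto
    then have "\<not> reach ?f r v" using reach_fixed[of ?f r v] a v by auto
    then have "\<not> reach ?f x v" using reach_cases[of ?f x v] a by auto
    then have "deep_paths ?f v n N \<subseteq> deep_paths f v n N"
      by (intro deep_paths_mono[of "{x}"]) auto
    then show "?D ?f \<subseteq> ?D f" by blast
  next
    fix F assume a: "F \<in> forests S W" "x0 \<noteq> v"
    have "\<not> reach (F(x0 := x0)) x0 v" using reach_fixed[of "F(x0 := x0)" x0 v] a by auto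
    then have "deep_paths (F(x0 := x0)) v n N \<subseteq> deep_paths F v n N"
      by (intro deep_paths_mono[of "{x0}"]) auto
    then show "?D (F(x0 := x0)) \<subseteq> ?D F" by blast
  next
    fix x f K assume a: "x \<in> W" "x \<noteq> v" "f \<in> forests S (W - {x})" "K \<in> ?D f"
    have "x \<notin> K"
    proof
      assume "x \<in> K"
      then have "reach f x v" using a(4) deep_paths_in[of K f v n N x] by simp
      then show False using reach_fixed[of f x v] forests_out[OF a(3), of x] a by auto
    qed
    then show "K \<subseteq> W - {x}" using a by blast
  qed
  have "c * ZZ W (\<lambda>F. of_bool (sel k Q (?D F))) = ZZ W (\<lambda>F. c * of_bool (sel k Q (?D F)))"
    by (rule ZZ_cmult[symmetric])
  also have "\<dots> \<le> ZZ W (\<lambda>F. \<Sum>x\<in>W. m x * kap W x * loss W k Q (?D F) x)"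
  proof (rule ZZ_mono)
    fix F
    show "c * of_bool (sel k Q (?D F)) \<le> (\<Sum>x\<in>W. m x * kap W x * loss W k Q (?D F) x)"
    proof (cases "sel k Q (?D F)")
      case True
      then show ?thesis using Q[of "chosen Q (?D F)"] chosen[OF True] by (simp add: loss_def)
    qed (simp add: loss_def)
  qed
  also have "\<dots> = (\<Sum>x\<in>W. m x * kap W x * ZZ W (\<lambda>F. loss W k Q (?D F) x))"
    by (simp add: ZZ_sum ZZ_cmult)
  also have "\<dots> \<le> (\<Sum>x\<in>W. m x * kap W x * (real k * G W x v * Z W))"
  proof (rule sum_mono)
    fix x assume x: "x \<in> W"
    have "ZZ W (\<lambda>F. loss W k Q (?D F) x) \<le> real k * hit W {v} x * Z W" by (rule one[OF x])
    also have "\<dots> \<le> real k * G W x v * Z W"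
      using hit_le_G[OF W v, of x] x W Z_pos[OF W] by (intro mult_right_mono mult_left_mono) auto
    finally show "m x * kap W x * ZZ W (\<lambda>F. loss W k Q (?D F) x) \<le> m x * kap W x * (real k * G W x v * Z W)"
      using less_imp_le[OF m_pos[of x]] kap_nonneg[of W x] x W by (intro mult_left_mono mult_nonneg_nonneg) auto
  qed
  also have "\<dots> = real k * Z W * (\<Sum>x\<in>W. (m x * G W x v) * kap W x)"
    by (simp add: sum_distrib_left mult_ac)
  also have "(\<Sum>x\<in>W. (m x * G W x v) * kap W x) = m v * (\<Sum>x\<in>W. G W v x * kap W x)"
    using G_rev[OF W _ v] by (simp add: sum_distrib_left mult.assoc)
  also have "\<dots> = m v" using sum_G_kap[OF W v] by simp
  also have "real k * Z W * m v \<le> real k * Z W * A"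
    using m_upper[of v] v W Z_pos[OF W] by (intro mult_left_mono) auto
  finally show ?thesis by (simp add: mult_ac)
qed

end

section \<open>Reversal of forest paths\<close>

definition orb :: "('a \<Rightarrow> 'a) \<Rightarrow> 'a \<Rightarrow> nat \<Rightarrow> 'a list" where
  "orb f u n = map (\<lambda>j. (f ^^ j) u) [0..<n]"

lemma orb_length [simp]: "length (orb f u n) = n"
  and orb_nth: "j < n \<Longrightarrow> orb f u n ! j = (f ^^ j) u"
  by (auto simp: orb_def)

lemma orb_0 [simp]: "orb f u 0 = []"
  by (simp add: orb_def)

lemma orb_Suc: "orb f u (Suc n) = u # orb f (f u) n"
  by (rule nth_equalityI) (auto simp: orb_nth nth_Cons funpow_swap1 split: nat.splits)

lemma orb_append: "orb f u (Suc n) = orb f u n @ [(f ^^ n) u]"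
  by (simp add: orb_def)

lemma follows_orb: "follows f (orb f u n)"
proof (induction n arbitrary: u)
  case (Suc n)
  then show ?case by (cases n) (auto simp: orb_Suc)
qed (simp add: orb_def)

lemma follows_eq_orb: "follows f (u # ys) \<Longrightarrow> u # ys = orb f u (Suc (length ys))"
proof (induction ys arbitrary: u)
  case (Cons a ys)
  then show ?case using Cons.IH[of a] by (simp add: orb_Suc)
qed (simp add: orb_def)

lemma follows_append_last: "xs \<noteq> [] \<Longrightarrow> follows f (xs @ ys) \<longleftrightarrow> follows f xs \<and> follows f (last xs # ys)"
proof (induction xs)
  case (Cons x xs)
  then show ?case by (cases xs) auto
qed simp

lemma upd_path_off: "a \<notin> set (butlast xs) \<Longrightarrow> upd_path g xs a = g a"
proof (induction xs)
  case (Cons x xs)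
  then show ?case by (cases xs) (auto simp: upd_path_single upd_path_Cons)
qed simp

lemma follows_upd_path: "distinct xs \<Longrightarrow> follows (upd_path g xs) xs"
proof (induction xs)
  case (Cons x xs)
  show ?case
  proof (cases xs)
    case (Cons y ys)
    have "x \<notin> set (butlast xs)" using Cons.prems by (auto dest: in_set_butlastD)
    moreover have "follows (upd_path g xs) xs" using Cons.IH Cons.prems by simp
    ultimately have "follows ((upd_path g xs)(x := y)) xs" using follows_upd[of x xs "upd_path g xs" y] by simp
    then have q: "follows ((upd_path g (y # ys))(x := y)) (y # ys)" unfolding Cons .
    show ?thesis unfolding Cons upd_path_Cons follows.simps(1) using q by (intro conjI fun_upd_same)
  qed simp
qed simp

lemma forests_reach_in: "f \<in> forests S W \<Longrightarrow> reach f a v \<Longrightarrow> v \<in> W \<Longrightarrow> a \<in> W"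
  using reach_fixed[of f a v] forests_out[of f S W a] by auto

lemma orb_distinct:
  assumes f: "f \<in> forests S W" and W: "\<And>j. j < n \<Longrightarrow> (f ^^ j) u \<in> W"
  shows "distinct (orb f u (Suc n))"
proof -
  have "(f ^^ i) u \<noteq> (f ^^ j) u" if "i < j" "j < Suc n" for i j
  proof -
    obtain d where d: "j = Suc d + i" using \<open>i < j\<close> by (metis add.commute less_imp_Suc_add add_Suc_right)
    have "(f ^^ i) u \<in> W" using W that by simp
    then have "(f ^^ Suc d) ((f ^^ i) u) \<noteq> (f ^^ i) u" by (rule forests_no_cycle[OF f])
    then show ?thesis unfolding d funpow_add_apply by simp
  qed
  then show ?thesis
    by (auto simp: distinct_conv_nth orb_nth) (metis nat_neq_iff)
qed

definition lev :: "('a \<Rightarrow> 'a) \<Rightarrow> 'a \<Rightarrow> 'a \<Rightarrow> nat \<Rightarrow> bool" where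
  "lev f u v n \<longleftrightarrow> (f ^^ n) u = v \<and> (\<forall>j<n. (f ^^ j) u \<noteq> v)"

text \<open>Past paths of \<open>v\<close> are coded by the list \<open>zs\<close> of their other
  vertices read backwards from \<open>v\<close>, so that \<open>(v # zs) ! i\<close> has distance
  \<open>i\<close> to \<open>v\<close>. Absence of cycles makes these lists distinct.\<close>

lemma lev_orb:
  assumes f: "f \<in> forests S W" and l: "lev f u v n"
  shows "rev (orb f u n) \<in> TL (W - {v}) n" "length (rev (orb f u n)) = n"
    "rev (v # rev (orb f u n)) = orb f u (Suc n)" "follows f (rev (v # rev (orb f u n)))" "last (v # rev (orb f u n)) = u"
proof -
  have inW: "(f ^^ j) u \<in> W - {v}" if "j < n" for j
  proof -
    have nv: "(f ^^ j) u \<noteq> v" using l that by (auto simp: lev_def)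
    moreover have "(f ^^ j) u \<in> W"
    proof (rule ccontr)
      assume "(f ^^ j) u \<notin> W"
      then have "(f ^^ n) u = (f ^^ j) u" using that by (intro forests_stay[OF f]) auto
      then show False using nv l by (auto simp: lev_def)
    qed
    ultimately show ?thesis by auto
  qed
  then have d: "distinct (orb f u (Suc n))" by (intro orb_distinct[OF f]) auto
  show "rev (orb f u n) \<in> TL (W - {v}) n"
  proof -
    have "set (orb f u n) \<subseteq> W - {v}" 
    proof
      fix a assume "a \<in> set (orb f u n)"
      then obtain j where "j < n" "a = (f ^^ j) u" by (auto simp: orb_def)
      then show "a \<in> W - {v}" using inW by blast
    qed
    moreover have "distinct (orb f u n)" using d by (simp add: orb_append)
    ultimately show ?thesis by (simp add: TL_def)
  qed
  show "length (rev (orb f u n)) = n" by simp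
  show e: "rev (v # rev (orb f u n)) = orb f u (Suc n)" using l by (simp add: orb_append lev_def)
  show "follows f (rev (v # rev (orb f u n)))" unfolding e by (rule follows_orb)
  have "v # rev (orb f u n) = rev (orb f u (Suc n))" unfolding e[symmetric] by simp
  then have "last (v # rev (orb f u n)) = last (rev (orb f u (Suc n)))" by (simp only:)
  then show "last (v # rev (orb f u n)) = u" unfolding orb_Suc by simp
qed

lemma deep_lev: "deep f u N \<longleftrightarrow> (\<exists>y. lev f y u N)"
  by (simp add: deep_def lev_def)

context chain
begin

section \<open>Conditioning the forest on a whole path to the root\<close>

lemma ZZ_follows_full:
  assumes ys: "ys \<noteq> []" "distinct ys" "set (butlast ys) \<subseteq> W" "set ys \<subseteq> S" and W: "W \<subseteq> I"
  defines "E \<equiv> {ws. distinct (ys @ ws) \<and> set (butlast (ys @ ws)) \<subseteq> W \<and> set (ys @ ws) \<subseteq> S \<and> last (ys @ ws) \<notin> W}"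
  shows "finite E" "ZZ W (\<lambda>f. of_bool (follows f ys) * \<Phi> f) =
     (\<Sum>ws\<in>E. ZZ W (\<lambda>f. of_bool (follows f (ys @ ws)) * \<Phi> f))"
proof -
  show fin: "finite E"
    by (rule finite_subset[OF _ finite_TL[OF fin_S, of "card S"]])
       (auto simp: E_def TL_def intro: distinct_card[symmetric, THEN ord_eq_le_trans] card_mono[OF fin_S])
  have one: "of_bool (follows f ys) = (\<Sum>ws\<in>E. of_bool (follows f (ys @ ws)) :: real)" if f: "f \<in> forests S W" for f
  proof (cases "follows f ys")
    case True
    define u where "u = hd ys"
    define k where "k = length ys - 1"
    have k: "length ys = Suc k" using ys(1) by (simp add: k_def)
    have yo: "ys = orb f u (Suc k)" using follows_eq_orb[of f u "tl ys"] True ys(1) k by (simp add: u_def)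
    define N where "N = (LEAST n. (f ^^ n) u \<notin> W)"
    have N: "(f ^^ N) u \<notin> W" unfolding N_def using forests_exit[OF f] by (rule LeastI_ex)
    have NW: "(f ^^ j) u \<in> W" if "j < N" for j using not_less_Least[of j] that unfolding N_def by blast
    have bl: "set (butlast ys) = (\<lambda>j. (f ^^ j) u) ` {..<k}" unfolding yo orb_append by (auto simp: orb_def)
    have kN: "k \<le> N"
    proof (rule ccontr)
      assume "\<not> k \<le> N"
      then have "(f ^^ N) u \<in> set (butlast ys)" unfolding bl by auto
      then show False using N ys(3) by auto
    qed
    define ws where "ws = map (\<lambda>j. (f ^^ j) u) [Suc k..<Suc N]"
    have yw: "ys @ ws = orb f u (Suc N)" unfolding yo ws_def orb_def map_append[symmetric]
      by (rule arg_cong[where f = "map _"]) (metis kN Suc_le_mono le_add_diff_inverse upt_add_eq_append zero_le)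
    have uS: "u \<in> S" using ys(1,4) unfolding u_def by auto
    have wsE: "ws \<in> E" unfolding E_def
    proof (intro CollectI conjI)
      show "distinct (ys @ ws)" unfolding yw using NW by (intro orb_distinct[OF f])
      show "set (butlast (ys @ ws)) \<subseteq> W" unfolding yw orb_append using NW by (auto simp: orb_def)
      show "set (ys @ ws) \<subseteq> S" unfolding yw using forests_funpow_in[OF f uS] by (auto simp: orb_def)
      show "last (ys @ ws) \<notin> W" unfolding yw orb_append using N by simp
    qed
    have uniq: "ws' = ws" if w: "ws' \<in> E" "follows f (ys @ ws')" for ws'
    proof -
      have "hd (ys @ ws') = u" using ys(1) by (simp add: u_def)
      then have o: "ys @ ws' = orb f u (Suc (k + length ws'))"
      proof -
        have "u # tl (ys @ ws') = ys @ ws'" using ys(1) by (simp add: u_def)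
        moreover have "length (tl (ys @ ws')) = k + length ws'" using k by simp
        ultimately show ?thesis using follows_eq_orb[of f u "tl (ys @ ws')"] w(2) by simp
      qed
      have "last (ys @ ws') \<notin> W" and b: "set (butlast (ys @ ws')) \<subseteq> W" using w(1) unfolding E_def by blast+
      then have "(f ^^ (k + length ws')) u \<notin> W" unfolding o orb_append by simp
      moreover have "(f ^^ j) u \<in> W" if "j < k + length ws'" for j using b that unfolding o orb_append by (auto simp: orb_def)
      ultimately have "k + length ws' = N" using N NW by (metis nat_neq_iff)
      then have "ys @ ws' = ys @ ws" unfolding o yw by simp
      then show ?thesis by simp
    qed
    have "follows f (ys @ ws)" unfolding yw by (rule follows_orb)
    then have "follows f (ys @ w) \<longleftrightarrow> w = ws" if "w \<in> E" for w
      using uniq[OF that] by blast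
    then have "of_bool (follows f (ys @ w)) = (if w = ws then 1 else (0::real))" if "w \<in> E" for w
      using that by (simp only: of_bool_def)
    then have "(\<Sum>w\<in>E. of_bool (follows f (ys @ w))) = (\<Sum>w\<in>E. if w = ws then 1 else (0::real))"
      by (intro sum.cong) simp_all
    also have "\<dots> = 1" using fin wsE by simp
    finally show ?thesis using True by simp
  next
    case False
    then show ?thesis using follows_append_last[OF ys(1)] by simp
  qed
  show "ZZ W (\<lambda>f. of_bool (follows f ys) * \<Phi> f) = (\<Sum>ws\<in>E. ZZ W (\<lambda>f. of_bool (follows f (ys @ ws)) * \<Phi> f))"
    unfolding ZZ_sum[symmetric] sum_distrib_right[symmetric] by (rule ZZ_cong) (simp only: one)
qed

text \<open>Given a path up to the root, the rest is a forest in which the vertices of the path are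
  additional roots. A forest that follows \<open>ys\<close> has exactly one continuation to the
  root, so a bound valid for every complete path holds given any initial segment.\<close>

lemma ZZ_markov:
  assumes ys: "ys \<noteq> []" "distinct ys" "set (butlast ys) \<subseteq> W" "set ys \<subseteq> S" and W: "W \<subseteq> I"
    and c: "\<And>ws. distinct (ys @ ws) \<Longrightarrow> set (butlast (ys @ ws)) \<subseteq> W \<Longrightarrow> set (ys @ ws) \<subseteq> S \<Longrightarrow> last (ys @ ws) \<notin> W \<Longrightarrow>
        ZZ (W - set (ys @ ws)) (\<lambda>g. \<Phi> (upd_path g (ys @ ws))) \<le> c * Z (W - set (ys @ ws))"
  shows "ZZ W (\<lambda>f. of_bool (follows f ys) * \<Phi> f) \<le> c * ZZ W (\<lambda>f. of_bool (follows f ys))"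
proof -
  let ?E = "{ws. distinct (ys @ ws) \<and> set (butlast (ys @ ws)) \<subseteq> W \<and> set (ys @ ws) \<subseteq> S \<and> last (ys @ ws) \<notin> W}"
  have "ZZ W (\<lambda>f. of_bool (follows f ys) * \<Phi> f) = (\<Sum>ws\<in>?E. ZZ W (\<lambda>f. of_bool (follows f (ys @ ws)) * \<Phi> f))"
    by (rule ZZ_follows_full[OF ys W])
  also have "\<dots> \<le> (\<Sum>ws\<in>?E. c * ZZ W (\<lambda>f. of_bool (follows f (ys @ ws)) * 1))"
  proof (rule sum_mono)
    fix ws assume "ws \<in> ?E"
    then have w: "distinct (ys @ ws)" "set (butlast (ys @ ws)) \<subseteq> W" "set (ys @ ws) \<subseteq> S" "last (ys @ ws) \<notin> W" by auto
    have ne: "ys @ ws \<noteq> []" using ys(1) by simp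
    show "ZZ W (\<lambda>f. of_bool (follows f (ys @ ws)) * \<Phi> f) \<le> c * ZZ W (\<lambda>f. of_bool (follows f (ys @ ws)) * 1)"
      unfolding ZZ_follows_root[OF ne w(1,2,3) W w(4)]
      using mult_left_mono[OF c[OF w] pp_nonneg[of "ys @ ws"]] by (simp only: mult_ac)
  qed
  also have "\<dots> = c * ZZ W (\<lambda>f. of_bool (follows f ys) * 1)"
    unfolding sum_distrib_left[symmetric] by (rule arg_cong[where f = "\<lambda>t. c * t"], rule ZZ_follows_full(2)[OF ys W, symmetric])
  finally show ?thesis by simp
qed

text \<open>A path into the start of \<open>xs\<close> that used an arc of \<open>xs\<close> would
  close a cycle, so it is a path of \<open>g\<close> as well.\<close>

lemma deep_upd_path:
  assumes g: "g \<in> forests S (W - set xs)" and xs: "xs \<noteq> []" "distinct xs" and f: "upd_path g xs \<in> forests S W"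
    and d: "lev (upd_path g xs) y (hd xs) N"
  shows "lev g y (hd xs) N"
proof -
  let ?f = "upd_path g xs" and ?u = "hd xs"
  have off: "(?f ^^ j) y \<notin> set (butlast xs)" if j: "j < N" for j
  proof
    assume a: "(?f ^^ j) y \<in> set (butlast xs)"
    let ?a = "(?f ^^ j) y"
    have "?a \<in> set xs" using a by (rule in_set_butlastD)
    have o: "xs = orb ?f ?u (length xs)" using follows_eq_orb[of ?f ?u "tl xs"] follows_upd_path[OF xs(2)] xs(1) by simp
    have "reach ?f ?u ?a" using \<open>?a \<in> set xs\<close> by (subst (asm) o) (auto simp: orb_def reach_def)
    moreover have "reach ?f ?a ?u"
    proof -
      have "(?f ^^ (N - j)) ?a = ?u" using d j unfolding lev_def by (metis funpow_add_apply le_add_diff_inverse2 less_imp_le)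
      then show ?thesis by (auto simp: reach_def)
    qed
    ultimately have "?a = ?u" using forests_antisym[OF f] by blast
    then show False using d j by (auto simp: lev_def)
  qed
  have "(g ^^ j) y = (?f ^^ j) y" if "j \<le> N" for j
    using that
  proof (induction j)
    case (Suc j)
    then show ?case using upd_path_off[OF off[of j], of g] by simp
  qed simp
  then show ?thesis using d unfolding lev_def by simp
qed

lemma upd_path_forests:
  assumes "xs \<noteq> []" "distinct xs" "set (butlast xs) \<subseteq> W" "set xs \<subseteq> S" "W \<subseteq> I" "last xs \<notin> W" "g \<in> forests S (W - set xs)"
  shows "upd_path g xs \<in> forests S W"
  using assms
proof (induction xs arbitrary: W)
  case (Cons x xs)
  show ?case
  proof (cases xs)
    case Nil
    then show ?thesis using Cons.prems by (simp add: upd_path_single)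
  next
    case (Cons y ys)
    have x: "x \<in> W" "x \<notin> set xs" using Cons.prems Cons by auto
    have e: "W - {x} - set xs = W - set (x # xs)" by auto
    have h: "upd_path g xs \<in> forests S (W - {x})"
    proof (rule Cons.IH)
      show "set (butlast xs) \<subseteq> W - {x}" using Cons.prems x Cons by (auto dest: in_set_butlastD)
    qed (use Cons.prems x Cons e in auto)
    have "\<not> reach (upd_path g xs) y x"
    proof
      assume "reach (upd_path g xs) y x"
      moreover have "reach (upd_path g xs) y (last xs)" using follows_reach[of "upd_path g xs" y ys] follows_upd_path[of xs g] Cons.prems Cons by simp
      moreover have "upd_path g xs (last xs) = last xs" using forests_out[OF h, of "last xs"] Cons.prems Cons by auto
      moreover have "upd_path g xs x = x" using forests_out[OF h, of x] by auto
      ultimately have "x = last xs" using reach_fixed_unique by metis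
      moreover have "last xs \<in> set xs" using Cons by (intro last_in_set) simp
      ultimately show False using x by metis
    qed
    then have "(upd_path g xs)(x := y) \<in> forests S W"
      using h x Cons.prems Cons by (intro forests_upd) auto
    then show ?thesis unfolding Cons upd_path_Cons .
  qed
qed simp

text \<open>Prescribing the arc from \<open>u\<close> to \<open>bd\<close> makes \<open>u\<close> a
  root at the cost of the factor \<open>P u bd\<close>, and depth at \<open>u\<close> depends only
  on the arcs above \<open>u\<close>. This converts a bound for ordinary vertices into one for
  roots.\<close>

lemma root_deep_le:
  assumes W: "W \<subseteq> I" and u: "u \<in> I" "u \<notin> W" and half: "1/2 \<le> P u bd"
    and q: "ZZ (insert u W) (\<lambda>f. of_bool (deep f u N)) \<le> q * Z (insert u W)" "0 \<le> q"
  shows "ZZ W (\<lambda>f. of_bool (deep f u N)) \<le> 2 * q * Z W"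
proof -
  let ?V = "insert u W"
  have V: "?V \<subseteq> I" and uV: "u \<in> ?V" and rem: "?V - {u} = W" using W u by auto
  have dp: "deep (g(u := bd)) u N \<longleftrightarrow> deep g u N" for g
  proof -
    have "lev (g(u := bd)) y u N \<longleftrightarrow> lev g y u N" for y
    proof
      assume l: "lev (g(u := bd)) y u N"
      have "(((g(u := bd))(u := g u)) ^^ j) y = ((g(u := bd)) ^^ j) y" if "j \<le> N" for j
        by (rule funpow_upd_avoid) (use l that in \<open>auto simp: lev_def\<close>)
      then show "lev g y u N" using l by (simp add: lev_def)
    next
      assume l: "lev g y u N"
      have "((g(u := bd)) ^^ j) y = (g ^^ j) y" if "j \<le> N" for j
        by (rule funpow_upd_avoid) (use l that in \<open>auto simp: lev_def\<close>)
      then show "lev (g(u := bd)) y u N" using l by (simp add: lev_def)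
    qed
    then show ?thesis by (simp add: deep_lev)
  qed
  have nr: "\<not> reach g bd u" if "g \<in> forests S W" for g
    using reach_fixed[of g bd u] forests_out[OF that, of bd] W u by auto
  have "1/2 * ZZ W (\<lambda>f. of_bool (deep f u N)) \<le> P u bd * ZZ W (\<lambda>f. of_bool (deep f u N))"
    by (intro mult_right_mono half ZZ_nonneg) auto
  also have "\<dots> = P u bd * ZZ W (\<lambda>g. of_bool (\<not> reach g bd u) * of_bool (deep (g(u := bd)) u N))"
    using nr by (intro arg_cong[where f = "\<lambda>t. P u bd * t"] ZZ_cong) (simp add: dp)
  also have "\<dots> = ZZ ?V (\<lambda>f. of_bool (f u = bd) * of_bool (deep f u N))"
    using ZZ_eq_step[OF V uV bd_S] by (simp only: rem)
  also have "\<dots> \<le> ZZ ?V (\<lambda>f. of_bool (deep f u N))" by (intro ZZ_mono) auto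
  also have "\<dots> \<le> q * Z W"
    using q(1) mult_left_mono[OF Z_mono_remove[OF V uV] q(2)] by (simp only: rem)
  finally show ?thesis by simp
qed

end

section \<open>Probabilities of past paths by reversal\<close>

context rev_chain
begin

lemma B_ge_1: "v \<in> I \<Longrightarrow> 1 \<le> B"
  using G_diag_ge_1[of I v] G_le_B[of I v v] by auto

lemma pp_rev:
  "xs \<noteq> [] \<Longrightarrow> set xs \<subseteq> I \<Longrightarrow> m (last xs) * pp P (rev xs) = m (hd xs) * pp P xs"
proof (induction xs)
  case (Cons x xs)
  show ?case
  proof (cases xs)
    case (Cons y ys)
    have xs: "xs \<noteq> []" "set xs \<subseteq> I" "x \<in> I" "y \<in> I" using Cons.prems Cons by auto
    have l: "last (rev xs) = y" using Cons by simp
    have "pp P (rev (x # xs)) = pp P (rev xs) * P y x" using pp_append[of "rev xs" P "[x]"] xs l by simp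
    then have "m (last (x # xs)) * pp P (rev (x # xs)) = (m y * pp P xs) * P y x"
      using Cons.IH[OF xs(1,2)] xs Cons by (simp add: mult_ac)
    also have "\<dots> = (m x * P x y) * pp P xs" using m_rev[OF xs(3,4)] by (simp add: mult_ac)
    finally show ?thesis using Cons by simp
  qed simp
qed simp

lemma pp_rev_le:
  assumes "xs \<noteq> []" "set xs \<subseteq> I"
  shows "pp P (rev xs) \<le> A\<^sup>2 * pp P xs"
proof -
  have h: "hd xs \<in> I" "last xs \<in> I"
    using hd_in_set[OF assms(1)] last_in_set[OF assms(1)] assms(2) by blast+
  have "pp P (rev xs) = m (hd xs) / m (last xs) * pp P xs"
    using pp_rev[OF assms] m_pos[OF h(2)] by (simp add: field_simps)
  also have "\<dots> \<le> A\<^sup>2 * pp P xs" by (intro mult_right_mono m_ratio h pp_nonneg)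
  finally show ?thesis .
qed

lemma TL_props:
  assumes W: "W \<subseteq> I" and v: "v \<in> I" and zs: "zs \<in> TL (W - {v}) M"
  shows "rev (v # zs) \<noteq> []" "distinct (rev (v # zs))" "set (butlast (rev (v # zs))) \<subseteq> W" "set (rev (v # zs)) \<subseteq> S"
    "v # zs \<noteq> []" "set (v # zs) \<subseteq> I" "butlast (rev (v # zs)) = rev zs" "last (rev (v # zs)) = v" "hd (rev (v # zs)) = last (v # zs)"
  using assms by (auto simp: TL_def hd_rev)

text \<open>Reversing the path costs the ratio of the reversing measure at its ends. The factor
  \<open>B\<close> compares the domain in which \<open>v\<close> is an ordinary vertex with the one
  in which \<open>v\<close> is a root, as \<open>tw\<close> requires.\<close>

lemma ZZ_follows_rev_le:
  assumes W: "W \<subseteq> I" and v: "v \<in> I" and zs: "zs \<in> TL (W - {v}) M"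
  shows "ZZ W (\<lambda>f. of_bool (follows f (rev (v # zs)))) \<le> A\<^sup>2 * B * tw (W - {v}) v zs * Z W"
proof -
  note t = TL_props[OF W v zs]
  have Z1: "Z (W - set zs) \<le> Z (W - {v} - set zs)"
  proof (cases "v \<in> W - set zs")
    case True
    have e: "W - set zs - {v} = W - {v} - set zs" by auto
    show ?thesis using Z_mono_remove[of "W - set zs" v] True W unfolding e by auto
  next
    case False
    then have "W - {v} - set zs = W - set zs" by auto
    then show ?thesis by simp
  qed
  have Z2: "Z (W - {v}) \<le> B * Z W"
  proof (cases "v \<in> W")
    case True then show ?thesis by (rule Z_remove_le[OF W])
  next
    case False
    then have "W - {v} = W" by auto
    moreover have "1 * Z W \<le> B * Z W" using B_ge_1[OF v] Z_pos[OF W] by (intro mult_right_mono) auto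
    ultimately show ?thesis by simp
  qed
  have Zp: "Z (W - {v}) > 0" using Z_pos[of "W - {v}"] W by auto
  have "ZZ W (\<lambda>f. of_bool (follows f (rev (v # zs)))) = pp P (rev (v # zs)) * ZZ (W - set zs) (\<lambda>g. of_bool (\<forall>a\<in>set zs. \<not> reach g v a))"
    using ZZ_follows[OF t(1-4) W, of "\<lambda>_. 1"] unfolding t(7,8) by simp
  also have "\<dots> \<le> (A\<^sup>2 * pp P (v # zs)) * Z (W - set zs)"
    using pp_rev_le[OF t(5,6)] pp_nonneg[of "v # zs"] pp_nonneg[of "rev (v # zs)"]
    by (intro mult_mono ZZ_mono ZZ_nonneg) auto
  also have "\<dots> \<le> (A\<^sup>2 * pp P (v # zs)) * Z (W - {v} - set zs)"
    using Z1 pp_nonneg by (intro mult_left_mono) auto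
  also have "\<dots> = A\<^sup>2 * tw (W - {v}) v zs * Z (W - {v})" using Zp by (simp add: tw_def)
  also have "\<dots> \<le> A\<^sup>2 * tw (W - {v}) v zs * (B * Z W)"
    using Z2 tw_nonneg[of "W - {v}" v zs] W by (intro mult_left_mono) auto
  finally show ?thesis by (simp add: mult_ac)
qed

lemma sum_tw_any:
  assumes W: "W \<subseteq> I" and v: "v \<in> I"
  shows "(\<Sum>zs\<in>TL (W - {v}) M. tw (W - {v}) v zs) \<le> B * (real M + 1)"
  using assms by (intro sum_tw_le) auto

lemma fin_TL: "W \<subseteq> I \<Longrightarrow> finite (TL (W - K) M)"
  by (intro finite_TL fin_sub Diff_sub)

definition past_upto :: "('a \<Rightarrow> 'a) \<Rightarrow> 'a \<Rightarrow> nat \<Rightarrow> 'a set" where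
  "past_upto f v M = {u\<in>S. \<exists>n\<le>M. lev f u v n}"

lemma card_past_upto_le:
  assumes W: "W \<subseteq> I" and f: "f \<in> forests S W"
  shows "real (card (past_upto f v M)) \<le> (\<Sum>zs\<in>TL (W - {v}) M. of_bool (follows f (rev (v # zs))))"
proof -
  let ?T = "{zs\<in>TL (W - {v}) M. follows f (rev (v # zs))}"
  have fin: "finite (TL (W - {v}) M)" by (rule fin_TL[OF W])
  have "past_upto f v M \<subseteq> (\<lambda>zs. last (v # zs)) ` ?T"
  proof
    fix u assume "u \<in> past_upto f v M"
    then obtain n where n: "n \<le> M" "lev f u v n" by (auto simp: past_upto_def)
    note l = lev_orb[OF f n(2)]
    have "rev (orb f u n) \<in> ?T" using l n(1) by (auto simp: TL_def)
    then show "u \<in> (\<lambda>zs. last (v # zs)) ` ?T" using l(5) by (metis (mono_tags, lifting) image_eqI)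
  qed
  have finT: "finite ?T" using fin by simp
  have "card (past_upto f v M) \<le> card ((\<lambda>zs. last (v # zs)) ` ?T)"
    by (rule card_mono[OF finite_imageI[OF finT]]) fact
  also have "\<dots> \<le> card ?T" by (rule card_image_le[OF finT])
  also have "real (card ?T) = (\<Sum>zs\<in>TL (W - {v}) M. of_bool (follows f (rev (v # zs))))"
    using fin by (simp add: of_bool_def sum.If_cases Int_def)
  finally show ?thesis by (simp only: of_nat_le_iff)
qed

lemma ZZ_past_upto_le:
  assumes W: "W \<subseteq> I" and v: "v \<in> I"
  shows "ZZ W (\<lambda>f. real (card (past_upto f v M))) \<le> A\<^sup>2 * B\<^sup>2 * (real M + 1) * Z W"
proof -
  have "ZZ W (\<lambda>f. real (card (past_upto f v M))) \<le> ZZ W (\<lambda>f. \<Sum>zs\<in>TL (W - {v}) M. of_bool (follows f (rev (v # zs))))"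
    by (rule ZZ_mono[OF card_past_upto_le[OF W]])
  also have "\<dots> = (\<Sum>zs\<in>TL (W - {v}) M. ZZ W (\<lambda>f. of_bool (follows f (rev (v # zs)))))" by (rule ZZ_sum)
  also have "\<dots> \<le> (\<Sum>zs\<in>TL (W - {v}) M. A\<^sup>2 * B * tw (W - {v}) v zs * Z W)"
    by (intro sum_mono ZZ_follows_rev_le[OF W v])
  also have "\<dots> = A\<^sup>2 * B * Z W * (\<Sum>zs\<in>TL (W - {v}) M. tw (W - {v}) v zs)"
    by (simp add: sum_distrib_left mult_ac)
  also have "\<dots> \<le> A\<^sup>2 * B * Z W * (B * (real M + 1))"
    using B_nonneg Z_pos[OF W] by (intro mult_left_mono sum_tw_any[OF W v]) auto
  finally show ?thesis by (simp add: mult_ac power2_eq_square)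
qed

end

section \<open>The recursion for the depth of the past\<close>

lemma deep_paths_nonempty:
  assumes f: "f \<in> forests S W" and v: "v \<in> W" and d: "deep f v M" and nN: "n + N \<le> M"
  shows "deep_paths f v n N \<inter> Pow W \<noteq> {}"
proof -
  obtain y where y: "(f ^^ M) y = v" "\<forall>j<M. (f ^^ j) y \<noteq> v" using d by (auto simp: deep_def)
  define u where "u = (f ^^ (M - n)) y"
  define y' where "y' = (f ^^ (M - n - N)) y"
  have uj: "(f ^^ j) u = (f ^^ (j + (M - n))) y" for j by (simp add: u_def funpow_add_apply)
  have u: "(f ^^ n) u = v" "\<forall>j<n. (f ^^ j) u \<noteq> v" using y nN unfolding uj by auto
  have y'j: "(f ^^ j) y' = (f ^^ (j + (M - n - N))) y" for j by (simp add: y'_def funpow_add_apply)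
  have "(f ^^ N) y' = u" unfolding y'j u_def using nN by (intro arg_cong[where f = "\<lambda>i. (f ^^ i) y"]) simp
  moreover have "(f ^^ j) y' \<noteq> u" if "j < N" for j
  proof
    assume "(f ^^ j) y' = u"
    then have "(f ^^ (n + (j + (M - n - N)))) y = v" using u(1) unfolding y'j by (simp add: funpow_add_apply)
    moreover have "n + (j + (M - n - N)) < M" using that nN by linarith
    ultimately show False using y(2) by blast
  qed
  ultimately have "deep f u N" by (auto simp: deep_def)
  moreover have "(\<lambda>j. (f ^^ j) u) ` {..n} \<subseteq> W"
  proof
    fix a assume "a \<in> (\<lambda>j. (f ^^ j) u) ` {..n}"
    then obtain j where j: "a = (f ^^ j) u" "j \<le> n" by auto
    then have "(f ^^ (n - j)) a = v" using u by (metis funpow_add_apply le_add_diff_inverse2)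
    then have "reach f a v" by (auto simp: reach_def)
    then show "a \<in> W" using forests_reach_in[OF f _ v] by blast
  qed
  ultimately show ?thesis using u unfolding deep_paths_def by blast
qed

lemma deep_paths_list:
  assumes f: "f \<in> forests S W" and K: "K \<in> deep_paths f v n N"
  obtains zs where "zs \<in> TL (W - {v}) n" "length zs = n" "follows f (rev (v # zs))" "K = set (v # zs)" "deep f (last (v # zs)) N"
proof -
  obtain u where K: "K = (\<lambda>j. (f ^^ j) u) ` {..n}" and l: "lev f u v n" and d: "deep f u N"
    using K by (auto simp: deep_paths_def lev_def)
  note o = lev_orb[OF f l]
  have "set (v # rev (orb f u n)) = set (rev (v # rev (orb f u n)))" by auto
  also have "\<dots> = K"
  proof -
    have "{0..<Suc n} = {..n}" by auto
    then show ?thesis unfolding o(3) unfolding K orb_def set_map set_upt by (simp only:)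
  qed
  finally have "K = set (v # rev (orb f u n))" by simp
  then show thesis using that[OF o(1,2,4)] o(5) d by metis
qed

context rev_chain
begin

lemma A_ge_1: "v \<in> I \<Longrightarrow> 1 \<le> A"
proof -
  assume v: "v \<in> I"
  have "inverse A \<le> A" using m_lower[OF v] m_upper[OF v] by linarith
  then have "1 \<le> A * A" using A_pos by (simp add: field_simps)
  then show ?thesis using A_pos by (metis less_1_mult mult_less_cancel_left_pos not_le mult.right_neutral order_less_trans)
qed

section \<open>Energy and capacity of past paths\<close>

lemma energy_sum_le:
  assumes W: "W \<subseteq> I" and d: "set xs \<subseteq> W" "length xs = Suc L"
  shows "(\<Sum>i\<le>L. \<Sum>k\<le>L. G W (xs ! i) (xs ! k)) \<le> 2 * A\<^sup>2 * (\<Sum>i\<le>L. \<Sum>j\<le>L - i. G W (xs ! (i + j)) (xs ! i))"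
proof -
  have xW: "xs ! i \<in> W" if "i \<le> L" for i using d that by (metis le_imp_less_Suc nth_mem subsetD)
  have xI: "xs ! i \<in> I" if "i \<le> L" for i using xW[OF that] W by blast
  have A1: "1 \<le> A\<^sup>2" using A_ge_1[OF xI[of 0]] by (simp add: one_le_power)
  let ?g = "\<lambda>i k. of_bool (i \<le> k) * G W (xs ! k) (xs ! i)"
  have le: "G W (xs ! i) (xs ! k) \<le> A\<^sup>2 * (?g i k + ?g k i)" if ik: "i \<le> L" "k \<le> L" for i k
  proof (cases "i \<le> k")
    case True
    have "G W (xs ! i) (xs ! k) = m (xs ! k) / m (xs ! i) * G W (xs ! k) (xs ! i)"
      using G_rev[OF W xW[OF ik(1)] xW[OF ik(2)]] m_pos[OF xI[OF ik(1)]] by (simp add: field_simps)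
    also have "\<dots> \<le> A\<^sup>2 * G W (xs ! k) (xs ! i)" by (intro mult_right_mono m_ratio xI ik G_nonneg W)
    also have "\<dots> \<le> A\<^sup>2 * (?g i k + ?g k i)" using True G_nonneg[OF W] by (intro mult_left_mono) auto
    finally show ?thesis .
  next
    case False
    have "1 * G W (xs ! i) (xs ! k) \<le> A\<^sup>2 * G W (xs ! i) (xs ! k)" by (intro mult_right_mono A1 G_nonneg W)
    then show ?thesis using False by simp
  qed
  have "(\<Sum>i\<le>L. \<Sum>k\<le>L. G W (xs ! i) (xs ! k)) \<le> (\<Sum>i\<le>L. \<Sum>k\<le>L. A\<^sup>2 * (?g i k + ?g k i))"
    using le by (intro sum_mono) auto
  also have "\<dots> = A\<^sup>2 * ((\<Sum>i\<le>L. \<Sum>k\<le>L. ?g i k) + (\<Sum>i\<le>L. \<Sum>k\<le>L. ?g k i))"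
    by (simp add: sum_distrib_left[symmetric] sum.distrib)
  also have "(\<Sum>i\<le>L. \<Sum>k\<le>L. ?g k i) = (\<Sum>i\<le>L. \<Sum>k\<le>L. ?g i k)" by (rule sum.swap)
  also have "(\<Sum>i\<le>L. \<Sum>k\<le>L. ?g i k) = (\<Sum>i\<le>L. \<Sum>j\<le>L - i. G W (xs ! (i + j)) (xs ! i))"
  proof (rule sum.cong[OF refl])
    fix i assume i: "i \<in> {..L}"
    have "(\<Sum>k\<le>L. ?g i k) = (\<Sum>k\<in>{i..L}. G W (xs ! k) (xs ! i))"
      by (rule sum.mono_neutral_cong_right) auto
    also have "\<dots> = (\<Sum>j\<le>L - i. G W (xs ! (i + j)) (xs ! i))"
      using i by (intro sum.reindex_bij_witness[where i = "\<lambda>j. i + j" and j = "\<lambda>k. k - i"]) auto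
    finally show "(\<Sum>k\<le>L. ?g i k) = (\<Sum>j\<le>L - i. G W (xs ! (i + j)) (xs ! i))" .
  qed
  finally show ?thesis by simp
qed

text \<open>By Markov's inequality at most \<open>N / 2\<close> vertices have potential above
  \<open>4 * A\<^sup>2 * t\<close>. At least \<open>N / 2\<close> good vertices remain, each of mass
  at least \<open>inverse A\<close>, and \<open>capacity_ge\<close> is applied to them.\<close>

lemma low_energy_capacity:
  assumes W: "W \<subseteq> I" and xs: "distinct xs" "set xs \<subseteq> W" "length xs = Suc L" and N: "N \<le> L" "0 < N" and t: "0 < t"
    and en: "(\<Sum>i\<le>L. \<Sum>j\<le>L - i. G W (xs ! (i + j)) (xs ! i)) \<le> t * real N"
  shows "real N / (8 * A ^ 3 * t) \<le> (\<Sum>x\<in>W. m x * kap W x * hit W (set xs) x)"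
proof -
  let ?K = "set xs"
  let ?row = "\<lambda>a. \<Sum>b\<in>?K. G W a b"
  define l where "l = 4 * A\<^sup>2 * t"
  define g where "g = {a\<in>?K. ?row a \<le> l}"
  have l: "0 < l" using A_pos t by (simp add: l_def)
  have eq: "{..<length xs} = {..L}" using xs(3) by auto
  have "(\<Sum>a\<in>?K. ?row a) = (\<Sum>i\<le>L. \<Sum>k\<le>L. G W (xs ! i) (xs ! k))"
    unfolding sum_set_nth[OF xs(1)] eq ..
  also have "\<dots> \<le> 2 * A\<^sup>2 * (t * real N)"
    using energy_sum_le[OF W xs(2,3)] en A_pos by (meson mult_left_mono order_trans zero_le_mult_iff zero_le_numeral zero_le_power2)
  finally have tot: "(\<Sum>a\<in>?K. ?row a) \<le> l * (real N / 2)" by (simp add: l_def mult_ac)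
  have "real (card (?K - g)) * l \<le> (\<Sum>a\<in>?K - g. ?row a)"
    unfolding g_def by (rule sum_bounded_below) auto
  also have "\<dots> \<le> (\<Sum>a\<in>?K. ?row a)"
    by (intro sum_mono2 sum_nonneg G_nonneg W) auto
  finally have "real (card (?K - g)) * l \<le> (real N / 2) * l" using tot by (simp add: mult.commute)
  then have cK: "real (card (?K - g)) \<le> real N / 2" using l by simp
  have gK: "g \<subseteq> ?K" by (auto simp: g_def)
  have "card g + card (?K - g) = card ?K" using gK by (metis List.finite_set card_Diff_subset card_mono finite_subset le_add_diff_inverse)
  then have "real (card g) + real (card (?K - g)) = real (Suc L)" using distinct_card[OF xs(1)] xs(3) by (metis of_nat_add)
  then have cg: "real N / 2 \<le> real (card g)" using cK N by simp
  have mI: "inverse A \<le> m y" if "y \<in> g" for y using that gK xs(2) W by (intro m_lower) auto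
  have "real N / 2 * inverse A \<le> real (card g) * inverse A" using cg A_pos by (intro mult_right_mono) auto
  also have "\<dots> \<le> (\<Sum>y\<in>g. m y)" using mI by (intro sum_bounded_below) auto
  finally have mg: "real N / (2 * A) \<le> (\<Sum>y\<in>g. m y)" by (simp add: field_simps)
  have "real N / (8 * A ^ 3 * t) = real N / (2 * A) / l"
    using A_pos t by (simp add: l_def field_simps power2_eq_square power3_eq_cube)
  also have "\<dots> \<le> (\<Sum>y\<in>g. m y) / l" using mg l by (intro divide_right_mono) auto
  also have "\<dots> \<le> (\<Sum>x\<in>W. m x * kap W x * hit W ?K x)"
  proof (rule capacity_ge[OF W gK xs(2) l])
    fix z assume z: "z \<in> g"
    have "(\<Sum>y\<in>g. G W z y) \<le> ?row z" using gK by (intro sum_mono2 G_nonneg W) auto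
    also have "\<dots> \<le> l" using z by (simp add: g_def)
    finally show "(\<Sum>y\<in>g. G W z y) \<le> l" .
  qed
  finally show ?thesis .
qed

text \<open>The hypothesis \<open>H\<close> speaks of roots, since after conditioning on the path
  its start \<open>last (v # zs)\<close> has become one.\<close>

lemma ZZ_follows_deep_le:
  assumes W: "W \<subseteq> I" and v: "v \<in> W" and zs: "zs \<in> TL (W - {v}) M" and e: "0 \<le> e"
    and H: "\<And>W' u. W' \<subseteq> I \<Longrightarrow> u \<in> I \<Longrightarrow> u \<notin> W' \<Longrightarrow> ZZ W' (\<lambda>f. of_bool (deep f u N)) \<le> e * Z W'"
  shows "ZZ W (\<lambda>f. of_bool (follows f (rev (v # zs))) * of_bool (deep f (last (v # zs)) N)) \<le> e * (A\<^sup>2 * B * tw (W - {v}) v zs * Z W)"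
proof -
  have vI: "v \<in> I" using v W by auto
  note t = TL_props[OF W vI zs]
  let ?ys = "rev (v # zs)" and ?u = "last (v # zs)"
  have "ZZ W (\<lambda>f. of_bool (follows f ?ys) * of_bool (deep f ?u N)) \<le> e * ZZ W (\<lambda>f. of_bool (follows f ?ys))"
  proof (rule ZZ_markov[OF t(1-4) W])
    fix ws assume w: "distinct (?ys @ ws)" "set (butlast (?ys @ ws)) \<subseteq> W" "set (?ys @ ws) \<subseteq> S" "last (?ys @ ws) \<notin> W"
    let ?xs = "?ys @ ws"
    have ne: "?xs \<noteq> []" using t(1) by simp
    have hd: "hd ?xs = ?u" unfolding hd_append2[OF t(1)] by (rule t(9))
    have uI: "?u \<in> I" "?u \<notin> W - set ?xs" using t(6) hd_in_set[OF ne] hd last_in_set[OF t(5)] by auto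
    have "ZZ (W - set ?xs) (\<lambda>g. of_bool (deep (upd_path g ?xs) ?u N)) \<le> ZZ (W - set ?xs) (\<lambda>g. of_bool (deep g ?u N))"
    proof (rule ZZ_mono)
      fix g assume g: "g \<in> forests S (W - set ?xs)"
      have f: "upd_path g ?xs \<in> forests S W" by (rule upd_path_forests[OF ne w(1-3) W w(4) g])
      show "of_bool (deep (upd_path g ?xs) ?u N) \<le> (of_bool (deep g ?u N) :: real)"
      proof -
        have "deep g ?u N" if "deep (upd_path g ?xs) ?u N"
          using that deep_upd_path[OF g ne w(1) f, unfolded hd] unfolding deep_lev by blast
        then show ?thesis by (simp only: of_bool_def split: if_split) simp
      qed
    qed
    also have "\<dots> \<le> e * Z (W - set ?xs)" using uI W by (intro H) auto
    finally show "ZZ (W - set ?xs) (\<lambda>g. of_bool (deep (upd_path g ?xs) ?u N)) \<le> e * Z (W - set ?xs)" .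
  qed
  also have "\<dots> \<le> e * (A\<^sup>2 * B * tw (W - {v}) v zs * Z W)"
    by (intro mult_left_mono e ZZ_follows_rev_le[OF W vI zs])
  finally show ?thesis .
qed

text \<open>For every \<open>n\<close> between \<open>N\<close> and \<open>2 * N\<close>, depth
  \<open>4 * N\<close> provides past paths of length \<open>n\<close> that are \<open>N\<close>
  deep. Either there are at most \<open>k\<close> and one has large capacity, or there are more than
  \<open>k\<close>, or one has small capacity. The first event is bounded by an excursion, the other
  two by first moments, which carry the factor \<open>e\<close>. Those first moments are controlled
  only for all lengths together, so the inequality is averaged over \<open>n\<close>.\<close>

lemma deep_recursion:
  assumes W: "W \<subseteq> I" and v: "v \<in> W" and N: "0 < N" and k: "0 < k" and t: "0 < t" and e: "0 \<le> e"
    and H: "\<And>W' u. W' \<subseteq> I \<Longrightarrow> u \<in> I \<Longrightarrow> u \<notin> W' \<Longrightarrow> ZZ W' (\<lambda>f. of_bool (deep f u N)) \<le> e * Z W'"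
  shows "ZZ W (\<lambda>f. of_bool (deep f v (4 * N))) \<le>
     (8 * real k * A ^ 4 * t / real N + e * A\<^sup>2 * B * (3 * B / real k + 9 * B ^ 3 / t)) * Z W"
proof -
  have vI: "v \<in> I" using v W by auto
  have finW: "finite W" by (rule fin_sub[OF W])
  define c where "c = real N / (8 * A ^ 3 * t)"
  define Q where "Q = (\<lambda>K. c \<le> (\<Sum>x\<in>W. m x * kap W x * hit W K x))"
  let ?TL = "TL (W - {v}) (2 * N)"
  define T where "T n = {zs\<in>?TL. length zs = n}" for n
  let ?X = "\<lambda>zs f. of_bool (follows f (rev (v # zs))) * of_bool (deep f (last (v # zs)) N) :: real"
  let ?D = "\<lambda>n f. deep_paths f v n N \<inter> Pow W"
  define En where "En zs = (\<Sum>i\<le>length zs. \<Sum>j\<le>length zs - i. G W ((v # zs) ! (i + j)) ((v # zs) ! i))" for zs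
  have c: "0 < c" using N t A_pos by (simp add: c_def)
  have finTL: "finite ?TL" by (rule fin_TL[OF W])
  have finT: "finite (T n)" for n using finTL by (simp add: T_def)
  have Zp: "0 < Z W" by (rule Z_pos[OF W])
  have point: "of_bool (deep f v (4 * N)) \<le> of_bool (sel k Q (?D n f)) + (\<Sum>zs\<in>T n. ?X zs f) / real k + (\<Sum>zs\<in>T n. of_bool (\<not> Q (set (v # zs))) * ?X zs f)"
    if f: "f \<in> forests S W" and n: "n \<in> {N..<2*N}" for f n
  proof (cases "deep f v (4 * N) \<and> \<not> sel k Q (?D n f)")
    case True
    then have ne: "?D n f \<noteq> {}" using deep_paths_nonempty[OF f v, of "4 * N" n N] n by auto
    have nn: "0 \<le> (\<Sum>zs\<in>T n. ?X zs f) / real k" "0 \<le> (\<Sum>zs\<in>T n. of_bool (\<not> Q (set (v # zs))) * ?X zs f)"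
      by (auto intro!: sum_nonneg divide_nonneg_nonneg)
    have lst: "\<exists>zs\<in>T n. ?X zs f = 1 \<and> K = set (v # zs)" if "K \<in> ?D n f" for K
    proof -
      have "K \<in> deep_paths f v n N" using that by blast
      then obtain zs where zs: "zs \<in> TL (W - {v}) n" "length zs = n" "follows f (rev (v # zs))" "K = set (v # zs)" "deep f (last (v # zs)) N"
        by (rule deep_paths_list[OF f])
      then have "zs \<in> T n" using n by (auto simp: T_def TL_def)
      then show ?thesis using zs by (intro bexI[of _ zs] conjI) simp_all
    qed
    show ?thesis
    proof (cases "card (?D n f) \<le> k")
      case False
      have "?D n f \<subseteq> (\<lambda>zs. set (v # zs)) ` {zs\<in>T n. ?X zs f = 1}" using lst by blast
      then have "card (?D n f) \<le> card ((\<lambda>zs. set (v # zs)) ` {zs\<in>T n. ?X zs f = 1})"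
        using finT by (intro card_mono finite_imageI) auto
      also have "\<dots> \<le> card {zs\<in>T n. ?X zs f = 1}" using finT by (intro card_image_le) auto
      finally have "real k \<le> real (card {zs\<in>T n. ?X zs f = 1})" using False by linarith
      also have "\<dots> = (\<Sum>zs\<in>{zs\<in>T n. ?X zs f = 1}. ?X zs f)" by simp
      also have "\<dots> \<le> (\<Sum>zs\<in>T n. ?X zs f)" using finT by (intro sum_mono2) auto
      finally have "1 \<le> (\<Sum>zs\<in>T n. ?X zs f) / real k" using k by (simp add: le_divide_eq)
      then show ?thesis using nn by (smt (verit) of_bool_def)
    next
      case le: True
      obtain K where K: "K \<in> ?D n f" using ne by blast
      have nQ: "\<not> Q K" using True le K unfolding sel_def by blast
      obtain zs where zs: "zs \<in> T n" "?X zs f = 1" "K = set (v # zs)" using lst[OF K] by blast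
      have "of_bool (\<not> Q (set (v # zs))) * ?X zs f \<le> (\<Sum>zs\<in>T n. of_bool (\<not> Q (set (v # zs))) * ?X zs f)"
        using finT zs(1) by (intro member_le_sum) auto
      moreover have "of_bool (\<not> Q (set (v # zs))) * ?X zs f = 1" using zs(2) nQ unfolding zs(3) by (simp only: of_bool_eq simp_thms mult_1)
      ultimately show ?thesis using nn by (smt (verit) of_bool_def)
    qed
  next
    case False
    have "0 \<le> (\<Sum>zs\<in>T n. ?X zs f) / real k" "0 \<le> (\<Sum>zs\<in>T n. of_bool (\<not> Q (set (v # zs))) * ?X zs f)"
      by (auto intro!: sum_nonneg divide_nonneg_nonneg)
    moreover have "of_bool (deep f v (4 * N)) \<le> (of_bool (sel k Q (?D n f)) :: real)" using False by auto
    ultimately show ?thesis by linarith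
  qed
  have selle: "ZZ W (\<lambda>f. of_bool (sel k Q (?D n f))) \<le> real k * A * Z W / c" for n
  proof -
    have "c * ZZ W (\<lambda>F. of_bool (sel k Q (deep_paths F v n N \<inter> Pow W))) \<le> real k * A * Z W"
      by (rule deep_paths_excursion[OF W v]) (use c in \<open>auto simp: Q_def\<close>)
    then show ?thesis using c by (simp add: le_divide_eq mult.commute)
  qed
  have Xle: "ZZ W (?X zs) \<le> e * (A\<^sup>2 * B * tw (W - {v}) v zs * Z W)" if "zs \<in> ?TL" for zs
    by (rule ZZ_follows_deep_le[OF W v that e H])
  have tail: "ZZ W (\<lambda>f. \<Sum>zs\<in>T n. r zs * ?X zs f) \<le> e * A\<^sup>2 * B * Z W * (\<Sum>zs\<in>T n. r zs * tw (W - {v}) v zs)"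
    if r: "\<And>zs. 0 \<le> r zs" for r n
  proof -
    have "ZZ W (\<lambda>f. \<Sum>zs\<in>T n. r zs * ?X zs f) = (\<Sum>zs\<in>T n. r zs * ZZ W (?X zs))" by (simp only: ZZ_sum ZZ_cmult)
    also have "\<dots> \<le> (\<Sum>zs\<in>T n. r zs * (e * (A\<^sup>2 * B * tw (W - {v}) v zs * Z W)))"
      by (intro sum_mono mult_left_mono Xle r) (auto simp: T_def)
    also have "\<dots> = e * A\<^sup>2 * B * Z W * (\<Sum>zs\<in>T n. r zs * tw (W - {v}) v zs)" by (simp add: sum_distrib_left mult_ac)
    finally show ?thesis .
  qed
  let ?g = "\<lambda>zs. 1 / real k + of_bool (\<not> Q (set (v # zs)))"
  have each: "ZZ W (\<lambda>f. of_bool (deep f v (4 * N))) \<le> real k * A * Z W / c + e * A\<^sup>2 * B * Z W * (\<Sum>zs\<in>T n. ?g zs * tw (W - {v}) v zs)"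
    if n: "n \<in> {N..<2*N}" for n
  proof -
    have "ZZ W (\<lambda>f. of_bool (deep f v (4 * N))) \<le> ZZ W (\<lambda>f. of_bool (sel k Q (?D n f)) + (\<Sum>zs\<in>T n. ?g zs * ?X zs f))"
    proof (rule ZZ_mono)
      fix f assume f: "f \<in> forests S W"
      have "(\<Sum>zs\<in>T n. ?g zs * ?X zs f) = (\<Sum>zs\<in>T n. ?X zs f) / real k + (\<Sum>zs\<in>T n. of_bool (\<not> Q (set (v # zs))) * ?X zs f)"
        by (simp only: distrib_right sum.distrib sum_divide_distrib) simp
      then show "of_bool (deep f v (4 * N)) \<le> of_bool (sel k Q (?D n f)) + (\<Sum>zs\<in>T n. ?g zs * ?X zs f)"
        using point[OF f n] by linarith
    qed
    also have "\<dots> = ZZ W (\<lambda>f. of_bool (sel k Q (?D n f))) + ZZ W (\<lambda>f. \<Sum>zs\<in>T n. ?g zs * ?X zs f)" by (rule ZZ_add)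
    also have "\<dots> \<le> real k * A * Z W / c + e * A\<^sup>2 * B * Z W * (\<Sum>zs\<in>T n. ?g zs * tw (W - {v}) v zs)"
      by (intro add_mono selle tail) simp
    finally show ?thesis .
  qed
  have "real N * ZZ W (\<lambda>f. of_bool (deep f v (4 * N))) = (\<Sum>n\<in>{N..<2*N}. ZZ W (\<lambda>f. of_bool (deep f v (4 * N))))" by simp
  also have "\<dots> \<le> (\<Sum>n\<in>{N..<2*N}. real k * A * Z W / c + e * A\<^sup>2 * B * Z W * (\<Sum>zs\<in>T n. ?g zs * tw (W - {v}) v zs))"
    by (intro sum_mono each)
  also have "\<dots> = real N * (real k * A * Z W / c) + e * A\<^sup>2 * B * Z W * (\<Sum>n\<in>{N..<2*N}. \<Sum>zs\<in>T n. ?g zs * tw (W - {v}) v zs)"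
    by (simp add: sum.distrib sum_distrib_left)
  also have "(\<Sum>n\<in>{N..<2*N}. \<Sum>zs\<in>T n. ?g zs * tw (W - {v}) v zs) \<le> real N * (3 * B / real k + 9 * B ^ 3 / t)"
  proof -
    have twn: "0 \<le> tw (W - {v}) v zs" for zs using W by (intro tw_nonneg) auto
    have Enn: "0 \<le> En zs" for zs unfolding En_def by (intro sum_nonneg G_nonneg W)
    have "(\<Sum>n\<in>{N..<2*N}. \<Sum>zs\<in>T n. ?g zs * tw (W - {v}) v zs) \<le> (\<Sum>n\<in>{N..<2*N}. \<Sum>zs\<in>T n. (1 / real k + En zs / (t * real N)) * tw (W - {v}) v zs)"
    proof (intro sum_mono mult_right_mono twn)
      fix n zs assume n: "n \<in> {N..<2*N}" and zs: "zs \<in> T n"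
      \<comment> \<open>A path of small capacity has energy above \<open>t * real N\<close> by
        \<open>low_energy_capacity\<close>; Markov's inequality replaces the indicator by the
        normalised energy.\<close>
      have "of_bool (\<not> Q (set (v # zs))) \<le> En zs / (t * real N)"
      proof (cases "En zs \<le> t * real N")
        case True
        have "c \<le> (\<Sum>x\<in>W. m x * kap W x * hit W (set (v # zs)) x)"
          unfolding c_def
          by (rule low_energy_capacity[OF W _ _ _ _ N t, of _ "length zs"])
             (use True zs v n in \<open>auto simp: T_def TL_def En_def simp del: nth_Cons_Suc\<close>)
        then have "Q (set (v # zs))" by (simp only: Q_def)
        then show ?thesis using Enn[of zs] t N by simp
      next
        case False
        then have "1 \<le> En zs / (t * real N)" using t N by (simp add: le_divide_eq)
        then show ?thesis by (simp add: of_bool_def)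
      qed
      then show "?g zs \<le> 1 / real k + En zs / (t * real N)" by simp
    qed
    also have "\<dots> = (\<Sum>zs\<in>(\<Union>n\<in>{N..<2*N}. T n). (1 / real k + En zs / (t * real N)) * tw (W - {v}) v zs)"
      using finT by (intro sum.UNION_disjoint[symmetric]) (auto simp: T_def)
    also have "\<dots> \<le> (\<Sum>zs\<in>?TL. (1 / real k + En zs / (t * real N)) * tw (W - {v}) v zs)"
      using finTL t Enn twn by (intro sum_mono2) (auto simp: T_def intro!: mult_nonneg_nonneg add_nonneg_nonneg divide_nonneg_nonneg)
    also have "\<dots> = (\<Sum>zs\<in>?TL. tw (W - {v}) v zs) / real k + (\<Sum>zs\<in>?TL. tw (W - {v}) v zs * En zs) / (t * real N)"
      by (simp add: distrib_right distrib_left sum.distrib sum_divide_distrib mult_ac)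
    also have "\<dots> \<le> (B * (real (2 * N) + 1)) / real k + (B * (real (2 * N) + 1) * (B * (B * (real (2 * N) + 1)))) / (t * real N)"
    proof (intro add_mono divide_right_mono sum_tw_any[OF W vI])
      have ins: "insert v (W - {v}) = W" using v by auto
      show "(\<Sum>zs\<in>?TL. tw (W - {v}) v zs * En zs) \<le> B * (real (2 * N) + 1) * (B * (B * (real (2 * N) + 1)))"
        unfolding En_def using sum_tw_energy_le[of v "W - {v}" "2 * N"] W unfolding ins by auto
    qed (use k t in auto)
    \<comment> \<open>The constants 3 and 9 of the recursion come from
      \<open>2 * N + 1 \<le> 3 * N\<close>, used once for the number of paths and twice for the
      energy.\<close>
    also have "\<dots> \<le> (B * (3 * real N)) / real k + (B * (3 * real N) * (B * (B * (3 * real N)))) / (t * real N)"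
      using N B_nonneg t by (intro add_mono divide_right_mono mult_mono mult_nonneg_nonneg) auto
    also have "\<dots> = real N * (3 * B / real k + 9 * B ^ 3 / t)"
      using N t k by (simp add: field_simps power3_eq_cube)
    finally show ?thesis .
  qed
  finally have "real N * ZZ W (\<lambda>f. of_bool (deep f v (4 * N))) \<le> real N * (real k * A * Z W / c) + e * A\<^sup>2 * B * Z W * (real N * (3 * B / real k + 9 * B ^ 3 / t))"
    using e B_nonneg Zp by (simp add: mult_left_mono)
  also have "\<dots> = real N * ((8 * real k * A ^ 4 * t / real N + e * A\<^sup>2 * B * (3 * B / real k + 9 * B ^ 3 / t)) * Z W)"
  proof -
    have "real k * A * Z W / c = 8 * real k * A ^ 4 * t / real N * Z W"
      using N t A_pos by (simp add: c_def field_simps power_numeral_reduce)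
    then show ?thesis by (simp only: distrib_left distrib_right mult_ac)
  qed
  finally show ?thesis using N by simp
qed

end

section \<open>Second moment and lower bound for the levels of the past\<close>

context rev_chain
begin

definition lists_at :: "'a set \<Rightarrow> 'a \<Rightarrow> nat \<Rightarrow> nat set \<Rightarrow> 'a list set" where
  "lists_at W v M L = {zs\<in>TL (W - {v}) M. length zs \<in> L}"

definition past_at :: "('a \<Rightarrow> 'a) \<Rightarrow> 'a \<Rightarrow> nat \<Rightarrow> nat set \<Rightarrow> 'a set" where
  "past_at f v M L = {u\<in>S. \<exists>n\<le>M. n \<in> L \<and> lev f u v n}"

lemma past_at_upto: "past_at f v M L \<subseteq> past_upto f v M"
  by (auto simp: past_at_def past_upto_def)

lemma finite_past: "finite (past_upto f v M)" "finite (past_at f v M L)"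
  using fin_S by (auto simp: past_upto_def past_at_def)

lemma follows_rev_lev:
  assumes "follows f (rev (v # zs))" "distinct (v # zs)"
  shows "lev f (last (v # zs)) v (length zs)" "rev (v # zs) = orb f (last (v # zs)) (Suc (length zs))"
proof -
  let ?u = "last (v # zs)"
  have "?u # tl (rev (v # zs)) = rev (v # zs)"
  proof -
    have "hd (rev (v # zs)) = ?u" by (subst hd_rev) simp
    then show ?thesis by (metis hd_Cons_tl rev_is_Nil_conv list.discI)
  qed
  moreover have "length (tl (rev (v # zs))) = length zs" by simp
  ultimately show o: "rev (v # zs) = orb f ?u (Suc (length zs))"
    using follows_eq_orb[of f ?u "tl (rev (v # zs))"] assms(1) by metis
  have v: "(f ^^ length zs) ?u = v"
  proof -
    have "last (rev (v # zs)) = v" by simp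
    then show ?thesis unfolding o orb_append by simp
  qed
  have "distinct (orb f ?u (Suc (length zs)))" using assms(2) unfolding o[symmetric] by simp
  then have "(f ^^ j) ?u \<noteq> v" if "j < length zs" for j
    using that v unfolding orb_append by (auto simp: orb_def)
  then show "lev f ?u v (length zs)" using v by (simp add: lev_def)
qed

lemma lev_unique: "lev f u v n \<Longrightarrow> lev f u v n' \<Longrightarrow> n = n'"
  unfolding lev_def by (metis nat_neq_iff)

lemma card_past_at:
  assumes W: "W \<subseteq> I" and v: "v \<in> I" and f: "f \<in> forests S W"
  shows "real (card (past_at f v M L)) = (\<Sum>zs\<in>lists_at W v M L. of_bool (follows f (rev (v # zs))))"
proof -
  let ?T = "{zs\<in>lists_at W v M L. follows f (rev (v # zs))}"
  have fin: "finite (lists_at W v M L)" using fin_TL[OF W] by (auto simp: lists_at_def)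
  have d: "distinct (v # zs)" if "zs \<in> lists_at W v M L" for zs using that by (auto simp: lists_at_def TL_def)
  have img: "past_at f v M L = (\<lambda>zs. last (v # zs)) ` ?T"
  proof (intro equalityI subsetI)
    fix u assume "u \<in> past_at f v M L"
    then obtain n where n: "n \<le> M" "n \<in> L" "lev f u v n" by (auto simp: past_at_def)
    note l = lev_orb[OF f n(3)]
    have "rev (orb f u n) \<in> ?T" using l n(1,2) by (auto simp: TL_def lists_at_def)
    then show "u \<in> (\<lambda>zs. last (v # zs)) ` ?T" using l(5) by (metis (mono_tags, lifting) image_eqI)
  next
    fix u assume "u \<in> (\<lambda>zs. last (v # zs)) ` ?T"
    then obtain zs where zs: "zs \<in> lists_at W v M L" "follows f (rev (v # zs))" "u = last (v # zs)" by blast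
    have "lev f u v (length zs)" using follows_rev_lev(1)[OF zs(2) d[OF zs(1)]] zs(3) by simp
    moreover have "length zs \<le> M" "length zs \<in> L" using zs(1) by (auto simp: lists_at_def TL_def)
    moreover have "u \<in> S"
    proof -
      have "u \<in> set (v # zs)" using zs(3) last_in_set[of "v # zs"] by simp
      then show ?thesis using zs(1) W v by (auto simp: lists_at_def TL_def)
    qed
    ultimately show "u \<in> past_at f v M L" by (auto simp: past_at_def)
  qed
  have inj: "inj_on (\<lambda>zs. last (v # zs)) ?T"
  proof (rule inj_onI)
    fix zs zs' assume a: "zs \<in> ?T" "zs' \<in> ?T" and e: "last (v # zs) = last (v # zs')"
    have z: "lev f (last (v # zs)) v (length zs)" "rev (v # zs) = orb f (last (v # zs)) (Suc (length zs))"
      using follows_rev_lev[of f v zs] a d by blast+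
    have z': "lev f (last (v # zs')) v (length zs')" "rev (v # zs') = orb f (last (v # zs')) (Suc (length zs'))"
      using follows_rev_lev[of f v zs'] a d by blast+
    have "length zs = length zs'" using lev_unique[OF z(1)] z'(1) unfolding e by blast
    then have "rev (v # zs) = rev (v # zs')" using z(2) z'(2) e by metis
    then have "v # zs = v # zs'" by (metis rev_rev_ident)
    then show "zs = zs'" by simp
  qed
  have "card (past_at f v M L) = card ?T" unfolding img by (rule card_image[OF inj])
  then show ?thesis using fin by (simp add: of_bool_def sum.If_cases Int_def)
qed

text \<open>A past path of the last vertex of \<open>ys\<close> is followed up to its first meeting
  with \<open>ys\<close>. Until then it uses no arc of the prescribed path: the vertices of
  \<open>ws\<close> come after that last vertex, and passing through one would close a
  cycle.\<close>

lemma past_upto_upd_path: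
  assumes W: "W \<subseteq> I" and xs: "distinct (ys @ ws)" "set (butlast (ys @ ws)) \<subseteq> W" "set (ys @ ws) \<subseteq> S" "last (ys @ ws) \<notin> W"
    and ys: "ys \<noteq> []" and g: "g \<in> forests S (W - set (ys @ ws))"
  shows "past_upto (upd_path g (ys @ ws)) (last ys) M \<subseteq> (\<Union>a\<in>set ys. past_upto g a M)"
proof
  let ?xs = "ys @ ws" and ?v = "last ys"
  let ?f = "upd_path g ?xs"
  have ne: "?xs \<noteq> []" using ys by simp
  have f: "?f \<in> forests S W" by (rule upd_path_forests[OF ne xs(1-3) W xs(4) g])
  fix y assume "y \<in> past_upto ?f ?v M"
  then obtain n where y: "y \<in> S" and n: "n \<le> M" "(?f ^^ n) y = ?v" by (auto simp: past_upto_def lev_def)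
  have ex: "(?f ^^ n) y \<in> set ys" using n ys by simp
  define j where "j = (LEAST j. (?f ^^ j) y \<in> set ys)"
  have j: "(?f ^^ j) y \<in> set ys" unfolding j_def using ex by (rule LeastI)
  have jmin: "(?f ^^ i) y \<notin> set ys" if "i < j" for i using not_less_Least that unfolding j_def by blast
  have jn: "j \<le> n" unfolding j_def using ex by (rule Least_le)
  have off: "(?f ^^ i) y \<notin> set (butlast ?xs)" if i: "i < j" for i
  proof
    let ?a = "(?f ^^ i) y"
    assume "?a \<in> set (butlast ?xs)"
    then have "?a \<in> set ws" using jmin[OF i] in_set_butlastD by fastforce
    moreover have "follows ?f (?v # ws)"
      using follows_upd_path[OF xs(1), of g] follows_append_last[OF ys, of ?f ws] by blast
    then have "?v # ws = orb ?f ?v (Suc (length ws))" by (rule follows_eq_orb)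
    ultimately have "?a \<in> set (orb ?f ?v (Suc (length ws)))" by (metis list.set_intros(2))
    then have "reach ?f ?v ?a" by (auto simp: orb_def reach_def)
    moreover have "reach ?f ?a ?v"
    proof -
      have "(?f ^^ (n - i)) ?a = ?v" using n i jn by (metis funpow_add_apply le_add_diff_inverse2 less_imp_le order_less_le_trans)
      then show ?thesis by (auto simp: reach_def)
    qed
    ultimately have "?a = ?v" using forests_antisym[OF f] by blast
    then show False using jmin[OF i] ys by simp
  qed
  have eq: "(g ^^ i) y = (?f ^^ i) y" if "i \<le> j" for i
    using that
  proof (induction i)
    case (Suc i)
    then show ?case using upd_path_off[OF off[of i], of g] by simp
  qed simp
  have "lev g y ((?f ^^ j) y) j" unfolding lev_def
  proof (intro conjI allI impI)
    show "(g ^^ j) y = (?f ^^ j) y" using eq by simp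
    fix i assume i: "i < j"
    have "(g ^^ i) y = (?f ^^ i) y" using eq i by simp
    then show "(g ^^ i) y \<noteq> (?f ^^ j) y" using jmin[OF i] j by metis
  qed
  then have "y \<in> past_upto g ((?f ^^ j) y) M" unfolding past_upto_def using y n(1) jn by (blast intro: order_trans)
  then show "y \<in> (\<Union>a\<in>set ys. past_upto g a M)" using j by blast
qed

text \<open>One of the two factors is expanded into past paths. Given such a path, the other is at
  most the sum of the pasts of its vertices in a forest where these are roots: at most
  \<open>M + 1\<close> vertices, each with an expected past linear in \<open>M\<close>.\<close>

lemma ZZ_past_square_le:
  assumes W: "W \<subseteq> I" and v: "v \<in> W"
  shows "ZZ W (\<lambda>f. (real (card (past_at f v M L)))\<^sup>2) \<le> A\<^sup>2 * B\<^sup>2 * (real M + 1)\<^sup>2 * ZZ W (\<lambda>f. real (card (past_at f v M L)))"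
proof -
  have vI: "v \<in> I" using v W by auto
  let ?c = "A\<^sup>2 * B\<^sup>2 * (real M + 1)\<^sup>2"
  have "ZZ W (\<lambda>f. (real (card (past_at f v M L)))\<^sup>2) \<le> ZZ W (\<lambda>f. (\<Sum>zs\<in>lists_at W v M L. of_bool (follows f (rev (v # zs)))) * real (card (past_upto f v M)))"
  proof (rule ZZ_mono)
    fix f assume f: "f \<in> forests S W"
    have "card (past_at f v M L) \<le> card (past_upto f v M)" by (intro card_mono finite_past past_at_upto)
    then show "(real (card (past_at f v M L)))\<^sup>2 \<le> (\<Sum>zs\<in>lists_at W v M L. of_bool (follows f (rev (v # zs)))) * real (card (past_upto f v M))"
      unfolding card_past_at[OF W vI f, symmetric] power2_eq_square by (intro mult_left_mono) auto
  qed
  also have "\<dots> = (\<Sum>zs\<in>lists_at W v M L. ZZ W (\<lambda>f. of_bool (follows f (rev (v # zs))) * real (card (past_upto f v M))))"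
    by (simp only: sum_distrib_right ZZ_sum)
  also have "\<dots> \<le> (\<Sum>zs\<in>lists_at W v M L. ?c * ZZ W (\<lambda>f. of_bool (follows f (rev (v # zs)))))"
  proof (rule sum_mono)
    fix zs assume zsL: "zs \<in> lists_at W v M L"
    then have zs: "zs \<in> TL (W - {v}) M" by (simp add: lists_at_def)
    note t = TL_props[OF W vI zs]
    let ?ys = "rev (v # zs)"
    have cys: "card (set ?ys) \<le> M + 1"
    proof -
      have "card (set ?ys) \<le> length ?ys" by (rule card_length)
      also have "\<dots> \<le> M + 1" using zs by (simp add: TL_def)
      finally show ?thesis .
    qed
    show "ZZ W (\<lambda>f. of_bool (follows f ?ys) * real (card (past_upto f v M))) \<le> ?c * ZZ W (\<lambda>f. of_bool (follows f ?ys))"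
    proof (rule ZZ_markov[OF t(1-4) W])
      fix ws assume w: "distinct (?ys @ ws)" "set (butlast (?ys @ ws)) \<subseteq> W" "set (?ys @ ws) \<subseteq> S" "last (?ys @ ws) \<notin> W"
      let ?W = "W - set (?ys @ ws)"
      have W': "?W \<subseteq> I" using W by auto
      have "ZZ ?W (\<lambda>g. real (card (past_upto (upd_path g (?ys @ ws)) v M))) \<le> ZZ ?W (\<lambda>g. \<Sum>a\<in>set ?ys. real (card (past_upto g a M)))"
      proof (rule ZZ_mono)
        fix g assume g: "g \<in> forests S ?W"
        have "past_upto (upd_path g (?ys @ ws)) v M \<subseteq> (\<Union>a\<in>set ?ys. past_upto g a M)"
          using past_upto_upd_path[OF W w t(1) g] unfolding t(8) .
        then have "card (past_upto (upd_path g (?ys @ ws)) v M) \<le> card (\<Union>a\<in>set ?ys. past_upto g a M)"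
          by (intro card_mono finite_UN_I finite_past) auto
        also have "\<dots> \<le> (\<Sum>a\<in>set ?ys. card (past_upto g a M))" by (intro card_UN_le) auto
        finally show "real (card (past_upto (upd_path g (?ys @ ws)) v M)) \<le> (\<Sum>a\<in>set ?ys. real (card (past_upto g a M)))"
          unfolding of_nat_sum[symmetric] of_nat_le_iff .
      qed
      also have "\<dots> = (\<Sum>a\<in>set ?ys. ZZ ?W (\<lambda>g. real (card (past_upto g a M))))" by (rule ZZ_sum)
      also have "\<dots> \<le> (\<Sum>a\<in>set ?ys. A\<^sup>2 * B\<^sup>2 * (real M + 1) * Z ?W)"
        using t(6) by (intro sum_mono ZZ_past_upto_le[OF W']) auto
      also have "\<dots> = real (card (set ?ys)) * (A\<^sup>2 * B\<^sup>2 * (real M + 1) * Z ?W)" by simp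
      also have "\<dots> \<le> (real M + 1) * (A\<^sup>2 * B\<^sup>2 * (real M + 1) * Z ?W)"
        using cys Z_pos[OF W'] by (intro mult_right_mono mult_nonneg_nonneg) (auto simp del: of_nat_Suc)
      also have "\<dots> = ?c * Z ?W" by (simp add: power2_eq_square)
      finally show "ZZ ?W (\<lambda>g. real (card (past_upto (upd_path g (?ys @ ws)) v M))) \<le> ?c * Z ?W" .
    qed
  qed
  also have "\<dots> = ?c * ZZ W (\<lambda>f. \<Sum>zs\<in>lists_at W v M L. of_bool (follows f (rev (v # zs))))"
    by (simp only: sum_distrib_left[symmetric] ZZ_sum)
  also have "ZZ W (\<lambda>f. \<Sum>zs\<in>lists_at W v M L. of_bool (follows f (rev (v # zs)))) = ZZ W (\<lambda>f. real (card (past_at f v M L)))"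
    by (rule ZZ_cong) (simp only: card_past_at[OF W vI])
  finally show ?thesis .
qed

text \<open>Read forwards, the list \<open>v # zs\<close> has as its probability a path weight times
  the escape probability at its end, which is at most 1; read backwards, the reversed path weight
  times the escape probability at \<open>v\<close>. So a past path is at least as likely, up to
  \<open>A\<^sup>2\<close>, as the same future path times the escape probability of \<open>v\<close>
  from it, which is no smaller than that from the whole future.\<close>

lemma ZZ_level_ge:
  assumes W: "W \<subseteq> I" and v: "v \<in> W" and L: "j \<le> M" "j \<in> L"
  shows "ZZ W (\<lambda>f. esc W ({a. reach f v a} \<inter> W) v) - ZZ W (\<lambda>f. of_bool ((f ^^ j) v \<notin> W))
     \<le> A\<^sup>2 * (\<Sum>zs\<in>lists_at W v M {j}. ZZ W (\<lambda>f. of_bool (follows f (rev (v # zs)))))"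
proof -
  have vI: "v \<in> I" using v W by auto
  let ?T = "lists_at W v M {j}"
  let ?e = "\<lambda>f. esc W ({a. reach f v a} \<inter> W) v"
  let ?k = "\<lambda>zs. esc W (set (v # zs)) v"
  have finT: "finite ?T" using fin_TL[OF W] by (auto simp: lists_at_def)
  have kn: "0 \<le> ?k zs" for zs by (rule esc_nonneg[OF W vI])
  have "ZZ W ?e \<le> ZZ W (\<lambda>f. (\<Sum>zs\<in>?T. of_bool (follows f (v # zs)) * ?k zs) + of_bool ((f ^^ j) v \<notin> W))"
  proof (rule ZZ_mono)
    fix f assume f: "f \<in> forests S W"
    have nn: "0 \<le> (\<Sum>zs\<in>?T. of_bool (follows f (v # zs)) * ?k zs)" using kn by (intro sum_nonneg) auto
    show "?e f \<le> (\<Sum>zs\<in>?T. of_bool (follows f (v # zs)) * ?k zs) + of_bool ((f ^^ j) v \<notin> W)"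
    proof (cases "(f ^^ j) v \<in> W")
      case False
      then show ?thesis using esc_le_1[OF W, of "{a. reach f v a} \<inter> W" v] nn by simp
    next
      case True
      have inW: "(f ^^ i) v \<in> W" if "i \<le> j" for i
      proof (rule ccontr)
        assume "(f ^^ i) v \<notin> W"
        then have "(f ^^ j) v = (f ^^ i) v" by (rule forests_stay[OF f _ that])
        then show False using True \<open>(f ^^ i) v \<notin> W\<close> by simp
      qed
      define zs where "zs = orb f (f v) j"
      have o: "v # zs = orb f v (Suc j)" by (simp add: zs_def orb_Suc)
      have d: "distinct (v # zs)" unfolding o using inW by (intro orb_distinct[OF f]) auto
      have s: "set (v # zs) \<subseteq> {a. reach f v a} \<inter> W" unfolding o using inW by (auto simp: orb_def reach_def)
      have zT: "zs \<in> ?T" using d s L by (auto simp: lists_at_def TL_def zs_def)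
      have fo: "follows f (v # zs)" unfolding o by (rule follows_orb)
      have "?e f \<le> ?k zs" by (rule esc_antimono[OF W s]) auto
      also have "\<dots> = of_bool (follows f (v # zs)) * ?k zs" using fo by simp
      also have "\<dots> \<le> (\<Sum>zs\<in>?T. of_bool (follows f (v # zs)) * ?k zs)"
        using finT zT kn by (intro member_le_sum) auto
      finally show ?thesis by simp
    qed
  qed
  also have "\<dots> = (\<Sum>zs\<in>?T. ?k zs * ZZ W (\<lambda>f. of_bool (follows f (v # zs)))) + ZZ W (\<lambda>f. of_bool ((f ^^ j) v \<notin> W))"
    by (simp only: ZZ_add ZZ_sum ZZ_cmult[symmetric] mult.commute)
  also have "(\<Sum>zs\<in>?T. ?k zs * ZZ W (\<lambda>f. of_bool (follows f (v # zs)))) \<le> (\<Sum>zs\<in>?T. A\<^sup>2 * ZZ W (\<lambda>f. of_bool (follows f (rev (v # zs)))))"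
  proof (rule sum_mono)
    fix zs assume "zs \<in> ?T"
    then have zs: "zs \<in> TL (W - {v}) M" by (simp add: lists_at_def)
    note t = TL_props[OF W vI zs]
    have sW: "set (v # zs) \<subseteq> W" using zs v by (auto simp: TL_def)
    have d: "distinct (v # zs)" using zs by (auto simp: TL_def)
    have Zp: "0 \<le> Z (W - set (v # zs))" using Z_pos[of "W - set (v # zs)"] W by auto
    have h: "hd (v # zs) \<in> I" "last (v # zs) \<in> I" using t(5,6) last_in_set[OF t(5)] vI by auto
    have fw: "ZZ W (\<lambda>f. of_bool (follows f (v # zs))) \<le> pp P (v # zs) * Z (W - set (v # zs))"
    proof -
      have "ZZ W (\<lambda>f. of_bool (follows f (v # zs))) = pp P (v # zs) * (Z (W - set (v # zs)) * esc W (set (v # zs)) (last (v # zs)))"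
        by (rule ZZ_follows_esc[OF t(5) d sW W])
      also have "\<dots> \<le> pp P (v # zs) * (Z (W - set (v # zs)) * 1)"
        using Zp by (intro mult_left_mono pp_nonneg esc_le_1[OF W])
      finally show ?thesis by simp
    qed
    have bw: "ZZ W (\<lambda>f. of_bool (follows f (rev (v # zs)))) = pp P (rev (v # zs)) * (Z (W - set (v # zs)) * ?k zs)"
      using ZZ_follows_esc[OF t(1,2) _ W] sW by (simp only: set_rev t(8))
    have pr: "pp P (v # zs) \<le> A\<^sup>2 * pp P (rev (v # zs))"
    proof -
      have "pp P (v # zs) = m (last (v # zs)) / m (hd (v # zs)) * pp P (rev (v # zs))"
        using pp_rev[OF t(5,6)] m_pos[OF h(1)] by (simp add: field_simps)
      also have "\<dots> \<le> A\<^sup>2 * pp P (rev (v # zs))" by (intro mult_right_mono m_ratio h pp_nonneg)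
      finally show ?thesis .
    qed
    have "?k zs * ZZ W (\<lambda>f. of_bool (follows f (v # zs))) \<le> ?k zs * (pp P (v # zs) * Z (W - set (v # zs)))"
      by (rule mult_left_mono[OF fw kn])
    also have "\<dots> \<le> ?k zs * ((A\<^sup>2 * pp P (rev (v # zs))) * Z (W - set (v # zs)))"
      by (intro mult_left_mono mult_right_mono pr kn Zp)
    also have "\<dots> = A\<^sup>2 * ZZ W (\<lambda>f. of_bool (follows f (rev (v # zs))))" unfolding bw by (simp only: mult_ac)
    finally show "?k zs * ZZ W (\<lambda>f. of_bool (follows f (v # zs))) \<le> A\<^sup>2 * ZZ W (\<lambda>f. of_bool (follows f (rev (v # zs))))" .
  qed
  finally show ?thesis by (simp add: sum_distrib_left)
qed

end

context chain
begin

section \<open>Comparison of the forest path with the random walk\<close>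

primrec exit_by :: "'a set \<Rightarrow> nat \<Rightarrow> 'a \<Rightarrow> real" where
  "exit_by W 0 x = of_bool (x \<notin> W)"
| "exit_by W (Suc j) x = (if x \<in> W then \<Sum>y\<in>S. P x y * exit_by W j y else 1)"

lemma exit_by_nonneg: "0 \<le> exit_by W j x"
  by (induction j arbitrary: x) (auto intro!: sum_nonneg mult_nonneg_nonneg P_nonneg)

lemma exit_by_out: "x \<notin> W \<Longrightarrow> exit_by W j x = 1"
  by (cases j) auto

text \<open>Each step of the forest path costs at most a factor \<open>B\<close> more than a step of
  the walk, by \<open>Z_remove_le\<close>. In the induction \<open>W\<close> shrinks while the exit
  set stays fixed. The exponential factor does no harm, since \<open>j\<close> is fixed before the
  domain is enlarged.\<close>

lemma ZZ_exit_le: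
  assumes W: "W \<subseteq> V" and V: "V \<subseteq> I" and x: "x \<in> S" and B1: "1 \<le> B"
  shows "ZZ W (\<lambda>f. of_bool ((f ^^ j) x \<notin> V)) \<le> B ^ j * exit_by V j x * Z W"
  using W x
proof (induction j arbitrary: W x)
  case 0
  then show ?case using ZZ_const[of W "of_bool (x \<notin> V)"] by simp
next
  case (Suc j)
  have WI: "W \<subseteq> I" using Suc.prems V by auto
  have Zp: "0 < Z W" by (rule Z_pos[OF WI])
  have Bp: "1 \<le> B ^ n" for n by (rule one_le_power[OF B1])
  consider "x \<in> W" | "x \<in> V" "x \<notin> W" | "x \<notin> V" by auto
  then show ?case
  proof cases
    case 1
    let ?W = "W - {x}"
    have "ZZ W (\<lambda>f. of_bool ((f ^^ Suc j) x \<notin> V)) = (\<Sum>y\<in>S. P x y * ZZ ?W (\<lambda>g. of_bool (\<not> reach g y x) * of_bool (((g(x := y)) ^^ Suc j) x \<notin> V)))"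
      by (rule Z_split[OF WI 1])
    also have "\<dots> \<le> (\<Sum>y\<in>S. P x y * (B ^ j * exit_by V j y * Z ?W))"
    proof (intro sum_mono mult_left_mono P_nonneg)
      fix y assume y: "y \<in> S"
      have "ZZ ?W (\<lambda>g. of_bool (\<not> reach g y x) * of_bool (((g(x := y)) ^^ Suc j) x \<notin> V)) \<le> ZZ ?W (\<lambda>g. of_bool ((g ^^ j) y \<notin> V))"
      proof (rule ZZ_mono)
        fix g
        have "((g(x := y)) ^^ Suc j) x = (g ^^ j) y" if "\<not> reach g y x"
          using funpow_upd_not_reach[OF that, of j y] by (simp add: funpow_swap1)
        then show "of_bool (\<not> reach g y x) * of_bool (((g(x := y)) ^^ Suc j) x \<notin> V) \<le> (of_bool ((g ^^ j) y \<notin> V) :: real)"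
          by (cases "reach g y x") auto
      qed
      also have "\<dots> \<le> B ^ j * exit_by V j y * Z ?W" using Suc.prems y by (intro Suc.IH) auto
      finally show "ZZ ?W (\<lambda>g. of_bool (\<not> reach g y x) * of_bool (((g(x := y)) ^^ Suc j) x \<notin> V)) \<le> B ^ j * exit_by V j y * Z ?W" .
    qed
    also have "\<dots> = B ^ j * exit_by V (Suc j) x * Z ?W"
      using 1 Suc.prems by (simp add: sum_distrib_left sum_distrib_right mult_ac subset_iff)
    also have "\<dots> \<le> B ^ j * exit_by V (Suc j) x * (B * Z W)"
      using B1 exit_by_nonneg by (intro mult_left_mono Z_remove_le[OF WI 1] mult_nonneg_nonneg) (auto simp del: exit_by.simps)
    finally show ?thesis by (simp add: mult_ac)
  next
    case 2
    have "ZZ W (\<lambda>f. of_bool ((f ^^ Suc j) x \<notin> V)) = ZZ W (\<lambda>f. 0)"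
    proof (rule ZZ_cong)
      fix f assume "f \<in> forests S W"
      then have "(f ^^ Suc j) x = x" using 2 by (intro funpow_fixed forests_out)
      then show "of_bool ((f ^^ Suc j) x \<notin> V) = (0::real)" using 2 by (simp del: funpow.simps)
    qed
    also have "\<dots> = 0" by (simp add: ZZ_def)
    also have "0 \<le> B ^ Suc j * exit_by V (Suc j) x * Z W"
      using B1 exit_by_nonneg Zp by (intro mult_nonneg_nonneg) (auto simp del: exit_by.simps)
    finally show ?thesis .
  next
    case 3
    have "ZZ W (\<lambda>f. of_bool ((f ^^ Suc j) x \<notin> V)) \<le> 1 * 1 * Z W"
      using ZZ_mono[of W "\<lambda>f. of_bool ((f ^^ Suc j) x \<notin> V)" "\<lambda>_. 1"] by simp
    also have "\<dots> \<le> B ^ Suc j * exit_by V (Suc j) x * Z W"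
      using Bp[of "Suc j"] Zp exit_by_out[OF 3, of "Suc j"] by (intro mult_right_mono) (auto simp del: exit_by.simps)
    finally show ?thesis .
  qed
qed

text \<open>Expectation of \<open>a\<close> at the union of \<open>C\<close> with the set of
  vertices visited before leaving \<open>W\<close>, counted only if the walk leaves within
  \<open>k\<close> steps. The set \<open>C\<close> accumulates the range.\<close>

primrec range_val :: "('a set \<Rightarrow> real) \<Rightarrow> 'a set \<Rightarrow> nat \<Rightarrow> 'a \<Rightarrow> 'a set \<Rightarrow> real" where
  "range_val a W 0 x C = (if x \<in> W then 0 else a C)"
| "range_val a W (Suc k) x C = (if x \<in> W then \<Sum>z\<in>S. P x z * range_val a W k z (insert x C) else a C)"

text \<open>
  By Wilson's algorithm the forest path from \<open>x\<close> is a loop erasure of the random walk, so that its vertices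
  form a subset of the range of the walk.
\<close>

lemma range_val_le:
  assumes W: "W \<subseteq> I" and nn: "\<And>C. 0 \<le> a C" and anti: "\<And>C C'. C \<subseteq> C' \<Longrightarrow> C' \<subseteq> W \<Longrightarrow> a C' \<le> a C"
    and x: "x \<in> S" and C: "C \<subseteq> W"
  shows "range_val a W k x C * Z W \<le> ZZ W (\<lambda>f. a (C \<union> ({y. reach f x y} \<inter> W)))"
  using x C
proof (induction k arbitrary: x C)
  case (Suc k)
  show ?case
  proof (cases "x \<in> W")
    case True
    let ?\<Psi> = "\<lambda>f z. a (insert x C \<union> ({y. reach f z y} \<inter> W))"
    let ?\<psi> = "\<lambda>g z. a (insert x C \<union> ({y. reach g z y} \<inter> W))"
    have xr: "{w. reach (g(x := y)) x w} = insert x {w. reach g y w}" if "\<not> reach g y x" for g y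
      using reach_cases[of "g(x := y)" x] reach_upd_not_reach[OF that] by auto
    have "range_val a W (Suc k) x C * Z W = (\<Sum>z\<in>S. P x z * (range_val a W k z (insert x C) * Z W))"
      using True by (simp add: sum_distrib_right mult.assoc)
    also have "\<dots> \<le> (\<Sum>z\<in>S. P x z * ZZ W (\<lambda>f. ?\<Psi> f z))"
      using True Suc.prems by (intro sum_mono mult_left_mono P_nonneg Suc.IH) auto
    also have "\<dots> \<le> ZZ W (\<lambda>f. ?\<Psi> f x)"
    proof (rule ZZ_superharmonic[OF W True, where \<psi> = ?\<psi>])
      fix g y assume a: "\<not> reach g y x"
      show "?\<Psi> (g(x := y)) x = ?\<psi> g y" unfolding xr[OF a] by (intro arg_cong[where f = a]) auto
    next
      fix g y z assume "\<not> reach g z x"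
      then show "?\<Psi> (g(x := y)) z = ?\<psi> g z" by (simp add: reach_upd_not_reach)
    next
      fix g y z assume a: "\<not> reach g y x" "reach g z x"
      have "reach (g(x := y)) z w" if "reach g y w" for w
      proof -
        have "reach (g(x := y)) z x" using a(2) by (simp add: reach_upd_iff)
        moreover have "reach (g(x := y)) x w" using xr[OF a(1)] that by auto
        ultimately show ?thesis by (rule reach_trans)
      qed
      then show "?\<Psi> (g(x := y)) z \<le> ?\<psi> g y" using Suc.prems True by (intro anti) auto
    qed
    also have "\<dots> = ZZ W (\<lambda>f. a (C \<union> ({y. reach f x y} \<inter> W)))"
      using True by (intro ZZ_cong arg_cong[where f = a]) auto
    finally show ?thesis .
  next
    case False
    have "ZZ W (\<lambda>f. a (C \<union> ({y. reach f x y} \<inter> W))) = ZZ W (\<lambda>f. a C)"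
    proof (rule ZZ_cong)
      fix f assume "f \<in> forests S W"
      then have "f x = x" using False by (intro forests_out)
      then show "a (C \<union> ({y. reach f x y} \<inter> W)) = a C" using False reach_fixed[of f x] by (intro arg_cong[where f = a]) auto
    qed
    then show ?thesis using False ZZ_const[of W "a C"] by simp
  qed
next
  case 0
  show ?case
  proof (cases "x \<in> W")
    case False
    have "ZZ W (\<lambda>f. a (C \<union> ({y. reach f x y} \<inter> W))) = ZZ W (\<lambda>f. a C)"
    proof (rule ZZ_cong)
      fix f assume "f \<in> forests S W"
      then have "f x = x" using False by (intro forests_out)
      then show "a (C \<union> ({y. reach f x y} \<inter> W)) = a C" using False reach_fixed[of f x] by (intro arg_cong[where f = a]) auto
    qed
    then show ?thesis using False ZZ_const[of W "a C"] by simp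
  qed (use nn in \<open>auto intro: ZZ_nonneg\<close>)
qed

text \<open>Probability of leaving \<open>W\<close> within \<open>k\<close> steps without visiting
  \<open>C\<close>.\<close>

primrec avoid :: "'a set \<Rightarrow> nat \<Rightarrow> 'a \<Rightarrow> 'a set \<Rightarrow> real" where
  "avoid W 0 x C = of_bool (x \<notin> W \<and> x \<notin> C)"
| "avoid W (Suc k) x C = (if x \<in> C then 0 else if x \<notin> W then 1 else \<Sum>z\<in>S. P x z * avoid W k z C)"

lemma avoid_le: 
  assumes W: "W \<subseteq> I" and x: "x \<in> S"
  shows "avoid W k x C \<le> 1 - hit W C x"
  using x
proof (induction k arbitrary: x)
  case 0
  then show ?case using hit_le_1[OF W, of C x] hit_out[of x W C] by (cases "x \<notin> W \<and> x \<notin> C") auto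
next
  case (Suc k)
  consider "x \<in> C" | "x \<notin> C" "x \<notin> W" | "x \<notin> C" "x \<in> W" by auto
  then show ?case
  proof cases
    case 3
    have "avoid W (Suc k) x C = (\<Sum>z\<in>S. P x z * avoid W k z C)" using 3 by simp
    also have "\<dots> \<le> (\<Sum>z\<in>S. P x z * (1 - hit W C z))" by (intro sum_mono mult_left_mono P_nonneg Suc.IH)
    also have "\<dots> = 1 - hit W C x"
      using hit_harmonic[OF W 3(2,1)] row[of x] 3 W by (auto simp: right_diff_distrib sum_subtractf)
    finally show ?thesis .
  qed (use Suc.prems hit_in[OF W] hit_out[of x W C] hit_le_1[OF W, of C x] in auto)
qed

lemma avoid_nonneg: "0 \<le> avoid W k x C"
  by (induction k arbitrary: x) (auto intro!: sum_nonneg mult_nonneg_nonneg P_nonneg)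

lemma avoid_antimono: "C \<subseteq> C' \<Longrightarrow> avoid W k x C' \<le> avoid W k x C"
  by (induction k arbitrary: x) (auto intro!: sum_mono sum_nonneg mult_left_mono mult_nonneg_nonneg P_nonneg avoid_nonneg)

lemma avoid_le_esc:
  assumes W: "W \<subseteq> I" and v: "v \<in> W"
  shows "(\<Sum>z\<in>S. P v z * avoid W k z C) \<le> esc W C v"
proof -
  have "(\<Sum>z\<in>S. P v z * avoid W k z C) \<le> (\<Sum>z\<in>S. P v z * (1 - hit W C z))"
    by (intro sum_mono mult_left_mono P_nonneg avoid_le W)
  also have "\<dots> = esc W C v" using row[of v] v W by (auto simp: esc_def right_diff_distrib sum_subtractf)
  finally show ?thesis .
qed

text \<open>The range of the first walk serves as the obstacle for the second. The future of
  \<open>v\<close> is stochastically smaller than this range, and avoiding a smaller set is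
  easier.\<close>

lemma two_walks_le_esc:
  assumes W: "W \<subseteq> I" and v: "v \<in> W"
  shows "range_val (\<lambda>C. \<Sum>z\<in>S. P v z * avoid W k z C) W l v {} * Z W \<le> ZZ W (\<lambda>f. esc W ({a. reach f v a} \<inter> W) v)"
proof -
  let ?a = "\<lambda>C. \<Sum>z\<in>S. P v z * avoid W k z C"
  have "range_val ?a W l v {} * Z W \<le> ZZ W (\<lambda>f. ?a ({} \<union> ({y. reach f v y} \<inter> W)))"
    by (rule range_val_le[OF W]) (use v W in \<open>auto intro!: sum_nonneg sum_mono mult_nonneg_nonneg mult_left_mono P_nonneg avoid_nonneg avoid_antimono\<close>)
  also have "\<dots> \<le> ZZ W (\<lambda>f. esc W ({a. reach f v a} \<inter> W) v)"
    using avoid_le_esc[OF W v] by (intro ZZ_mono) auto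
  finally show ?thesis .
qed

end

section \<open>Depth and volume of the past in networks with killing\<close>

lemma deep_antimono:
  assumes "deep f v N" "N' \<le> N"
  shows "deep f v N'"
proof -
  obtain y where y: "(f ^^ N) y = v" "\<forall>j<N. (f ^^ j) y \<noteq> v" using assms by (auto simp: deep_def)
  have e: "(f ^^ j) ((f ^^ (N - N')) y) = (f ^^ (j + (N - N'))) y" for j by (simp add: funpow_add_apply)
  show ?thesis unfolding deep_def
    by (rule exI[of _ "(f ^^ (N - N')) y"]) (use y assms(2) in \<open>auto simp: e\<close>)
qed

text \<open>
  \<open>thin p D h\<close> is the walk \<open>p\<close> that survives at \<open>x\<close> with probability \<open>h x\<close> and is killed (sent to the
  root \<open>None\<close>) on leaving \<open>D\<close>.
\<close>

fun thin :: "('v \<Rightarrow> 'v \<Rightarrow> real) \<Rightarrow> 'v set \<Rightarrow> ('v \<Rightarrow> real) \<Rightarrow> 'v option \<Rightarrow> 'v option \<Rightarrow> real" where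
  "thin p D h (Some x) (Some y) = h x * p x y"
| "thin p D h (Some x) None = (if x \<in> D then 1 - h x * (\<Sum>y\<in>D. p x y) else 0)"
| "thin p D h None _ = 0"

definition states :: "'v set \<Rightarrow> 'v option set" where
  "states D = insert None (Some ` D)"

section \<open>Walks with killing that share one bubble bound\<close>

locale base_walk =
  fixes V :: "'v set" and p :: "'v \<Rightarrow> 'v \<Rightarrow> real" and mm :: "'v \<Rightarrow> real" and b :: "nat \<Rightarrow> real" and A :: real
  assumes p_nonneg: "\<And>x y. 0 \<le> p x y"
    and p_sub: "\<And>D x. finite D \<Longrightarrow> D \<subseteq> V \<Longrightarrow> x \<in> V \<Longrightarrow> (\<Sum>y\<in>D. p x y) \<le> 1"
    and p_rev: "\<And>x y. x \<in> V \<Longrightarrow> y \<in> V \<Longrightarrow> mm x * p x y = mm y * p y x"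
    and mm_lower: "\<And>x. x \<in> V \<Longrightarrow> inverse A \<le> mm x" and mm_upper: "\<And>x. x \<in> V \<Longrightarrow> mm x \<le> A" and A_positive: "0 < A"
    and pw_bound: "\<And>D n x y. finite D \<Longrightarrow> D \<subseteq> V \<Longrightarrow> pw p D n x y \<le> b n"
    and b_summable': "summable (\<lambda>n. (real n + 1) * b n)"
begin

text \<open>Dividing the reversing measure by \<open>h\<close> compensates the thinning, and
  \<open>h\<close> between 1/2 and 1 only turns \<open>A\<close> into \<open>2 * A\<close>.
  Transition weights inside the domain do not increase, so \<open>b\<close> serves every
  \<open>h\<close>.\<close>

lemma thin_chain:
  assumes D: "finite D" "D \<subseteq> V" and h: "\<And>x. 1/2 \<le> h x" "\<And>x. h x \<le> 1"
  shows "rev_chain (states D) None (thin p D h) b (\<lambda>x. case x of None \<Rightarrow> 1 | Some x \<Rightarrow> mm x / h x) (2 * A)"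
proof unfold_locales
  have I: "states D - {None} = Some ` D" by (auto simp: states_def)
  have hn: "0 \<le> h x" for x using h(1)[of x] by simp
  have hs: "h x * (\<Sum>y\<in>D. p x y) \<le> 1" if "x \<in> V" for x
  proof -
    have "h x * (\<Sum>y\<in>D. p x y) \<le> 1 * 1"
      using p_sub[OF D that] h hn p_nonneg by (intro mult_mono sum_nonneg) auto
    then show ?thesis by simp
  qed
  show "finite (states D)" "None \<in> states D" using D by (auto simp: states_def)
  show nn: "0 \<le> thin p D h x y" for x y
    by (cases "(p, D, h, x, y)" rule: thin.cases) (use hs D hn p_nonneg in auto)
  show "(\<Sum>y\<in>states D. thin p D h x y) = 1" if xD: "x \<in> states D" "x \<noteq> None" for x
  proof -
    obtain x' where x': "x = Some x'" "x' \<in> D" using xD by (auto simp: states_def)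
    have "(\<Sum>y\<in>states D. thin p D h x y) = thin p D h x None + (\<Sum>y\<in>Some ` D. thin p D h x y)"
      unfolding states_def using D by (subst sum.insert) auto
    also have "(\<Sum>y\<in>Some ` D. thin p D h x y) = h x' * (\<Sum>y\<in>D. p x' y)"
      by (subst sum.reindex) (auto simp: x' sum_distrib_left)
    finally show ?thesis using x' by simp
  qed
  have pwle: "pw (thin p D h) (Some ` D) n (Some x) (Some y) \<le> pw p D n x y" for n x y
  proof (induction n arbitrary: x)
    case (Suc n)
    show ?case
    proof (cases "x \<in> D")
      case True
      have "(\<Sum>z\<in>Some ` D. thin p D h (Some x) z * pw (thin p D h) (Some ` D) n z (Some y))
          = (\<Sum>z\<in>D. h x * p x z * pw (thin p D h) (Some ` D) n (Some z) (Some y))"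
        by (subst sum.reindex) auto
      also have "\<dots> \<le> (\<Sum>z\<in>D. 1 * p x z * pw p D n z y)"
      proof (intro sum_mono mult_mono Suc.IH)
        fix z
        show "0 \<le> pw (thin p D h) (Some ` D) n (Some z) (Some y)"
        proof -
          have "0 \<le> pw (thin p D h) (Some ` D) n w (Some y)" for w
            by (induction n arbitrary: w) (auto intro!: sum_nonneg mult_nonneg_nonneg nn)
          then show ?thesis .
        qed
      qed (use h p_nonneg in auto)
      finally show ?thesis using True by auto
    qed auto
  qed auto
  have bn: "0 \<le> b n" for n
  proof -
    have "pw p {} n x y = 0" for x y by (cases n) auto
    then show ?thesis using pw_bound[of "{}" n] by simp
  qed
  show "pw (thin p D h) (states D - {None}) n x y \<le> b n" for n x y
  proof -
    have o1: "pw P W n x y = 0" if "x \<notin> W" for P :: "'v option \<Rightarrow> 'v option \<Rightarrow> real" and W x y using that by (cases n) auto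
    have o2: "pw P W n x y = 0" if "y \<notin> W" for P :: "'v option \<Rightarrow> 'v option \<Rightarrow> real" and W x y
      using that by (induction n arbitrary: x) auto
    show ?thesis
    proof (cases "x \<in> Some ` D \<and> y \<in> Some ` D")
      case True
      then obtain x' y' where "x = Some x'" "y = Some y'" by auto
      then show ?thesis unfolding I using pwle[of n x' y'] pw_bound[OF D, of n x' y'] by simp
    next
      case False
      then show ?thesis unfolding I using o1[of x "Some ` D"] o2[of y "Some ` D"] bn by auto
    qed
  qed
  show "summable (\<lambda>n. (real n + 1) * b n)" by (rule b_summable')
  fix x assume x: "x \<in> states D - {None}"
  then obtain x' where x': "x = Some x'" "x' \<in> D" "x' \<in> V" unfolding I using D by auto
  have mp: "0 < mm x'" using mm_lower[OF x'(3)] A_positive by (meson less_le_trans positive_imp_inverse_positive)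
  have hp: "0 < h x'" using h(1)[of x'] by simp
  show "inverse (2 * A) \<le> (case x of None \<Rightarrow> 1 | Some x \<Rightarrow> mm x / h x)"
  proof -
    have "inverse (2 * A) \<le> inverse A" using A_positive by (simp add: field_simps)
    also have "\<dots> \<le> mm x'" by (rule mm_lower[OF x'(3)])
    also have "\<dots> \<le> mm x' / h x'" using h(2)[of x'] mp hp by (simp add: le_divide_eq mult_left_le)
    finally show ?thesis using x' by simp
  qed
  show "(case x of None \<Rightarrow> 1 | Some x \<Rightarrow> mm x / h x) \<le> 2 * A"
  proof -
    have "mm x' / h x' \<le> A / (1/2)" using mm_upper[OF x'(3)] mp h(1)[of x'] A_positive by (intro frac_le) auto
    then show ?thesis using x' by simp
  qed
next
  fix x y assume "x \<in> states D - {None}" "y \<in> states D - {None}"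
  then obtain x' y' where x: "x = Some x'" "x' \<in> V" "y = Some y'" "y' \<in> V" using D by (auto simp: states_def)
  have "0 < h x'" "0 < h y'" using h(1)[of x'] h(1)[of y'] by auto
  then show "(case x of None \<Rightarrow> 1 | Some x \<Rightarrow> mm x / h x) * thin p D h x y = (case y of None \<Rightarrow> 1 | Some x \<Rightarrow> mm x / h x) * thin p D h y x"
    using p_rev[OF x(2,4)] x by simp
next
  show "0 < 2 * A" using A_positive by simp
qed

definition ZD :: "'v set \<Rightarrow> ('v \<Rightarrow> real) \<Rightarrow> 'v option set \<Rightarrow> (('v option \<Rightarrow> 'v option) \<Rightarrow> real) \<Rightarrow> real" where
  "ZD D h = chain.ZZ (states D) (thin p D h)"

definition BB :: real where "BB = (\<Sum>n. (real n + 1) * b n)"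

lemma states_I: "states D - {None} = Some ` D"
  by (auto simp: states_def)

text \<open>Induction on \<open>k\<close>, uniformly over domains and over all killing functions
  \<open>h\<close>. This class is closed under raising the killing of one vertex to 1/2, which is
  how the bound for roots demanded by \<open>deep_recursion\<close> is obtained.\<close>

lemma deep_pow4:
  "\<exists>C\<ge>1. \<forall>k D h W v. finite D \<longrightarrow> D \<subseteq> V \<longrightarrow> (\<forall>x. 1/2 \<le> h x \<and> h x \<le> 1) \<longrightarrow> W \<subseteq> Some ` D \<longrightarrow> v \<in> W \<longrightarrow>
     ZD D h W (\<lambda>f. of_bool (deep f v (4 ^ k))) \<le> C / 4 ^ k * ZD D h W (\<lambda>_. 1)"
proof -
  define A' where "A' = 2 * A"
  \<comment> \<open>\<open>k0\<close> and \<open>t\<close> make each of the two error terms at most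
    1/32, with 96 = 3 * 32 and 288 = 9 * 32; the summands 1 keep both positive.\<close>
  define k0 where "k0 = nat \<lceil>96 * A'\<^sup>2 * BB\<^sup>2\<rceil> + 1"
  define t where "t = 288 * A'\<^sup>2 * BB ^ 4 + 1"
  define c1 where "c1 = 8 * real k0 * A' ^ 4 * t"
  \<comment> \<open>The recursion yields \<open>c1 / 4 ^ k\<close> plus one eighth of
    \<open>C / 4 ^ k\<close> and has to stay below one quarter of it, so \<open>C\<close> at least
    \<open>8 * c1\<close> is enough. The summand 1 serves the case \<open>k = 0\<close>.\<close>
  define C where "C = 8 * c1 + 1"
  have t: "0 < t" unfolding t_def by (intro add_nonneg_pos mult_nonneg_nonneg) auto
  have k0: "0 < k0" by (simp add: k0_def)
  have c1: "0 \<le> c1" using t by (simp add: c1_def)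
  have small: "A'\<^sup>2 * BB * (3 * BB / real k0 + 9 * BB ^ 3 / t) \<le> 1/16"
  proof -
    have "96 * A'\<^sup>2 * BB\<^sup>2 \<le> real k0" unfolding k0_def by linarith
    then have "3 * A'\<^sup>2 * BB\<^sup>2 / real k0 \<le> 1/32" using k0 by (simp add: divide_le_eq)
    moreover have "9 * A'\<^sup>2 * BB ^ 4 / t \<le> 1/32" using t by (simp add: divide_le_eq) (simp add: t_def)
    moreover have "A'\<^sup>2 * BB * (3 * BB / real k0 + 9 * BB ^ 3 / t) = 3 * A'\<^sup>2 * BB\<^sup>2 / real k0 + 9 * A'\<^sup>2 * BB ^ 4 / t"
      by (simp add: distrib_left power2_eq_square power3_eq_cube power4_eq_xxxx mult_ac)
    ultimately show ?thesis by linarith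
  qed
  have "ZD D h W (\<lambda>f. of_bool (deep f v (4 ^ k))) \<le> C / 4 ^ k * ZD D h W (\<lambda>_. 1)"
    if a: "finite D" "D \<subseteq> V" "\<forall>x. 1/2 \<le> h x \<and> h x \<le> 1" "W \<subseteq> Some ` D" "v \<in> W" for k D h W v
    using that
  proof (induction k arbitrary: h W v)
    case 0
    interpret rev_chain "states D" None "thin p D h" b "\<lambda>x. case x of None \<Rightarrow> 1 | Some x \<Rightarrow> mm x / h x" "2 * A"
      using 0 by (intro thin_chain) auto
    have "ZZ W (\<lambda>f. of_bool (deep f v (4 ^ 0))) \<le> ZZ W (\<lambda>_. 1)" by (rule ZZ_mono) auto
    moreover have "0 < ZZ W (\<lambda>_. 1)" using 0 by (intro Z_pos) (auto simp: states_I)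
    ultimately show ?case using c1 unfolding ZD_def C_def by (simp add: distrib_right add_increasing)
  next
    case (Suc k)
    interpret rev_chain "states D" None "thin p D h" b "\<lambda>x. case x of None \<Rightarrow> 1 | Some x \<Rightarrow> mm x / h x" "2 * A"
      using Suc by (intro thin_chain) auto
    have B: "B = BB" by (simp add: B_def BB_def)
    have WI: "W \<subseteq> states D - {None}" using Suc.prems by (simp add: states_I)
    have H: "ZZ W' (\<lambda>f. of_bool (deep f u (4 ^ k))) \<le> (2 * (C / 4 ^ k)) * ZZ W' (\<lambda>_. 1)"
      if W': "W' \<subseteq> states D - {None}" and u: "u \<in> states D - {None}" "u \<notin> W'" for W' u
    proof -
      obtain u0 where u0: "u = Some u0" "u0 \<in> D" using u by (auto simp: states_I)
      \<comment> \<open>\<open>u\<close> lies outside \<open>W'\<close>, so changing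
        \<open>h\<close> at \<open>u\<close> changes no weight of a forest on \<open>W'\<close>,
        while the walk at \<open>u\<close> is now killed with probability at least 1/2.\<close>
      define h' where "h' = h(u0 := 1/2)"
      have h': "1/2 \<le> h' x \<and> h' x \<le> 1" for x using Suc.prems(3) by (auto simp: h'_def)
      interpret H: rev_chain "states D" None "thin p D h'" b "\<lambda>x. case x of None \<Rightarrow> 1 | Some x \<Rightarrow> mm x / h' x" "2 * A"
        using Suc.prems h' by (intro thin_chain) auto
      have eq: "ZZ W' \<Phi> = H.ZZ W' \<Phi>" for \<Phi>
      proof -
        have "thin p D h x y = thin p D h' x y" if "x \<in> W'" for x y
        proof -
          have "x \<noteq> Some u0" using that u u0 by auto
          then show ?thesis by (cases x; cases y) (auto simp: h'_def)
        qed
        then have "wt W' f = H.wt W' f" for f unfolding wt_def H.wt_def by (intro prod.cong) auto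
        then show ?thesis by (simp add: ZZ_def H.ZZ_def)
      qed
      have half: "1/2 \<le> thin p D h' u None"
      proof -
        have "(\<Sum>y\<in>D. p u0 y) \<le> 1" using p_sub[of D u0] Suc.prems u0 by auto
        then show ?thesis using u0 by (simp add: h'_def)
      qed
      have "H.ZZ W' (\<lambda>f. of_bool (deep f u (4 ^ k))) \<le> 2 * (C / 4 ^ k) * H.ZZ W' (\<lambda>_. 1)"
      proof (rule H.root_deep_le[OF W' u half])
        have "insert u W' \<subseteq> Some ` D" using W' u by (auto simp: states_I)
        then show "H.ZZ (insert u W') (\<lambda>f. of_bool (deep f u (4 ^ k))) \<le> C / 4 ^ k * H.ZZ (insert u W') (\<lambda>_. 1)"
          using Suc.IH[of h' "insert u W'" u] Suc.prems h' unfolding ZD_def by auto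
        show "0 \<le> C / 4 ^ k" using c1 by (simp add: C_def)
      qed
      then show ?thesis unfolding eq .
    qed
    have e0: "0 \<le> 2 * (C / 4 ^ k)" using c1 by (simp add: C_def)
    have "ZZ W (\<lambda>f. of_bool (deep f v (4 * 4 ^ k))) \<le> (8 * real k0 * (2 * A) ^ 4 * t / real (4 ^ k) + 2 * (C / 4 ^ k) * (2 * A)\<^sup>2 * B * (3 * B / real k0 + 9 * B ^ 3 / t)) * ZZ W (\<lambda>_. 1)"
      by (rule deep_recursion[OF WI Suc.prems(5) _ k0 t e0 H]) auto
    also have "\<dots> \<le> (C / 4 ^ Suc k) * ZZ W (\<lambda>_. 1)"
    proof (rule mult_right_mono)
      have "2 * (C / 4 ^ k) * (A'\<^sup>2 * BB * (3 * BB / real k0 + 9 * BB ^ 3 / t)) \<le> 2 * (C / 4 ^ k) * (1/16)"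
        by (rule mult_left_mono[OF small e0])
      moreover have "c1 / 4 ^ k + 2 * (C / 4 ^ k) * (1/16) \<le> C / 4 ^ Suc k"
        by (simp add: C_def field_simps)
      ultimately show "8 * real k0 * (2 * A) ^ 4 * t / real (4 ^ k) + 2 * (C / 4 ^ k) * (2 * A)\<^sup>2 * B * (3 * B / real k0 + 9 * B ^ 3 / t) \<le> C / 4 ^ Suc k"
        unfolding B A'_def[symmetric] c1_def[symmetric] by (simp add: mult.assoc)
      show "0 \<le> ZZ W (\<lambda>_. 1)" by (rule ZZ_nonneg) simp
    qed
    finally show ?case unfolding ZD_def by simp
  qed
  then show ?thesis using c1 by (intro exI[of _ C]) (auto simp: C_def)
qed

definition CD :: real where
  "CD = (SOME C. 1 \<le> C \<and> (\<forall>k D h W v. finite D \<longrightarrow> D \<subseteq> V \<longrightarrow> (\<forall>x. 1/2 \<le> h x \<and> h x \<le> 1) \<longrightarrow> W \<subseteq> Some ` D \<longrightarrow> v \<in> W \<longrightarrow>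
     ZD D h W (\<lambda>f. of_bool (deep f v (4 ^ k))) \<le> C / 4 ^ k * ZD D h W (\<lambda>_. 1)))"

lemma CD: "1 \<le> CD" "finite D \<Longrightarrow> D \<subseteq> V \<Longrightarrow> v \<in> Some ` D \<Longrightarrow>
     ZD D (\<lambda>_. 1) (Some ` D) (\<lambda>f. of_bool (deep f v (4 ^ k))) \<le> CD / 4 ^ k * ZD D (\<lambda>_. 1) (Some ` D) (\<lambda>_. 1)"
  using someI_ex[OF deep_pow4] unfolding CD_def[symmetric] by auto

end

section \<open>Depth and volume bounds in the wired network itself\<close>

locale wired_walk = base_walk V p mm b A
  for V :: "'v set" and p :: "'v \<Rightarrow> 'v \<Rightarrow> real" and mm :: "'v \<Rightarrow> real" and b :: "nat \<Rightarrow> real" and A :: real +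
  fixes D :: "'v set"
  assumes finD: "finite D" and DV: "D \<subseteq> V"
begin

sublocale rev_chain "states D" None "thin p D (\<lambda>_. 1)" b "\<lambda>x. case x of None \<Rightarrow> 1 | Some x \<Rightarrow> mm x / 1" "2 * A"
  by (rule thin_chain[OF finD DV]) auto

lemma B_BB: "B = BB"
  by (simp add: B_def BB_def)

lemma SI: "Some ` D \<subseteq> states D - {None}"
  by (simp add: states_I)

abbreviation "U \<equiv> Some ` D"

lemma deep_le:
  assumes v: "v \<in> U" and N: "1 \<le> N"
  shows "ZZ U (\<lambda>f. of_bool (deep f v N)) \<le> 4 * CD / real N * Z U"
proof -
  obtain k where k: "4 ^ k \<le> N" "N < 4 ^ (k + 1)" using ex_power_ivl1[of 4 N] N by auto
  have Zp: "0 < Z U" by (rule Z_pos[OF SI])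
  have "ZZ U (\<lambda>f. of_bool (deep f v N)) \<le> ZZ U (\<lambda>f. of_bool (deep f v (4 ^ k)))"
    using deep_antimono[OF _ k(1)] by (intro ZZ_mono) auto
  also have "\<dots> \<le> CD / 4 ^ k * Z U" using CD(2)[OF finD DV v, of k] unfolding ZD_def .
  also have "\<dots> \<le> 4 * CD / real N * Z U"
  proof (rule mult_right_mono)
    have "real N \<le> 4 * 4 ^ k" using k(2) by (metis Suc_eq_plus1 less_imp_le of_nat_le_iff of_nat_numeral of_nat_power power_Suc of_nat_mult)
    then have "CD * real N \<le> CD * (4 * 4 ^ k)" using CD(1) by (intro mult_left_mono) auto
    then show "CD / 4 ^ k \<le> 4 * CD / real N" using N by (simp add: field_simps)
  qed (use Zp in auto)
  finally show ?thesis .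
qed

text \<open>Unless the past has depth \<open>N\<close>, with \<open>N\<close> about
  \<open>sqrt R\<close>, all of it lies within distance \<open>N\<close>, and its expected size
  there is linear in \<open>N\<close>. Both alternatives have probability of order
  \<open>1 / sqrt R\<close>.\<close>

lemma past_volume_le:
  assumes v: "v \<in> U" and R: "1 \<le> R"
  shows "ZZ U (\<lambda>f. of_bool (R \<le> real (card {u\<in>states D. reach f u v}))) \<le> (4 * CD + 12 * A\<^sup>2 * BB\<^sup>2) / sqrt R * Z U"
proof -
  have vI: "v \<in> states D - {None}" using v SI by auto
  define N where "N = nat \<lceil>sqrt R\<rceil>"
  have s1: "1 \<le> sqrt R" using R by simp
  have N: "sqrt R \<le> real N" "real N \<le> sqrt R + 1" "1 \<le> N" unfolding N_def using s1 by linarith+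
  have Zp: "0 < Z U" by (rule Z_pos[OF SI])
  have "ZZ U (\<lambda>f. of_bool (R \<le> real (card {u\<in>states D. reach f u v}))) \<le> ZZ U (\<lambda>f. of_bool (deep f v N) + (1 / R) * real (card (past_upto f v N)))"
  proof (rule ZZ_mono)
    fix f assume f: "f \<in> forests (states D) U"
    show "of_bool (R \<le> real (card {u\<in>states D. reach f u v})) \<le> of_bool (deep f v N) + (1 / R) * real (card (past_upto f v N))"
    proof (cases "deep f v N")
      case True
      then show ?thesis using R by simp
    next
      case False
      have "{u\<in>states D. reach f u v} \<subseteq> past_upto f v N"
      proof
        fix u assume u: "u \<in> {u\<in>states D. reach f u v}"
        then obtain n where n: "(f ^^ n) u = v" "\<And>k. k < n \<Longrightarrow> (f ^^ k) u \<noteq> v" by (auto elim: reach_least)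
        have "n < N"
        proof (rule ccontr)
          assume "\<not> n < N"
          moreover have "deep f v n" using n by (auto simp: deep_def)
          ultimately show False using deep_antimono[of f v n N] False by simp
        qed
        then show "u \<in> past_upto f v N" using u n by (auto simp: past_upto_def lev_def intro!: exI[of _ n])
      qed
      then have "card {u\<in>states D. reach f u v} \<le> card (past_upto f v N)" by (intro card_mono finite_past)
      then have "of_bool (R \<le> real (card {u\<in>states D. reach f u v})) \<le> (1 / R) * real (card (past_upto f v N))"
        using R by (auto simp: of_bool_def field_simps)
      then show ?thesis using False by (simp only: of_bool_eq)
    qed
  qed
  also have "\<dots> = ZZ U (\<lambda>f. of_bool (deep f v N)) + (1 / R) * ZZ U (\<lambda>f. real (card (past_upto f v N)))"
    by (simp only: ZZ_add ZZ_cmult)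
  also have "\<dots> \<le> 4 * CD / real N * Z U + (1 / R) * ((2 * A)\<^sup>2 * B\<^sup>2 * (real N + 1) * Z U)"
    using R by (intro add_mono deep_le v N mult_left_mono ZZ_past_upto_le[OF SI vI]) auto
  also have "\<dots> \<le> 4 * CD / sqrt R * Z U + (12 * A\<^sup>2 * BB\<^sup>2) / sqrt R * Z U"
  proof (intro add_mono mult_right_mono divide_left_mono)
    have "(1 / R) * (real N + 1) \<le> 3 / sqrt R"
    proof -
      have "real N + 1 \<le> 3 * sqrt R" using N(2) s1 by linarith
      then have "(1 / R) * (real N + 1) \<le> (1 / R) * (3 * sqrt R)" using R by (intro mult_left_mono) auto
      also have "\<dots> = 3 / sqrt R" using R by (simp add: field_simps)
      finally show ?thesis .
    qed
    then have "((2 * A)\<^sup>2 * B\<^sup>2 * Z U) * ((1 / R) * (real N + 1)) \<le> ((2 * A)\<^sup>2 * B\<^sup>2 * Z U) * (3 / sqrt R)"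
      using Zp by (intro mult_left_mono) auto
    then show "(1 / R) * ((2 * A)\<^sup>2 * B\<^sup>2 * (real N + 1) * Z U) \<le> (12 * A\<^sup>2 * BB\<^sup>2) / sqrt R * Z U"
      unfolding B_BB by (simp add: mult_ac power_mult_distrib)
  next
    show "0 < real N * sqrt R" using N(3) R by (intro mult_pos_pos) auto
  qed (use CD(1) N s1 Zp in auto)
  finally show ?thesis by (simp add: add_divide_distrib distrib_right)
qed

end

section \<open>Paths of the random walk\<close>

abbreviation prb :: "'a pmf \<Rightarrow> 'a set \<Rightarrow> real" where "prb p \<equiv> measure (measure_pmf p)"

locale net =
  fixes G :: "('v, 'e) network"
  assumes network: "is_network G" and csm: "controlled_stationary_measure G" and bubble: "bubble_norm G < \<infinity>"
begin

abbreviation "V \<equiv> verts G"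

lemma wf: "e \<in> edges G \<Longrightarrow> \<exists>u\<in>V. \<exists>w\<in>V. ends G e = {u, w}"
  using network by (auto simp: is_network_def wf_graph_def)

lemma V_ne: "V \<noteq> {}" and conn: "u \<in> V \<Longrightarrow> w \<in> V \<Longrightarrow> (u, w) \<in> (adj G)\<^sup>*"
  using network by (auto simp: is_network_def connected_graph_def)

lemma cond_pos: "e \<in> edges G \<Longrightarrow> 0 < cond G e"
  and cond_summable: "v \<in> V \<Longrightarrow> cond G summable_on incident G v"
  using network by (auto simp: is_network_def)

lemma incident_edges: "incident G v \<subseteq> edges G"
  by (auto simp: incident_def)

definition AA :: real where
  "AA = (SOME A. 0 < A \<and> (\<forall>v\<in>V. inverse A \<le> vcond G v \<and> vcond G v \<le> A))"

lemma AA: "0 < AA" "v \<in> V \<Longrightarrow> inverse AA \<le> vcond G v" "v \<in> V \<Longrightarrow> vcond G v \<le> AA"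
proof -
  have "\<exists>A. 0 < A \<and> (\<forall>v\<in>V. inverse A \<le> vcond G v \<and> vcond G v \<le> A)"
    using csm by (auto simp: controlled_stationary_measure_def)
  then have "0 < AA \<and> (\<forall>v\<in>V. inverse AA \<le> vcond G v \<and> vcond G v \<le> AA)" unfolding AA_def by (rule someI_ex)
  then show "0 < AA" "v \<in> V \<Longrightarrow> inverse AA \<le> vcond G v" "v \<in> V \<Longrightarrow> vcond G v \<le> AA" by auto
qed

lemma vcond_pos: "v \<in> V \<Longrightarrow> 0 < vcond G v"
  using AA by (meson less_le_trans positive_imp_inverse_positive)

lemma infsum_cond_subset_nn:
  assumes v: "v \<in> V" and X: "X \<subseteq> incident G v"
  shows "(\<integral>\<^sup>+e. ennreal (cond G e) \<partial>count_space X) = ennreal (\<Sum>\<^sub>\<infinity>e\<in>X. cond G e)"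
proof -
  have s: "cond G summable_on X" using cond_summable[OF v] X by (rule summable_on_subset_banach)
  then have a: "Infinite_Set_Sum.abs_summable_on (cond G) X"
    using abs_summable_equivalent[of "cond G" X] summable_on_iff_abs_summable_on_real[of "cond G" X] by simp
  have "(\<integral>\<^sup>+e. ennreal (cond G e) \<partial>count_space X) = ennreal (infsetsum (cond G) X)"
    using X incident_edges cond_pos by (intro nn_integral_conv_infsetsum a) (meson less_imp_le subsetD)
  then show ?thesis by (simp add: infsetsum_infsum[OF a])
qed

lemma pmf_walk_edge:
  assumes v: "v \<in> V"
  shows "pmf (walk_edge G v) e = (if e \<in> incident G v then cond G e / vcond G v else 0)"
  unfolding walk_edge_def
proof (rule pmf_embed_pmf)
  let ?f = "\<lambda>e. if e \<in> incident G v then cond G e / vcond G v else 0"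
  show nn: "0 \<le> ?f e" for e
    using cond_pos[of e] incident_edges[of v] vcond_pos[OF v] by (auto intro!: divide_nonneg_pos simp: less_imp_le subset_iff)
  have "(\<integral>\<^sup>+e. ennreal (?f e) \<partial>count_space UNIV) = (\<integral>\<^sup>+e. ennreal (cond G e) * ennreal (1 / vcond G v) * indicator (incident G v) e \<partial>count_space UNIV)"
  proof (rule nn_integral_cong)
    fix e
    show "ennreal (?f e) = ennreal (cond G e) * ennreal (1 / vcond G v) * indicator (incident G v) e"
      using cond_pos[of e] incident_edges[of v] vcond_pos[OF v] by (auto simp: ennreal_mult[symmetric] less_imp_le subset_iff)
  qed
  also have "\<dots> = (\<integral>\<^sup>+e. ennreal (cond G e) * ennreal (1 / vcond G v) \<partial>count_space (incident G v))"
    by (subst nn_integral_restrict_space[symmetric]) (auto simp: restrict_count_space)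
  also have "\<dots> = (\<integral>\<^sup>+e. ennreal (cond G e) \<partial>count_space (incident G v)) * ennreal (1 / vcond G v)"
    by (rule nn_integral_multc) auto
  also have "\<dots> = ennreal (vcond G v) * ennreal (1 / vcond G v)"
    using infsum_cond_subset_nn[OF v order_refl] by (simp add: vcond_def)
  also have "\<dots> = 1" using vcond_pos[OF v] by (simp add: ennreal_mult[symmetric])
  finally show "(\<integral>\<^sup>+e. ennreal (?f e) \<partial>count_space UNIV) = 1" .
qed

lemma set_walk_edge: "v \<in> V \<Longrightarrow> set_pmf (walk_edge G v) = incident G v"
  using pmf_walk_edge[of v] vcond_pos[of v] cond_pos incident_edges[of v]
  by (auto simp: set_pmf_eq subset_iff) (metis less_irrefl)+

lemma other_end_eq: "ends G e = {u, w} \<Longrightarrow> other_end G u e = w"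
  unfolding other_end_def by (rule the_equality) (auto simp: doubleton_eq_iff)

lemma incident_ends:
  assumes "e \<in> incident G u"
  shows "ends G e = {u, other_end G u e}" "other_end G u e \<in> V" "u \<in> V"
proof -
  obtain a c where ac: "a \<in> V" "c \<in> V" "ends G e = {a, c}"
    using assms wf[of e] by (auto simp: incident_def)
  moreover have "u = a \<or> u = c" using assms ac by (auto simp: incident_def)
  ultimately obtain w where w: "ends G e = {u, w}" "u \<in> V" "w \<in> V" by (metis insert_commute)
  then show "ends G e = {u, other_end G u e}" "other_end G u e \<in> V" "u \<in> V" using other_end_eq[OF w(1)] by auto
qed

lemma set_walk_step: "v \<in> V \<Longrightarrow> set_pmf (walk_step G v) \<subseteq> V"
  unfolding walk_step_def using incident_ends set_walk_edge by auto

text \<open>The network is connected, and each vertex has countably many neighbours because they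
  form the support of a step distribution.\<close>

lemma countable_V: "countable V"
proof -
  obtain v0 where v0: "v0 \<in> V" using V_ne by auto
  have "countable ((adj G)\<^sup>* `` {v0})"
  proof (rule countable_rtrancl)
    fix Y :: "'v set" assume Y: "countable Y"
    have "adj G `` Y \<subseteq> (\<Union>u\<in>Y \<inter> V. set_pmf (walk_step G u))"
    proof
      fix w assume "w \<in> adj G `` Y"
      then obtain u e where e: "u \<in> Y" "e \<in> edges G" "ends G e = {u, w}" by (auto simp: adj_def)
      then have i: "e \<in> incident G u" by (auto simp: incident_def)
      then have u: "u \<in> V" using incident_ends(3) by blast
      have "w = other_end G u e" using other_end_eq[OF e(3)] by simp
      then show "w \<in> (\<Union>u\<in>Y \<inter> V. set_pmf (walk_step G u))" using i u e by (auto simp: walk_step_def set_walk_edge)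
    qed
    moreover have "countable (\<Union>u\<in>Y \<inter> V. set_pmf (walk_step G u))" using Y by auto
    ultimately show "countable (adj G `` Y)" by (rule countable_subset)
  qed simp
  moreover have "V \<subseteq> (adj G)\<^sup>* `` {v0}" using conn[OF v0] by auto
  ultimately show ?thesis by (rule countable_subset[rotated])
qed

lemma countable_edges: "countable (edges G)"
proof -
  have "edges G \<subseteq> (\<Union>u\<in>V. incident G u)" using wf by (fastforce simp: incident_def)
  moreover have "countable (\<Union>u\<in>V. incident G u)"
  proof (intro countable_UN countable_V)
    fix u assume "u \<in> V"
    then show "countable (incident G u)" using set_walk_edge[of u] countable_set_pmf[of "walk_edge G u"] by simp
  qed
  ultimately show ?thesis by (rule countable_subset)
qed

definition p0 :: "'v \<Rightarrow> 'v \<Rightarrow> real" where "p0 u w = pmf (walk_step G u) w"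

lemma p0_edges: "p0 u w = prb (walk_edge G u) {e. other_end G u e = w}"
  unfolding p0_def walk_step_def pmf_map by (simp add: vimage_def)

text \<open>Both sides are the total conductance of the edges with end set
  \<open>{u, w}\<close>.\<close>

lemma p0_rev:
  assumes u: "u \<in> V" and w: "w \<in> V"
  shows "vcond G u * p0 u w = vcond G w * p0 w u"
proof -
  have "ennreal (vcond G u * p0 u w) = (\<integral>\<^sup>+e. ennreal (cond G e) \<partial>count_space {e\<in>edges G. ends G e = {u, w}})"
    if u: "u \<in> V" for u w
  proof -
    let ?X = "{e\<in>edges G. ends G e = {u, w}}"
    have X: "?X \<subseteq> incident G u" by (auto simp: incident_def)
    have "emeasure (measure_pmf (walk_edge G u)) {e. other_end G u e = w} = (\<integral>\<^sup>+e. ennreal (pmf (walk_edge G u) e) \<partial>count_space {e. other_end G u e = w})"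
      by (simp add: nn_integral_pmf)
    also have "\<dots> = (\<integral>\<^sup>+e. ennreal (cond G e) * ennreal (1 / vcond G u) * indicator ?X e \<partial>count_space UNIV)"
    proof (subst nn_integral_count_space_indicator, simp, rule nn_integral_cong)
      fix e
      have "e \<in> incident G u \<and> other_end G u e = w \<longleftrightarrow> e \<in> ?X"
        using incident_ends(1)[of e u] incident_edges[of u] other_end_eq[of e u w] by (auto simp: incident_def)
      then show "ennreal (pmf (walk_edge G u) e) * indicator {e. other_end G u e = w} e = ennreal (cond G e) * ennreal (1 / vcond G u) * indicator ?X e"
        using cond_pos[of e] vcond_pos[OF u] by (auto simp: pmf_walk_edge[OF u] ennreal_mult[symmetric] less_imp_le indicator_def)
    qed
    also have "\<dots> = (\<integral>\<^sup>+e. ennreal (cond G e) * ennreal (1 / vcond G u) \<partial>count_space ?X)"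
      by (subst nn_integral_restrict_space[symmetric]) (auto simp: restrict_count_space)
    also have "\<dots> = (\<integral>\<^sup>+e. ennreal (cond G e) \<partial>count_space ?X) * ennreal (1 / vcond G u)"
      by (rule nn_integral_multc) auto
    finally have "ennreal (p0 u w) = (\<integral>\<^sup>+e. ennreal (cond G e) \<partial>count_space ?X) * ennreal (1 / vcond G u)"
      by (simp add: p0_edges measure_pmf.emeasure_eq_measure)
    then have "ennreal (vcond G u) * ennreal (p0 u w) = (\<integral>\<^sup>+e. ennreal (cond G e) \<partial>count_space ?X) * (ennreal (1 / vcond G u) * ennreal (vcond G u))"
      by (simp add: mult_ac)
    also have "ennreal (1 / vcond G u) * ennreal (vcond G u) = 1" using vcond_pos[OF u] by (simp add: ennreal_mult[symmetric])
    finally show ?thesis using vcond_pos[OF u] by (simp add: ennreal_mult p0_def)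
  qed
  from this[OF u, of w] this[OF w, of u] have "ennreal (vcond G u * p0 u w) = ennreal (vcond G w * p0 w u)"
    by (simp add: insert_commute)
  then show ?thesis using vcond_pos[OF u] vcond_pos[OF w] by (simp add: p0_def)
qed

section \<open>Finite segments of the walk and the Ionescu-Tulcea law\<close>

primrec paths :: "nat \<Rightarrow> 'v \<Rightarrow> 'v list pmf" where
  "paths 0 v = return_pmf [v]"
| "paths (Suc n) v = bind_pmf (walk_step G v) (\<lambda>z. map_pmf ((#) v) (paths n z))"

definition extend :: "'v list \<Rightarrow> 'v list pmf" where
  "extend xs = map_pmf (\<lambda>z. xs @ [z]) (walk_step G (last xs))"

lemma paths_props: "xs \<in> set_pmf (paths n v) \<Longrightarrow> length xs = Suc n \<and> hd xs = v"
  by (induction n arbitrary: v xs) (auto simp: set_bind_pmf)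

lemma paths_in_V: "v \<in> V \<Longrightarrow> xs \<in> set_pmf (paths n v) \<Longrightarrow> set xs \<subseteq> V"
proof (induction n arbitrary: v xs)
  case (Suc n)
  then obtain z ys where z: "z \<in> set_pmf (walk_step G v)" "ys \<in> set_pmf (paths n z)" "xs = v # ys" by (auto simp: set_bind_pmf)
  then show ?case using Suc.IH[of z ys] set_walk_step[OF Suc.prems(1)] Suc.prems by auto
qed auto

lemma paths_extend: "paths (Suc n) v = bind_pmf (paths n v) extend"
proof (induction n arbitrary: v)
  case 0
  show ?case by (simp add: bind_return_pmf extend_def map_pmf_def bind_assoc_pmf)
next
  case (Suc n)
  have ext: "map_pmf ((#) v) (extend xs) = extend (v # xs)" if "xs \<noteq> []" for v xs
    using that by (simp add: extend_def map_pmf_comp)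
  have "paths (Suc (Suc n)) v = bind_pmf (walk_step G v) (\<lambda>z. map_pmf ((#) v) (bind_pmf (paths n z) extend))"
    by (subst paths.simps(2)) (simp only: Suc.IH)
  also have "\<dots> = bind_pmf (walk_step G v) (\<lambda>z. bind_pmf (paths n z) (\<lambda>xs. extend (v # xs)))"
    unfolding map_bind_pmf
    by (intro bind_pmf_cong refl ext) (use paths_props in force)
  also have "\<dots> = bind_pmf (paths (Suc n) v) extend"
    by (simp add: bind_assoc_pmf bind_map_pmf)
  finally show ?case .
qed

abbreviation "MV \<equiv> \<lambda>_::nat. count_space V"

lemma kernel_measurable: "walk_kernel G v i \<in> measurable (PiM {0..<i} MV) (subprob_algebra (MV i))"
  if v: "v \<in> V"
proof (cases i)
  case 0
  have "return (count_space V) v \<in> space (subprob_algebra (count_space V))"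
    using v by (intro measurable_space[OF return_measurable]) auto
  then show ?thesis unfolding 0 walk_kernel_def by simp
next
  case (Suc j)
  have k: "(\<lambda>x. restrict_space (measure_pmf (walk_step G x)) V) \<in> measurable (count_space V) (subprob_algebra (count_space V))"
  proof (rule measurable_count_space_eq1[THEN iffD2], rule Pi_I)
    fix x assume x: "x \<in> V"
    have "emeasure (restrict_space (measure_pmf (walk_step G x)) V) V \<le> 1"
      by (simp add: emeasure_restrict_space measure_pmf.emeasure_le_1)
    then show "restrict_space (measure_pmf (walk_step G x)) V \<in> space (subprob_algebra (count_space V))"
      using V_ne by (auto simp: space_subprob_algebra space_restrict_space sets_restrict_space intro!: subprob_spaceI)
  qed
  have "(\<lambda>X. X j) \<in> measurable (PiM {0..<Suc j} MV) (count_space V)"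
    by (rule measurable_component_singleton) simp
  from measurable_compose[OF this k] show ?thesis unfolding Suc walk_kernel_def by simp
qed

lemma kernel_prob:
  assumes v: "v \<in> V" and x: "x \<in> space (PiM {0..<i} MV)"
  shows "prob_space (walk_kernel G v i x)"
proof (cases i)
  case 0
  then show ?thesis unfolding walk_kernel_def using v by (simp add: prob_space_return)
next
  case (Suc j)
  have xj: "x j \<in> V" using x Suc by (auto simp: space_PiM PiE_iff)
  have "emeasure (measure_pmf (walk_step G (x j))) V = 1"
    using set_walk_step[OF xj] by (intro measure_pmf.emeasure_eq_1_AE) (auto simp: AE_measure_pmf_iff)
  then have "emeasure (restrict_space (measure_pmf (walk_step G (x j))) V) V = 1"
    by (simp add: emeasure_restrict_space)
  then show ?thesis unfolding Suc walk_kernel_def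
    by (intro prob_spaceI) (simp add: space_restrict_space)
qed

lemma IT: "v \<in> V \<Longrightarrow> Ionescu_Tulcea (walk_kernel G v) MV"
  by (intro Ionescu_Tulcea.intro kernel_measurable kernel_prob)

definition to_fun :: "'v list \<Rightarrow> nat \<Rightarrow> 'v" where
  "to_fun xs = (\<lambda>i\<in>{0..<length xs}. xs ! i)"

lemma to_fun_space: "set xs \<subseteq> V \<Longrightarrow> length xs = n \<Longrightarrow> to_fun xs \<in> space (PiM {0..<n} MV)"
  by (auto simp: to_fun_def space_PiM PiE_iff extensional_def)

lemma to_fun_snoc: "to_fun (xs @ [z]) = (to_fun xs)(length xs := z)"
  by (auto simp: to_fun_def fun_eq_iff nth_append)

lemma emeasure_C:
  assumes v: "v \<in> V" and B: "B \<in> sets (PiM {0..<Suc n} MV)"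
  shows "emeasure (Ionescu_Tulcea.C (walk_kernel G v) MV 0 (Suc n) (\<lambda>_. undefined)) B = emeasure (measure_pmf (paths n v)) {xs. to_fun xs \<in> B}"
proof -
  interpret IT: Ionescu_Tulcea "walk_kernel G v" MV by (rule IT[OF v])
  have und: "(\<lambda>_. undefined) \<in> space (PiM {0..<0} MV)" by (simp add: space_PiM)
  have step: "emeasure (IT.C 0 (Suc n) (\<lambda>_. undefined)) B = (\<integral>\<^sup>+x. emeasure (IT.eP n x) B \<partial>IT.C 0 n (\<lambda>_. undefined))"
    if B: "B \<in> sets (PiM {0..<Suc n} MV)" for n B
  proof -
    have ne: "space (IT.C 0 n (\<lambda>_. undefined)) \<noteq> {}"
      using IT.prob_space_C[OF und, of n] by (rule prob_space.not_empty)
    have m: "IT.eP n \<in> measurable (IT.C 0 n (\<lambda>_. undefined)) (subprob_algebra (PiM {0..<Suc n} MV))"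
    proof -
      have s: "sets (IT.C 0 n (\<lambda>_. undefined)) = sets (PiM {0..<n} MV)" using IT.sets_C[OF und, of n] by simp
      show ?thesis unfolding measurable_cong_sets[OF s refl] by (rule IT.measurable_eP)
    qed
    show ?thesis using emeasure_bind[OF ne m B] by simp
  qed
  show ?thesis using B
  proof (induction n arbitrary: B)
    case 0
    have e0: "emeasure (IT.eP 0 (\<lambda>_. undefined)) B = indicator {xs. to_fun xs \<in> B} [v]"
    proof -
      have "emeasure (IT.eP 0 (\<lambda>_. undefined)) B = emeasure (return (count_space V) v) ((\<lambda>x. (\<lambda>_. undefined)(0 := x)) -` B \<inter> V)"
        using IT.emeasure_eP[OF und 0] by (simp add: walk_kernel_def)
      also have "\<dots> = indicator ((\<lambda>x. (\<lambda>_. undefined)(0 := x)) -` B \<inter> V) v" by (rule emeasure_return) simp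
      also have "(\<lambda>_. undefined)(0 := v) = to_fun [v]" by (auto simp: to_fun_def fun_eq_iff)
      then have "indicator ((\<lambda>x. (\<lambda>_. undefined)(0 := x)) -` B \<inter> V) v = (indicator {xs. to_fun xs \<in> B} [v] :: ennreal)"
        using v by (auto simp: indicator_def)
      finally show ?thesis .
    qed
    have "emeasure (IT.C 0 (Suc 0) (\<lambda>_. undefined)) B = (\<integral>\<^sup>+x. emeasure (IT.eP 0 x) B \<partial>return (PiM {0..<0} MV) (\<lambda>_. undefined))"
      using step[OF 0] by simp
    also have "\<dots> = emeasure (IT.eP 0 (\<lambda>_. undefined)) B"
      using measurable_emeasure_kernel[OF IT.measurable_eP 0] by (intro nn_integral_return und) simp
    finally show ?case using e0 by simp
  next
    case (Suc n)
    let ?C = "IT.C 0 (Suc n) (\<lambda>_. undefined)"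
    have sC: "sets ?C = sets (PiM {0..<Suc n} MV)" using IT.sets_C[OF und, of "Suc n"] by simp
    \<comment> \<open>\<open>to_fun\<close> may leave the product space on lists outside the
      support. There a constant list at \<open>v\<close> is substituted, which makes the map
      measurable without changing its law.\<close>
    define tf where "tf xs = (if length xs = Suc n \<and> set xs \<subseteq> V then to_fun xs else to_fun (replicate (Suc n) v))" for xs
    have tfs: "tf xs \<in> space (PiM {0..<Suc n} MV)" for xs
      using v by (auto simp: tf_def intro!: to_fun_space)
    have tfe: "tf xs = to_fun xs" if "xs \<in> set_pmf (paths n v)" for xs
      using paths_props[OF that] paths_in_V[OF v that] by (simp add: tf_def)
    have tm: "tf \<in> measurable (measure_pmf (paths n v)) (PiM {0..<Suc n} MV)"
      using tfs by (auto simp: measurable_def)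
    have Cd: "?C = distr (measure_pmf (paths n v)) (PiM {0..<Suc n} MV) tf"
    proof (rule measure_eqI)
      show "sets ?C = sets (distr (measure_pmf (paths n v)) (PiM {0..<Suc n} MV) tf)" using sC by simp
      fix X assume X: "X \<in> sets ?C"
      then have X': "X \<in> sets (PiM {0..<Suc n} MV)" using sC by simp
      have "emeasure ?C X = emeasure (measure_pmf (paths n v)) {xs. to_fun xs \<in> X}" by (rule Suc.IH[OF X'])
      also have "\<dots> = emeasure (measure_pmf (paths n v)) (tf -` X)"
        using tfe by (intro emeasure_eq_AE) (auto simp: AE_measure_pmf_iff)
      also have "\<dots> = emeasure (distr (measure_pmf (paths n v)) (PiM {0..<Suc n} MV) tf) X"
        using X' tm by (simp add: emeasure_distr)
      finally show "emeasure ?C X = emeasure (distr (measure_pmf (paths n v)) (PiM {0..<Suc n} MV) tf) X" .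
    qed
    have ePm: "(\<lambda>x. emeasure (IT.eP (Suc n) x) B) \<in> borel_measurable (PiM {0..<Suc n} MV)"
      by (rule measurable_emeasure_kernel[OF IT.measurable_eP Suc.prems])
    have "emeasure (IT.C 0 (Suc (Suc n)) (\<lambda>_. undefined)) B = (\<integral>\<^sup>+x. emeasure (IT.eP (Suc n) x) B \<partial>?C)"
      by (rule step[OF Suc.prems])
    also have "\<dots> = (\<integral>\<^sup>+xs. emeasure (IT.eP (Suc n) (tf xs)) B \<partial>measure_pmf (paths n v))"
      unfolding Cd by (rule nn_integral_distr[OF tm]) (use ePm in simp)
    also have "\<dots> = (\<integral>\<^sup>+xs. emeasure (measure_pmf (extend xs)) {ys. to_fun ys \<in> B} \<partial>measure_pmf (paths n v))"
    proof (rule nn_integral_cong_AE, rule AE_pmfI)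
      fix xs assume xs: "xs \<in> set_pmf (paths n v)"
      have l: "length xs = Suc n" "set xs \<subseteq> V" "xs \<noteq> []" using paths_props[OF xs] paths_in_V[OF v xs] by auto
      have tx: "to_fun xs \<in> space (PiM {0..<Suc n} MV)" by (rule to_fun_space) (use l in auto)
      have last: "to_fun xs n = last xs" "last xs \<in> V" using l by (auto simp: to_fun_def last_conv_nth)
      have "emeasure (IT.eP (Suc n) (tf xs)) B = emeasure (walk_kernel G v (Suc n) (to_fun xs)) ((\<lambda>x. (to_fun xs)(Suc n := x)) -` B \<inter> V)"
        unfolding tfe[OF xs] using IT.emeasure_eP[OF tx Suc.prems] by simp
      also have "\<dots> = emeasure (measure_pmf (walk_step G (last xs))) ((\<lambda>x. (to_fun xs)(Suc n := x)) -` B \<inter> V)"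
        unfolding walk_kernel_def by (simp add: last emeasure_restrict_space)
      also have "\<dots> = emeasure (measure_pmf (walk_step G (last xs))) ((\<lambda>z. xs @ [z]) -` {ys. to_fun ys \<in> B})"
        using set_walk_step[OF last(2)] l by (intro emeasure_eq_AE) (auto simp: AE_measure_pmf_iff to_fun_snoc)
      also have "\<dots> = emeasure (measure_pmf (extend xs)) {ys. to_fun ys \<in> B}" by (simp add: extend_def)
      finally show "emeasure (IT.eP (Suc n) (tf xs)) B = emeasure (measure_pmf (extend xs)) {ys. to_fun ys \<in> B}" .
    qed
    also have "\<dots> = emeasure (measure_pmf (paths (Suc n) v)) {xs. to_fun xs \<in> B}"
      unfolding paths_extend by simp
    finally show ?case .
  qed
qed

lemma space_walk_law: "v \<in> V \<Longrightarrow> space (walk_law G v) = {X. \<forall>i. X i \<in> V}"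
  and sets_walk_law: "v \<in> V \<Longrightarrow> sets (walk_law G v) = sets (PiM UNIV MV)"
proof -
  assume v: "v \<in> V"
  interpret IT: Ionescu_Tulcea "walk_kernel G v" MV by (rule IT[OF v])
  show "space (walk_law G v) = {X. \<forall>i. X i \<in> V}" unfolding walk_law_def by (auto simp: space_PiM)
  show "sets (walk_law G v) = sets (PiM UNIV MV)" unfolding walk_law_def by simp
qed

definition prefix :: "nat \<Rightarrow> (nat \<Rightarrow> 'v) \<Rightarrow> 'v list" where
  "prefix n X = map X [0..<Suc n]"

lemma walk_law_cylinder:
  assumes v: "v \<in> V" and B: "B \<in> sets (PiM {0..<Suc n} MV)"
  shows "emeasure (walk_law G v) {X\<in>space (walk_law G v). restrict X {0..<Suc n} \<in> B} = emeasure (measure_pmf (paths n v)) {xs. to_fun xs \<in> B}"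
proof -
  interpret IT: Ionescu_Tulcea "walk_kernel G v" MV by (rule IT[OF v])
  have "{X\<in>space (walk_law G v). restrict X {0..<Suc n} \<in> B} = prod_emb UNIV MV {0..<Suc n} B"
    by (auto simp: prod_emb_def space_walk_law[OF v] space_PiM)
  then have "emeasure (walk_law G v) {X\<in>space (walk_law G v). restrict X {0..<Suc n} \<in> B} = emeasure IT.PF.lim (prod_emb UNIV MV {0..<Suc n} B)"
    by (simp add: walk_law_def)
  also have "\<dots> = emeasure (IT.CI {0..<Suc n}) B" by (rule IT.lim[OF _ B]) simp
  also have "\<dots> = emeasure (IT.C 0 (Suc n) (\<lambda>_. undefined)) (prod_emb {0..<Suc n} MV {0..<Suc n} B)"
    by (rule IT.emeasure_CI[OF order_refl B])
  also have "prod_emb {0..<Suc n} MV {0..<Suc n} B = B" using B sets.sets_into_space[OF B] by (simp add: prod_emb_id space_PiM)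
  finally show ?thesis unfolding emeasure_C[OF v B] .
qed

text \<open>All later statements about \<open>walk_law\<close> pass through this identification of
  its finite segments with a discrete law. Only countably many lists occur, so singletons
  suffice.\<close>

lemma distr_prefix:
  assumes v: "v \<in> V"
  shows "prefix n \<in> measurable (walk_law G v) (count_space UNIV)"
    "distr (walk_law G v) (count_space UNIV) (prefix n) = measure_pmf (paths n v)"
proof -
  let ?L = "{xs. set xs \<subseteq> V \<and> length xs = Suc n}"
  have cL: "countable ?L"
    by (rule countable_subset[OF _ countable_lists[OF countable_V]]) (auto simp: lists_eq_set)
  let ?S = "\<lambda>ys. {X\<in>space (walk_law G v). restrict X {0..<Suc n} \<in> {to_fun ys}}"
  have one: "{to_fun ys} \<in> sets (PiM {0..<Suc n} MV)" if "ys \<in> ?L" for ys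
  proof -
    have "{to_fun ys} = (\<Pi>\<^sub>E i\<in>{0..<Suc n}. {ys ! i})" using that
      by (auto simp: to_fun_def PiE_iff extensional_def fun_eq_iff)
    also have "\<dots> \<in> sets (PiM {0..<Suc n} MV)" using that by (intro sets_PiM_I_finite) auto
    finally show ?thesis .
  qed
  have eq: "prefix n -` {ys} \<inter> space (walk_law G v) = ?S ys" if ys: "ys \<in> ?L" for ys
  proof (intro equalityI subsetI)
    fix X assume X: "X \<in> prefix n -` {ys} \<inter> space (walk_law G v)"
    then have "ys = map X [0..<Suc n]" by (auto simp: prefix_def)
    then have "restrict X {0..<Suc n} = to_fun ys" by (auto simp: to_fun_def fun_eq_iff nth_append simp del: upt_Suc)
    then show "X \<in> ?S ys" using X by simp
  next
    fix X assume X: "X \<in> ?S ys"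
    then have r: "restrict X {0..<Suc n} = to_fun ys" by simp
    have "X i = ys ! i" if "i < Suc n" for i using fun_cong[OF r, of i] that ys by (simp add: to_fun_def)
    then have "prefix n X = ys" unfolding prefix_def using ys by (intro nth_equalityI) (auto simp del: upt_Suc)
    then show "X \<in> prefix n -` {ys} \<inter> space (walk_law G v)" using X by simp
  qed
  have meas: "?S ys \<in> sets (walk_law G v)" if "ys \<in> ?L" for ys
  proof -
    have "(\<lambda>X. restrict X {0..<Suc n}) \<in> measurable (walk_law G v) (PiM {0..<Suc n} MV)"
      unfolding measurable_cong_sets[OF sets_walk_law[OF v] refl] by (rule measurable_restrict_subset) simp
    from measurable_sets[OF this one[OF that]] show ?thesis by (simp add: vimage_def Int_def conj_commute)
  qed
  have into: "prefix n X \<in> ?L" if "X \<in> space (walk_law G v)" for X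
    using that by (auto simp: prefix_def space_walk_law[OF v])
  have mL: "prefix n \<in> measurable (walk_law G v) (count_space ?L)"
    using into meas eq by (subst measurable_count_space_eq_countable[OF cL]) auto
  show m: "prefix n \<in> measurable (walk_law G v) (count_space UNIV)"
  proof (rule measurableI)
    fix X :: "'v list set"
    have "prefix n -` X \<inter> space (walk_law G v) = prefix n -` (X \<inter> ?L) \<inter> space (walk_law G v)" using into by auto
    also have "\<dots> \<in> sets (walk_law G v)" by (rule measurable_sets[OF mL]) auto
    finally show "prefix n -` X \<inter> space (walk_law G v) \<in> sets (walk_law G v)" .
  qed simp
  have pl: "emeasure (distr (walk_law G v) (count_space UNIV) (prefix n)) {ys} = emeasure (measure_pmf (paths n v)) {ys}" for ys
  proof (cases "ys \<in> ?L")
    case True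
    have "emeasure (distr (walk_law G v) (count_space UNIV) (prefix n)) {ys} = emeasure (walk_law G v) (?S ys)"
      using m by (simp add: emeasure_distr eq[OF True])
    also have "\<dots> = emeasure (measure_pmf (paths n v)) {xs. to_fun xs \<in> {to_fun ys}}"
      by (rule walk_law_cylinder[OF v one[OF True]])
    also have "\<dots> = emeasure (measure_pmf (paths n v)) {ys}"
    proof (rule emeasure_eq_AE)
      have "to_fun xs = to_fun ys \<longleftrightarrow> xs = ys" if "xs \<in> set_pmf (paths n v)" for xs
      proof
        assume e: "to_fun xs = to_fun ys"
        have l: "length xs = length ys" using paths_props[OF that] True by simp
        show "xs = ys"
        proof (rule nth_equalityI[OF l])
          fix i assume "i < length xs"
          then show "xs ! i = ys ! i" using fun_cong[OF e, of i] l by (simp add: to_fun_def)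
        qed
      qed simp
      then show "AE x in measure_pmf (paths n v). (x \<in> {xs. to_fun xs \<in> {to_fun ys}}) = (x \<in> {ys})" by (auto simp: AE_measure_pmf_iff)
    qed auto
    finally show ?thesis .
  next
    case False
    have "prefix n -` {ys} \<inter> space (walk_law G v) = {}" using into False by auto
    then have "emeasure (distr (walk_law G v) (count_space UNIV) (prefix n)) {ys} = 0" using m by (simp add: emeasure_distr)
    moreover have "ys \<notin> set_pmf (paths n v)" using False paths_props[of ys n v] paths_in_V[OF v, of ys n] by auto
    then have "emeasure (measure_pmf (paths n v)) {ys} = 0" by (simp add: emeasure_pmf_single pmf_eq_0_set_pmf)
    ultimately show ?thesis by simp
  qed
  show "distr (walk_law G v) (count_space UNIV) (prefix n) = measure_pmf (paths n v)"
  proof (rule measure_eqI_countable_AE[where \<Omega> = ?L])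
    show "AE x in distr (walk_law G v) (count_space UNIV) (prefix n). x \<in> ?L"
      using into m by (simp add: AE_distr_iff)
    show "AE x in measure_pmf (paths n v). x \<in> ?L"
      using paths_props paths_in_V[OF v] by (auto simp: AE_measure_pmf_iff)
    show "countable ?L" by (rule cL)
  qed (use pl in auto)
qed

lemma prob_space_walk_law: "v \<in> V \<Longrightarrow> prob_space (walk_law G v)"
  using distr_prefix[of v 0] prob_space_distrD[of "prefix 0" "walk_law G v" "count_space UNIV"] measure_pmf.prob_space_axioms by metis

lemma trans_prob_paths:
  assumes v: "v \<in> V"
  shows "trans_prob G n v w = prb (paths n v) {xs. xs ! n = w}"
proof -
  have "prb (paths n v) {xs. xs ! n = w} = measure (distr (walk_law G v) (count_space UNIV) (prefix n)) {xs. xs ! n = w}"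
    using distr_prefix(2)[OF v] by simp
  also have "\<dots> = measure (walk_law G v) (prefix n -` {xs. xs ! n = w} \<inter> space (walk_law G v))"
    by (rule measure_distr[OF distr_prefix(1)[OF v]]) simp
  also have "prefix n -` {xs. xs ! n = w} \<inter> space (walk_law G v) = {X\<in>space (walk_law G v). X n = w}"
    by (auto simp: prefix_def nth_append)
  finally show ?thesis by (simp add: trans_prob_def)
qed

end

section \<open>Escape probabilities of the random walk\<close>

lemma pmf_tight:
  assumes "0 < (e :: real)"
  shows "\<exists>X. finite X \<and> prb p (- X) \<le> e"
proof -
  obtain f :: "nat \<Rightarrow> 'a" where f: "set_pmf p \<subseteq> range f"
    using countable_set_pmf[of p] by (metis uncountable_def set_pmf_not_empty subset_refl)
  let ?A = "\<lambda>n. f ` {..n}"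
  have "(\<lambda>n. prb p (?A n)) \<longlonglongrightarrow> prb p (\<Union>n. ?A n)"
    by (rule measure_pmf.finite_Lim_measure_incseq) (auto simp: incseq_def)
  moreover have "prb p (\<Union>n. ?A n) = 1"
  proof -
    have "(\<Union>n. ?A n) = range f" by auto
    then show ?thesis using f by (subst measure_pmf.prob_eq_1) (auto simp: AE_measure_pmf_iff)
  qed
  ultimately have "(\<lambda>n. prb p (?A n)) \<longlonglongrightarrow> 1" by simp
  from LIMSEQ_D[OF this assms] obtain n where "\<bar>prb p (?A n) - 1\<bar> < e" by auto
  then have "prb p (- ?A n) \<le> e"
    using measure_pmf.prob_compl[of "?A n" p] by (simp add: Compl_eq_Diff_UNIV)
  then show ?thesis by (intro exI[of _ "?A n"]) auto
qed

context net
begin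

definition bb :: "nat \<Rightarrow> real" where "bb n = enn2real (norm_1_inf G n)"

lemma norm_le_1: "norm_1_inf G n \<le> 1"
  unfolding norm_1_inf_def
proof (intro SUP_least)
  fix u v assume "u \<in> V"
  then show "ennreal (trans_prob G n u v) \<le> 1"
    unfolding trans_prob_def by (simp add: prob_space.prob_le_1[OF prob_space_walk_law])
qed

lemma ennreal_bb: "ennreal (bb n) = norm_1_inf G n"
  unfolding bb_def using norm_le_1[of n] by (intro ennreal_enn2real) (auto simp: less_top[symmetric] top_unique)

lemma bb_nonneg: "0 \<le> bb n" by (simp add: bb_def)

lemma trans_prob_le: "u \<in> V \<Longrightarrow> w \<in> V \<Longrightarrow> trans_prob G n u w \<le> bb n"
proof -
  assume "u \<in> V" "w \<in> V"
  then have "ennreal (trans_prob G n u w) \<le> norm_1_inf G n" unfolding norm_1_inf_def by (intro SUP_upper2[of u] SUP_upper2[of w]) auto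
  then show ?thesis using ennreal_bb[of n] bb_nonneg by (metis ennreal_le_iff)
qed

lemma bb_summable: "summable (\<lambda>n. (real n + 1) * bb n)"
proof (rule summable_suminf_not_top)
  have "(\<Sum>n. ennreal ((real n + 1) * bb n)) = bubble_norm G"
    unfolding bubble_norm_def
    by (intro suminf_cong) (simp add: ennreal_mult bb_nonneg ennreal_bb[symmetric] add.commute ennreal_of_nat_eq_real_of_nat)
  then show "(\<Sum>n. ennreal ((real n + 1) * bb n)) \<noteq> top" using bubble by simp
qed (simp add: bb_nonneg)

lemma bb_lim: "bb \<longlonglongrightarrow> 0"
proof (rule Lim_null_comparison[OF _ summable_LIMSEQ_zero[OF bb_summable]])
  show "\<forall>\<^sub>F n in sequentially. norm (bb n) \<le> (real n + 1) * bb n"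
    using bb_nonneg by (intro always_eventually allI) (simp add: distrib_right)
qed

lemma emeasure_paths_Suc:
  "emeasure (measure_pmf (paths (Suc n) x)) A = (\<integral>\<^sup>+z. emeasure (measure_pmf (paths n z)) {ys. x # ys \<in> A} \<partial>measure_pmf (walk_step G x))"
  by (simp add: vimage_def)

lemma nn_walk_step_ge: "finite D \<Longrightarrow> (\<Sum>z\<in>D. ennreal (p0 x z) * f z) \<le> (\<integral>\<^sup>+z. f z \<partial>measure_pmf (walk_step G x))"
proof -
  assume D: "finite D"
  have "(\<Sum>z\<in>D. ennreal (p0 x z) * f z) = (\<integral>\<^sup>+z. f z * indicator D z \<partial>measure_pmf (walk_step G x))"
    by (subst nn_integral_measure_pmf_support[OF D]) (auto simp: p0_def mult.commute intro!: sum.cong)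
  also have "\<dots> \<le> (\<integral>\<^sup>+z. f z \<partial>measure_pmf (walk_step G x))" by (intro nn_integral_mono) (auto simp: indicator_def)
  finally show ?thesis .
qed

lemma pw_le_paths:
  assumes D: "finite D"
  shows "ennreal (pw p0 D n x y) \<le> emeasure (measure_pmf (paths n x)) {xs. xs ! n = y}"
proof (induction n arbitrary: x)
  case 0
  show ?case by (auto simp: emeasure_return_pmf)
next
  case (Suc n)
  show ?case
  proof (cases "x \<in> D")
    case True
    have nn: "0 \<le> pw p0 D n z y" for z by (induction n arbitrary: z) (auto intro!: sum_nonneg mult_nonneg_nonneg simp: p0_def)
    have "ennreal (pw p0 D (Suc n) x y) = (\<Sum>z\<in>D. ennreal (p0 x z) * ennreal (pw p0 D n z y))"
      using True nn by (simp add: sum_ennreal[symmetric] ennreal_mult p0_def)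
    also have "\<dots> \<le> (\<Sum>z\<in>D. ennreal (p0 x z) * emeasure (measure_pmf (paths n z)) {xs. xs ! n = y})"
      by (intro sum_mono mult_left_mono Suc.IH) simp
    also have "\<dots> \<le> (\<integral>\<^sup>+z. emeasure (measure_pmf (paths n z)) {xs. xs ! n = y} \<partial>measure_pmf (walk_step G x))"
      by (rule nn_walk_step_ge[OF D])
    also have "\<dots> = emeasure (measure_pmf (paths (Suc n) x)) {xs. xs ! Suc n = y}"
      unfolding emeasure_paths_Suc by simp
    finally show ?thesis .
  qed simp
qed

lemma pw_in: "pw p0 D n x y \<noteq> 0 \<Longrightarrow> x \<in> D \<and> y \<in> D"
proof (induction n arbitrary: x)
  case (Suc n)
  then have x: "x \<in> D" "(\<Sum>z\<in>D. p0 x z * pw p0 D n z y) \<noteq> 0" by (auto split: if_splits)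
  then obtain z where "pw p0 D n z y \<noteq> 0" by (metis (no_types, lifting) mult_zero_right sum.neutral)
  then show ?case using Suc.IH x by blast
qed (auto split: if_splits)

lemma pw_le_bb:
  assumes D: "finite D" "D \<subseteq> V"
  shows "pw p0 D n x y \<le> bb n"
proof (cases "pw p0 D n x y = 0")
  case False
  then have xy: "x \<in> V" "y \<in> V" using pw_in D by blast+
  have "ennreal (pw p0 D n x y) \<le> ennreal (trans_prob G n x y)"
    using pw_le_paths[OF D(1)] by (simp add: trans_prob_paths[OF xy(1)] measure_pmf.emeasure_eq_measure)
  then have "pw p0 D n x y \<le> trans_prob G n x y" by (simp add: trans_prob_def)
  then show ?thesis using trans_prob_le[OF xy, of n] by simp
qed (simp add: bb_nonneg)

text \<open>At time \<open>n\<close> each of the \<open>card D\<close> vertices carries mass at most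
  \<open>bb n\<close>, which tends to 0; so a walk leaves every finite set almost surely.\<close>

lemma paths_stay_le:
  assumes D: "finite D" "D \<subseteq> V" and v: "v \<in> V"
  shows "prb (paths n v) {xs. set xs \<subseteq> D} \<le> real (card D) * bb n"
proof -
  have "prb (paths n v) {xs. set xs \<subseteq> D} \<le> prb (paths n v) (\<Union>y\<in>D. {xs. xs ! n = y})"
  proof (intro measure_pmf.finite_measure_mono_AE, rule AE_pmfI, rule impI)
    fix xs assume "xs \<in> set_pmf (paths n v)" "xs \<in> {xs. set xs \<subseteq> D}"
    then have "xs ! n \<in> D" using paths_props[of xs n v] by auto
    then show "xs \<in> (\<Union>y\<in>D. {xs. xs ! n = y})" by auto
  qed simp
  also have "\<dots> \<le> (\<Sum>y\<in>D. prb (paths n v) {xs. xs ! n = y})"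
    by (rule measure_pmf.finite_measure_subadditive_finite) (use D in auto)
  also have "\<dots> \<le> (\<Sum>y\<in>D. bb n)"
    using D by (intro sum_mono) (auto simp: trans_prob_paths[OF v, symmetric] intro!: trans_prob_le v)
  finally show ?thesis by simp
qed

lemma base: "base_walk V p0 (vcond G) bb AA"
proof unfold_locales
  fix D :: "'v set" and x assume "finite D"
  then have "(\<Sum>y\<in>D. p0 x y) = prb (walk_step G x) D" by (simp add: p0_def measure_measure_pmf_finite)
  then show "(\<Sum>y\<in>D. p0 x y) \<le> 1" by simp
next
  show "0 \<le> p0 x y" for x y by (simp add: p0_def)
qed (auto intro: p0_rev AA pw_le_bb bb_summable)

end

section \<open>The walk observed until it leaves a finite set\<close>

locale wnet = net G for G :: "('v, 'e) network" +
  fixes D :: "'v set"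
  assumes D_fin: "finite D" and D_V: "D \<subseteq> V"
begin

sublocale W: wired_walk V p0 "vcond G" bb AA D
  using base D_fin D_V by (intro wired_walk.intro wired_walk_axioms.intro)

abbreviation T :: "'v option \<Rightarrow> 'v option \<Rightarrow> real" where "T \<equiv> thin p0 D (\<lambda>_. 1)"

definition op :: "'v \<Rightarrow> 'v option" where "op z = (if z \<in> D then Some z else None)"

lemma op_U: "op z \<in> W.U \<longleftrightarrow> z \<in> D"
  by (auto simp: op_def)

lemma pmf_op:
  assumes x: "x \<in> D" and s: "s \<in> states D"
  shows "pmf (map_pmf op (walk_step G x)) s = T (Some x) s"
proof -
  have Some: "pmf (map_pmf op (walk_step G x)) (Some y) = p0 x y" if "y \<in> D" for y
  proof -
    have "op -` {Some y} = {y}" using that by (auto simp: op_def split: if_splits)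
    then show ?thesis by (simp add: pmf_map p0_def measure_pmf_single)
  qed
  have "(\<Sum>s\<in>states D. pmf (map_pmf op (walk_step G x)) s) = 1"
    using D_fin by (intro sum_pmf_eq_1) (auto simp: states_def op_def)
  then have "pmf (map_pmf op (walk_step G x)) None + (\<Sum>y\<in>D. p0 x y) = 1"
    using D_fin Some by (simp add: states_def sum.reindex)
  then show ?thesis using s x Some by (auto simp: states_def)
qed

lemma nn_step:
  assumes x: "x \<in> D" and g: "\<And>s. 0 \<le> g s"
  shows "(\<integral>\<^sup>+z. ennreal (g (op z)) \<partial>measure_pmf (walk_step G x)) = ennreal (\<Sum>s\<in>states D. T (Some x) s * g s)"
proof -
  have "(\<integral>\<^sup>+z. ennreal (g (op z)) \<partial>measure_pmf (walk_step G x)) = (\<integral>\<^sup>+s. ennreal (g s) \<partial>measure_pmf (map_pmf op (walk_step G x)))"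
    by simp
  also have "\<dots> = (\<Sum>s\<in>states D. ennreal (g s) * ennreal (pmf (map_pmf op (walk_step G x)) s))"
    using D_fin by (intro nn_integral_measure_pmf_support) (auto simp: states_def op_def)
  also have "\<dots> = (\<Sum>s\<in>states D. ennreal (T (Some x) s * g s))"
    using g by (intro sum.cong refl) (simp add: pmf_op[OF x] ennreal_mult' mult.commute)
  also have "\<dots> = ennreal (\<Sum>s\<in>states D. T (Some x) s * g s)"
    using g by (intro sum_ennreal mult_nonneg_nonneg W.P_nonneg)
  finally show ?thesis .
qed

lemma nn_paths_Suc:
  "(\<integral>\<^sup>+xs. f xs \<partial>measure_pmf (paths (Suc n) x)) = (\<integral>\<^sup>+z. (\<integral>\<^sup>+ys. f (x # ys) \<partial>measure_pmf (paths n z)) \<partial>measure_pmf (walk_step G x))"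
  by simp

lemma nn_paths_0: "(\<integral>\<^sup>+xs. f xs \<partial>measure_pmf (paths 0 x)) = f [x]"
  by (simp add: nn_integral_return_pmf)

definition outs :: "'v list \<Rightarrow> bool" where "outs xs \<longleftrightarrow> (\<exists>y\<in>set xs. y \<notin> D)"

text \<open>The vertices visited before the first exit from \<open>D\<close>, as states of the wired
  chain. What the walk does after the exit is invisible there.\<close>

definition ini :: "'v list \<Rightarrow> 'v option set" where "ini xs = Some ` set (takeWhile (\<lambda>y. y \<in> D) xs)"

lemma range_val_nonneg: "(\<And>C. 0 \<le> a C) \<Longrightarrow> 0 \<le> W.range_val a W.U k s C"
  by (induction k arbitrary: s C) (auto intro!: sum_nonneg mult_nonneg_nonneg W.P_nonneg)

lemma range_val_paths:
  assumes a: "\<And>C. 0 \<le> a C" and x: "x \<in> V"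
  shows "ennreal (W.range_val a W.U k (op x) C) = (\<integral>\<^sup>+xs. ennreal (of_bool (outs xs) * a (C \<union> ini xs)) \<partial>measure_pmf (paths k x))"
  using x
proof (induction k arbitrary: x C)
  case 0
  show ?case by (simp add: nn_paths_0 del: paths.simps) (auto simp: op_U outs_def ini_def)
next
  case (Suc k)
  show ?case
  proof (cases "x \<in> D")
    case True
    have "(\<integral>\<^sup>+xs. ennreal (of_bool (outs xs) * a (C \<union> ini xs)) \<partial>measure_pmf (paths (Suc k) x)) =
        (\<integral>\<^sup>+z. (\<integral>\<^sup>+ys. ennreal (of_bool (outs ys) * a (insert (Some x) C \<union> ini ys)) \<partial>measure_pmf (paths k z)) \<partial>measure_pmf (walk_step G x))"
      unfolding nn_paths_Suc using True by (simp add: outs_def ini_def)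
    also have "\<dots> = (\<integral>\<^sup>+z. ennreal (W.range_val a W.U k (op z) (insert (Some x) C)) \<partial>measure_pmf (walk_step G x))"
      using set_walk_step[OF Suc.prems] by (intro nn_integral_cong_AE AE_pmfI Suc.IH[symmetric]) auto
    also have "\<dots> = ennreal (\<Sum>s\<in>states D. T (Some x) s * W.range_val a W.U k s (insert (Some x) C))"
      by (rule nn_step[OF True range_val_nonneg[OF a]])
    finally show ?thesis using True by (simp add: op_def del: paths.simps)
  next
    case False
    have "(\<integral>\<^sup>+xs. ennreal (of_bool (outs xs) * a (C \<union> ini xs)) \<partial>measure_pmf (paths (Suc k) x)) = (\<integral>\<^sup>+xs. ennreal (a C) \<partial>measure_pmf (paths (Suc k) x))"
    proof (intro nn_integral_cong_AE AE_pmfI)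
      fix xs assume "xs \<in> set_pmf (paths (Suc k) x)"
      then obtain ys where "xs = x # ys" using paths_props[of xs "Suc k" x] by (cases xs) auto
      then show "ennreal (of_bool (outs xs) * a (C \<union> ini xs)) = ennreal (a C)" using False by (simp add: outs_def ini_def)
    qed
    also have "\<dots> = ennreal (a C)" by (simp del: paths.simps)
    finally show ?thesis using False by (simp add: op_def image_iff del: paths.simps)
  qed
qed

lemma avoid_paths:
  assumes C: "None \<notin> C" and x: "x \<in> V"
  shows "ennreal (W.avoid W.U k (op x) C) = emeasure (measure_pmf (paths k x)) {xs. outs xs \<and> ini xs \<inter> C = {}}"
  using x
proof (induction k arbitrary: x)
  case 0
  show ?case using C by (auto simp: emeasure_return_pmf outs_def ini_def op_def)
next
  case (Suc k)
  consider "x \<in> D" "Some x \<in> C" | "x \<in> D" "Some x \<notin> C" | "x \<notin> D" by auto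
  then show ?case
  proof cases
    case 1
    have "emeasure (measure_pmf (paths (Suc k) x)) {xs. outs xs \<and> ini xs \<inter> C = {}} = emeasure (measure_pmf (paths (Suc k) x)) {}"
    proof (intro emeasure_eq_AE AE_pmfI)
      fix xs assume "xs \<in> set_pmf (paths (Suc k) x)"
      then obtain ys where "xs = x # ys" using paths_props[of xs "Suc k" x] by (cases xs) auto
      then show "xs \<in> {xs. outs xs \<and> ini xs \<inter> C = {}} \<longleftrightarrow> xs \<in> {}" using 1 by (auto simp: outs_def ini_def)
    qed auto
    then show ?thesis using 1 by (simp add: op_def del: paths.simps)
  next
    case 2
    have "emeasure (measure_pmf (paths (Suc k) x)) {xs. outs xs \<and> ini xs \<inter> C = {}} =
        (\<integral>\<^sup>+z. emeasure (measure_pmf (paths k z)) {ys. outs ys \<and> ini ys \<inter> C = {}} \<partial>measure_pmf (walk_step G x))"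
      unfolding emeasure_paths_Suc using 2 by (simp add: outs_def ini_def)
    also have "\<dots> = (\<integral>\<^sup>+z. ennreal (W.avoid W.U k (op z) C) \<partial>measure_pmf (walk_step G x))"
      using set_walk_step[OF Suc.prems] by (intro nn_integral_cong_AE AE_pmfI Suc.IH[symmetric]) auto
    also have "\<dots> = ennreal (\<Sum>s\<in>states D. T (Some x) s * W.avoid W.U k s C)"
      by (rule nn_step[OF 2(1) W.avoid_nonneg])
    finally show ?thesis using 2 by (simp add: op_def del: paths.simps)
  next
    case 3
    have "emeasure (measure_pmf (paths (Suc k) x)) {xs. outs xs \<and> ini xs \<inter> C = {}} = emeasure (measure_pmf (paths (Suc k) x)) UNIV"
    proof (intro emeasure_eq_AE AE_pmfI)
      fix xs assume "xs \<in> set_pmf (paths (Suc k) x)"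
      then obtain ys where "xs = x # ys" using paths_props[of xs "Suc k" x] by (cases xs) auto
      then show "xs \<in> {xs. outs xs \<and> ini xs \<inter> C = {}} \<longleftrightarrow> xs \<in> UNIV" using 3 by (auto simp: outs_def ini_def)
    qed auto
    then show ?thesis using 3 C by (simp add: op_def image_iff del: paths.simps)
  qed
qed

lemma exit_by_paths:
  assumes V0: "V0 \<subseteq> D" and x: "x \<in> V"
  shows "ennreal (W.exit_by (Some ` V0) k (op x)) = emeasure (measure_pmf (paths k x)) {xs. \<not> set xs \<subseteq> V0}"
  using x
proof (induction k arbitrary: x)
  case 0
  have "op x \<in> Some ` V0 \<longleftrightarrow> x \<in> V0" using V0 by (auto simp: op_def)
  then show ?case by (simp add: emeasure_return_pmf indicator_def)
next
  case (Suc k)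
  show ?case
  proof (cases "x \<in> V0")
    case True
    then have xD: "x \<in> D" using V0 by auto
    have "emeasure (measure_pmf (paths (Suc k) x)) {xs. \<not> set xs \<subseteq> V0} =
        (\<integral>\<^sup>+z. emeasure (measure_pmf (paths k z)) {ys. \<not> set ys \<subseteq> V0} \<partial>measure_pmf (walk_step G x))"
      unfolding emeasure_paths_Suc using True by simp
    also have "\<dots> = (\<integral>\<^sup>+z. ennreal (W.exit_by (Some ` V0) k (op z)) \<partial>measure_pmf (walk_step G x))"
      using set_walk_step[OF Suc.prems] by (intro nn_integral_cong_AE AE_pmfI Suc.IH[symmetric]) auto
    also have "\<dots> = ennreal (\<Sum>s\<in>states D. T (Some x) s * W.exit_by (Some ` V0) k s)"
      by (rule nn_step[OF xD W.exit_by_nonneg])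
    finally show ?thesis using True xD by (simp add: op_def del: paths.simps)
  next
    case False
    have "emeasure (measure_pmf (paths (Suc k) x)) {xs. \<not> set xs \<subseteq> V0} = emeasure (measure_pmf (paths (Suc k) x)) UNIV"
    proof (intro emeasure_eq_AE AE_pmfI)
      fix xs assume "xs \<in> set_pmf (paths (Suc k) x)"
      then obtain ys where "xs = x # ys" using paths_props[of xs "Suc k" x] by (cases xs) auto
      then show "xs \<in> {xs. \<not> set xs \<subseteq> V0} \<longleftrightarrow> xs \<in> UNIV" using False by auto
    qed auto
    moreover have "op x \<notin> Some ` V0" using False by (auto simp: op_def)
    ultimately show ?thesis by (simp del: paths.simps)
  qed
qed

lemma pp_pmf: "set (x # xs) \<subseteq> D \<Longrightarrow> pp T (map Some (x # xs)) = pmf (paths (length xs) x) (x # xs)"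
proof (induction xs arbitrary: x)
  case (Cons y ys)
  have "ennreal (pmf (paths (Suc (length ys)) x) (x # y # ys)) =
      (\<integral>\<^sup>+z. emeasure (measure_pmf (paths (length ys) z)) {zs. zs = y # ys} \<partial>measure_pmf (walk_step G x))"
    using emeasure_paths_Suc[of "length ys" x "{x # y # ys}"] by (simp add: emeasure_pmf_single del: paths.simps)
  also have "\<dots> = (\<integral>\<^sup>+z. ennreal (pmf (paths (length ys) y) (y # ys)) * indicator {y} z \<partial>measure_pmf (walk_step G x))"
  proof (rule nn_integral_cong)
    fix z
    have "emeasure (measure_pmf (paths (length ys) z)) {y # ys} = 0" if "z \<noteq> y"
      using that paths_props[of "y # ys" "length ys" z] by (auto simp: emeasure_pmf_single pmf_eq_0_set_pmf)
    then show "emeasure (measure_pmf (paths (length ys) z)) {zs. zs = y # ys} = ennreal (pmf (paths (length ys) y) (y # ys)) * indicator {y} z"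
      by (cases "z = y") (auto simp: emeasure_pmf_single)
  qed
  also have "\<dots> = ennreal (pmf (paths (length ys) y) (y # ys)) * ennreal (p0 x y)"
    by (simp add: nn_integral_cmult emeasure_pmf_single p0_def)
  also have "\<dots> = ennreal (p0 x y * pmf (paths (length ys) y) (y # ys))" by (simp add: p0_def ennreal_mult mult.commute)
  finally show ?case using Cons by (simp add: p0_def del: paths.simps)
qed simp

text \<open>Distinct lists are disjoint outcomes of the first \<open>j\<close> steps. The bound
  controls past paths of fixed length that leave a large finite set \<open>V0\<close>.\<close>

lemma sum_pp_outside_le:
  assumes A: "finite A" "\<And>zs. zs \<in> A \<Longrightarrow> set zs \<subseteq> W.U \<and> length zs = j \<and> \<not> set zs \<subseteq> Some ` V0" and v: "v \<in> D"
  shows "(\<Sum>zs\<in>A. pp T (Some v # zs)) \<le> prb (paths j v) {xs. \<not> set xs \<subseteq> V0}"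
proof -
  let ?g = "\<lambda>zs. v # map the zs"
  have ms: "map Some (map the zs) = zs" if "zs \<in> A" for zs
    using A(2)[OF that] by (auto intro!: map_idI)
  have inj: "inj_on ?g A"
  proof (rule inj_onI)
    fix a c assume "a \<in> A" "c \<in> A" "?g a = ?g c"
    then show "a = c" using ms[of a] ms[of c] by simp
  qed
  have "(\<Sum>zs\<in>A. pp T (Some v # zs)) = (\<Sum>zs\<in>A. pmf (paths j v) (?g zs))"
  proof (rule sum.cong[OF refl])
    fix zs assume zs: "zs \<in> A"
    have "set (v # map the zs) \<subseteq> D" using A(2)[OF zs] v by auto
    from pp_pmf[OF this] show "pp T (Some v # zs) = pmf (paths j v) (?g zs)" using ms[OF zs] A(2)[OF zs] by simp
  qed
  also have "\<dots> = prb (paths j v) (?g ` A)"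
    using A(1) inj by (simp add: measure_measure_pmf_finite sum.reindex)
  also have "\<dots> \<le> prb (paths j v) {xs. \<not> set xs \<subseteq> V0}"
  proof (rule measure_pmf.finite_measure_mono)
    show "?g ` A \<subseteq> {xs. \<not> set xs \<subseteq> V0}"
    proof safe
      fix zs assume zs: "zs \<in> A" and s: "set (?g zs) \<subseteq> V0"
      have "set zs \<subseteq> Some ` V0" using s ms[OF zs] by (metis image_mono set_map set_subset_Cons subset_trans)
      then show False using A(2)[OF zs] by simp
    qed
  qed simp
  finally show ?thesis .
qed

end

context net
begin

section \<open>Two independent walks and the quantity \<open>q_prob\<close>\<close>

text \<open>Segments form a countable set, so an event determined by two of them is a countable
  union of measurable rectangles, and its probability is computed with the discrete laws.\<close>

lemma walk_pair:
  fixes n :: nat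
  assumes v: "v \<in> V" and E: "E \<subseteq> lists V \<times> lists V"
  defines "S \<equiv> {\<omega>\<in>space (walk_law G v \<Otimes>\<^sub>M walk_law G v). (prefix n (fst \<omega>), prefix n (snd \<omega>)) \<in> E}"
  shows "S \<in> sets (walk_law G v \<Otimes>\<^sub>M walk_law G v)"
    and "emeasure (walk_law G v \<Otimes>\<^sub>M walk_law G v) S = (\<integral>\<^sup>+xs. emeasure (measure_pmf (paths n v)) {ys. (xs, ys) \<in> E} \<partial>measure_pmf (paths n v))"
proof -
  let ?M = "walk_law G v"
  interpret prob_space ?M by (rule prob_space_walk_law[OF v])
  have m: "prefix n \<in> measurable ?M (count_space UNIV)" by (rule distr_prefix[OF v])
  have cE: "countable E" using countable_lists[OF countable_V] E by (meson countable_SIGMA countable_subset)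
  have "S = (\<Union>(a, c)\<in>E. (prefix n -` {a} \<inter> space ?M) \<times> (prefix n -` {c} \<inter> space ?M))"
    by (auto simp: S_def space_pair_measure)
  also have "\<dots> \<in> sets (?M \<Otimes>\<^sub>M ?M)"
    using cE m by (intro sets.countable_UN') (auto intro!: measurable_sets pair_measureI)
  finally show S: "S \<in> sets (?M \<Otimes>\<^sub>M ?M)" .
  have pm: "emeasure ?M (prefix n -` A \<inter> space ?M) = emeasure (measure_pmf (paths n v)) A" for A
    using distr_prefix(2)[OF v, of n] emeasure_distr[OF m, of A] by simp
  have "emeasure (?M \<Otimes>\<^sub>M ?M) S = (\<integral>\<^sup>+X. emeasure ?M (Pair X -` S) \<partial>?M)" by (rule emeasure_pair_measure_alt[OF S])
  also have "\<dots> = (\<integral>\<^sup>+X. emeasure (measure_pmf (paths n v)) {ys. (prefix n X, ys) \<in> E} \<partial>?M)"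
  proof (rule nn_integral_cong)
    fix X assume "X \<in> space ?M"
    then have "Pair X -` S = prefix n -` {ys. (prefix n X, ys) \<in> E} \<inter> space ?M" by (auto simp: S_def space_pair_measure)
    then show "emeasure ?M (Pair X -` S) = emeasure (measure_pmf (paths n v)) {ys. (prefix n X, ys) \<in> E}" by (simp only: pm)
  qed
  also have "\<dots> = (\<integral>\<^sup>+xs. emeasure (measure_pmf (paths n v)) {ys. (xs, ys) \<in> E} \<partial>distr ?M (count_space UNIV) (prefix n))"
    by (rule nn_integral_distr[symmetric, OF m]) simp
  finally show "emeasure (?M \<Otimes>\<^sub>M ?M) S = (\<integral>\<^sup>+xs. emeasure (measure_pmf (paths n v)) {ys. (xs, ys) \<in> E} \<partial>measure_pmf (paths n v))"
    by (simp add: distr_prefix(2)[OF v])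
qed

end

context wnet
begin

text \<open>Disjointness for all times implies disjointness up to the exit from \<open>D\<close>.
  The error terms are the probabilities that one of the walks has not left \<open>D\<close> after
  \<open>Suc k\<close> steps.\<close>

lemma q_prob_finite_horizon:
  assumes v: "v \<in> D"
  shows "q_prob G v \<le> W.range_val (\<lambda>C. \<Sum>z\<in>states D. T (Some v) z * W.avoid W.U k z C) W.U (Suc k) (Some v) {} + 2 * (real (card D) * bb (Suc k))"
proof -
  have vV: "v \<in> V" using v D_V by auto
  let ?M = "walk_law G v" and ?p = "paths (Suc k) v"
  interpret pair_prob_space ?M ?M using prob_space_walk_law[OF vV] by (intro pair_prob_space.intro pair_sigma_finite.intro prob_space_imp_sigma_finite)
  let ?a = "\<lambda>C. \<Sum>z\<in>states D. T (Some v) z * W.avoid W.U k z C"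
  have a0: "0 \<le> ?a C" for C by (intro sum_nonneg mult_nonneg_nonneg W.P_nonneg W.avoid_nonneg)
  \<comment> \<open>\<open>tl ys\<close> drops the starting vertex of the second walk, while
    \<open>ini xs\<close> keeps that of the first. Disjointness therefore also says that the second
    walk does not return to \<open>v\<close> before its exit.\<close>
  define E1 where "E1 = {(xs, ys). xs \<in> lists V \<and> ys \<in> lists V \<and> outs xs \<and> outs ys \<and> ini (tl ys) \<inter> ini xs = {}}"
  define E2 where "E2 = {(xs, ys). xs \<in> lists V \<and> ys \<in> lists V \<and> set xs \<subseteq> D}"
  define E3 where "E3 = {(xs, ys). xs \<in> lists V \<and> ys \<in> lists V \<and> set ys \<subseteq> D}"
  define S where "S E = {\<omega>\<in>space (?M \<Otimes>\<^sub>M ?M). (prefix (Suc k) (fst \<omega>), prefix (Suc k) (snd \<omega>)) \<in> E}" for E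
  have E: "E1 \<subseteq> lists V \<times> lists V" "E2 \<subseteq> lists V \<times> lists V" "E3 \<subseteq> lists V \<times> lists V" by (auto simp: E1_def E2_def E3_def)
  note s = E[THEN walk_pair(1)[OF vV, where n = "Suc k"], folded S_def]
  note e = E[THEN walk_pair(2)[OF vV, where n = "Suc k"], folded S_def]
  let ?Q = "{(X, Y). (X, Y) \<in> space (?M \<Otimes>\<^sub>M ?M) \<and> {X i |i. i > 0} \<inter> {Y i |i. i > 0} = {} \<and> v \<notin> {X i |i. i > 0} \<and> v \<notin> {Y i |i. i > 0}}"
  \<comment> \<open>The space of the walk law contains all sequences in the vertex set; starting at
    \<open>v\<close> holds only almost surely, and this null event collects the exceptions.\<close>
  define S0 where "S0 = {\<omega>\<in>space (?M \<Otimes>\<^sub>M ?M). hd (prefix (Suc k) (fst \<omega>)) \<noteq> v}"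
  have S0: "S0 = S {(xs, ys). xs \<in> lists V \<and> ys \<in> lists V \<and> hd xs \<noteq> v}"
    by (auto simp: S0_def S_def space_pair_measure space_walk_law[OF vV] prefix_def simp del: upt_Suc)
  have e0: "S0 \<in> sets (?M \<Otimes>\<^sub>M ?M)" "emeasure (?M \<Otimes>\<^sub>M ?M) S0 = 0"
  proof -
    have i: "{(xs, ys). xs \<in> lists V \<and> ys \<in> lists V \<and> hd xs \<noteq> v} \<subseteq> lists V \<times> lists V" by auto
    show "S0 \<in> sets (?M \<Otimes>\<^sub>M ?M)" unfolding S0 S_def by (rule walk_pair(1)[OF vV i])
    have "emeasure (?M \<Otimes>\<^sub>M ?M) S0 = (\<integral>\<^sup>+xs. 0 \<partial>measure_pmf ?p)"
      unfolding S0 S_def walk_pair(2)[OF vV i]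
    proof (intro nn_integral_cong_AE AE_pmfI)
      fix xs assume "xs \<in> set_pmf ?p"
      then show "emeasure (measure_pmf ?p) {ys. (xs, ys) \<in> {(xs, ys). xs \<in> lists V \<and> ys \<in> lists V \<and> hd xs \<noteq> v}} = 0"
        using paths_props[of xs "Suc k" v] by (simp del: paths.simps)
    qed
    then show "emeasure (?M \<Otimes>\<^sub>M ?M) S0 = 0" by simp
  qed
  have sub: "?Q \<subseteq> S0 \<union> (S E1 \<union> (S E2 \<union> S E3))"
  proof (rule subsetI)
    fix \<omega> assume w: "\<omega> \<in> ?Q"
    obtain X Y where XY: "\<omega> = (X, Y)" by (cases \<omega>)
    let ?x = "prefix (Suc k) X" and ?y = "prefix (Suc k) Y"
    have q: "X i \<noteq> Y j" "X i \<noteq> v" "Y j \<noteq> v" if "0 < i" "0 < j" for i j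
      using w XY that by (auto simp: disjoint_iff)
    have in_V: "X i \<in> V" "Y i \<in> V" for i using w XY by (auto simp: space_pair_measure space_walk_law[OF vV])
    have l: "?x \<in> lists V" "?y \<in> lists V" using in_V by (auto simp: prefix_def simp del: upt_Suc)
    have xe: "?x = X 0 # map X [1..<Suc (Suc k)]" "?y = Y 0 # map Y [1..<Suc (Suc k)]"
      by (simp_all add: prefix_def upt_rec[of 0] del: upt_Suc)
    consider "X 0 \<noteq> v" | "X 0 = v" "set ?x \<subseteq> D" | "set ?y \<subseteq> D" | "X 0 = v" "outs ?x" "outs ?y"
      unfolding outs_def by blast
    then show "\<omega> \<in> S0 \<union> (S E1 \<union> (S E2 \<union> S E3))"
    proof cases
      case 1
      then show ?thesis using w XY xe by (simp add: S0_def)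
    next
      case 2
      then show ?thesis using w XY l by (simp add: S_def E2_def)
    next
      case 3
      then show ?thesis using w XY l by (simp add: S_def E3_def)
    next
      case 4
      have "X i \<noteq> Y j" if "0 < j" for i j using q[of i j] q[of 1 j] that 4(1) by (cases "i = 0") auto
      then have ne: "Y j \<noteq> X i" if "Suc 0 \<le> j" for i j using that by (metis Suc_le_eq)
      have "set (tl ?y) \<inter> set ?x = {}" unfolding xe using ne ne[symmetric] by (auto simp del: upt_Suc)
      moreover have "ini xs \<subseteq> Some ` set xs" for xs by (auto simp: ini_def dest: set_takeWhileD)
      ultimately have "ini (tl ?y) \<inter> ini ?x = {}" by blast
      then show ?thesis using w XY l 4 by (simp add: S_def E1_def)
    qed
  qed
  have st: "emeasure (measure_pmf ?p) {xs. set xs \<subseteq> D} \<le> ennreal (real (card D) * bb (Suc k))"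
    using paths_stay_le[OF D_fin D_V vV, of "Suc k"] by (simp add: measure_pmf.emeasure_eq_measure ennreal_leI del: paths.simps)
  have b1: "emeasure (?M \<Otimes>\<^sub>M ?M) (S E1) \<le> ennreal (W.range_val ?a W.U (Suc k) (Some v) {})"
  proof -
    have "emeasure (?M \<Otimes>\<^sub>M ?M) (S E1) \<le> (\<integral>\<^sup>+xs. ennreal (of_bool (outs xs) * ?a ({} \<union> ini xs)) \<partial>measure_pmf ?p)"
      unfolding e(1)
    proof (rule nn_integral_mono)
      fix xs
      show "emeasure (measure_pmf ?p) {ys. (xs, ys) \<in> E1} \<le> ennreal (of_bool (outs xs) * ?a ({} \<union> ini xs))"
      proof (cases "outs xs")
        case True
        let ?C = "ini xs"
        have nC: "None \<notin> ?C" by (auto simp: ini_def)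
        have "emeasure (measure_pmf ?p) {ys. (xs, ys) \<in> E1} \<le> emeasure (measure_pmf ?p) {ys. outs ys \<and> ini (tl ys) \<inter> ?C = {}}"
          by (intro emeasure_mono) (auto simp: E1_def)
        also have "\<dots> = (\<integral>\<^sup>+z. emeasure (measure_pmf (paths k z)) {ys. outs ys \<and> ini ys \<inter> ?C = {}} \<partial>measure_pmf (walk_step G v))"
          unfolding emeasure_paths_Suc using v by (simp add: outs_def)
        also have "\<dots> = (\<integral>\<^sup>+z. ennreal (W.avoid W.U k (op z) ?C) \<partial>measure_pmf (walk_step G v))"
          using set_walk_step[OF vV] by (intro nn_integral_cong_AE AE_pmfI avoid_paths[OF nC, symmetric]) auto
        also have "\<dots> = ennreal (?a ?C)" by (rule nn_step[OF v W.avoid_nonneg])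
        finally show ?thesis using True by simp
      qed (simp add: E1_def)
    qed
    also have "\<dots> = ennreal (W.range_val ?a W.U (Suc k) (op v) {})" by (rule range_val_paths[symmetric, OF a0 vV])
    finally show ?thesis using v by (simp add: op_def)
  qed
  have b2: "emeasure (?M \<Otimes>\<^sub>M ?M) (S E2) \<le> ennreal (real (card D) * bb (Suc k))"
  proof -
    have "emeasure (?M \<Otimes>\<^sub>M ?M) (S E2) \<le> (\<integral>\<^sup>+xs. indicator {xs. set xs \<subseteq> D} xs \<partial>measure_pmf ?p)"
      unfolding e(2)
    proof (rule nn_integral_mono)
      fix xs
      show "emeasure (measure_pmf ?p) {ys. (xs, ys) \<in> E2} \<le> indicator {xs. set xs \<subseteq> D} xs"
        using measure_pmf.emeasure_le_1[of ?p] by (auto simp: E2_def indicator_def simp del: paths.simps)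
    qed
    then show ?thesis using st by (simp del: paths.simps)
  qed
  have b3: "emeasure (?M \<Otimes>\<^sub>M ?M) (S E3) \<le> ennreal (real (card D) * bb (Suc k))"
  proof -
    have "emeasure (?M \<Otimes>\<^sub>M ?M) (S E3) \<le> (\<integral>\<^sup>+xs. emeasure (measure_pmf ?p) {xs. set xs \<subseteq> D} \<partial>measure_pmf ?p)"
      unfolding e(3) by (intro nn_integral_mono emeasure_mono) (auto simp: E3_def)
    also have "\<dots> = emeasure (measure_pmf ?p) {xs. set xs \<subseteq> D}" by (simp add: measure_pmf.emeasure_space_1 del: paths.simps)
    finally show ?thesis using st by order
  qed
  have R0: "0 \<le> W.range_val ?a W.U (Suc k) (Some v) {}" by (rule range_val_nonneg[OF a0])
  have c0: "0 \<le> real (card D) * bb (Suc k)" by (simp add: bb_nonneg)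
  have "emeasure (?M \<Otimes>\<^sub>M ?M) (S0 \<union> (S E1 \<union> (S E2 \<union> S E3))) \<le>
     emeasure (?M \<Otimes>\<^sub>M ?M) S0 + (emeasure (?M \<Otimes>\<^sub>M ?M) (S E1) + (emeasure (?M \<Otimes>\<^sub>M ?M) (S E2) + emeasure (?M \<Otimes>\<^sub>M ?M) (S E3)))"
    using s e0 by (intro order_trans[OF emeasure_subadditive] add_mono order_refl) auto
  also have "\<dots> \<le> 0 + (ennreal (W.range_val ?a W.U (Suc k) (Some v) {}) + (ennreal (real (card D) * bb (Suc k)) + ennreal (real (card D) * bb (Suc k))))"
    using b1 b2 b3 e0 by (intro add_mono) auto
  also have "\<dots> = ennreal (W.range_val ?a W.U (Suc k) (Some v) {} + 2 * (real (card D) * bb (Suc k)))"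
    unfolding mult_2 using R0 c0 by (subst ennreal_plus, simp, simp, subst ennreal_plus) auto
  finally have "measure (?M \<Otimes>\<^sub>M ?M) (S0 \<union> (S E1 \<union> (S E2 \<union> S E3))) \<le> W.range_val ?a W.U (Suc k) (Some v) {} + 2 * (real (card D) * bb (Suc k))"
    unfolding P.emeasure_eq_measure using R0 c0 by (subst (asm) ennreal_le_iff) auto
  moreover have "measure (?M \<Otimes>\<^sub>M ?M) ?Q \<le> measure (?M \<Otimes>\<^sub>M ?M) (S0 \<union> (S E1 \<union> (S E2 \<union> S E3)))"
    using sub s e0 by (intro P.finite_measure_mono) auto
  ultimately show ?thesis unfolding q_prob_def by linarith
qed

lemma q_prob_le:
  assumes v: "v \<in> D"
  shows "q_prob G v * W.Z W.U \<le> W.ZZ W.U (\<lambda>f. W.esc W.U ({a. reach f (Some v) a} \<inter> W.U) (Some v))"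
proof -
  let ?E = "W.ZZ W.U (\<lambda>f. W.esc W.U ({a. reach f (Some v) a} \<inter> W.U) (Some v))"
  have Zp: "0 < W.Z W.U" by (rule W.Z_pos[OF W.SI])
  have *: "q_prob G v * W.Z W.U \<le> ?E + 2 * (real (card D) * bb (Suc k)) * W.Z W.U" for k
  proof -
    have "q_prob G v * W.Z W.U \<le> (W.range_val (\<lambda>C. \<Sum>z\<in>states D. T (Some v) z * W.avoid W.U k z C) W.U (Suc k) (Some v) {} + 2 * (real (card D) * bb (Suc k))) * W.Z W.U"
      using q_prob_finite_horizon[OF v, of k] Zp by (intro mult_right_mono) auto
    also have "\<dots> \<le> ?E + 2 * (real (card D) * bb (Suc k)) * W.Z W.U"
      unfolding distrib_right using v by (intro add_mono W.two_walks_le_esc[OF W.SI] order_refl) auto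
    finally show ?thesis .
  qed
  have "(\<lambda>k. ?E + 2 * (real (card D) * bb (Suc k)) * W.Z W.U) \<longlonglongrightarrow> ?E + 2 * (real (card D) * 0) * W.Z W.U"
    by (intro tendsto_intros LIMSEQ_Suc bb_lim)
  then show ?thesis using * by (intro LIMSEQ_le_const[where X = "\<lambda>k. ?E + 2 * (real (card D) * bb (Suc k)) * W.Z W.U"]) auto
qed

end

section \<open>The wired uniform spanning tree as a random forest\<close>

lemma rtrancl_distinct_path:
  assumes "(x, y) \<in> r\<^sup>*"
  shows "\<exists>xs. xs \<noteq> [] \<and> hd xs = x \<and> last xs = y \<and> distinct xs \<and> successively (\<lambda>a b. (a, b) \<in> r) xs"
  using assms
proof (induction rule: converse_rtrancl_induct)
  case base
  show ?case by (intro exI[of _ "[y]"]) auto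
next
  case (step x z)
  then obtain xs where xs: "xs \<noteq> []" "hd xs = z" "last xs = y" "distinct xs" "successively (\<lambda>a b. (a, b) \<in> r) xs" by blast
  show ?case
  proof (cases "x \<in> set xs")
    case True
    then obtain as bs where "xs = as @ x # bs" by (meson split_list)
    then show ?thesis using xs by (intro exI[of _ "x # bs"]) (auto simp: successively_append_iff)
  next
    case False
    then show ?thesis using xs step.hyps(1) by (intro exI[of _ "x # xs"]) (cases xs; auto)
  qed
qed

lemma graph_dist_le: "(u, w) \<in> adj H ^^ n \<Longrightarrow> graph_dist H u w \<le> enat n"
  unfolding graph_dist_def by (rule INF_lower) simp

lemma graph_dist_eqI:
  assumes "(u, w) \<in> adj H ^^ n" "\<And>m. (u, w) \<in> adj H ^^ m \<Longrightarrow> n \<le> m"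
  shows "graph_dist H u w = enat n"
proof (rule antisym)
  show "graph_dist H u w \<le> enat n" by (rule graph_dist_le[OF assms(1)])
  show "enat n \<le> graph_dist H u w" unfolding graph_dist_def by (rule INF_greatest) (use assms(2) in auto)
qed

lemma adj_sym: "(u, w) \<in> adj H \<Longrightarrow> (w, u) \<in> adj H"
  by (auto simp: adj_def insert_commute)

text \<open>A distinct path in \<open>T'\<close> between the ends of a missing edge \<open>e\<close>
  closes up with \<open>e\<close> to a cycle in \<open>T\<close>. If \<open>e\<close> is a loop, the
  path is a single vertex and the cycle has length one.\<close>

lemma spanning_tree_extra_edge:
  assumes T': "connected_graph (H\<lparr>edges := T'\<rparr>)" and T: "\<nexists>vs es. is_cycle (H\<lparr>edges := T\<rparr>) vs es"
    and sub: "T' \<subseteq> T" and e: "e \<in> T" "ends H e = {x, y}" "x \<in> verts H" "y \<in> verts H"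
  shows "e \<in> T'"
proof (rule ccontr)
  assume e': "e \<notin> T'"
  have "(x, y) \<in> (adj (H\<lparr>edges := T'\<rparr>))\<^sup>*" using T' e by (simp add: connected_graph_def)
  from rtrancl_distinct_path[OF this] obtain xs where xs: "xs \<noteq> []" "hd xs = x" "last xs = y" "distinct xs"
    and s: "successively (\<lambda>a b. (a, b) \<in> adj (H\<lparr>edges := T'\<rparr>)) xs" by blast
  define n where "n = length xs - 1"
  have len: "length xs = Suc n" using xs(1) by (cases xs) (auto simp: n_def)
  have ex: "\<exists>a\<in>T'. ends H a = {xs ! i, xs ! Suc i}" if "i < n" for i
    using successively_nth[OF s, of i] that len by (auto simp: adj_def)
  define c where "c i = (SOME a. a \<in> T' \<and> ends H a = {xs ! i, xs ! Suc i})" for i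
  have c: "c i \<in> T'" "ends H (c i) = {xs ! i, xs ! Suc i}" if "i < n" for i
    using someI_ex[of "\<lambda>a. a \<in> T' \<and> ends H a = {xs ! i, xs ! Suc i}"] ex[OF that] unfolding c_def by blast+
  let ?es = "map c [0..<n] @ [e]"
  have inj: "inj_on c {0..<n}"
  proof (rule inj_onI)
    fix i j assume ij: "i \<in> {0..<n}" "j \<in> {0..<n}" "c i = c j"
    then have "{xs ! i, xs ! Suc i} = {xs ! j, xs ! Suc j}" using c(2)[of i] c(2)[of j] by simp
    then have "{i, Suc i} = {j, Suc j}" using ij len xs(4) by (auto simp: doubleton_eq_iff nth_eq_iff_index_eq)
    then show "i = j" by (auto simp: doubleton_eq_iff)
  qed
  have "is_cycle (H\<lparr>edges := T\<rparr>) xs ?es"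
    unfolding is_cycle_def
  proof (intro conjI allI impI)
    show "distinct ?es" using inj c(1) e' by (auto simp: distinct_map)
    show "set ?es \<subseteq> edges (H\<lparr>edges := T\<rparr>)" using c(1) sub e by auto
    fix i assume "i < length ?es"
    then consider "i < n" | "i = n" by force
    then show "ends (H\<lparr>edges := T\<rparr>) (?es ! i) = {xs ! i, xs ! (Suc i mod length ?es)}"
    proof cases
      case 1
      then show ?thesis using c(2)[OF 1] by (simp add: nth_append)
    next
      case 2
      have "xs ! n = y" "xs ! 0 = x" using xs len by (auto simp: last_conv_nth hd_conv_nth)
      then show ?thesis using 2 e by (simp add: nth_append insert_commute)
    qed
  qed (use len xs in auto)
  then show False using T by blast
qed

context wnet
begin

abbreviation H :: "('v option, 'e) network" where "H \<equiv> wired G D"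

section \<open>Independent out-edges conditioned on acyclicity\<close>

definition prod_edges :: "('v \<Rightarrow> 'e) pmf" where
  "prod_edges = Pi_pmf D undefined (walk_edge G)"

definition succ_map :: "('v \<Rightarrow> 'e) \<Rightarrow> 'v option \<Rightarrow> 'v option" where
  "succ_map \<eta> s = (case s of None \<Rightarrow> None | Some u \<Rightarrow> if u \<in> D then op (other_end G u (\<eta> u)) else Some u)"

definition acyc :: "('v \<Rightarrow> 'e) set" where
  "acyc = {\<eta>. succ_map \<eta> \<in> forests (states D) W.U}"

lemma verts_H: "verts H = states D" and ends_H: "ends H e = op ` ends G e"
  and edges_H: "edges H = {e\<in>edges G. ends G e \<inter> D \<noteq> {}}" and cond_H: "cond H = cond G"
  by (auto simp: wired_def states_def op_def)

lemma op_states: "op x \<in> states D"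
  by (auto simp: op_def states_def)

lemma set_prod_edges: "\<eta> \<in> set_pmf prod_edges \<longleftrightarrow> (\<forall>u\<in>D. \<eta> u \<in> incident G u) \<and> (\<forall>u. u \<notin> D \<longrightarrow> \<eta> u = undefined)"
  using D_V by (auto simp: prod_edges_def set_Pi_pmf[OF D_fin] PiE_dflt_def set_walk_edge subset_iff)

lemma ends_incident: "u \<in> D \<Longrightarrow> e \<in> incident G u \<Longrightarrow> ends H e = {Some u, op (other_end G u e)}"
  unfolding ends_H by (subst incident_ends(1)[of e u]) (auto simp: op_def)

lemma prob_box: "prb prod_edges {\<eta>. \<forall>u\<in>D. \<eta> u \<in> C u} = (\<Prod>u\<in>D. prb (walk_edge G u) (C u))"
  using measure_Pi_pmf_Pi[OF D_fin, of undefined "walk_edge G" C] by (simp add: prod_edges_def Pi_def Ball_def)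

lemma measure_succ: "u \<in> D \<Longrightarrow> s \<in> states D \<Longrightarrow> prb (walk_edge G u) {e. op (other_end G u e) = s} = T (Some u) s"
  by (subst pmf_op[symmetric]) (auto simp: walk_step_def pmf_map vimage_def)

lemma prob_succ_map:
  assumes "f \<in> forests (states D) W.U"
  shows "prb prod_edges {\<eta>. succ_map \<eta> = f} = W.wt W.U f"
proof -
  have f: "f (Some u) \<in> states D" if "u \<in> D" for u using forests_in[OF assms] that by auto
  have fo: "f s = s" if "s \<notin> W.U" for s using forests_out[OF assms that] .
  have "{\<eta>. succ_map \<eta> = f} = {\<eta>. \<forall>u\<in>D. \<eta> u \<in> {e. op (other_end G u e) = f (Some u)}}"
  proof (intro equalityI subsetI)
    fix \<eta> assume "\<eta> \<in> {\<eta>. \<forall>u\<in>D. \<eta> u \<in> {e. op (other_end G u e) = f (Some u)}}"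
    then have "succ_map \<eta> s = f s" for s using fo[of s] by (cases s) (auto simp: succ_map_def image_iff)
    then show "\<eta> \<in> {\<eta>. succ_map \<eta> = f}" by auto
  qed (auto simp: succ_map_def)
  then show ?thesis
    using f by (simp add: prob_box[of "\<lambda>u. {e. op (other_end G u e) = f (Some u)}", simplified] W.wt_def prod.reindex measure_succ del: thin.simps)
qed

lemma prob_acyc_sum:
  "prb prod_edges {\<eta>\<in>acyc. A (succ_map \<eta>)} = W.ZZ W.U (\<lambda>f. of_bool (A f))"
proof -
  let ?F = "{f\<in>forests (states D) W.U. A f}"
  have fin: "finite (forests (states D) W.U)" by (rule W.fin_forests[OF W.SI])
  have "{\<eta>\<in>acyc. A (succ_map \<eta>)} = (\<Union>f\<in>?F. {\<eta>. succ_map \<eta> = f})" by (auto simp: acyc_def)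
  then have "prb prod_edges {\<eta>\<in>acyc. A (succ_map \<eta>)} = (\<Sum>f\<in>?F. prb prod_edges {\<eta>. succ_map \<eta> = f})"
    using fin by (simp only:) (intro measure_pmf.finite_measure_finite_Union, auto simp: disjoint_family_on_def)
  also have "\<dots> = (\<Sum>f\<in>?F. W.wt W.U f)" by (intro sum.cong refl prob_succ_map) auto
  also have "\<dots> = W.ZZ W.U (\<lambda>f. of_bool (A f))"
    unfolding W.ZZ_def using fin by (simp add: sum.inter_filter[symmetric] if_distrib cong: if_cong) (intro sum.cong, auto)
  finally show ?thesis .
qed

lemma prob_acyc: "prb prod_edges acyc = W.Z W.U"
  using prob_acyc_sum[of "\<lambda>_. True"] by simp

lemma prob_acyc_pos: "0 < prb prod_edges acyc"
  unfolding prob_acyc by (rule W.Z_pos[OF W.SI])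

lemma acyc_ne: "set_pmf prod_edges \<inter> acyc \<noteq> {}"
  using prob_acyc_pos measure_pmf_zero_iff[of prod_edges acyc] by auto

definition forest_pmf :: "('v \<Rightarrow> 'e) pmf" where
  "forest_pmf = cond_pmf prod_edges acyc"

lemma set_forest_pmf: "set_pmf forest_pmf = set_pmf prod_edges \<inter> acyc"
  unfolding forest_pmf_def by (rule set_cond_pmf[OF acyc_ne])

lemma measure_forest_pmf:
  "prb forest_pmf A = prb prod_edges (acyc \<inter> A) / W.Z W.U"
  unfolding forest_pmf_def cond_pmf.rep_eq[OF acyc_ne]
  using prob_acyc_pos by (subst measure_uniform_measure) (auto simp: measure_pmf.emeasure_eq_measure prob_acyc)

lemma forest_prob: "prb forest_pmf {\<eta>. A (succ_map \<eta>)} = W.ZZ W.U (\<lambda>f. of_bool (A f)) / W.Z W.U"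
  unfolding measure_forest_pmf using prob_acyc_sum[of A] by (simp add: Collect_conj_eq)

text \<open>Resetting the successor of \<open>u\<close> frees the choice of its edge from the
  acyclicity constraint and makes it independent of the rest. The price is a quotient of partition
  functions, at most \<open>W.BB\<close>.\<close>

lemma forest_edge_prob:
  assumes u: "u \<in> D"
  shows "prb forest_pmf {\<eta>. \<eta> u \<in> X} \<le> W.BB * prb (walk_edge G u) X"
proof -
  let ?W = "W.U - {Some u}" and ?p = "prb (walk_edge G u) X"
  let ?F = "forests (states D) ?W"
  have WI: "?W \<subseteq> W.I" using W.SI by auto
  have fin: "finite ?F" by (rule W.fin_forests[OF WI])
  have "acyc \<inter> {\<eta>. \<eta> u \<in> X} \<subseteq> (\<Union>g\<in>?F. {\<eta>. \<eta> u \<in> X \<and> (succ_map \<eta>)(Some u := Some u) = g})"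
    using u by (auto simp: acyc_def intro: forests_reset)
  then have "prb prod_edges (acyc \<inter> {\<eta>. \<eta> u \<in> X}) \<le> prb prod_edges (\<Union>g\<in>?F. {\<eta>. \<eta> u \<in> X \<and> (succ_map \<eta>)(Some u := Some u) = g})"
    by (intro measure_pmf.finite_measure_mono) auto
  also have "\<dots> \<le> (\<Sum>g\<in>?F. prb prod_edges {\<eta>. \<eta> u \<in> X \<and> (succ_map \<eta>)(Some u := Some u) = g})"
    by (rule measure_pmf.finite_measure_subadditive_finite[OF fin]) auto
  also have "\<dots> \<le> (\<Sum>g\<in>?F. ?p * W.wt ?W g)"
  proof (rule sum_mono)
    fix g assume g: "g \<in> ?F"
    let ?C = "\<lambda>w. if w = u then X else {e. op (other_end G w e) = g (Some w)}"
    have "prb prod_edges {\<eta>. \<eta> u \<in> X \<and> (succ_map \<eta>)(Some u := Some u) = g} \<le> prb prod_edges {\<eta>. \<forall>w\<in>D. \<eta> w \<in> ?C w}"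
      by (intro measure_pmf.finite_measure_mono) (auto simp: succ_map_def)
    also have "\<dots> = ?p * (\<Prod>w\<in>D - {u}. prb (walk_edge G w) (?C w))"
      using u by (subst prob_box) (simp add: prod.remove[OF D_fin])
    also have "(\<Prod>w\<in>D - {u}. prb (walk_edge G w) (?C w)) = (\<Prod>w\<in>D - {u}. T (Some w) (g (Some w)))"
      using forests_in[OF g] by (intro prod.cong refl) (auto simp: measure_succ[symmetric] simp del: thin.simps)
    also have "\<dots> = W.wt ?W g"
    proof -
      have "?W = Some ` (D - {u})" by auto
      then show ?thesis by (simp add: W.wt_def prod.reindex)
    qed
    finally show "prb prod_edges {\<eta>. \<eta> u \<in> X \<and> (succ_map \<eta>)(Some u := Some u) = g} \<le> ?p * W.wt ?W g" .
  qed
  also have "\<dots> = ?p * W.Z ?W" by (simp add: W.ZZ_def sum_distrib_left)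
  also have "\<dots> \<le> ?p * (W.BB * W.Z W.U)"
    using W.Z_remove_le[OF W.SI, of "Some u"] u by (intro mult_left_mono) (auto simp: W.B_BB)
  finally show ?thesis
    unfolding measure_forest_pmf using W.Z_pos[OF W.SI] by (simp add: divide_le_eq mult_ac)
qed

section \<open>Spanning trees of the wired network and their orientation\<close>

definition dep :: "('v option \<Rightarrow> 'v option) \<Rightarrow> 'v option \<Rightarrow> nat" where
  "dep f x = (LEAST n. (f ^^ n) x \<notin> W.U)"

lemma dep_out: "x \<notin> W.U \<Longrightarrow> dep f x = 0"
  unfolding dep_def by (rule Least_equality) auto

lemma dep_in:
  assumes f: "f \<in> forests (states D) W.U" and x: "x \<in> W.U"
  shows "dep f x = Suc (dep f (f x))"
proof -
  obtain n where "(f ^^ n) x \<notin> W.U" using forests_exit[OF f] by blast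
  from Least_Suc[of "\<lambda>n. (f ^^ n) x \<notin> W.U", OF this] x show ?thesis unfolding dep_def by (simp add: funpow_Suc_right_apply del: funpow.simps)
qed

text \<open>Depth in the forest changes by exactly one along every tree edge, hence it is the graph
  distance to \<open>None\<close>, and the orientation towards \<open>None\<close> gives back the
  chosen out-edges.\<close>

lemma H_tree:
  assumes \<eta>: "\<eta> \<in> set_pmf prod_edges" "\<eta> \<in> acyc"
  shows "\<eta> ` D \<in> spanning_trees H" and "orient_towards H None (\<eta> ` D) = {(Some u, \<eta> u) |u. u \<in> D}" and "inj_on \<eta> D"
proof -
  let ?f = "succ_map \<eta>" and ?T = "\<eta> ` D"
  let ?K = "H\<lparr>edges := ?T\<rparr>"
  have f: "?f \<in> forests (states D) W.U" using \<eta>(2) by (simp add: acyc_def)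
  have inc: "\<eta> u \<in> incident G u" if "u \<in> D" for u using \<eta>(1) that by (simp add: set_prod_edges)
  have en: "ends H (\<eta> u) = {Some u, ?f (Some u)}" if "u \<in> D" for u
    using ends_incident[OF that inc[OF that]] that by (simp add: succ_map_def)
  have dp: "dep ?f (Some u) = Suc (dep ?f (?f (Some u)))" if "u \<in> D" for u
    using dep_in[OF f, of "Some u"] that by simp
  have adjK: "(x, y) \<in> adj ?K \<longleftrightarrow> (x \<in> W.U \<and> y = ?f x) \<or> (y \<in> W.U \<and> x = ?f y)" for x y
    using en by (auto simp: adj_def doubleton_eq_iff)
  have to_root: "(x, None) \<in> adj ?K ^^ dep ?f x" if "x \<in> states D" for x
    using that
  proof (induction "dep ?f x" arbitrary: x)
    case 0
    then have "x = None" using dp by (auto simp: states_def)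
    then show ?case using 0 by simp
  next
    case (Suc n)
    have x: "x \<in> W.U" using Suc.hyps(2) Suc.prems dep_out[of None ?f] by (auto simp: states_def)
    then have "n = dep ?f (?f x)" using dep_in[OF f x] Suc.hyps(2) by simp
    from Suc.hyps(1)[OF this] have "(?f x, None) \<in> adj ?K ^^ n" using forests_in[OF f x] \<open>n = _\<close> by simp
    then show ?case unfolding Suc.hyps(2)[symmetric] using x adjK by (intro relpow_Suc_I2) auto
  qed
  have lip: "dep ?f x \<le> m" if "(x, None) \<in> adj ?K ^^ m" for x m
    using that
  proof (induction m arbitrary: x)
    case (Suc m)
    then obtain y where y: "(x, y) \<in> adj ?K" "(y, None) \<in> adj ?K ^^ m" by (meson relpow_Suc_D2)
    have "dep ?f x \<le> Suc (dep ?f y)" using y(1) adjK dep_in[OF f] by auto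
    then show ?case using Suc.IH[OF y(2)] by simp
  qed (simp add: dep_out image_iff)
  have dist: "graph_dist ?K x None = enat (dep ?f x)" if "x \<in> states D" for x
    by (rule graph_dist_eqI[OF to_root[OF that] lip])
  have neq: "Some u \<noteq> ?f (Some u)" if "u \<in> D" for u using dp[OF that] by (metis n_not_Suc_n)
  show inj: "inj_on \<eta> D"
  proof (rule inj_onI)
    fix u w assume a: "u \<in> D" "w \<in> D" "\<eta> u = \<eta> w"
    then have "{Some u, ?f (Some u)} = {Some w, ?f (Some w)}" using en by metis
    then consider "u = w" | "?f (Some u) = Some w" "?f (Some w) = Some u" unfolding doubleton_eq_iff by (metis option.inject)
    then show "u = w"
    proof cases
      case 2
      show ?thesis using dp[OF a(1), unfolded 2(1)] dp[OF a(2), unfolded 2(2)] by linarith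
    qed
  qed
  have conn: "connected_graph ?K"
    unfolding connected_graph_def
  proof (intro conjI ballI)
    show "verts ?K \<noteq> {}" by (simp add: verts_H states_def)
    fix x y assume "x \<in> verts ?K" "y \<in> verts ?K"
    then have "(x, None) \<in> (adj ?K)\<^sup>*" "(y, None) \<in> (adj ?K)\<^sup>*" using to_root by (auto simp: verts_H intro: relpow_imp_rtrancl)
    moreover have "sym ((adj ?K)\<^sup>*)" by (rule sym_rtrancl, rule symI, erule adj_sym)
    ultimately show "(x, y) \<in> (adj ?K)\<^sup>*" by (meson symD rtrancl_trans)
  qed
  have nocyc: "\<nexists>vs es. is_cycle ?K vs es"
  proof
    assume "\<exists>vs es. is_cycle ?K vs es"
    then obtain vs es where c: "es \<noteq> []" "length vs = length es" "distinct es" "set es \<subseteq> ?T"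
      and ce: "\<And>i. i < length es \<Longrightarrow> ends H (es ! i) = {vs ! i, vs ! (Suc i mod length es)}"
      by (auto simp: is_cycle_def)
    let ?n = "length es"
    have n0: "0 < ?n" using c by simp
    define d where "d i = dep ?f (vs ! i)" for i
    \<comment> \<open>At a vertex of maximal depth on a cycle both cycle edges lead to vertices that
      are not deeper, so each is the out-edge of that vertex. The two edges coincide, the cycle is a
      loop, and a vertex would be its own successor.\<close>
    define m where "m = (ARG_MAX d i. i < ?n)"
    have m: "m < ?n" and mx: "\<And>i. i < ?n \<Longrightarrow> d i \<le> d m"
      using arg_max_nat_lemma[of "\<lambda>i. i < ?n" 0 d "Suc (Max (d ` {..<?n}))"] n0
      by (auto simp: m_def less_Suc_eq_le)
    define m' where "m' = (m + ?n - 1) mod ?n"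
    have m': "m' < ?n" "Suc m' mod ?n = m"
      using n0 m by (auto simp: m'_def mod_Suc_eq)
    have top: "\<exists>u\<in>D. vs ! i = Some u \<and> es ! j = \<eta> u" if j: "j < ?n" and eq: "{vs ! j, vs ! (Suc j mod ?n)} = {vs ! i, vs ! k}" and dk: "d k \<le> d i" for i j k
    proof -
      have "es ! j \<in> ?T" using c(4) j nth_mem[OF j] by blast
      then obtain u where u: "u \<in> D" "es ! j = \<eta> u" by blast
      then have "{Some u, ?f (Some u)} = {vs ! i, vs ! k}" using en[OF u(1)] ce[OF j] eq by simp
      then consider "vs ! i = Some u" | "vs ! i = ?f (Some u)" "vs ! k = Some u" unfolding doubleton_eq_iff by metis
      then show ?thesis
      proof cases
        case 2
        then show ?thesis using dp[OF u(1)] dk by (simp add: d_def)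
      qed (use u in auto)
    qed
    obtain u where u: "u \<in> D" "vs ! m = Some u" "es ! m = \<eta> u"
      using top[OF m refl] mx[of "Suc m mod ?n"] n0 by auto
    have "{vs ! m', vs ! (Suc m' mod ?n)} = {vs ! m, vs ! m'}" using m'(2) by auto
    from top[OF m'(1) this mx[OF m'(1)]] obtain u' where u': "u' \<in> D" "vs ! m = Some u'" "es ! m' = \<eta> u'" by auto
    have "es ! m = es ! m'" using u u' by simp
    then have "m = m'" using c(3) m m'(1) by (simp add: nth_eq_iff_index_eq)
    then have "vs ! (Suc m mod ?n) = vs ! m" using m'(2) by simp
    then have "ends H (\<eta> u) = {vs ! m}" using ce[OF m] u(3) by simp
    then have "{Some u, ?f (Some u)} = {vs ! m}" using en[OF u(1)] by metis
    then show False using neq[OF u(1)] by (metis singletonD insertI1 insertI2)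
  qed
  have "?T \<subseteq> edges H" using inc by (auto simp: edges_H incident_def)
  then show "?T \<in> spanning_trees H" using conn nocyc by (auto simp: spanning_trees_def is_tree_def)
  show "orient_towards H None ?T = {(Some u, \<eta> u) |u. u \<in> D}"
  proof (intro equalityI subsetI)
    fix p assume "p \<in> orient_towards H None ?T"
    then obtain x u w where p: "p = (x, \<eta> u)" "u \<in> D" "ends H (\<eta> u) = {x, w}" "graph_dist ?K w None < graph_dist ?K x None"
      unfolding orient_towards_def by auto
    have fs: "?f (Some u) \<in> states D" using forests_in[OF f] p(2) by simp
    have us: "Some u \<in> states D" using p(2) by (simp add: states_def)
    from en[OF p(2)] p(3) consider "x = Some u" | "x = ?f (Some u)" "w = Some u" by (auto simp: doubleton_eq_iff)
    then show "p \<in> {(Some u, \<eta> u) |u. u \<in> D}"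
    proof cases
      case 2
      then show ?thesis using p(4) dist[OF fs] dist[OF us] dp[OF p(2)] by simp
    qed (use p in auto)
  next
    fix p assume "p \<in> {(Some u, \<eta> u) |u. u \<in> D}"
    then obtain u where p: "p = (Some u, \<eta> u)" "u \<in> D" by auto
    have fs: "?f (Some u) \<in> states D" using forests_in[OF f] p(2) by simp
    have us: "Some u \<in> states D" using p(2) by (simp add: states_def)
    show "p \<in> orient_towards H None ?T"
      unfolding orient_towards_def using p en[OF p(2)] dist[OF fs] dist[OF us] dp[OF p(2)] by auto
  qed
qed

text \<open>Each vertex selects an edge of the tree that decreases the distance to the root. The
  selected edges form a spanning tree inside the given one, and a spanning tree contains no smaller
  connected spanning subgraph.\<close>

lemma H_tree_surj:
  assumes T0: "T0 \<in> spanning_trees H"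
  shows "\<exists>\<eta>\<in>set_pmf prod_edges \<inter> acyc. T0 = \<eta> ` D"
proof -
  let ?K = "H\<lparr>edges := T0\<rparr>"
  have TE: "T0 \<subseteq> edges H" and conn: "connected_graph ?K" and nocyc: "\<nexists>vs es. is_cycle ?K vs es"
    using T0 by (auto simp: spanning_trees_def is_tree_def)
  define \<delta> where "\<delta> x = (LEAST n. (x, None) \<in> adj ?K ^^ n)" for x
  have ex: "\<exists>n. (x, None) \<in> adj ?K ^^ n" if "x \<in> states D" for x
    using conn that by (auto simp: connected_graph_def verts_H states_def intro: rtrancl_imp_relpow)
  have step: "\<exists>e. e \<in> T0 \<and> (\<exists>y. ends H e = {Some u, y} \<and> \<delta> y < \<delta> (Some u))" if u: "u \<in> D" for u
  proof -
    have us: "Some u \<in> states D" using u by (simp add: states_def)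
    have l: "(Some u, None) \<in> adj ?K ^^ \<delta> (Some u)" unfolding \<delta>_def by (rule LeastI_ex[OF ex[OF us]])
    then obtain n where n: "\<delta> (Some u) = Suc n" by (cases "\<delta> (Some u)") auto
    with l obtain y where y: "(Some u, y) \<in> adj ?K" "(y, None) \<in> adj ?K ^^ n" by (metis relpow_Suc_D2)
    have "\<delta> y \<le> n" unfolding \<delta>_def using y(2) by (rule Least_le[where P = "\<lambda>n. (y, None) \<in> adj (H\<lparr>edges := T0\<rparr>) ^^ n"])
    moreover obtain e where "e \<in> T0" "ends H e = {Some u, y}" using y(1) by (auto simp: adj_def)
    ultimately show ?thesis using n by (intro exI[of _ e] conjI exI[of _ y]) auto
  qed
  define \<eta> where "\<eta> u = (if u \<in> D then SOME e. e \<in> T0 \<and> (\<exists>y. ends H e = {Some u, y} \<and> \<delta> y < \<delta> (Some u)) else undefined)" for u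
  have \<eta>: "\<eta> u \<in> T0 \<and> (\<exists>y. ends H (\<eta> u) = {Some u, y} \<and> \<delta> y < \<delta> (Some u))" if "u \<in> D" for u
    using someI_ex[OF step[OF that]] that by (simp add: \<eta>_def)
  have inc: "\<eta> u \<in> incident G u" if "u \<in> D" for u
  proof -
    have "Some u \<in> op ` ends G (\<eta> u)" using \<eta>[OF that] by (auto simp: ends_H)
    then have "u \<in> ends G (\<eta> u)" by (auto simp: op_def split: if_splits)
    then show ?thesis using \<eta>[OF that] TE by (auto simp: edges_H incident_def)
  qed
  have set: "\<eta> \<in> set_pmf prod_edges" using inc by (auto simp: set_prod_edges \<eta>_def)
  have dec: "\<delta> (succ_map \<eta> (Some u)) < \<delta> (Some u)" if u: "u \<in> D" for u
  proof -
    obtain y where y: "ends H (\<eta> u) = {Some u, y}" "\<delta> y < \<delta> (Some u)" using \<eta>[OF u] by blast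
    moreover have "ends H (\<eta> u) = {Some u, succ_map \<eta> (Some u)}" using ends_incident[OF u inc[OF u]] u by (simp add: succ_map_def)
    ultimately have "y = succ_map \<eta> (Some u)" by (auto simp: doubleton_eq_iff)
    then show ?thesis using y by simp
  qed
  have exit: "\<exists>n. (succ_map \<eta> ^^ n) s \<notin> W.U" for s
  proof (induction "\<delta> s" arbitrary: s rule: less_induct)
    case less
    show ?case
    proof (cases "s \<in> W.U")
      case True
      then obtain u where "s = Some u" "u \<in> D" by auto
      then obtain n where "(succ_map \<eta> ^^ n) (succ_map \<eta> s) \<notin> W.U" using less[of "succ_map \<eta> s"] dec by auto
      then show ?thesis by (intro exI[of _ "Suc n"]) (simp add: funpow_Suc_right_apply del: funpow.simps)
    qed (auto intro: exI[of _ "0::nat"])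
  qed
  have ac: "\<eta> \<in> acyc"
    unfolding acyc_def forests_def using exit by (auto simp: succ_map_def op_states split: option.splits)
  have sub: "\<eta> ` D \<subseteq> T0" using \<eta> by auto
  have "connected_graph (H\<lparr>edges := \<eta> ` D\<rparr>)" using H_tree(1)[OF set ac] by (auto simp: spanning_trees_def is_tree_def)
  moreover have "\<exists>x y. ends H e = {x, y} \<and> x \<in> verts H \<and> y \<in> verts H" if eT: "e \<in> T0" for e
  proof -
    obtain a c where "ends G e = {a, c}" using wf[of e] eT TE by (auto simp: edges_H)
    then show ?thesis unfolding ends_H verts_H using op_states by (intro exI[of _ "op a"] exI[of _ "op c"]) auto
  qed
  ultimately have "T0 \<subseteq> \<eta> ` D" using spanning_tree_extra_edge[OF _ nocyc sub] by blast
  then show ?thesis using sub set ac by (intro bexI[of _ \<eta>]) auto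
qed

lemma H_tree_inj: "inj_on (\<lambda>\<eta>. \<eta> ` D) (set_pmf prod_edges \<inter> acyc)"
proof (rule inj_onI, rule ext)
  fix \<eta> \<eta>' u assume a: "\<eta> \<in> set_pmf prod_edges \<inter> acyc" "\<eta>' \<in> set_pmf prod_edges \<inter> acyc" "\<eta> ` D = \<eta>' ` D"
  have "{(Some u, \<eta> u) |u. u \<in> D} = {(Some u, \<eta>' u) |u. u \<in> D}"
    using H_tree(2)[of \<eta>] H_tree(2)[of \<eta>'] a by simp
  then have "u \<in> D \<Longrightarrow> \<exists>w. (Some u, \<eta> u) = (Some w, \<eta>' w)" by blast
  then show "\<eta> u = \<eta>' u" using a(1,2) by (cases "u \<in> D") (auto simp: set_prod_edges)
qed

text \<open>The weight of a tree is the constant product of the vertex conductances times the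
  probability of its out-edges under independent choices. Conditioning on acyclicity therefore gives
  the normalised tree weights; the infinite sum in the definition becomes that constant times a
  partition function.\<close>

lemma ust_wired: "ust H = map_pmf (\<lambda>\<eta>. \<eta> ` D) forest_pmf"
proof -
  let ?X = "set_pmf prod_edges \<inter> acyc" and ?g = "\<lambda>\<eta>::'v \<Rightarrow> 'e. \<eta> ` D"
  let ?w = "\<lambda>T0. \<Prod>e\<in>T0. cond H e" and ?c = "\<Prod>u\<in>D. vcond G u"
  have c0: "0 < ?c" using vcond_pos D_V by (intro prod_pos) auto
  have bij: "bij_betw ?g ?X (spanning_trees H)"
    using H_tree(1) H_tree_surj H_tree_inj by (fastforce simp: bij_betw_def)
  have w: "?w (?g \<eta>) = ?c * pmf prod_edges \<eta>" if "\<eta> \<in> ?X" for \<eta>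
  proof -
    have s: "\<eta> \<in> set_pmf prod_edges" "\<eta> \<in> acyc" using that by auto
    have "pmf prod_edges \<eta> = (\<Prod>u\<in>D. pmf (walk_edge G u) (\<eta> u))"
      using s unfolding prod_edges_def by (subst pmf_Pi[OF D_fin]) (auto simp: set_prod_edges[unfolded prod_edges_def])
    also have "\<dots> = (\<Prod>u\<in>D. cond G (\<eta> u) / vcond G u)"
      using s D_V by (intro prod.cong refl) (auto simp: pmf_walk_edge subset_iff set_prod_edges)
    also have "\<dots> = (\<Prod>u\<in>D. cond G (\<eta> u)) / ?c" by (rule prod_dividef)
    also have "(\<Prod>u\<in>D. cond G (\<eta> u)) = ?w (?g \<eta>)" using H_tree(3)[OF s] by (simp add: prod.reindex cond_H)
    finally show ?thesis using c0 by simp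
  qed
  have "infsum ?w (spanning_trees H) = infsum (\<lambda>\<eta>. ?w (?g \<eta>)) ?X" by (rule infsum_reindex_bij_betw[OF bij, symmetric])
  also have "\<dots> = infsum (\<lambda>\<eta>. ?c * pmf prod_edges \<eta>) ?X" by (rule infsum_cong[OF w])
  also have "\<dots> = ?c * infsum (pmf prod_edges) ?X" by (rule infsum_cmult_right')
  also have "infsum (pmf prod_edges) ?X = prb prod_edges ?X"
    unfolding measure_pmf_conv_infsetsum by (rule infsetsum_infsum[symmetric, OF pmf_abs_summable])
  also have "\<dots> = W.Z W.U" unfolding prob_acyc[symmetric] by (simp add: measure_Int_set_pmf Int_commute)
  finally have norm: "infsum ?w (spanning_trees H) = ?c * W.Z W.U" .
  have "(\<lambda>T0. if T0 \<in> spanning_trees H then ?w T0 / infsum ?w (spanning_trees H) else 0) = pmf (map_pmf ?g forest_pmf)"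
  proof
    fix T0
    show "(if T0 \<in> spanning_trees H then ?w T0 / infsum ?w (spanning_trees H) else 0) = pmf (map_pmf ?g forest_pmf) T0"
    proof (cases "T0 \<in> spanning_trees H")
      case True
      then obtain \<eta> where \<eta>: "\<eta> \<in> ?X" "T0 = ?g \<eta>" using H_tree_surj by blast
      have "pmf (map_pmf ?g forest_pmf) T0 = pmf forest_pmf \<eta>"
        unfolding \<eta>(2) by (rule pmf_map_inj) (use \<eta> H_tree_inj in \<open>auto simp: set_forest_pmf\<close>)
      also have "\<dots> = pmf prod_edges \<eta> / W.Z W.U"
        using \<eta> by (simp add: forest_pmf_def pmf_cond[OF acyc_ne] prob_acyc)
      finally show ?thesis using True w[OF \<eta>(1)] c0 \<eta>(2) by (simp add: norm)
    next
      case False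
      then have "T0 \<notin> set_pmf (map_pmf ?g forest_pmf)" using H_tree(1) by (auto simp: set_forest_pmf)
      then show ?thesis using False by (simp add: pmf_eq_0_set_pmf)
    qed
  qed
  then show ?thesis unfolding ust_def
    using type_definition.Rep_inverse[OF td_pmf_embed_pmf, of "map_pmf ?g forest_pmf"] by simp
qed

definition arc_map :: "('v \<Rightarrow> 'e) \<Rightarrow> 'v \<times> 'e \<Rightarrow> bool" where
  "arc_map \<eta> = (\<lambda>(u, e). u \<in> D \<and> e = \<eta> u)"

lemma wired_ust_law_eq: "wired_ust_law G D = distr (measure_pmf forest_pmf) borel arc_map"
proof -
  have "wired_ust_law G D = distr (measure_pmf forest_pmf) borel (\<lambda>\<eta> (u, e). (Some u, e) \<in> orient_towards H None (\<eta> ` D))"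
    unfolding wired_ust_law_def ust_wired map_pmf_rep_eq by (subst distr_distr) (auto simp: comp_def)
  also have "\<dots> = distr (measure_pmf forest_pmf) borel arc_map"
  proof (rule distr_cong_AE)
    show "AE \<eta> in measure_pmf forest_pmf. (\<lambda>(u, e). (Some u, e) \<in> orient_towards H None (\<eta> ` D)) = arc_map \<eta>"
      by (rule AE_pmfI) (auto simp: set_forest_pmf H_tree(2) arc_map_def fun_eq_iff)
  qed auto
  finally show ?thesis .
qed

end

section \<open>The past in a finite network\<close>

lemma sum_inverse_sqrt_le: "(\<Sum>i = 1..<Suc n. 1 / sqrt (real i)) \<le> 2 * sqrt (real n)"
proof (induction n)
  case (Suc n)
  have "1 / sqrt (real (Suc n)) \<le> 2 * (sqrt (real (Suc n)) - sqrt (real n))"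
  proof -
    let ?a = "sqrt (real (Suc n))" and ?b = "sqrt (real n)"
    have "0 < ?a" "0 \<le> ?b" "?b \<le> ?a" by auto
    moreover have "(?a - ?b) * (?a + ?b) = 1"
      by (simp add: algebra_simps power2_eq_square[symmetric])
    moreover have "(?a - ?b) * (?a + ?b) \<le> (?a - ?b) * (2 * ?a)" using calculation by (intro mult_left_mono) auto
    ultimately show ?thesis by (simp add: divide_le_eq mult_ac right_diff_distrib left_diff_distrib)
  qed
  then show ?case using Suc by simp
qed simp

text \<open>A second moment bound that discards values below \<open>s\<close>: their contribution to
  the mean is at most the sum of the tails, assumed to be at most \<open>m / 4\<close>. For
  \<open>s = 1\<close> nothing is discarded.\<close>

lemma second_moment_pmf:
  fixes X :: "'a \<Rightarrow> nat"
  assumes bdd: "\<And>x. x \<in> set_pmf p \<Longrightarrow> X x \<le> N" and Q: "0 < Q"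
    and mean: "3 * m / 4 \<le> (\<integral>x. real (X x) \<partial>measure_pmf p)"
    and sq: "(\<integral>x. (real (X x))\<^sup>2 \<partial>measure_pmf p) \<le> Q * m"
    and small: "(\<Sum>i = 1..<s. prb p {x. i \<le> X x}) \<le> m / 4"
  shows "m / (16 * Q) \<le> prb p {x. s \<le> X x}"
proof -
  have int: "integrable (measure_pmf p) (\<lambda>x. g (X x))" for g :: "nat \<Rightarrow> real"
  proof (rule measure_pmf.integrable_const_bound[where B = "Max ((\<lambda>i. \<bar>g i\<bar>) ` {..N})"])
    show "AE x in measure_pmf p. norm (g (X x)) \<le> Max ((\<lambda>i. \<bar>g i\<bar>) ` {..N})"
      using bdd by (intro AE_pmfI) (auto intro!: Max_ge)
  qed simp
  have pr: "prb p {x. i \<le> X x} = (\<integral>x. of_bool (i \<le> X x) \<partial>measure_pmf p)" for i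
  proof -
    have "(\<lambda>x. of_bool (i \<le> X x) :: real) = indicator {x. i \<le> X x}" by (auto simp: indicator_def)
    then show ?thesis by simp
  qed
  \<comment> \<open>Below \<open>s\<close> the sum of indicators equals \<open>x\<close>. From
    \<open>s\<close> on, the arithmetic-geometric mean inequality bounds \<open>x\<close> by
    \<open>x\<^sup>2 / (8 * Q) + 2 * Q\<close>. On average the square contributes at most
    \<open>m / 8\<close>.\<close>
  have point: "real x \<le> (\<Sum>i = 1..<s. of_bool (i \<le> x)) + x\<^sup>2 / (8 * Q) + 2 * Q * of_bool (s \<le> x)" for x :: nat
  proof (cases "s \<le> x")
    case True
    have "0 \<le> (real x - 4 * Q)\<^sup>2 / (8 * Q)" using Q by simp
    also have "\<dots> = x\<^sup>2 / (8 * Q) - real x + 2 * Q" using Q by (simp add: power2_eq_square field_simps)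
    moreover have "0 \<le> (\<Sum>i = 1..<s. of_bool (i \<le> x) :: real)" by (intro sum_nonneg) auto
    ultimately show ?thesis using True by simp
  next
    case False
    have "(\<Sum>i = 1..<s. of_bool (i \<le> x) :: real) = real (card ({1..<s} \<inter> {i. i \<le> x}))"
      using sum.inter_restrict[of "{1..<s}" "\<lambda>_. 1 :: real" "{i. i \<le> x}"] by (simp add: of_bool_def)
    also have "{1..<s} \<inter> {i. i \<le> x} = {1..x}" using False by auto
    finally show ?thesis using False Q by simp
  qed
  have sm: "(\<integral>x. (\<Sum>i = 1..<s. of_bool (i \<le> X x)) \<partial>measure_pmf p) = (\<Sum>i = 1..<s. prb p {x. i \<le> X x})"
    unfolding pr by (rule Bochner_Integration.integral_sum) (rule int)
  have "(\<integral>x. real (X x) \<partial>measure_pmf p) \<le> (\<integral>x. (\<Sum>i = 1..<s. of_bool (i \<le> X x)) + (X x)\<^sup>2 / (8 * Q) + 2 * Q * of_bool (s \<le> X x) \<partial>measure_pmf p)"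
    using int[of real] int[of "\<lambda>k. (\<Sum>i = 1..<s. of_bool (i \<le> k)) + k\<^sup>2 / (8 * Q) + 2 * Q * of_bool (s \<le> k)"] point
    by (intro integral_mono) auto
  also have "\<dots> = (\<Sum>i = 1..<s. prb p {x. i \<le> X x}) + (\<integral>x. (real (X x))\<^sup>2 \<partial>measure_pmf p) / (8 * Q) + 2 * Q * prb p {x. s \<le> X x}"
    using int[of "\<lambda>k. \<Sum>i = 1..<s. of_bool (i \<le> k)"] int[of "\<lambda>k. k\<^sup>2 / (8 * Q)"] int[of "\<lambda>k. 2 * Q * of_bool (s \<le> k)"]
      int[of "\<lambda>k. of_bool (s \<le> k)"] unfolding sm[symmetric] pr[of s]
    by (subst Bochner_Integration.integral_add, simp, simp, subst Bochner_Integration.integral_add) auto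
  also have "\<dots> \<le> m / 4 + Q * m / (8 * Q) + 2 * Q * prb p {x. s \<le> X x}"
    using small sq Q by (intro add_mono divide_right_mono) auto
  also have "Q * m / (8 * Q) = m / 8" using Q by simp
  finally have "3 * m / 8 \<le> 2 * Q * prb p {x. s \<le> X x}" using mean by simp
  moreover have "0 \<le> Q * prb p {x. s \<le> X x}" using Q by simp
  ultimately have "m \<le> 16 * Q * prb p {x. s \<le> X x}" by simp
  then show ?thesis using Q by (simp add: divide_le_eq mult_ac)
qed

lemma follows_successively: "follows f xs \<longleftrightarrow> successively (\<lambda>x y. f x = y) xs"
  by (induction f xs rule: follows.induct) auto

context net
begin

sublocale BW: base_walk V p0 "vcond G" bb AA
  by (rule base)

definition CV :: real where "CV = 4 * BW.CD + 12 * AA\<^sup>2 * BW.BB\<^sup>2"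

definition arc_path :: "'e set \<Rightarrow> ('v \<times> 'e \<Rightarrow> bool) \<Rightarrow> 'v list \<Rightarrow> bool" where
  "arc_path E0 F xs \<longleftrightarrow> successively (\<lambda>x y. \<exists>e\<in>E0 \<inter> edges G. F (x, e) \<and> ends G e = {x, y}) xs"

definition past_lists :: "'v set \<Rightarrow> 'v \<Rightarrow> nat set \<Rightarrow> 'v list set" where
  "past_lists U0 v L = {zs. distinct zs \<and> set zs \<subseteq> U0 - {v} \<and> length zs \<in> L}"

text \<open>Number of past paths of \<open>v\<close> inside \<open>U0\<close> with length in
  \<open>L\<close> and edges from \<open>E0\<close>. For finite \<open>U0\<close> and
  \<open>E0\<close> it depends on finitely many arcs, so its level sets are cylinder events to which
  weak convergence applies.\<close>

definition pcount :: "'v set \<Rightarrow> 'e set \<Rightarrow> 'v \<Rightarrow> nat set \<Rightarrow> ('v \<times> 'e \<Rightarrow> bool) \<Rightarrow> nat" where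
  "pcount U0 E0 v L F = card {zs\<in>past_lists U0 v L. arc_path E0 F (rev (v # zs))}"

lemma finite_past_lists: "finite U0 \<Longrightarrow> finite (past_lists U0 v L)"
  unfolding past_lists_def by (rule finite_subset[OF _ finite_TL[of U0 "card U0"]]) (auto simp: TL_def distinct_card[symmetric] intro!: card_mono)

end

context wnet
begin

lemma forest_expect: "(\<integral>\<eta>. \<Phi> (succ_map \<eta>) \<partial>measure_pmf forest_pmf) = W.ZZ W.U \<Phi> / W.Z W.U"
proof -
  let ?F = "forests (states D) W.U"
  have fin: "finite ?F" by (rule W.fin_forests[OF W.SI])
  have p: "pmf (map_pmf succ_map forest_pmf) f = W.wt W.U f / W.Z W.U" if f: "f \<in> ?F" for f
  proof -
    have "pmf (map_pmf succ_map forest_pmf) f = W.ZZ W.U (\<lambda>g. of_bool (g = f)) / W.Z W.U"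
      using forest_prob[of "\<lambda>g. g = f"] by (simp add: pmf_map vimage_def)
    also have "W.ZZ W.U (\<lambda>g. of_bool (g = f)) = W.wt W.U f"
      unfolding W.ZZ_def using fin f by (simp add: of_bool_def if_distrib sum.delta cong: if_cong)
    finally show ?thesis .
  qed
  have "(\<integral>\<eta>. \<Phi> (succ_map \<eta>) \<partial>measure_pmf forest_pmf) = (\<integral>f. \<Phi> f \<partial>measure_pmf (map_pmf succ_map forest_pmf))" by simp
  also have "\<dots> = (\<Sum>f\<in>?F. pmf (map_pmf succ_map forest_pmf) f *\<^sub>R \<Phi> f)"
    by (rule integral_measure_pmf[OF fin]) (auto simp: set_forest_pmf acyc_def)
  also have "\<dots> = W.ZZ W.U \<Phi> / W.Z W.U" using p by (simp add: W.ZZ_def sum_divide_distrib)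
  finally show ?thesis .
qed

lemma forest_incident: "\<eta> \<in> set_pmf forest_pmf \<Longrightarrow> u \<in> D \<Longrightarrow> \<eta> u \<in> incident G u"
  by (simp add: set_forest_pmf set_prod_edges)

lemma forest_forests: "\<eta> \<in> set_pmf forest_pmf \<Longrightarrow> succ_map \<eta> \<in> forests (states D) W.U"
  by (simp add: set_forest_pmf acyc_def)

lemma arc_path_iff:
  assumes \<eta>: "\<eta> \<in> set_pmf forest_pmf" and xs: "set xs \<subseteq> D"
  shows "arc_path E0 (arc_map \<eta>) xs \<longleftrightarrow> successively (\<lambda>x y. succ_map \<eta> (Some x) = Some y \<and> \<eta> x \<in> E0) xs"
  unfolding arc_path_def
proof (rule successively_cong[OF _ refl])
  fix x y assume "x \<in> set xs" "y \<in> set xs"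
  then have xy: "x \<in> D" "y \<in> D" using xs by auto
  have i: "\<eta> x \<in> incident G x" by (rule forest_incident[OF \<eta> xy(1)])
  have "(\<exists>e\<in>E0 \<inter> edges G. arc_map \<eta> (x, e) \<and> ends G e = {x, y}) \<longleftrightarrow> \<eta> x \<in> E0 \<and> ends G (\<eta> x) = {x, y}"
    using xy i incident_edges[of x] by (auto simp: arc_map_def)
  also have "ends G (\<eta> x) = {x, y} \<longleftrightarrow> other_end G x (\<eta> x) = y"
    using incident_ends(1)[OF i] by (auto simp: doubleton_eq_iff)
  finally show "(\<exists>e\<in>E0 \<inter> edges G. arc_map \<eta> (x, e) \<and> ends G e = {x, y}) \<longleftrightarrow> succ_map \<eta> (Some x) = Some y \<and> \<eta> x \<in> E0"
    using xy by (auto simp: succ_map_def op_def)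
qed

lemma follows_map_Some: "follows f (map Some xs) \<longleftrightarrow> successively (\<lambda>x y. f (Some x) = Some y) xs"
  by (simp add: follows_successively successively_map)

lemma past_lists_lists_at:
  assumes "U0 \<subseteq> D" "\<And>n. n \<in> L \<Longrightarrow> n \<le> M"
  shows "map Some ` past_lists U0 v L = {zs\<in>W.lists_at W.U (Some v) M L. set zs \<subseteq> Some ` U0}"
proof (intro equalityI subsetI)
  fix zs assume zs: "zs \<in> {zs\<in>W.lists_at W.U (Some v) M L. set zs \<subseteq> Some ` U0}"
  have z: "zs = map Some (map the zs)" using zs by (auto intro!: map_idI[symmetric])
  have "distinct (map the zs)" using zs z by (metis (mono_tags) W.lists_at_def TL_def distinct_map mem_Collect_eq)
  moreover have "set (map the zs) \<subseteq> U0 - {v}" using zs by (auto simp: W.lists_at_def TL_def)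
  ultimately have "map the zs \<in> past_lists U0 v L" using zs by (auto simp: past_lists_def W.lists_at_def)
  then show "zs \<in> map Some ` past_lists U0 v L" using z by blast
next
  fix zs assume "zs \<in> map Some ` past_lists U0 v L"
  then obtain xs where xs: "zs = map Some xs" "distinct xs" "set xs \<subseteq> U0 - {v}" "length xs \<in> L" by (auto simp: past_lists_def)
  then show "zs \<in> {zs\<in>W.lists_at W.U (Some v) M L. set zs \<subseteq> Some ` U0}"
    using assms image_mono[OF xs(3), of Some] by (auto simp: W.lists_at_def TL_def distinct_map subset_iff)
qed

text \<open>A past path escapes the truncated count only if it leaves \<open>U0\<close> or uses an
  edge outside \<open>E0\<close>. In the second case the number of all candidate lists serves as a
  crude bound.\<close>

lemma pcount_bounds:
  assumes \<eta>: "\<eta> \<in> set_pmf forest_pmf" and v: "v \<in> D" and U0: "U0 \<subseteq> D" and L: "\<And>n. n \<in> L \<Longrightarrow> n \<le> M"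
  defines "A \<equiv> W.lists_at W.U (Some v) M L" and "P \<equiv> (\<lambda>zs. follows (succ_map \<eta>) (rev (Some v # zs)))"
  shows "pcount U0 E0 v L (arc_map \<eta>) \<le> card (W.past_at (succ_map \<eta>) (Some v) M L)"
    and "real (card (W.past_at (succ_map \<eta>) (Some v) M L)) \<le> real (pcount U0 E0 v L (arc_map \<eta>))
      + (\<Sum>zs\<in>{zs\<in>A. \<not> set zs \<subseteq> Some ` U0}. of_bool (P zs)) + real (card (past_lists U0 v L)) * of_bool (\<exists>u\<in>U0. \<eta> u \<notin> E0)"
proof -
  have fU0: "finite U0" by (rule finite_subset[OF U0 D_fin])
  have fA: "finite A" unfolding A_def W.lists_at_def using finite_TL[of "W.U - {Some v}" M] D_fin by simp
  have vI: "Some v \<in> W.I" using W.SI v by auto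
  have c: "real (card (W.past_at (succ_map \<eta>) (Some v) M L)) = (\<Sum>zs\<in>A. of_bool (P zs))"
    unfolding A_def P_def by (rule W.card_past_at[OF W.SI vI forest_forests[OF \<eta>]])
  let ?X = "{zs\<in>past_lists U0 v L. arc_path E0 (arc_map \<eta>) (rev (v # zs))}"
  have PL: "map Some ` past_lists U0 v L = {zs\<in>A. set zs \<subseteq> Some ` U0}"
    unfolding A_def by (rule past_lists_lists_at[OF U0 L])
  have ap: "arc_path E0 (arc_map \<eta>) (rev (v # zs)) \<longleftrightarrow> successively (\<lambda>x y. succ_map \<eta> (Some x) = Some y \<and> \<eta> x \<in> E0) (rev (v # zs))"
    and fo: "P (map Some zs) \<longleftrightarrow> successively (\<lambda>x y. succ_map \<eta> (Some x) = Some y) (rev (v # zs))" if "zs \<in> past_lists U0 v L" for zs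
  proof -
    have "set (rev (v # zs)) \<subseteq> D" using that v U0 by (auto simp: past_lists_def)
    then show "arc_path E0 (arc_map \<eta>) (rev (v # zs)) \<longleftrightarrow> successively (\<lambda>x y. succ_map \<eta> (Some x) = Some y \<and> \<eta> x \<in> E0) (rev (v # zs))"
      by (rule arc_path_iff[OF \<eta>])
    have "rev (Some v # map Some zs) = map Some (rev (v # zs))" by (simp add: rev_map)
    then show "P (map Some zs) \<longleftrightarrow> successively (\<lambda>x y. succ_map \<eta> (Some x) = Some y) (rev (v # zs))"
      unfolding P_def by (metis follows_map_Some)
  qed
  have sA: "(\<Sum>zs\<in>A. of_bool (P zs) :: real) = real (card {zs\<in>A. P zs})"
    using fA by (simp add: of_bool_def sum.inter_filter[symmetric])
  have apP: "P (map Some zs)" if "zs \<in> ?X" for zs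
  proof -
    have zs: "zs \<in> past_lists U0 v L" "arc_path E0 (arc_map \<eta>) (rev (v # zs))" using that by auto
    show ?thesis unfolding fo[OF zs(1)] by (rule successively_mono[OF zs(2)[unfolded ap[OF zs(1)]]]) auto
  qed
  have "card ?X \<le> card {zs\<in>A. P zs}"
  proof (rule card_inj_on_le[of "map Some"])
    show "map Some ` ?X \<subseteq> {zs\<in>A. P zs}" using PL apP by blast
  qed (use fA in \<open>auto simp: inj_on_def\<close>)
  then show "pcount U0 E0 v L (arc_map \<eta>) \<le> card (W.past_at (succ_map \<eta>) (Some v) M L)"
    using c sA unfolding pcount_def by linarith
  let ?in = "{zs\<in>A. set zs \<subseteq> Some ` U0}" and ?out = "{zs\<in>A. \<not> set zs \<subseteq> Some ` U0}"
  have "A = ?in \<union> ?out" by auto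
  then have split: "(\<Sum>zs\<in>A. of_bool (P zs) :: real) = (\<Sum>zs\<in>?in. of_bool (P zs)) + (\<Sum>zs\<in>?out. of_bool (P zs))"
    using fA by (metis (no_types, lifting) sum.union_disjoint[of ?in ?out] finite_Un disjoint_iff mem_Collect_eq)
  have "(\<Sum>zs\<in>?in. of_bool (P zs) :: real) = (\<Sum>zs\<in>past_lists U0 v L. of_bool (P (map Some zs)))"
    unfolding PL[symmetric] by (subst sum.reindex) (auto simp: inj_on_def)
  also have "\<dots> \<le> real (card ?X) + real (card (past_lists U0 v L)) * of_bool (\<exists>u\<in>U0. \<eta> u \<notin> E0)"
  proof (cases "\<exists>u\<in>U0. \<eta> u \<notin> E0")
    case True
    have "(\<Sum>zs\<in>past_lists U0 v L. of_bool (P (map Some zs)) :: real) \<le> (\<Sum>zs\<in>past_lists U0 v L. 1)"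
      by (intro sum_mono) auto
    then show ?thesis using True by simp
  next
    case False
    have "P (map Some zs) \<longleftrightarrow> arc_path E0 (arc_map \<eta>) (rev (v # zs))" if zs: "zs \<in> past_lists U0 v L" for zs
    proof
      assume "P (map Some zs)"
      then have s: "successively (\<lambda>x y. succ_map \<eta> (Some x) = Some y) (rev zs @ [v])" using fo[OF zs] by simp
      have z: "\<eta> x \<in> E0" if "x \<in> set (rev zs)" for x using that zs False by (auto simp: past_lists_def)
      have "successively (\<lambda>x y. succ_map \<eta> (Some x) = Some y \<and> \<eta> x \<in> E0) (rev zs @ [v])"
        unfolding successively_append_iff
      proof (intro conjI)
        have "successively (\<lambda>x y. succ_map \<eta> (Some x) = Some y) (rev zs)" using s by (simp only: successively_append_iff)
        then show "successively (\<lambda>x y. succ_map \<eta> (Some x) = Some y \<and> \<eta> x \<in> E0) (rev zs)"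
          by (rule successively_mono) (use z in auto)
        show "rev zs = [] \<or> [v] = [] \<or> (succ_map \<eta> (Some (last (rev zs))) = Some (hd [v]) \<and> \<eta> (last (rev zs)) \<in> E0)"
          using s z last_in_set[of "rev zs"] unfolding successively_append_iff by blast
      qed simp
      then show "arc_path E0 (arc_map \<eta>) (rev (v # zs))" using ap[OF zs] by simp
    qed (use apP zs in auto)
    then have "(\<Sum>zs\<in>past_lists U0 v L. of_bool (P (map Some zs)) :: real) = real (card ?X)"
      using finite_past_lists[OF fU0, of v L] by (simp add: of_bool_def sum.inter_filter[symmetric])
    then show ?thesis by simp
  qed
  finally show "real (card (W.past_at (succ_map \<eta>) (Some v) M L)) \<le> real (pcount U0 E0 v L (arc_map \<eta>))
      + (\<Sum>zs\<in>?out. of_bool (P zs)) + real (card (past_lists U0 v L)) * of_bool (\<exists>u\<in>U0. \<eta> u \<notin> E0)"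
    unfolding c split pcount_def by simp
qed

lemma Z_remove_set_le: "finite X \<Longrightarrow> X \<subseteq> W' \<Longrightarrow> W' \<subseteq> W.I \<Longrightarrow> 1 \<le> BW.BB \<Longrightarrow> W.Z (W' - X) \<le> BW.BB ^ card X * W.Z W'"
proof (induction X rule: finite_induct)
  case (insert x X)
  have "W.Z (W' - X - {x}) \<le> BW.BB * W.Z (W' - X)"
    using insert W.Z_remove_le[of "W' - X" x] by (auto simp: W.B_BB)
  also have "\<dots> \<le> BW.BB * (BW.BB ^ card X * W.Z W')" using insert by (intro mult_left_mono insert.IH) auto
  also have "W' - X - {x} = W' - insert x X" by auto
  finally show ?case using insert.hyps by (simp add: mult.assoc)
qed simp

text \<open>Bounding every removed vertex by a factor \<open>BW.BB\<close> loses exponentially in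
  \<open>M\<close>. This is affordable, because \<open>\<delta>\<close> is chosen after
  \<open>M\<close>.\<close>

lemma follows_outside_le:
  assumes v: "v \<in> D" and \<delta>: "\<And>j. j \<le> M \<Longrightarrow> prb (paths j v) {xs. \<not> set xs \<subseteq> U0} \<le> \<delta>"
  shows "(\<Sum>zs\<in>{zs\<in>W.lists_at W.U (Some v) M L. \<not> set zs \<subseteq> Some ` U0}. W.ZZ W.U (\<lambda>f. of_bool (follows f (rev (Some v # zs)))))
    \<le> (2 * AA)\<^sup>2 * BW.BB ^ (M + 1) * (real (M + 1) * \<delta>) * W.Z W.U"
proof -
  let ?X = "{zs\<in>W.lists_at W.U (Some v) M L. \<not> set zs \<subseteq> Some ` U0}" and ?W = "W.U - {Some v}"
  have vI: "Some v \<in> W.I" using W.SI v by auto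
  have BB1: "1 \<le> BW.BB" using W.B_ge_1[OF vI] by (simp add: W.B_BB)
  have WI: "?W \<subseteq> W.I" using W.SI by auto
  have Zp: "0 < W.Z W.U" by (rule W.Z_pos[OF W.SI])
  have fX: "finite ?X" unfolding W.lists_at_def using finite_TL[of ?W M] D_fin by simp
  have "(\<Sum>zs\<in>?X. W.ZZ W.U (\<lambda>f. of_bool (follows f (rev (Some v # zs))))) \<le> (\<Sum>zs\<in>?X. (2 * AA)\<^sup>2 * BW.BB ^ (M + 1) * W.Z W.U * pp T (Some v # zs))"
  proof (rule sum_mono)
    fix zs assume zs: "zs \<in> ?X"
    then have TL: "zs \<in> TL ?W M" by (simp add: W.lists_at_def)
    then have z: "set zs \<subseteq> ?W" "card (set zs) \<le> M" by (auto simp: TL_def distinct_card)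
    have pn: "0 \<le> pp T (Some v # zs)" by (rule W.pp_nonneg)
    have "W.tw ?W (Some v) zs \<le> pp T (Some v # zs) * BW.BB ^ M"
    proof -
      have "W.Z (?W - set zs) \<le> BW.BB ^ card (set zs) * W.Z ?W" using z WI BB1 by (intro Z_remove_set_le) auto
      also have "\<dots> \<le> BW.BB ^ M * W.Z ?W" using z BB1 W.Z_pos[OF WI] by (intro mult_right_mono power_increasing) auto
      finally have "W.Z (?W - set zs) / W.Z ?W \<le> BW.BB ^ M" using W.Z_pos[OF WI] by (simp add: divide_le_eq)
      then show ?thesis unfolding W.tw_def times_divide_eq_right[symmetric] using pn by (intro mult_left_mono)
    qed
    then have "(2 * AA)\<^sup>2 * BW.BB * W.tw ?W (Some v) zs * W.Z W.U \<le> (2 * AA)\<^sup>2 * BW.BB * (pp T (Some v # zs) * BW.BB ^ M) * W.Z W.U"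
      using BB1 Zp by (intro mult_right_mono mult_left_mono) auto
    with W.ZZ_follows_rev_le[OF W.SI vI TL, unfolded W.B_BB]
    show "W.ZZ W.U (\<lambda>f. of_bool (follows f (rev (Some v # zs)))) \<le> (2 * AA)\<^sup>2 * BW.BB ^ (M + 1) * W.Z W.U * pp T (Some v # zs)"
      by (simp add: mult_ac)
  qed
  also have "\<dots> = (2 * AA)\<^sup>2 * BW.BB ^ (M + 1) * W.Z W.U * (\<Sum>zs\<in>?X. pp T (Some v # zs))" by (simp add: sum_distrib_left)
  also have "\<dots> \<le> (2 * AA)\<^sup>2 * BW.BB ^ (M + 1) * W.Z W.U * (real (M + 1) * \<delta>)"
  proof (rule mult_left_mono)
    have "(\<Sum>zs\<in>?X. pp T (Some v # zs)) = (\<Sum>j\<in>{..M}. \<Sum>zs\<in>{zs\<in>?X. length zs = j}. pp T (Some v # zs))"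
      using fX by (intro sum.group[symmetric]) (auto simp: W.lists_at_def TL_def)
    also have "\<dots> \<le> (\<Sum>j\<in>{..M}. \<delta>)"
    proof (rule sum_mono)
      fix j assume "j \<in> {..M}"
      then have j: "j \<le> M" by simp
      have "(\<Sum>zs\<in>{zs\<in>?X. length zs = j}. pp T (Some v # zs)) \<le> prb (paths j v) {xs. \<not> set xs \<subseteq> U0}"
        using v by (intro sum_pp_outside_le finite_subset[OF _ fX]) (auto simp: W.lists_at_def TL_def)
      then show "(\<Sum>zs\<in>{zs\<in>?X. length zs = j}. pp T (Some v # zs)) \<le> \<delta>" using \<delta>[OF j] by simp
    qed
    finally show "(\<Sum>zs\<in>?X. pp T (Some v # zs)) \<le> real (M + 1) * \<delta>" by simp
  qed (use Zp BB1 in auto)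
  finally show ?thesis by (simp add: mult_ac)
qed

text \<open>Each level between \<open>r\<close> and \<open>2 * r\<close> contributes at least half
  of \<open>q_prob G v\<close>, up to the reversal constant: \<open>q_prob_le\<close> bounds the
  expected escape probability, and the forest path leaves \<open>D\<close> within
  \<open>2 * r\<close> steps with probability at most the other half.\<close>

lemma past_mean_ge:
  assumes v: "v \<in> D" and \<delta>: "\<And>j. j \<le> 2 * r \<Longrightarrow> prb (paths j v) {xs. \<not> set xs \<subseteq> D} \<le> \<delta>"
    and small: "BW.BB ^ (2 * r) * \<delta> \<le> q_prob G v / 2"
  shows "real r * q_prob G v / (2 * (2 * AA)\<^sup>2) * W.Z W.U \<le> W.ZZ W.U (\<lambda>f. real (card (W.past_at f (Some v) (2 * r) {r..2 * r})))"
proof -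
  let ?Fl = "\<lambda>zs. W.ZZ W.U (\<lambda>f. of_bool (follows f (rev (Some v # zs))))" and ?L = "\<lambda>J. W.lists_at W.U (Some v) (2 * r) J"
  have vU: "Some v \<in> W.U" and vI: "Some v \<in> W.I" using W.SI v by auto
  have BB1: "1 \<le> BW.BB" using W.B_ge_1[OF vI] by (simp add: W.B_BB)
  have Zp: "0 < W.Z W.U" by (rule W.Z_pos[OF W.SI])
  have A0: "0 < (2 * AA)\<^sup>2" using AA(1) by simp
  have q0: "0 \<le> q_prob G v" by (simp add: q_prob_def)
  have fL: "finite (?L J)" for J unfolding W.lists_at_def using finite_TL[of "W.U - {Some v}" "2 * r"] D_fin by simp
  have one: "q_prob G v / 2 / (2 * AA)\<^sup>2 * W.Z W.U \<le> (\<Sum>zs\<in>?L {j}. ?Fl zs)" if j: "j \<le> 2 * r" for j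
  proof -
    have "v \<in> V" using v D_V by auto
    then have "ennreal (W.exit_by W.U j (op v)) \<le> ennreal \<delta>"
      using ennreal_leI[OF \<delta>[OF j]] exit_by_paths[of D v j] by (simp add: measure_pmf.emeasure_eq_measure)
    moreover have "0 \<le> \<delta>" using \<delta>[OF j] by (meson measure_nonneg order_trans)
    ultimately have ex: "W.exit_by W.U j (Some v) \<le> \<delta>" using v by (simp add: op_def)
    have "W.ZZ W.U (\<lambda>f. of_bool ((f ^^ j) (Some v) \<notin> W.U)) \<le> BW.BB ^ j * W.exit_by W.U j (Some v) * W.Z W.U"
      using W.ZZ_exit_le[OF order_refl W.SI, of "Some v" j] vI BB1 by (simp add: W.B_BB)
    also have "\<dots> \<le> BW.BB ^ (2 * r) * \<delta> * W.Z W.U"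
      using ex BB1 Zp j W.exit_by_nonneg[of W.U j "Some v"] by (intro mult_right_mono mult_mono power_increasing) auto
    also have "\<dots> \<le> q_prob G v / 2 * W.Z W.U" using small Zp by (intro mult_right_mono) auto
    finally have "q_prob G v / 2 * W.Z W.U \<le> (2 * AA)\<^sup>2 * (\<Sum>zs\<in>?L {j}. ?Fl zs)"
      using W.ZZ_level_ge[OF W.SI vU j, of "{j}"] q_prob_le[OF v] by simp
    then show ?thesis using A0 by (simp add: divide_le_eq mult_ac)
  qed
  have "real r * q_prob G v / (2 * (2 * AA)\<^sup>2) * W.Z W.U \<le> (\<Sum>j\<in>{r..2 * r}. q_prob G v / 2 / (2 * AA)\<^sup>2 * W.Z W.U)"
  proof -
    have "(\<Sum>j\<in>{r..2 * r}. q_prob G v / 2 / (2 * AA)\<^sup>2 * W.Z W.U) = real (r + 1) * (q_prob G v / 2 / (2 * AA)\<^sup>2 * W.Z W.U)" by simp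
    moreover have "real r * (q_prob G v / 2 / (2 * AA)\<^sup>2 * W.Z W.U) \<le> real (r + 1) * (q_prob G v / 2 / (2 * AA)\<^sup>2 * W.Z W.U)"
      using q0 A0 Zp by (intro mult_right_mono mult_nonneg_nonneg divide_nonneg_nonneg) auto
    ultimately show ?thesis by (simp add: mult.assoc)
  qed
  also have "\<dots> \<le> (\<Sum>j\<in>{r..2 * r}. \<Sum>zs\<in>?L {j}. ?Fl zs)" by (intro sum_mono one) auto
  also have "\<dots> = (\<Sum>j\<in>{r..2 * r}. \<Sum>zs\<in>{zs\<in>?L {r..2 * r}. length zs = j}. ?Fl zs)"
    by (intro sum.cong refl arg_cong2[where f = sum]) (auto simp: W.lists_at_def)
  also have "\<dots> = (\<Sum>zs\<in>?L {r..2 * r}. ?Fl zs)" by (rule sum.group[OF fL]) (auto simp: W.lists_at_def)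
  also have "\<dots> = W.ZZ W.U (\<lambda>f. real (card (W.past_at f (Some v) (2 * r) {r..2 * r})))"
    unfolding W.ZZ_sum[symmetric] by (rule W.ZZ_cong, rule W.card_past_at[OF W.SI vI, symmetric])
  finally show ?thesis .
qed

lemma forest_volume_le:
  assumes v: "v \<in> D" and R: "1 \<le> R"
  shows "prb forest_pmf {\<eta>. R \<le> real (card {u\<in>states D. reach (succ_map \<eta>) u (Some v)})} \<le> CV / sqrt R"
  unfolding forest_prob[of "\<lambda>f. R \<le> real (card {u\<in>states D. reach f u (Some v)})"]
  using W.past_volume_le[of "Some v" R] v R W.Z_pos[OF W.SI] by (simp add: divide_le_eq CV_def)

lemma forest_deep_le:
  assumes v: "v \<in> D" and N: "1 \<le> N"
  shows "prb forest_pmf {\<eta>. deep (succ_map \<eta>) (Some v) N} \<le> 4 * BW.CD / real N"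
  unfolding forest_prob[of "\<lambda>f. deep f (Some v) N"]
  using W.deep_le[of "Some v" N] v N W.Z_pos[OF W.SI] by (simp add: divide_le_eq)

text \<open>The mean \<open>m\<close> of the full count is at least \<open>r * q / (2 * A2)\<close>.
  The truncation error and the contribution of values below \<open>s\<close>, bounded through the
  upper volume tail, are each required to be at most a quarter of that. In the conclusion 288 = 16 *
  9 * 2: from the second moment bound, from \<open>2 * r + 1 \<le> 3 * r\<close> squared, and from
  the mean.\<close>

lemma pcount_lower:
  fixes v r s U0 E0 \<delta> \<delta>'
  defines "L \<equiv> {r..2 * r}" and "A2 \<equiv> (2 * AA)\<^sup>2" and "q \<equiv> q_prob G v"
  assumes v: "v \<in> D" and U0: "U0 \<subseteq> D" and r: "1 \<le> r" and s: "1 \<le> s" and q: "0 < q"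
    and \<delta>: "\<And>j. j \<le> 2 * r \<Longrightarrow> prb (paths j v) {xs. \<not> set xs \<subseteq> U0} \<le> \<delta>"
    and \<delta>': "\<And>u. u \<in> U0 \<Longrightarrow> prb (walk_edge G u) (- E0) \<le> \<delta>'"
    and small: "BW.BB ^ (2 * r) * \<delta> \<le> q / 2"
    and small': "A2 * BW.BB ^ (2 * r + 1) * (real (2 * r + 1) * \<delta>) + real (card (past_lists U0 v L)) * (real (card U0) * (BW.BB * \<delta>')) \<le> real r * q / (8 * A2)"
    and vol: "2 * CV * sqrt (real (s - 1)) \<le> real r * q / (8 * A2)"
  shows "q / (288 * A2\<^sup>2 * BW.BB\<^sup>2 * real r) \<le> prb forest_pmf {\<eta>. s \<le> pcount U0 E0 v L (arc_map \<eta>)}"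
proof -
  let ?v = "Some v" and ?M = "2 * r" and ?f = "measure_pmf forest_pmf"
  define Vn where "Vn f = card (W.past_at f ?v ?M L)" for f
  define X where "X \<eta> = pcount U0 E0 v L (arc_map \<eta>)" for \<eta>
  have vU: "Some v \<in> W.U" and vI: "Some v \<in> W.I" using W.SI v by auto
  have BB1: "1 \<le> BW.BB" using W.B_ge_1[OF vI] by (simp add: W.B_BB)
  have Zp: "0 < W.Z W.U" by (rule W.Z_pos[OF W.SI])
  have A0: "0 < A2" using AA(1) by (simp add: A2_def)
  have LM: "n \<in> L \<Longrightarrow> n \<le> ?M" for n by (simp add: L_def)
  have fU0: "finite U0" by (rule finite_subset[OF U0 D_fin])
  let ?out = "{zs\<in>W.lists_at W.U ?v ?M L. \<not> set zs \<subseteq> Some ` U0}"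
  let ?b1 = "\<lambda>f. \<Sum>zs\<in>?out. of_bool (follows f (rev (?v # zs))) :: real"
  let ?b2 = "\<lambda>\<eta>::'v \<Rightarrow> 'e. of_bool (\<exists>u\<in>U0. \<eta> u \<notin> E0) :: real"
  have XV: "X \<eta> \<le> Vn (succ_map \<eta>)" "real (Vn (succ_map \<eta>)) \<le> real (X \<eta>) + ?b1 (succ_map \<eta>) + real (card (past_lists U0 v L)) * ?b2 \<eta>"
    if "\<eta> \<in> set_pmf forest_pmf" for \<eta>
    using pcount_bounds[OF that v U0 LM, where ?E0.0 = E0] by (simp_all add: X_def Vn_def)
  have fS: "finite (states D)" using D_fin by (simp add: states_def)
  have pa: "W.past_at f ?v ?M L \<subseteq> {u\<in>states D. reach f u ?v}" for f
    by (auto simp: W.past_at_def lev_def reach_def)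
  have VN: "Vn f \<le> card (states D)" for f
    unfolding Vn_def by (rule card_mono[OF fS]) (use pa in blast)
  have bint: "integrable ?f g" if "\<And>\<eta>. \<eta> \<in> set_pmf forest_pmf \<Longrightarrow> \<bar>g \<eta>\<bar> \<le> c" for g :: "_ \<Rightarrow> real" and c
    using that by (intro measure_pmf.integrable_const_bound[where B = c] AE_pmfI) auto
  define m where "m = W.ZZ W.U (\<lambda>f. real (Vn f)) / W.Z W.U"
  define Q where "Q = A2 * BW.BB\<^sup>2 * (real ?M + 1)\<^sup>2"
  have Q0: "0 < Q" using A0 BB1 by (simp add: Q_def)
  have m0: "real r * q / (2 * A2) \<le> m"
  proof -
    have "prb (paths j v) {xs. \<not> set xs \<subseteq> D} \<le> \<delta>" if "j \<le> 2 * r" for j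
    proof -
      have "prb (paths j v) {xs. \<not> set xs \<subseteq> D} \<le> prb (paths j v) {xs. \<not> set xs \<subseteq> U0}"
        using U0 by (intro measure_pmf.finite_measure_mono) auto
      then show ?thesis using \<delta>[OF that] by simp
    qed
    from past_mean_ge[OF v this small[unfolded q_def]] show ?thesis
      using Zp by (simp add: m_def Vn_def L_def q_def A2_def le_divide_eq)
  qed
  have mV: "m = (\<integral>\<eta>. real (Vn (succ_map \<eta>)) \<partial>?f)" unfolding m_def by (rule forest_expect[symmetric])
  have intX: "integrable ?f (\<lambda>\<eta>. real (X \<eta>))"
    using XV(1) VN by (intro bint[of _ "real (card (states D))"]) (simp, meson order_trans)
  have intV: "integrable ?f (\<lambda>\<eta>. real (Vn (succ_map \<eta>)))"
    using VN by (intro bint[of _ "real (card (states D))"]) simp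
  have b1_bound: "\<bar>?b1 f\<bar> \<le> real (card ?out)" for f
    using sum_bounded_above[of ?out "\<lambda>zs. of_bool (follows f (rev (?v # zs))) :: real" 1] by (auto simp: sum_nonneg)
  have intb1: "integrable ?f (\<lambda>\<eta>. ?b1 (succ_map \<eta>))"
    by (rule bint) (rule b1_bound)
  have intb2: "integrable ?f ?b2" by (intro bint[of _ 1]) auto
  have b1: "(\<integral>\<eta>. ?b1 (succ_map \<eta>) \<partial>?f) \<le> A2 * BW.BB ^ (2 * r + 1) * (real (2 * r + 1) * \<delta>)"
    unfolding forest_expect[of ?b1] W.ZZ_sum A2_def
    using follows_outside_le[OF v \<delta>, of ?M L] Zp by (simp add: divide_le_eq)
  have b2: "(\<integral>\<eta>. ?b2 \<eta> \<partial>?f) \<le> real (card U0) * (BW.BB * \<delta>')"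
  proof -
    have "?b2 = indicator {\<eta>. \<exists>u\<in>U0. \<eta> u \<notin> E0}" by (auto simp: indicator_def)
    then have "(\<integral>\<eta>. ?b2 \<eta> \<partial>?f) = measure ?f {\<eta>. \<exists>u\<in>U0. \<eta> u \<notin> E0}" by simp
    also have "{\<eta>. \<exists>u\<in>U0. \<eta> u \<notin> E0} = (\<Union>u\<in>U0. {\<eta>. \<eta> u \<in> - E0})" by auto
    also have "measure ?f \<dots> \<le> (\<Sum>u\<in>U0. measure ?f {\<eta>. \<eta> u \<in> - E0})"
      by (rule measure_pmf.finite_measure_subadditive_finite[OF fU0]) auto
    also have "\<dots> \<le> (\<Sum>u\<in>U0. BW.BB * \<delta>')"
    proof (rule sum_mono)
      fix u assume u: "u \<in> U0"
      have "measure ?f {\<eta>. \<eta> u \<in> - E0} \<le> BW.BB * prb (walk_edge G u) (- E0)"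
        using u U0 by (intro forest_edge_prob) auto
      also have "\<dots> \<le> BW.BB * \<delta>'" using \<delta>'[OF u] BB1 by (intro mult_left_mono) auto
      finally show "measure ?f {\<eta>. \<eta> u \<in> - E0} \<le> BW.BB * \<delta>'" .
    qed
    finally show ?thesis by simp
  qed
  have "m / (16 * Q) \<le> measure ?f {\<eta>. s \<le> X \<eta>}"
  proof (rule second_moment_pmf[OF _ Q0])
    show "X \<eta> \<le> card (states D)" if "\<eta> \<in> set_pmf forest_pmf" for \<eta> using XV(1)[OF that] VN order_trans by blast
    have "m \<le> (\<integral>\<eta>. real (X \<eta>) + ?b1 (succ_map \<eta>) + real (card (past_lists U0 v L)) * ?b2 \<eta> \<partial>?f)"
      unfolding mV using XV(2) intX intV intb1 intb2 by (intro integral_mono_AE AE_pmfI) auto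
    also have "\<dots> = (\<integral>\<eta>. real (X \<eta>) \<partial>?f) + (\<integral>\<eta>. ?b1 (succ_map \<eta>) \<partial>?f) + real (card (past_lists U0 v L)) * (\<integral>\<eta>. ?b2 \<eta> \<partial>?f)"
      using intX intb1 intb2 by simp
    also have "\<dots> \<le> (\<integral>\<eta>. real (X \<eta>) \<partial>?f) + real r * q / (8 * A2)"
      using b1 mult_left_mono[OF b2, of "real (card (past_lists U0 v L))"] small' by simp
    finally have "m \<le> (\<integral>\<eta>. real (X \<eta>) \<partial>?f) + m / 4" using m0 by simp
    then show "3 * m / 4 \<le> (\<integral>\<eta>. real (X \<eta>) \<partial>?f)" by simp
    have "(\<integral>\<eta>. (real (X \<eta>))\<^sup>2 \<partial>?f) \<le> (\<integral>\<eta>. (real (Vn (succ_map \<eta>)))\<^sup>2 \<partial>?f)"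
    proof (intro integral_mono_AE AE_pmfI)
      show "integrable ?f (\<lambda>\<eta>. (real (X \<eta>))\<^sup>2)"
        using XV(1) VN by (intro bint[of _ "(real (card (states D)))\<^sup>2"]) (auto intro!: power_mono, meson order_trans)
      show "integrable ?f (\<lambda>\<eta>. (real (Vn (succ_map \<eta>)))\<^sup>2)"
        using VN by (intro bint[of _ "(real (card (states D)))\<^sup>2"]) (auto intro!: power_mono)
    qed (use XV(1) in \<open>auto intro!: power_mono\<close>)
    also have "\<dots> = W.ZZ W.U (\<lambda>f. (real (Vn f))\<^sup>2) / W.Z W.U" by (rule forest_expect)
    also have "\<dots> \<le> Q * m"
      using W.ZZ_past_square_le[OF W.SI vU, of ?M L] Zp
      by (simp add: m_def Q_def A2_def Vn_def W.B_BB divide_le_eq)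
    finally show "(\<integral>\<eta>. (real (X \<eta>))\<^sup>2 \<partial>?f) \<le> Q * m" .
    have "(\<Sum>i = 1..<s. measure ?f {\<eta>. i \<le> X \<eta>}) \<le> (\<Sum>i = 1..<s. CV / sqrt (real i))"
    proof (rule sum_mono)
      fix i assume i: "i \<in> {1..<s}"
      have "measure ?f {\<eta>. i \<le> X \<eta>} \<le> measure ?f {\<eta>. real i \<le> real (card {u\<in>states D. reach (succ_map \<eta>) u (Some v)})}"
      proof (intro measure_pmf.finite_measure_mono_AE AE_pmfI impI)
        fix \<eta> assume \<eta>: "\<eta> \<in> set_pmf forest_pmf" and "\<eta> \<in> {\<eta>. i \<le> X \<eta>}"
        then have "i \<le> Vn (succ_map \<eta>)" using XV(1)[OF \<eta>] by simp
        also have "\<dots> \<le> card {u\<in>states D. reach (succ_map \<eta>) u (Some v)}"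
          unfolding Vn_def by (rule card_mono[OF _ pa]) (use fS in simp)
        finally show "\<eta> \<in> {\<eta>. real i \<le> real (card {u\<in>states D. reach (succ_map \<eta>) u (Some v)})}" by simp
      qed simp
      also have "\<dots> \<le> CV / sqrt (real i)" using i by (intro forest_volume_le[OF v]) auto
      finally show "measure ?f {\<eta>. i \<le> X \<eta>} \<le> CV / sqrt (real i)" .
    qed
    also have "\<dots> = CV * (\<Sum>i = 1..<Suc (s - 1). 1 / sqrt (real i))" using s by (simp add: sum_distrib_left)
    also have "\<dots> \<le> CV * (2 * sqrt (real (s - 1)))"
      using BW.CD(1) by (intro mult_left_mono sum_inverse_sqrt_le) (simp add: CV_def)
    also have "\<dots> \<le> m / 4" using vol m0 by (simp add: mult_ac)
    finally show "(\<Sum>i = 1..<s. measure ?f {\<eta>. i \<le> X \<eta>}) \<le> m / 4" .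
  qed
  moreover have "q / (288 * A2\<^sup>2 * BW.BB\<^sup>2 * real r) \<le> m / (16 * Q)"
  proof -
    have "(real ?M + 1)\<^sup>2 \<le> (3 * real r)\<^sup>2" using r by (intro power_mono) auto
    then have Q9: "Q \<le> A2 * BW.BB\<^sup>2 * (9 * (real r)\<^sup>2)" using A0 by (simp add: Q_def power_mult_distrib mult_left_mono)
    have "q / (288 * A2\<^sup>2 * BW.BB\<^sup>2 * real r) = real r * q / (2 * A2) / (16 * (A2 * BW.BB\<^sup>2 * (9 * (real r)\<^sup>2)))"
      using r A0 BB1 by (simp add: field_simps power2_eq_square)
    also have "\<dots> \<le> m / (16 * Q)"
      using m0 Q9 Q0 A0 q by (intro frac_le) (auto simp: mult_ac intro: order_trans[OF _ m0])
    finally show ?thesis .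
  qed
  ultimately show ?thesis unfolding X_def by linarith
qed

end

section \<open>Finitary events\<close>

text \<open>The function is a finite sum, over the patterns on \<open>a\<close>, of products of
  coordinate indicators, and these are continuous because \<open>bool\<close> is discrete.\<close>

lemma continuous_on_cylinder:
  fixes g :: "('a \<Rightarrow> bool) \<Rightarrow> real"
  assumes a: "finite a" and dep: "\<And>F F'. (\<And>p. p \<in> a \<Longrightarrow> F p = F' p) \<Longrightarrow> g F = g F'"
  shows "continuous_on UNIV g" and "bounded (range g)"
proof -
  have ga: "g F = g (\<lambda>p. p \<in> {p\<in>a. F p})" for F by (rule dep) auto
  have geq: "g F = (\<Sum>b\<in>Pow a. g (\<lambda>p. p \<in> b) * (\<Prod>p\<in>a. of_bool (F p = (p \<in> b))))" for F
  proof -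
    have "(\<Prod>p\<in>a. of_bool (F p = (p \<in> b)) :: real) = of_bool (b = {p\<in>a. F p})" if "b \<subseteq> a" for b
      using a that by (cases "\<forall>p\<in>a. F p = (p \<in> b)") (auto intro!: prod_zero)
    then have "(\<Sum>b\<in>Pow a. g (\<lambda>p. p \<in> b) * (\<Prod>p\<in>a. of_bool (F p = (p \<in> b)))) = (\<Sum>b\<in>Pow a. if b = {p\<in>a. F p} then g (\<lambda>p. p \<in> b) else 0)"
      by (intro sum.cong) auto
    also have "\<dots> = g (\<lambda>p. p \<in> {p\<in>a. F p})" using a by (subst sum.delta) auto
    finally show ?thesis using ga[of F] by simp
  qed
  have co: "continuous_on UNIV (\<lambda>F::'a \<Rightarrow> bool. of_bool (F p = c) :: real)" for p c
    using continuous_on_compose2[OF Topological_Spaces.continuous_on_discrete[of UNIV "\<lambda>x. of_bool (x = c) :: real"] continuous_on_product_coordinates[of p]]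
    by simp
  have "continuous_on UNIV (\<lambda>F. \<Sum>b\<in>Pow a. g (\<lambda>p. p \<in> b) * (\<Prod>p\<in>a. of_bool (F p = (p \<in> b))))"
    by (intro continuous_on_sum continuous_on_mult continuous_on_const continuous_on_prod co)
  then show "continuous_on UNIV g" by (subst continuous_on_cong[OF refl geq])
  have "range g \<subseteq> (\<lambda>b. g (\<lambda>p. p \<in> b)) ` Pow a"
  proof (rule image_subsetI)
    fix F
    show "g F \<in> (\<lambda>b. g (\<lambda>p. p \<in> b)) ` Pow a" by (rule image_eqI[where x = "{p\<in>a. F p}"]) (use ga[of F] in auto)
  qed
  then show "bounded (range g)" using a by (intro finite_imp_bounded finite_subset[of "range g"]) auto
qed

lemma pred_coordinate: "Measurable.pred borel (\<lambda>F :: 'a \<Rightarrow> bool. F p)"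
proof -
  have "open ((\<lambda>F :: 'a \<Rightarrow> bool. F p) -` {True})"
    by (rule open_vimage) (auto simp: discrete_topology_class.open_discrete)
  then show ?thesis unfolding pred_def by (simp add: vimage_def)
qed

lemma pred_countable_Bex:
  assumes "countable X" "\<And>i. i \<in> X \<Longrightarrow> Measurable.pred borel (P i)"
  shows "Measurable.pred borel (\<lambda>x. \<exists>i\<in>X. P i x)"
proof -
  have "{x. \<exists>i\<in>X. P i x} = (\<Union>i\<in>X. {x. P i x})" by auto
  also have "\<dots> \<in> sets borel" using assms by (intro sets.countable_UN') (auto simp: pred_def)
  finally show ?thesis by (simp add: pred_def)
qed

lemma successively_relpow:
  "successively (\<lambda>x y. (x, y) \<in> r) xs \<Longrightarrow> xs \<noteq> [] \<Longrightarrow> (hd xs, last xs) \<in> r ^^ (length xs - 1)"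
proof (induction xs)
  case (Cons x xs)
  show ?case
  proof (cases xs)
    case (Cons y ys)
    then have "(hd xs, last xs) \<in> r ^^ (length xs - 1)" "(x, hd xs) \<in> r" using Cons.IH Cons.prems by auto
    then show ?thesis using Cons relpow_Suc_I2[of x "hd xs" r "last xs" "length xs - 1"] by (simp del: relpow.simps)
  qed simp
qed simp

lemma successively_single_valued:
  assumes "single_valued r" "successively (\<lambda>x y. (x, y) \<in> r) xs" "successively (\<lambda>x y. (x, y) \<in> r) ys"
    "length xs = length ys" "xs \<noteq> []" "hd xs = hd ys"
  shows "xs = ys"
  using assms(4,2,3,5,6)
proof (induction xs ys rule: list_induct2)
  case (Cons x xs y ys)
  show ?case
  proof (cases "xs = []")
    case False
    then have "(x, hd xs) \<in> r" "(x, hd ys) \<in> r" using Cons by (auto simp: successively_Cons)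
    then have "hd xs = hd ys" using assms(1) by (auto dest: single_valuedD)
    then show ?thesis using Cons False by (auto simp: successively_Cons)
  qed (use Cons in auto)
qed simp

lemma le_ereal_of_enat_iff: "ereal R \<le> ereal_of_enat x \<longleftrightarrow> enat (nat \<lceil>R\<rceil>) \<le> x"
  by (cases x) (auto simp: nat_le_iff ceiling_le_iff)

lemma le_graph_diam_iff:
  assumes "1 \<le> k"
  shows "enat k \<le> graph_diam K \<longleftrightarrow> (\<exists>u\<in>verts K. \<exists>w\<in>verts K. \<forall>m<k. (u, w) \<notin> adj K ^^ m)"
proof -
  obtain j where k: "k = Suc j" using assms by (cases k) auto
  have "enat j < graph_dist K u w \<longleftrightarrow> (\<forall>m<k. (u, w) \<notin> adj K ^^ m)" for u w
  proof -
    have "enat j < graph_dist K u w \<longleftrightarrow> enat k \<le> graph_dist K u w" by (simp add: k Suc_ile_eq)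
    also have "\<dots> \<longleftrightarrow> (\<forall>m<k. (u, w) \<notin> adj K ^^ m)" unfolding graph_dist_def le_INF_iff by (auto simp: not_le[symmetric])
    finally show ?thesis .
  qed
  then show ?thesis unfolding graph_diam_def by (simp add: k Suc_ile_eq less_SUP_iff)
qed

context net
begin

section \<open>Events witnessed by finitely many arcs\<close>

definition Arcs :: "('v \<times> 'e) set" where "Arcs = {(u, e). e \<in> edges G \<and> u \<in> ends G e}"

lemma countable_Arcs: "countable Arcs"
proof -
  have "Arcs \<subseteq> V \<times> edges G" using wf by (fastforce simp: Arcs_def)
  then show ?thesis using countable_V countable_edges by (meson countable_SIGMA countable_subset)
qed

text \<open>Such an event is increasing and a countable union of cylinders, as \<open>Arcs\<close>
  is countable. It is therefore Borel, and an upper bound for it survives a weak limit.\<close>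

definition finitary :: "(('v \<times> 'e \<Rightarrow> bool) \<Rightarrow> bool) \<Rightarrow> bool" where
  "finitary \<Psi> \<longleftrightarrow> (\<forall>F. \<Psi> F \<longleftrightarrow> (\<exists>a. finite a \<and> a \<subseteq> Arcs \<and> (\<forall>p\<in>a. F p) \<and> \<Psi> (\<lambda>p. p \<in> a)))"

lemma finitaryI:
  assumes "\<And>F. \<Psi> F \<Longrightarrow> \<exists>a. finite a \<and> a \<subseteq> Arcs \<and> (\<forall>p\<in>a. F p) \<and> \<Psi> (\<lambda>p. p \<in> a)"
    and "\<And>F F'. \<Psi> F \<Longrightarrow> (\<And>p. F p \<Longrightarrow> F' p) \<Longrightarrow> \<Psi> F'"
  shows "finitary \<Psi>"
  unfolding finitary_def
proof (intro allI iffI)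
  fix F assume "\<exists>a. finite a \<and> a \<subseteq> Arcs \<and> (\<forall>p\<in>a. F p) \<and> \<Psi> (\<lambda>p. p \<in> a)"
  then obtain a where a: "\<forall>p\<in>a. F p" "\<Psi> (\<lambda>p. p \<in> a)" by (elim exE conjE)
  show "\<Psi> F" by (rule assms(2)[OF a(2)]) (use a(1) in simp)
qed (rule assms(1))

lemma finitary_eq:
  assumes "finitary \<Psi>"
  shows "{F. \<Psi> F} = (\<Union>a\<in>{a. finite a \<and> a \<subseteq> Arcs \<and> \<Psi> (\<lambda>p. p \<in> a)}. {F. \<forall>p\<in>a. F p})" (is "_ = ?R")
proof (rule set_eqI)
  fix F
  have "\<Psi> F \<longleftrightarrow> (\<exists>a. finite a \<and> a \<subseteq> Arcs \<and> (\<forall>p\<in>a. F p) \<and> \<Psi> (\<lambda>p. p \<in> a))"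
    using assms unfolding finitary_def by (rule spec)
  also have "\<dots> \<longleftrightarrow> F \<in> ?R" by blast
  finally show "F \<in> {F. \<Psi> F} \<longleftrightarrow> F \<in> ?R" by simp
qed

lemma pred_cylinder: "finite a \<Longrightarrow> Measurable.pred borel (\<lambda>F :: 'v \<times> 'e \<Rightarrow> bool. \<forall>p\<in>a. F p)"
  by (intro pred_intros_finite pred_coordinate)

lemma countable_finitary: "countable {a. finite a \<and> a \<subseteq> Arcs \<and> \<Psi> a}"
proof -
  have "{a. finite a \<and> a \<subseteq> Arcs \<and> \<Psi> a} \<subseteq> {a. finite a \<and> a \<subseteq> Arcs}" by blast
  then show ?thesis using countable_Collect_finite_subset[OF countable_Arcs] by (rule countable_subset)
qed

lemma pred_finitary:
  assumes "finitary \<Psi>"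
  shows "Measurable.pred borel \<Psi>"
proof -
  have "{F. \<Psi> F} \<in> sets borel"
    unfolding finitary_eq[OF assms]
  proof (rule sets.countable_UN'[OF countable_finitary])
    show "(\<lambda>a. {F :: 'v \<times> 'e \<Rightarrow> bool. \<forall>p\<in>a. F p}) ` {a. finite a \<and> a \<subseteq> Arcs \<and> \<Psi> (\<lambda>p. p \<in> a)} \<subseteq> sets borel"
      using pred_cylinder by (auto simp: pred_def)
  qed
  then show ?thesis by (simp add: pred_def)
qed

abbreviation arcs :: "('v \<times> 'e \<Rightarrow> bool) \<Rightarrow> 'v rel" where "arcs F \<equiv> forest_arcs G F"

lemma arcs_mono: "(\<And>p. F p \<Longrightarrow> F' p) \<Longrightarrow> arcs F \<subseteq> arcs F'"
  by (auto simp: forest_arcs_def)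

lemma relpow_arcs_mono:
  assumes "\<And>p. F p \<Longrightarrow> F' p" "(u, v) \<in> arcs F ^^ n"
  shows "(u, v) \<in> arcs F' ^^ n"
  using assms(2)
proof (induction n arbitrary: u)
  case (Suc n)
  then obtain w where "(u, w) \<in> arcs F" "(w, v) \<in> arcs F ^^ n" by (meson relpow_Suc_D2)
  then show ?case using Suc.IH arcs_mono[of F F', OF assms(1)] by (meson relpow_Suc_I2 subsetD)
qed simp

lemma relpow_arcs_finite:
  "(u, v) \<in> arcs F ^^ n \<Longrightarrow> \<exists>a. finite a \<and> a \<subseteq> Arcs \<and> (\<forall>p\<in>a. F p) \<and> (u, v) \<in> arcs (\<lambda>p. p \<in> a) ^^ n"
proof (induction n arbitrary: u)
  case 0
  then show ?case by (intro exI[of _ "{}"]) auto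
next
  case (Suc n)
  then obtain w where w: "(u, w) \<in> arcs F" "(w, v) \<in> arcs F ^^ n" by (meson relpow_Suc_D2)
  obtain a where a: "finite a" "a \<subseteq> Arcs" "\<forall>p\<in>a. F p" "(w, v) \<in> arcs (\<lambda>p. p \<in> a) ^^ n" using Suc.IH[OF w(2)] by blast
  obtain e where e: "e \<in> edges G" "F (u, e)" "ends G e = {u, w}" using w(1) by (auto simp: forest_arcs_def)
  let ?a = "insert (u, e) a"
  have "(w, v) \<in> arcs (\<lambda>p. p \<in> ?a) ^^ n" using a(4) by (rule relpow_arcs_mono[rotated]) auto
  moreover have "(u, w) \<in> arcs (\<lambda>p. p \<in> ?a)" using e by (auto simp: forest_arcs_def)
  ultimately have "(u, v) \<in> arcs (\<lambda>p. p \<in> ?a) ^^ Suc n" by (rule relpow_Suc_I2[rotated])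
  then show ?case using a e by (intro exI[of _ ?a]) (auto simp: Arcs_def)
qed

definition long_past :: "'v \<Rightarrow> nat \<Rightarrow> ('v \<times> 'e \<Rightarrow> bool) \<Rightarrow> bool" where
  "long_past v N F \<longleftrightarrow> (\<exists>u. (u, v) \<in> arcs F ^^ N)"

definition large_past :: "'v \<Rightarrow> nat \<Rightarrow> ('v \<times> 'e \<Rightarrow> bool) \<Rightarrow> bool" where
  "large_past v K F \<longleftrightarrow> (\<exists>X. finite X \<and> card X = K \<and> (\<forall>u\<in>X. (u, v) \<in> (arcs F)\<^sup>*))"

text \<open>Together with \<open>branching\<close> this expresses how a configuration fails to look
  like a forest near \<open>v\<close>. Nothing but a weak limit is known about the law, so both
  events have to be shown null by passing to the limit. A cycle through \<open>v\<close> is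
  included, with \<open>u = v\<close>.\<close>

definition two_lengths :: "'v \<Rightarrow> ('v \<times> 'e \<Rightarrow> bool) \<Rightarrow> bool" where
  "two_lengths v F \<longleftrightarrow> (\<exists>u n n'. n \<noteq> n' \<and> (u, v) \<in> arcs F ^^ n \<and> (u, v) \<in> arcs F ^^ n')"

definition branching :: "('v \<times> 'e \<Rightarrow> bool) \<Rightarrow> bool" where
  "branching F \<longleftrightarrow> \<not> single_valued (arcs F)"

lemma finitary_long_past: "finitary (long_past v N)"
proof (rule finitaryI)
  fix F assume "long_past v N F"
  then obtain u where "(u, v) \<in> arcs F ^^ N" by (auto simp: long_past_def)
  from relpow_arcs_finite[OF this] show "\<exists>a. finite a \<and> a \<subseteq> Arcs \<and> (\<forall>p\<in>a. F p) \<and> long_past v N (\<lambda>p. p \<in> a)"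
    unfolding long_past_def by (elim exE conjE) (intro exI conjI)
next
  fix F F' assume "long_past v N F" and FF': "\<And>p. F p \<Longrightarrow> F' p"
  then obtain u where "(u, v) \<in> arcs F ^^ N" by (auto simp: long_past_def)
  then have "(u, v) \<in> arcs F' ^^ N" by (rule relpow_arcs_mono[rotated]) (rule FF')
  then show "long_past v N F'" by (auto simp: long_past_def)
qed

lemma finitary_pair:
  assumes "(u, v) \<in> arcs F ^^ n" "(u', v') \<in> arcs F ^^ n'"
  shows "\<exists>a. finite a \<and> a \<subseteq> Arcs \<and> (\<forall>p\<in>a. F p) \<and> (u, v) \<in> arcs (\<lambda>p. p \<in> a) ^^ n \<and> (u', v') \<in> arcs (\<lambda>p. p \<in> a) ^^ n'"
proof -
  obtain a where a: "finite a" "a \<subseteq> Arcs" "\<forall>p\<in>a. F p" "(u, v) \<in> arcs (\<lambda>p. p \<in> a) ^^ n" using relpow_arcs_finite[OF assms(1)] by blast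
  obtain b where b: "finite b" "b \<subseteq> Arcs" "\<forall>p\<in>b. F p" "(u', v') \<in> arcs (\<lambda>p. p \<in> b) ^^ n'" using relpow_arcs_finite[OF assms(2)] by blast
  have "(u, v) \<in> arcs (\<lambda>p. p \<in> a \<union> b) ^^ n" by (rule relpow_arcs_mono[OF _ a(4)]) auto
  moreover have "(u', v') \<in> arcs (\<lambda>p. p \<in> a \<union> b) ^^ n'" by (rule relpow_arcs_mono[OF _ b(4)]) auto
  ultimately show ?thesis using a b by (intro exI[of _ "a \<union> b"]) auto
qed

lemma finitary_two_lengths: "finitary (two_lengths v)"
proof (rule finitaryI)
  fix F assume "two_lengths v F"
  then obtain u n n' where n: "n \<noteq> n'" and p: "(u, v) \<in> arcs F ^^ n" "(u, v) \<in> arcs F ^^ n'" by (auto simp: two_lengths_def)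
  obtain a where a: "finite a" "a \<subseteq> Arcs" "\<forall>p\<in>a. F p" "(u, v) \<in> arcs (\<lambda>p. p \<in> a) ^^ n" "(u, v) \<in> arcs (\<lambda>p. p \<in> a) ^^ n'"
    using finitary_pair[OF p] by (elim exE conjE)
  then have "two_lengths v (\<lambda>p. p \<in> a)" unfolding two_lengths_def using n by (intro exI[of _ u] exI[of _ n] exI[of _ n'] conjI)
  then show "\<exists>a. finite a \<and> a \<subseteq> Arcs \<and> (\<forall>p\<in>a. F p) \<and> two_lengths v (\<lambda>p. p \<in> a)" using a by (intro exI[of _ a] conjI)
next
  fix F F' assume "two_lengths v F" and FF': "\<And>p. F p \<Longrightarrow> F' p"
  then obtain u n n' where n: "n \<noteq> n'" and p: "(u, v) \<in> arcs F ^^ n" "(u, v) \<in> arcs F ^^ n'" by (auto simp: two_lengths_def)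
  have mono: "(x, y) \<in> arcs F' ^^ m" if "(x, y) \<in> arcs F ^^ m" for x y m
    using that by (rule relpow_arcs_mono[rotated]) (rule FF')
  show "two_lengths v F'" unfolding two_lengths_def using n mono[OF p(1)] mono[OF p(2)] by (intro exI[of _ u] exI[of _ n] exI[of _ n'] conjI)
qed

lemma branching_iff: "branching F \<longleftrightarrow> (\<exists>u w w'. w \<noteq> w' \<and> (u, w) \<in> arcs F ^^ 1 \<and> (u, w') \<in> arcs F ^^ 1)"
  by (auto simp: branching_def single_valued_def)

lemma finitary_branching: "finitary branching"
proof (rule finitaryI)
  fix F assume "branching F"
  then obtain u w w' where n: "w \<noteq> w'" and p: "(u, w) \<in> arcs F ^^ 1" "(u, w') \<in> arcs F ^^ 1" unfolding branching_iff by (elim exE conjE)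
  obtain a where a: "finite a" "a \<subseteq> Arcs" "\<forall>p\<in>a. F p" "(u, w) \<in> arcs (\<lambda>p. p \<in> a) ^^ 1" "(u, w') \<in> arcs (\<lambda>p. p \<in> a) ^^ 1"
    using finitary_pair[OF p] by (elim exE conjE)
  then have "branching (\<lambda>p. p \<in> a)" unfolding branching_iff using n by (intro exI[of _ u] exI[of _ w] exI[of _ w'] conjI)
  then show "\<exists>a. finite a \<and> a \<subseteq> Arcs \<and> (\<forall>p\<in>a. F p) \<and> branching (\<lambda>p. p \<in> a)" using a by (intro exI[of _ a] conjI)
next
  fix F F' assume "branching F" and FF': "\<And>p. F p \<Longrightarrow> F' p"
  then obtain u w w' where n: "w \<noteq> w'" and p: "(u, w) \<in> arcs F ^^ 1" "(u, w') \<in> arcs F ^^ 1" unfolding branching_iff by (elim exE conjE)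
  have mono: "(x, y) \<in> arcs F' ^^ m" if "(x, y) \<in> arcs F ^^ m" for x y m
    using that by (rule relpow_arcs_mono[rotated]) (rule FF')
  show "branching F'" unfolding branching_iff using n mono[OF p(1)] mono[OF p(2)] by (intro exI[of _ u] exI[of _ w] exI[of _ w'] conjI)
qed

lemma finitary_large_past: "finitary (large_past v K)"
proof (rule finitaryI)
  fix F assume "large_past v K F"
  then obtain X where X: "finite X" "card X = K" "\<forall>u\<in>X. (u, v) \<in> (arcs F)\<^sup>*" by (auto simp: large_past_def)
  have "\<exists>a. finite a \<and> a \<subseteq> Arcs \<and> (\<forall>p\<in>a. F p) \<and> (u, v) \<in> (arcs (\<lambda>p. p \<in> a))\<^sup>*" if u: "u \<in> X" for u
  proof -
    obtain n where "(u, v) \<in> arcs F ^^ n" using X(3) u rtrancl_imp_relpow by blast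
    from relpow_arcs_finite[OF this] show ?thesis using relpow_imp_rtrancl by blast
  qed
  then obtain a where a: "\<And>u. u \<in> X \<Longrightarrow> finite (a u) \<and> a u \<subseteq> Arcs \<and> (\<forall>p\<in>a u. F p) \<and> (u, v) \<in> (arcs (\<lambda>p. p \<in> a u))\<^sup>*" by metis
  let ?a = "\<Union>u\<in>X. a u"
  have "(u, v) \<in> (arcs (\<lambda>p. p \<in> ?a))\<^sup>*" if "u \<in> X" for u
    using a[OF that] rtrancl_mono[OF arcs_mono[of "\<lambda>p. p \<in> a u" "\<lambda>p. p \<in> ?a"]] that by blast
  then show "\<exists>a. finite a \<and> a \<subseteq> Arcs \<and> (\<forall>p\<in>a. F p) \<and> large_past v K (\<lambda>p. p \<in> a)"
    using a X by (intro exI[of _ ?a]) (auto simp: large_past_def)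
next
  fix F F' assume "large_past v K F" and FF': "\<And>p. F p \<Longrightarrow> F' p"
  then show "large_past v K F'" unfolding large_past_def using rtrancl_mono[OF arcs_mono[of F F', OF FF']] by blast
qed

end

context wnet
begin

lemma arcs_arc_map:
  assumes \<eta>: "\<eta> \<in> set_pmf forest_pmf"
  shows "(u, w) \<in> arcs (arc_map \<eta>) \<longleftrightarrow> u \<in> D \<and> w = other_end G u (\<eta> u)"
proof -
  have "ends G (\<eta> u) = {u, other_end G u (\<eta> u)}" "\<eta> u \<in> edges G" if "u \<in> D"
    using incident_ends(1)[OF forest_incident[OF \<eta> that]] forest_incident[OF \<eta> that] incident_edges by auto
  then show ?thesis by (auto simp: forest_arcs_def arc_map_def doubleton_eq_iff)
qed

lemma relpow_arcs_arc_map: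
  assumes \<eta>: "\<eta> \<in> set_pmf forest_pmf" and v: "v \<in> D" and p: "(u, v) \<in> arcs (arc_map \<eta>) ^^ n"
  shows "u \<in> D \<and> (succ_map \<eta> ^^ n) (Some u) = Some v"
  using p
proof (induction n arbitrary: u)
  case (Suc n)
  then obtain w where w: "(u, w) \<in> arcs (arc_map \<eta>)" "(w, v) \<in> arcs (arc_map \<eta>) ^^ n" by (meson relpow_Suc_D2)
  have "w \<in> D" "(succ_map \<eta> ^^ n) (Some w) = Some v" using Suc.IH[OF w(2)] by auto
  moreover have "u \<in> D" "succ_map \<eta> (Some u) = op w" using w(1) by (auto simp: arcs_arc_map[OF \<eta>] succ_map_def)
  ultimately show ?case by (simp add: funpow_Suc_right_apply op_def del: funpow.simps)
qed (use v in simp)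

lemma funpow_Some_unique:
  assumes \<eta>: "\<eta> \<in> set_pmf forest_pmf" and v: "v \<in> D"
    and n: "(succ_map \<eta> ^^ n) s = Some v" "(succ_map \<eta> ^^ n') s = Some v"
  shows "n = n'"
proof -
  have False if "(succ_map \<eta> ^^ i) s = Some v" "(succ_map \<eta> ^^ j) s = Some v" "i < j" for i j
  proof -
    have "(succ_map \<eta> ^^ Suc (j - i - 1)) (Some v) = Some v"
      using that funpow_add_apply[where f = "succ_map \<eta>" and m = "j - i" and n = i and x = s] by (simp add: Suc_diff_Suc del: funpow.simps)
    then show False using forests_no_cycle[OF forest_forests[OF \<eta>], of "Some v"] v by blast
  qed
  then show ?thesis using n by (metis linorder_neqE_nat)
qed

lemma measure_wired_ust_law:
  assumes "Measurable.pred borel \<Psi>"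
  shows "measure (wired_ust_law G D) {F. \<Psi> F} = prb forest_pmf {\<eta>. \<Psi> (arc_map \<eta>)}"
  unfolding wired_ust_law_eq using assms by (subst measure_distr) (auto simp: pred_def vimage_def)

lemma wired_long_past_le:
  assumes v: "v \<in> D" and N: "1 \<le> N"
  shows "measure (wired_ust_law G D) {F. long_past v N F} \<le> 4 * BW.CD / real N"
  unfolding measure_wired_ust_law[OF pred_finitary[OF finitary_long_past]]
proof (rule order_trans[OF _ forest_deep_le[OF v N]], intro measure_pmf.finite_measure_mono_AE AE_pmfI impI)
  fix \<eta> assume \<eta>: "\<eta> \<in> set_pmf forest_pmf" and "\<eta> \<in> {\<eta>. long_past v N (arc_map \<eta>)}"
  then obtain u where "(u, v) \<in> arcs (arc_map \<eta>) ^^ N" by (auto simp: long_past_def)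
  then have "(succ_map \<eta> ^^ N) (Some u) = Some v" using relpow_arcs_arc_map[OF \<eta> v] by blast
  then show "\<eta> \<in> {\<eta>. deep (succ_map \<eta>) (Some v) N}"
    unfolding deep_def using funpow_Some_unique[OF \<eta> v] by blast
qed simp

lemma wired_large_past_le:
  assumes v: "v \<in> D" and K: "1 \<le> K"
  shows "measure (wired_ust_law G D) {F. large_past v K F} \<le> CV / sqrt (real K)"
  unfolding measure_wired_ust_law[OF pred_finitary[OF finitary_large_past]]
proof (rule order_trans[OF _ forest_volume_le[OF v, of "real K"]], intro measure_pmf.finite_measure_mono_AE AE_pmfI impI)
  fix \<eta> assume \<eta>: "\<eta> \<in> set_pmf forest_pmf" and "\<eta> \<in> {\<eta>. large_past v K (arc_map \<eta>)}"
  then obtain X where X: "finite X" "card X = K" "\<forall>u\<in>X. (u, v) \<in> (arcs (arc_map \<eta>))\<^sup>*" by (auto simp: large_past_def)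
  have fS: "finite (states D)" using D_fin by (simp add: states_def)
  have "Some ` X \<subseteq> {u\<in>states D. reach (succ_map \<eta>) u (Some v)}"
  proof (rule image_subsetI)
    fix u assume "u \<in> X"
    then obtain n where "(u, v) \<in> arcs (arc_map \<eta>) ^^ n" using X(3) rtrancl_imp_relpow by blast
    then have "u \<in> D" "(succ_map \<eta> ^^ n) (Some u) = Some v" using relpow_arcs_arc_map[OF \<eta> v] by blast+
    then show "Some u \<in> {u\<in>states D. reach (succ_map \<eta>) u (Some v)}" unfolding reach_def states_def by blast
  qed
  then have "card (Some ` X) \<le> card {u\<in>states D. reach (succ_map \<eta>) u (Some v)}" using fS by (intro card_mono) auto
  then show "\<eta> \<in> {\<eta>. real K \<le> real (card {u\<in>states D. reach (succ_map \<eta>) u (Some v)})}" using X by (simp add: card_image)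
qed (use K in auto)

lemma wired_two_lengths: "v \<in> D \<Longrightarrow> measure (wired_ust_law G D) {F. two_lengths v F} \<le> 0"
proof -
  assume v: "v \<in> D"
  have "prb forest_pmf {\<eta>. two_lengths v (arc_map \<eta>)} \<le> prb forest_pmf {}"
  proof (intro measure_pmf.finite_measure_mono_AE AE_pmfI impI)
    fix \<eta> assume \<eta>: "\<eta> \<in> set_pmf forest_pmf" and "\<eta> \<in> {\<eta>. two_lengths v (arc_map \<eta>)}"
    then show "\<eta> \<in> {}" unfolding two_lengths_def
      using relpow_arcs_arc_map[OF \<eta> v] funpow_Some_unique[OF \<eta> v] by blast
  qed simp
  then show ?thesis by (simp add: measure_wired_ust_law[OF pred_finitary[OF finitary_two_lengths]])
qed

lemma wired_branching: "measure (wired_ust_law G D) {F. branching F} \<le> 0"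
proof -
  have "prb forest_pmf {\<eta>. branching (arc_map \<eta>)} \<le> prb forest_pmf {}"
    by (intro measure_pmf.finite_measure_mono_AE AE_pmfI impI)
       (auto simp: branching_def single_valued_def arcs_arc_map)
  then show ?thesis by (simp add: measure_wired_ust_law[OF pred_finitary[OF finitary_branching]])
qed

end

context net
begin

section \<open>Diameter and size of the past in terms of arcs\<close>

lemma arcs_V: "(u, w) \<in> arcs F \<Longrightarrow> u \<in> V \<and> w \<in> V"
  using wf by (fastforce simp: forest_arcs_def doubleton_eq_iff)

lemma relpow_arcs_V: "(u, v) \<in> arcs F ^^ n \<Longrightarrow> v \<in> V \<Longrightarrow> u \<in> V"
  by (cases n) (auto dest!: relpow_Suc_D2 dest: arcs_V simp del: relpow.simps(2))

lemma pred_arcs: "Measurable.pred borel (\<lambda>F. (u, w) \<in> arcs F)"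
proof -
  have "(\<lambda>F. (u, w) \<in> arcs F) = (\<lambda>F. \<exists>e\<in>{e\<in>edges G. ends G e = {u, w}}. F (u, e))" by (auto simp: forest_arcs_def)
  moreover have "Measurable.pred borel (\<lambda>F :: 'v \<times> 'e \<Rightarrow> bool. \<exists>e\<in>{e\<in>edges G. ends G e = {u, w}}. F (u, e))"
    by (intro pred_countable_Bex pred_coordinate countable_subset[OF _ countable_edges]) auto
  ultimately show ?thesis by simp
qed

lemma pred_relpow:
  fixes r :: "('v \<times> 'e \<Rightarrow> bool) \<Rightarrow> 'v rel"
  assumes m: "\<And>x y. Measurable.pred borel (\<lambda>F. (x, y) \<in> r F)" and V: "\<And>F x y. (x, y) \<in> r F \<Longrightarrow> y \<in> V"
  shows "Measurable.pred borel (\<lambda>F. (u, v) \<in> r F ^^ n)"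
proof (induction n arbitrary: u)
  case (Suc n)
  have "(\<lambda>F. (u, v) \<in> r F ^^ Suc n) = (\<lambda>F. \<exists>w\<in>V. (u, w) \<in> r F \<and> (w, v) \<in> r F ^^ n)"
    using V by (auto simp: fun_eq_iff dest!: relpow_Suc_D2 intro: relpow_Suc_I2 simp del: relpow.simps)
  moreover have "Measurable.pred borel (\<lambda>F. \<exists>w\<in>V. (u, w) \<in> r F \<and> (w, v) \<in> r F ^^ n)"
    by (intro pred_countable_Bex countable_V pred_intros_logic m Suc.IH)
  ultimately show ?case by simp
qed simp

lemma pred_rtrancl_arcs: "Measurable.pred borel (\<lambda>F. (u, v) \<in> (arcs F)\<^sup>*)"
proof -
  have "(\<lambda>F. (u, v) \<in> (arcs F)\<^sup>*) = (\<lambda>F. \<exists>n::nat. (u, v) \<in> arcs F ^^ n)" by (auto simp: rtrancl_power)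
  moreover have "Measurable.pred borel (\<lambda>F. \<exists>n::nat. (u, v) \<in> arcs F ^^ n)"
    by (intro pred_intros_countable pred_relpow pred_arcs) (auto dest: arcs_V)
  ultimately show ?thesis by simp
qed

lemma verts_past: "verts (past G F v) = {u. (u, v) \<in> (arcs F)\<^sup>*}"
  by (simp add: past_def Let_def)

lemma adj_past_iff:
  "(x, y) \<in> adj (past G F v) \<longleftrightarrow> (x, v) \<in> (arcs F)\<^sup>* \<and> (y, v) \<in> (arcs F)\<^sup>* \<and> ((x, y) \<in> arcs F \<or> (y, x) \<in> arcs F)"
  by (auto simp: adj_def past_def Let_def forest_arcs_def insert_commute)

lemma verts_past_V: "v \<in> V \<Longrightarrow> verts (past G F v) \<subseteq> V"
  using relpow_arcs_V by (auto simp: verts_past rtrancl_power)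

lemma pred_diam:
  assumes v: "v \<in> V" and k: "1 \<le> k"
  shows "Measurable.pred borel (\<lambda>F. enat k \<le> graph_diam (past G F v))"
proof -
  have "(\<lambda>F. enat k \<le> graph_diam (past G F v)) = (\<lambda>F. \<exists>u\<in>V. \<exists>w\<in>V. (u, v) \<in> (arcs F)\<^sup>* \<and> (w, v) \<in> (arcs F)\<^sup>* \<and> (\<forall>m\<in>{..<k}. (u, w) \<notin> adj (past G F v) ^^ m))"
    unfolding le_graph_diam_iff[OF k] using verts_past_V[OF v] by (auto simp: verts_past fun_eq_iff subset_iff) blast+
  moreover have "Measurable.pred borel (\<lambda>F. \<exists>u\<in>V. \<exists>w\<in>V. (u, v) \<in> (arcs F)\<^sup>* \<and> (w, v) \<in> (arcs F)\<^sup>* \<and> (\<forall>m\<in>{..<k}. (u, w) \<notin> adj (past G F v) ^^ m))"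
  proof (intro pred_countable_Bex countable_V pred_intros_logic pred_rtrancl_arcs pred_intros_finite pred_relpow)
    show "Measurable.pred borel (\<lambda>F. (x, y) \<in> adj (past G F v))" for x y
      unfolding adj_past_iff by (intro pred_intros_logic pred_rtrancl_arcs pred_arcs)
    show "y \<in> V" if "(x, y) \<in> adj (past G F v)" for F x y
      using that arcs_V by (auto simp: adj_past_iff)
  qed simp
  ultimately show ?thesis by simp
qed

lemma num_verts_past_iff: "enat k \<le> num_verts (past G F v) \<longleftrightarrow> large_past v k F"
proof -
  let ?K = "{u. (u, v) \<in> (arcs F)\<^sup>*}"
  have "(\<exists>X. finite X \<and> card X = k \<and> X \<subseteq> ?K) \<longleftrightarrow> enat k \<le> num_verts (past G F v)"
  proof (cases "finite ?K")
    case True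
    then show ?thesis using card_mono[OF True] obtain_subset_with_card_n[of k ?K]
      by (auto simp: num_verts_def verts_past)
  next
    case False
    then show ?thesis using infinite_arbitrarily_large[OF False, of k] by (auto simp: num_verts_def verts_past)
  qed
  then show ?thesis by (auto simp: large_past_def subset_iff)
qed

lemma relpow_arcs_adj:
  assumes "(u, v) \<in> arcs F ^^ n"
  shows "(u, v) \<in> adj (past G F v) ^^ n" "(v, u) \<in> adj (past G F v) ^^ n"
proof -
  have "(u, v) \<in> adj (past G F v) ^^ n \<and> (v, u) \<in> adj (past G F v) ^^ n"
    using assms
  proof (induction n arbitrary: u)
    case (Suc n)
    then obtain w where w: "(u, w) \<in> arcs F" "(w, v) \<in> arcs F ^^ n" by (meson relpow_Suc_D2)
    then have "(w, v) \<in> (arcs F)\<^sup>*" "(u, v) \<in> (arcs F)\<^sup>*" by (auto intro: relpow_imp_rtrancl converse_rtrancl_into_rtrancl)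
    then have "(u, w) \<in> adj (past G F v)" "(w, u) \<in> adj (past G F v)" using w by (auto simp: adj_past_iff)
    then show ?case using Suc.IH[OF w(2)] by (meson relpow_Suc_I relpow_Suc_I2)
  qed simp
  then show "(u, v) \<in> adj (past G F v) ^^ n" "(v, u) \<in> adj (past G F v) ^^ n" by auto
qed

text \<open>Two vertices of the past are joined through \<open>v\<close>, so one of them has a
  directed path to \<open>v\<close> of at least half the diameter, rounded up. A longer path
  contains one of the required length as its final piece.\<close>

lemma diam_past_long:
  assumes k: "1 \<le> k" and d: "enat k \<le> graph_diam (past G F v)"
  shows "long_past v ((k + 1) div 2) F"
proof -
  obtain u w where uw: "(u, v) \<in> (arcs F)\<^sup>*" "(w, v) \<in> (arcs F)\<^sup>*" and far: "\<forall>m<k. (u, w) \<notin> adj (past G F v) ^^ m"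
    using d unfolding le_graph_diam_iff[OF k] by (auto simp: verts_past)
  obtain n n' where n: "(u, v) \<in> arcs F ^^ n" "(w, v) \<in> arcs F ^^ n'" using uw by (meson rtrancl_imp_relpow)
  have "(u, w) \<in> adj (past G F v) ^^ (n + n')" using relpow_arcs_adj(1)[OF n(1)] relpow_arcs_adj(2)[OF n(2)] by (rule relpow_trans)
  then have "k \<le> n + n'" using far by (meson not_le)
  then have "(k + 1) div 2 \<le> n \<or> (k + 1) div 2 \<le> n'" by linarith
  moreover have "long_past v N F" if "(z, v) \<in> arcs F ^^ i" "N \<le> i" for z i N
  proof -
    have "(z, v) \<in> arcs F ^^ ((i - N) + N)" using that by simp
    then show ?thesis unfolding relpow_add long_past_def by blast
  qed
  ultimately show ?thesis using n by blast
qed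

text \<open>When all directed paths from a vertex to \<open>v\<close> have the same length, this
  length changes by one along every edge of the past. Hence no undirected path from \<open>u\<close>
  to \<open>v\<close> is shorter than \<open>n\<close>.\<close>

lemma long_past_diam:
  assumes k: "1 \<le> k" and u: "(u, v) \<in> arcs F ^^ n" and n: "k \<le> n" and no: "\<not> two_lengths v F"
  shows "enat k \<le> graph_diam (past G F v)"
proof -
  have "n \<le> m" if "(x, v) \<in> adj (past G F v) ^^ m" "(x, v) \<in> arcs F ^^ n" for x m n
    using that
  proof (induction m arbitrary: x n)
    case 0
    then have "(v, v) \<in> arcs F ^^ n" "(v, v) \<in> arcs F ^^ 0" by auto
    then show ?case using no unfolding two_lengths_def by blast
  next
    case (Suc m)
    then obtain y where y: "(x, y) \<in> adj (past G F v)" "(y, v) \<in> adj (past G F v) ^^ m" by (meson relpow_Suc_D2)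
    then consider "(x, y) \<in> arcs F" "(y, v) \<in> (arcs F)\<^sup>*" | "(y, x) \<in> arcs F" by (auto simp: adj_past_iff)
    then show ?case
    proof cases
      case 1
      then obtain n' where n': "(y, v) \<in> arcs F ^^ n'" by (meson rtrancl_imp_relpow)
      then have "(x, v) \<in> arcs F ^^ Suc n'" using 1 by (meson relpow_Suc_I2)
      then have "n = Suc n'" using no Suc.prems(2) unfolding two_lengths_def by blast
      then show ?thesis using Suc.IH[OF y(2) n'] by simp
    next
      case 2
      then have "(y, v) \<in> arcs F ^^ Suc n" using Suc.prems(2) by (meson relpow_Suc_I2)
      from Suc.IH[OF y(2) this] show ?thesis by simp
    qed
  qed
  from this[OF _ u] have "\<forall>m<k. (u, v) \<notin> adj (past G F v) ^^ m" using n by (meson leD le_trans not_le)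
  moreover have "(u, v) \<in> (arcs F)\<^sup>*" using u by (rule relpow_imp_rtrancl)
  ultimately show ?thesis unfolding le_graph_diam_iff[OF k] by (intro bexI[of _ u] bexI[of _ v]) (auto simp: verts_past)
qed

lemma arc_path_arcs: "arc_path E0 F xs \<Longrightarrow> successively (\<lambda>x y. (x, y) \<in> arcs F) xs"
  unfolding arc_path_def by (erule successively_mono) (auto simp: forest_arcs_def)

lemma arc_path_relpow:
  assumes "arc_path E0 F (rev (v # zs))"
  shows "(last (v # zs), v) \<in> arcs F ^^ length zs"
proof -
  have "(hd (rev (v # zs)), last (rev (v # zs))) \<in> arcs F ^^ (length (rev (v # zs)) - 1)"
    by (rule successively_relpow[OF arc_path_arcs[OF assms]]) simp
  moreover have "last (rev (v # zs)) = v" "length (rev (v # zs)) - 1 = length zs" by simp_all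
  ultimately show ?thesis by (simp only: hd_rev)
qed

lemma pcount_diam:
  assumes "1 \<le> pcount U0 E0 v {r..2 * r} F" and r: "1 \<le> r" and no: "\<not> two_lengths v F"
  shows "enat r \<le> graph_diam (past G F v)"
proof -
  have "{zs\<in>past_lists U0 v {r..2 * r}. arc_path E0 F (rev (v # zs))} \<noteq> {}" using assms(1) unfolding pcount_def by (metis card.empty not_one_le_zero)
  then obtain zs where zs: "zs \<in> past_lists U0 v {r..2 * r}" "arc_path E0 F (rev (v # zs))" by blast
  show ?thesis by (rule long_past_diam[OF r arc_path_relpow[OF zs(2)] _ no]) (use zs in \<open>simp add: past_lists_def\<close>)
qed

text \<open>Without \<open>two_lengths\<close> the starting vertex determines the length of a past
  path, and without \<open>branching\<close> it then determines the path. So different paths have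
  different starts.\<close>

lemma pcount_large:
  assumes s: "s \<le> pcount U0 E0 v L F" and no: "\<not> two_lengths v F" "\<not> branching F"
  shows "large_past v s F"
proof -
  let ?X = "{zs\<in>past_lists U0 v L. arc_path E0 F (rev (v # zs))}"
  obtain Y where Y: "Y \<subseteq> ?X" "card Y = s" "finite Y" using s unfolding pcount_def by (rule obtain_subset_with_card_n)
  have inj: "inj_on (\<lambda>zs. last (v # zs)) Y"
  proof (rule inj_onI)
    fix zs ws assume z: "zs \<in> Y" "ws \<in> Y" and l: "last (v # zs) = last (v # ws)"
    have ap: "arc_path E0 F (rev (v # zs))" "arc_path E0 F (rev (v # ws))" using z Y by auto
    have "length zs = length ws"
      using arc_path_relpow[OF ap(1)] arc_path_relpow[OF ap(2)] no(1) unfolding two_lengths_def l by blast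
    moreover have "hd (rev (v # zs)) = hd (rev (v # ws))" using l by (simp only: hd_rev)
    ultimately have "rev (v # zs) = rev (v # ws)"
      using no(2) by (intro successively_single_valued[OF _ arc_path_arcs[OF ap(1)] arc_path_arcs[OF ap(2)]]) (simp_all add: branching_def)
    then show "zs = ws" by simp
  qed
  have "(u, v) \<in> (arcs F)\<^sup>*" if "u \<in> (\<lambda>zs. last (v # zs)) ` Y" for u
    using that Y arc_path_relpow relpow_imp_rtrancl by blast
  then show ?thesis unfolding large_past_def using Y inj
    by (intro exI[of _ "(\<lambda>zs. last (v # zs)) ` Y"]) (auto simp: card_image simp del: last.simps)
qed

lemma wnetI: "finite D \<Longrightarrow> D \<subseteq> V \<Longrightarrow> wnet G D"
  by unfold_locales

text \<open>The order of choices matters: \<open>\<delta>\<close> depends on \<open>r\<close> and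
  \<open>q_prob G v\<close>, \<open>U0\<close> on \<open>\<delta>\<close> by tightness of the first
  \<open>2 * r\<close> steps, \<open>\<delta>'\<close> on the number of lists in \<open>U0\<close>,
  and \<open>E0\<close> on \<open>\<delta>'\<close>. None of them depends on the finite domain, as
  is needed for the limit. Each error receives half of the allowance.\<close>

lemma exists_truncation:
  assumes v: "v \<in> V" and r: "1 \<le> r" and q: "0 < q_prob G v"
  shows "\<exists>U0 E0 \<delta> \<delta>'. finite U0 \<and> U0 \<subseteq> V \<and> v \<in> U0 \<and> finite E0 \<and>
    (\<forall>j\<le>2 * r. prb (paths j v) {xs. \<not> set xs \<subseteq> U0} \<le> \<delta>) \<and>
    (\<forall>u\<in>U0. prb (walk_edge G u) (- E0) \<le> \<delta>') \<and>
    BW.BB ^ (2 * r) * \<delta> \<le> q_prob G v / 2 \<and>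
    (2 * AA)\<^sup>2 * BW.BB ^ (2 * r + 1) * (real (2 * r + 1) * \<delta>) + real (card (past_lists U0 v {r..2 * r})) * (real (card U0) * (BW.BB * \<delta>'))
      \<le> real r * q_prob G v / (8 * (2 * AA)\<^sup>2)"
proof -
  let ?q = "q_prob G v" and ?A = "(2 * AA)\<^sup>2" and ?b = "BW.BB"
  have A0: "0 < ?A" using AA(1) by simp
  interpret W0: wnet G "{v}" by (rule wnetI) (use v in auto)
  have b1: "1 \<le> ?b" using W0.W.B_ge_1[of "Some v"] W0.W.SI by (simp add: W0.W.B_BB)
  let ?t = "real r * ?q / (16 * ?A)"
  have t0: "0 < ?t" using A0 q r by simp
  define c where "c = ?A * ?b ^ (2 * r + 1) * real (2 * r + 1)"
  have c0: "0 < c" using A0 b1 by (simp add: c_def)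
  define \<delta> where "\<delta> = min (?q / (2 * ?b ^ (2 * r))) (?t / c)"
  have "0 < ?q / (2 * ?b ^ (2 * r))" using q b1 by simp
  then have \<delta>0: "0 < \<delta>" using divide_pos_pos[OF t0 c0] unfolding \<delta>_def min_less_iff_conj by (rule conjI)
  have d1: "?b ^ (2 * r) * \<delta> \<le> ?q / 2"
  proof -
    have "\<delta> \<le> ?q / (2 * ?b ^ (2 * r))" by (simp add: \<delta>_def)
    then show ?thesis using b1 by (simp add: le_divide_eq mult_ac)
  qed
  have d2: "c * \<delta> \<le> ?t"
  proof -
    have "c * \<delta> \<le> c * (?t / c)" using c0 by (intro mult_left_mono) (auto simp: \<delta>_def)
    then show ?thesis using c0 by (simp only: nonzero_mult_div_cancel_left times_divide_eq_right) simp
  qed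
  have "\<forall>j. \<exists>X. finite X \<and> prb (paths j v) (- X) \<le> \<delta>" using pmf_tight[OF \<delta>0] by blast
  then obtain X where X: "\<And>j. finite (X j)" "\<And>j. prb (paths j v) (- X j) \<le> \<delta>" by metis
  define U0 where "U0 = insert v (V \<inter> (\<Union>j\<in>{..2 * r}. \<Union>xs\<in>X j. set xs))"
  have U0: "finite U0" "U0 \<subseteq> V" "v \<in> U0" using X v by (auto simp: U0_def)
  have tail: "prb (paths j v) {xs. \<not> set xs \<subseteq> U0} \<le> \<delta>" if "j \<le> 2 * r" for j
  proof -
    have "prb (paths j v) {xs. \<not> set xs \<subseteq> U0} \<le> prb (paths j v) (- X j)"
    proof (intro measure_pmf.finite_measure_mono_AE AE_pmfI impI)
      fix xs assume "xs \<in> set_pmf (paths j v)" "xs \<in> {xs. \<not> set xs \<subseteq> U0}"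
      then show "xs \<in> - X j" using paths_in_V[OF v, of xs j] that by (auto simp: U0_def)
    qed simp
    then show ?thesis using X(2)[of j] by simp
  qed
  define k where "k = real (card (past_lists U0 v {r..2 * r})) * (real (card U0) * ?b) + 1"
  have k0: "0 < k" using b1 by (simp add: k_def add_nonneg_pos)
  define \<delta>' where "\<delta>' = ?t / k"
  have \<delta>'0: "0 < \<delta>'" unfolding \<delta>'_def by (rule divide_pos_pos[OF t0 k0])
  have "\<forall>u. \<exists>Y. finite Y \<and> prb (walk_edge G u) (- Y) \<le> \<delta>'" using pmf_tight[OF \<delta>'0] by blast
  then obtain Y where Y: "\<And>u. finite (Y u)" "\<And>u. prb (walk_edge G u) (- Y u) \<le> \<delta>'" by metis
  define E0 where "E0 = (\<Union>u\<in>U0. Y u)"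
  have edge: "prb (walk_edge G u) (- E0) \<le> \<delta>'" if "u \<in> U0" for u
  proof -
    have "prb (walk_edge G u) (- E0) \<le> prb (walk_edge G u) (- Y u)"
      using that by (intro measure_pmf.finite_measure_mono) (auto simp: E0_def)
    then show ?thesis using Y(2)[of u] by simp
  qed
  have "k * \<delta>' = ?t" using k0 by (simp add: \<delta>'_def)
  then have "real (card (past_lists U0 v {r..2 * r})) * (real (card U0) * (?b * \<delta>')) \<le> ?t"
    using \<delta>'0 by (simp add: k_def algebra_simps)
  then have "?A * ?b ^ (2 * r + 1) * (real (2 * r + 1) * \<delta>) + real (card (past_lists U0 v {r..2 * r})) * (real (card U0) * (?b * \<delta>')) \<le> real r * ?q / (8 * ?A)"
    using d2 by (simp add: c_def mult_ac)
  then show ?thesis using U0 tail edge d1 Y(1) by (intro exI[of _ U0] exI[of _ E0] exI[of _ \<delta>] exI[of _ \<delta>']) (auto simp: E0_def)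
qed

end

section \<open>The limit along an exhaustion\<close>

locale wusf_limit = net G for G :: "('v, 'e) network" +
  fixes \<mu> :: "('v \<times> 'e \<Rightarrow> bool) measure" and Wn :: "nat \<Rightarrow> 'v set"
  assumes prob_mu: "prob_space \<mu>" and sets_mu: "sets \<mu> = sets borel"
    and exh: "exhaustion G Wn" and conv: "weakly_converges (\<lambda>n. wired_ust_law G (Wn n)) \<mu>"
begin

sublocale M: prob_space \<mu> by (rule prob_mu)

lemma space_mu: "space \<mu> = UNIV"
  using sets_eq_imp_space_eq[OF sets_mu] by simp

lemma Wn: "finite (Wn n)" "Wn n \<subseteq> V" "incseq Wn"
  using exh by (auto simp: exhaustion_def)

lemma Wn_wnet: "wnet G (Wn n)"
  by (rule wnetI[OF Wn(1,2)])

lemma eventually_Wn: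
  assumes U0: "finite U0" "U0 \<subseteq> V"
  shows "\<forall>\<^sub>F n in sequentially. U0 \<subseteq> Wn n"
  using U0
proof (induction U0 rule: finite_induct)
  case (insert u U0)
  then have "u \<in> (\<Union>n. Wn n)" using exh by (simp add: exhaustion_def)
  then obtain N where "u \<in> Wn N" by blast
  then have "\<forall>\<^sub>F n in sequentially. u \<in> Wn n"
    using Wn(3) unfolding eventually_sequentially incseq_def by blast
  then show ?case using insert by (auto elim: eventually_elim2)
qed simp

lemma cylinder_limit:
  assumes a: "finite a" and dep: "\<And>F F'. (\<And>p. p \<in> a \<Longrightarrow> F p = F' p) \<Longrightarrow> \<Psi> F = \<Psi> F'"
  shows "(\<lambda>n. measure (wired_ust_law G (Wn n)) {F. \<Psi> F}) \<longlonglongrightarrow> measure \<mu> {F. \<Psi> F}" and "{F. \<Psi> F} \<in> sets borel"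
proof -
  let ?g = "\<lambda>F. of_bool (\<Psi> F) :: real"
  have g: "?g F = ?g F'" if "\<And>p. p \<in> a \<Longrightarrow> F p = F' p" for F F' using dep[OF that] by simp
  have c: "continuous_on UNIV ?g" "bounded (range ?g)" using continuous_on_cylinder[of a ?g, OF a g] by auto
  have i: "?g = indicator {F. \<Psi> F}" by (auto simp: indicator_def)
  have "?g \<in> borel_measurable borel" by (rule borel_measurable_continuous_onI[OF c(1)])
  then show m: "{F. \<Psi> F} \<in> sets borel" unfolding i borel_measurable_indicator_iff by simp
  have "integral\<^sup>L (wired_ust_law G (Wn n)) ?g = measure (wired_ust_law G (Wn n)) {F. \<Psi> F}" for n
    unfolding i by (simp add: wired_ust_law_def)
  moreover have "integral\<^sup>L \<mu> ?g = measure \<mu> {F. \<Psi> F}" unfolding i by (simp add: space_mu)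
  ultimately show "(\<lambda>n. measure (wired_ust_law G (Wn n)) {F. \<Psi> F}) \<longlonglongrightarrow> measure \<mu> {F. \<Psi> F}"
    using conv[unfolded weakly_converges_def, rule_format, of ?g] c by simp
qed

text \<open>A lower bound needs a continuous indicator, hence an event depending on a finite set of
  arcs. The domains contain \<open>U0\<close> from some index on.\<close>

lemma limit_ge:
  assumes a: "finite a" and dep: "\<And>F F'. (\<And>p. p \<in> a \<Longrightarrow> F p = F' p) \<Longrightarrow> \<Psi> F = \<Psi> F'"
    and U0: "finite U0" "U0 \<subseteq> V" and ge: "\<And>D. wnet G D \<Longrightarrow> U0 \<subseteq> D \<Longrightarrow> c \<le> measure (wired_ust_law G D) {F. \<Psi> F}"
  shows "c \<le> measure \<mu> {F. \<Psi> F}"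
proof (rule tendsto_lowerbound[OF cylinder_limit(1)[OF a dep]])
  show "\<forall>\<^sub>F n in sequentially. c \<le> measure (wired_ust_law G (Wn n)) {F. \<Psi> F}"
    using eventually_Wn[OF U0] by (rule eventually_mono) (rule ge[OF Wn_wnet])
qed auto

text \<open>A finitary event is an increasing union of cylinder events.\<close>

lemma limit_le:
  assumes fin: "finitary \<Psi>" and v: "v \<in> V"
    and le: "\<And>D. wnet G D \<Longrightarrow> v \<in> D \<Longrightarrow> measure (wired_ust_law G D) {F. \<Psi> F} \<le> c"
  shows "measure \<mu> {F. \<Psi> F} \<le> c"
proof -
  let ?A = "{a. finite a \<and> a \<subseteq> Arcs \<and> \<Psi> (\<lambda>p. p \<in> a)}"
  have ev: "\<forall>\<^sub>F n in sequentially. measure (wired_ust_law G (Wn n)) {F. \<Psi> F} \<le> c"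
    using eventually_Wn[of "{v}"] v by (auto elim!: eventually_mono intro: le[OF Wn_wnet])
  then have c0: "0 \<le> c" by (meson eventually_happens sequentially_bot measure_nonneg order_trans)
  have meas: "{F. \<Psi> F} \<in> sets borel" using pred_finitary[OF fin] by (simp add: pred_def)
  show ?thesis
  proof (cases "?A = {}")
    case True
    show ?thesis unfolding finitary_eq[OF fin] True using c0 by simp
  next
    case False
    define f where "f = from_nat_into ?A"
    have rf: "range f = ?A" unfolding f_def by (rule range_from_nat_into[OF False countable_finitary])
    then have fA: "f i \<in> ?A" for i by blast
    define O' where "O' k F \<longleftrightarrow> (\<exists>i\<le>k. \<forall>p\<in>f i. F p)" for k :: nat and F
    have un: "{F. \<Psi> F} = (\<Union>k. {F. O' k F})"
      unfolding finitary_eq[OF fin] rf[symmetric] by (auto simp: O'_def)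
    have fin_k: "finite (\<Union>i\<le>k. f i)" for k using fA by auto
    have dep: "O' k F = O' k F'" if "\<And>p. p \<in> (\<Union>i\<le>k. f i) \<Longrightarrow> F p = F' p" for k F F'
      using that unfolding O'_def by (intro ex_cong1 conj_cong refl ball_cong) auto
    have "measure \<mu> {F. O' k F} \<le> c" for k
    proof (rule tendsto_upperbound[OF cylinder_limit(1)[OF fin_k dep]])
      show "\<forall>\<^sub>F n in sequentially. measure (wired_ust_law G (Wn n)) {F. O' k F} \<le> c"
        using ev
      proof (rule eventually_mono)
        fix n assume n: "measure (wired_ust_law G (Wn n)) {F. \<Psi> F} \<le> c"
        interpret N: prob_space "wired_ust_law G (Wn n)"
          unfolding wired_ust_law_def by (rule measure_pmf.prob_space_distr) simp
        have "measure (wired_ust_law G (Wn n)) {F. O' k F} \<le> measure (wired_ust_law G (Wn n)) {F. \<Psi> F}"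
          using un meas by (intro N.finite_measure_mono) (auto simp: wired_ust_law_def)
        then show "measure (wired_ust_law G (Wn n)) {F. O' k F} \<le> c" using n by simp
      qed
    qed auto
    moreover have mk: "{F. O' k F} \<in> sets borel" for k by (rule cylinder_limit(2)[OF fin_k dep])
    have inc: "incseq (\<lambda>k. {F. O' k F})"
      unfolding incseq_def O'_def
    proof (intro allI impI subsetI CollectI)
      fix m n F assume "m \<le> n" "F \<in> {F. \<exists>i\<le>m. \<forall>p\<in>f i. F p}"
      then obtain i where "i \<le> m" "\<forall>p\<in>f i. F p" by blast
      then show "\<exists>i\<le>n. \<forall>p\<in>f i. F p" using \<open>m \<le> n\<close> by (intro exI[of _ i]) simp
    qed
    have "(\<lambda>k. measure \<mu> {F. O' k F}) \<longlonglongrightarrow> measure \<mu> (\<Union>k. {F. O' k F})"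
      using mk by (intro M.finite_Lim_measure_incseq inc image_subsetI) (simp add: sets_mu)
    ultimately show ?thesis unfolding un by (intro LIMSEQ_le_const2) auto
  qed
qed

lemma null_events:
  assumes v: "v \<in> V"
  shows "measure \<mu> {F. two_lengths v F \<or> branching F} = 0"
proof -
  have "measure \<mu> {F. two_lengths v F} \<le> 0" by (rule limit_le[OF finitary_two_lengths v wnet.wired_two_lengths])
  moreover have "measure \<mu> {F. branching F} \<le> 0" by (rule limit_le[OF finitary_branching v]) (rule wnet.wired_branching)
  moreover have "{F. two_lengths v F} \<in> sets \<mu>" "{F. branching F} \<in> sets \<mu>"
    using pred_finitary[OF finitary_two_lengths[of v]] pred_finitary[OF finitary_branching] by (simp_all add: pred_def sets_mu)
  then have "measure \<mu> ({F. two_lengths v F} \<union> {F. branching F}) \<le> measure \<mu> {F. two_lengths v F} + measure \<mu> {F. branching F}"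
    by (rule measure_Un_le)
  ultimately have "measure \<mu> ({F. two_lengths v F} \<union> {F. branching F}) \<le> 0" by linarith
  moreover have "{F. two_lengths v F \<or> branching F} = {F. two_lengths v F} \<union> {F. branching F}" by blast
  ultimately show ?thesis using measure_nonneg[of \<mu> "{F. two_lengths v F \<or> branching F}"] by (simp only: antisym)
qed

text \<open>The deterministic comparisons between paths, diameter and volume hold for forests;
  configurations that are not forest-like are absorbed in a null event.\<close>

lemma null_mono:
  assumes v: "v \<in> V" and A: "{F. A F} \<in> sets borel" and B: "{F. B F} \<in> sets borel"
    and imp: "\<And>F. A F \<Longrightarrow> \<not> two_lengths v F \<Longrightarrow> \<not> branching F \<Longrightarrow> B F"
  shows "measure \<mu> {F. A F} \<le> measure \<mu> {F. B F}"
proof -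
  let ?N = "{F. two_lengths v F \<or> branching F}"
  have N: "?N \<in> sets \<mu>"
    using pred_finitary[OF finitary_two_lengths[of v]] pred_finitary[OF finitary_branching] by (simp add: pred_def sets_mu Collect_disj_eq sets.Un)
  have "measure \<mu> {F. A F} \<le> measure \<mu> ({F. B F} \<union> ?N)"
    using imp B N by (intro M.finite_measure_mono) (auto simp: sets_mu)
  also have "\<dots> \<le> measure \<mu> {F. B F} + measure \<mu> ?N" using B N by (intro measure_Un_le) (auto simp: sets_mu)
  finally show ?thesis using null_events[OF v] by simp
qed

lemma pcount_limit:
  assumes v: "v \<in> V" and r: "1 \<le> r" and s: "1 \<le> s" and q: "0 < q_prob G v"
    and vol: "2 * CV * sqrt (real (s - 1)) \<le> real r * q_prob G v / (8 * (2 * AA)\<^sup>2)"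
  shows "\<exists>U0 E0. {F. s \<le> pcount U0 E0 v {r..2 * r} F} \<in> sets borel \<and>
    q_prob G v / (288 * ((2 * AA)\<^sup>2)\<^sup>2 * BW.BB\<^sup>2 * real r) \<le> measure \<mu> {F. s \<le> pcount U0 E0 v {r..2 * r} F}"
proof -
  obtain U0 E0 \<delta> \<delta>' where U0: "finite U0" "U0 \<subseteq> V" "v \<in> U0" and E0: "finite E0"
    and tail: "\<forall>j\<le>2 * r. prb (paths j v) {xs. \<not> set xs \<subseteq> U0} \<le> \<delta>"
    and edge: "\<forall>u\<in>U0. prb (walk_edge G u) (- E0) \<le> \<delta>'"
    and small: "BW.BB ^ (2 * r) * \<delta> \<le> q_prob G v / 2"
    and small': "(2 * AA)\<^sup>2 * BW.BB ^ (2 * r + 1) * (real (2 * r + 1) * \<delta>) + real (card (past_lists U0 v {r..2 * r})) * (real (card U0) * (BW.BB * \<delta>'))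
      \<le> real r * q_prob G v / (8 * (2 * AA)\<^sup>2)"
    using exists_truncation[OF v r q] by (elim exE conjE)
  have dep: "pcount U0 E0 v {r..2 * r} F = pcount U0 E0 v {r..2 * r} F'" if eq: "\<And>p. p \<in> U0 \<times> E0 \<Longrightarrow> F p = F' p" for F F'
  proof -
    have "arc_path E0 F (rev (v # zs)) = arc_path E0 F' (rev (v # zs))" if "zs \<in> past_lists U0 v {r..2 * r}" for zs
      unfolding arc_path_def
    proof (rule successively_cong[OF _ refl])
      fix x y assume "x \<in> set (rev (v # zs))"
      then have "x \<in> U0" using that U0(3) by (auto simp: past_lists_def)
      then show "(\<exists>e\<in>E0 \<inter> edges G. F (x, e) \<and> ends G e = {x, y}) = (\<exists>e\<in>E0 \<inter> edges G. F' (x, e) \<and> ends G e = {x, y})"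
        using eq by auto
    qed
    then show ?thesis unfolding pcount_def by (intro arg_cong[where f = card] Collect_cong conj_cong refl)
  qed
  have dep': "(s \<le> pcount U0 E0 v {r..2 * r} F) = (s \<le> pcount U0 E0 v {r..2 * r} F')" if "\<And>p. p \<in> U0 \<times> E0 \<Longrightarrow> F p = F' p" for F F'
    using dep[OF that] by simp
  have fa: "finite (U0 \<times> E0)" using U0 E0 by simp
  have meas: "{F. s \<le> pcount U0 E0 v {r..2 * r} F} \<in> sets borel" by (rule cylinder_limit(2)[OF fa dep'])
  have "q_prob G v / (288 * ((2 * AA)\<^sup>2)\<^sup>2 * BW.BB\<^sup>2 * real r) \<le> measure \<mu> {F. s \<le> pcount U0 E0 v {r..2 * r} F}"
  proof (rule limit_ge[OF fa dep' U0(1,2)])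
    fix D assume D: "wnet G D" and UD: "U0 \<subseteq> D"
    interpret N: wnet G D by (rule D)
    have "q_prob G v / (288 * ((2 * AA)\<^sup>2)\<^sup>2 * BW.BB\<^sup>2 * real r) \<le> prb N.forest_pmf {\<eta>. s \<le> pcount U0 E0 v {r..2 * r} (N.arc_map \<eta>)}"
      by (rule N.pcount_lower[OF _ UD r s q _ _ small small' vol]) (use UD U0 tail edge in auto)
    then show "q_prob G v / (288 * ((2 * AA)\<^sup>2)\<^sup>2 * BW.BB\<^sup>2 * real r) \<le> measure (wired_ust_law G D) {F. s \<le> pcount U0 E0 v {r..2 * r} F}"
      using meas by (subst N.measure_wired_ust_law) (auto simp: pred_def)
  qed
  then show ?thesis using meas by blast
qed

end

context net
begin

section \<open>Constants and the four bounds for the limit law\<close>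

lemma CD_pos: "1 \<le> BW.CD" and CV_pos: "0 < CV"
  using BW.CD(1) by (auto simp: CV_def add_pos_nonneg)

lemma q_prob_bounds: "v \<in> V \<Longrightarrow> 0 \<le> q_prob G v \<and> q_prob G v \<le> 1"
proof -
  assume "v \<in> V"
  then interpret pair_prob_space "walk_law G v" "walk_law G v"
    using prob_space_walk_law by (intro pair_prob_space.intro pair_sigma_finite.intro prob_space_imp_sigma_finite)
  show ?thesis unfolding q_prob_def by simp
qed

definition \<kappa> :: real where "\<kappa> = 1 / (288 * ((2 * AA)\<^sup>2)\<^sup>2 * BW.BB\<^sup>2)"

text \<open>Chosen so that \<open>2 * CV * sqrt R\<close> equals
  \<open>\<Lambda> * sqrt R / (8 * (2 * AA)\<^sup>2)\<close>, the form of the volume condition in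
  \<open>pcount_limit\<close>.\<close>

definition \<Lambda> :: real where "\<Lambda> = 16 * (2 * AA)\<^sup>2 * CV"

lemma BB_pos: "0 < BW.BB"
proof -
  obtain v where v: "v \<in> V" using V_ne by blast
  interpret W0: wnet G "{v}" by (rule wnetI) (use v in auto)
  show ?thesis using W0.W.B_ge_1[of "Some v"] W0.W.SI by (simp add: W0.W.B_BB)
qed

lemma \<kappa>_pos: "0 < \<kappa>" and \<Lambda>_pos: "0 < \<Lambda>"
  using AA(1) BB_pos CV_pos by (auto simp: \<kappa>_def \<Lambda>_def)

end

context wusf_limit
begin

lemma pcount_limit':
  assumes "v \<in> V" "1 \<le> r" "1 \<le> s" "0 < q_prob G v" "2 * CV * sqrt (real (s - 1)) \<le> real r * q_prob G v / (8 * (2 * AA)\<^sup>2)"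
  shows "\<exists>U0 E0. {F. s \<le> pcount U0 E0 v {r..2 * r} F} \<in> sets borel \<and> \<kappa> * q_prob G v / real r \<le> measure \<mu> {F. s \<le> pcount U0 E0 v {r..2 * r} F}"
  using pcount_limit[OF assms] by (simp add: \<kappa>_def)

lemma diam_upper:
  assumes v: "v \<in> V" and R: "1 \<le> R"
  shows "measure \<mu> {F. ereal R \<le> ereal_of_enat (graph_diam (past G F v))} \<le> 8 * BW.CD / R"
proof -
  let ?k = "nat \<lceil>R\<rceil>" and ?N = "(nat \<lceil>R\<rceil> + 1) div 2"
  have k: "R \<le> real ?k" "1 \<le> ?k" using R by linarith+
  have N: "1 \<le> ?N" "real ?k / 2 \<le> real ?N" using k(2) by linarith+
  have "measure \<mu> {F. ereal R \<le> ereal_of_enat (graph_diam (past G F v))} \<le> measure \<mu> {F. long_past v ?N F}"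
    unfolding le_ereal_of_enat_iff using diam_past_long[OF k(2)] pred_finitary[OF finitary_long_past[of v ?N]]
    by (intro M.finite_measure_mono) (auto simp: pred_def sets_mu)
  also have "\<dots> \<le> 4 * BW.CD / real ?N" by (rule limit_le[OF finitary_long_past v]) (rule wnet.wired_long_past_le[OF _ _ N(1)])
  also have "\<dots> \<le> 4 * BW.CD / (R / 2)"
  proof (rule divide_left_mono)
    show le: "R / 2 \<le> real ?N" using N(2) k(1) by linarith
    show "0 < real ?N * (R / 2)" using le R by (intro mult_pos_pos) linarith+
  qed (use CD_pos in simp)
  finally show ?thesis by simp
qed

lemma volume_upper:
  assumes v: "v \<in> V" and R: "1 \<le> R"
  shows "measure \<mu> {F. ereal R \<le> ereal_of_enat (num_verts (past G F v))} \<le> CV / sqrt R"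
proof -
  let ?k = "nat \<lceil>R\<rceil>"
  have k: "R \<le> real ?k" "1 \<le> ?k" using R by linarith+
  have "measure \<mu> {F. large_past v ?k F} \<le> CV / sqrt (real ?k)"
    by (rule limit_le[OF finitary_large_past v]) (rule wnet.wired_large_past_le[OF _ _ k(2)])
  also have "\<dots> \<le> CV / sqrt R" using CV_pos k R by (intro divide_left_mono mult_pos_pos) auto
  finally show ?thesis unfolding le_ereal_of_enat_iff num_verts_past_iff .
qed

text \<open>One past path of length at least \<open>?k\<close> suffices, so the threshold is 1 and
  the volume condition is empty. The factor 1/2 pays for rounding \<open>R\<close> up.\<close>

lemma diam_lower:
  assumes v: "v \<in> V" and R: "1 \<le> R"
  shows "\<kappa> / 2 * q_prob G v / R \<le> measure \<mu> {F. ereal R \<le> ereal_of_enat (graph_diam (past G F v))}"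
proof (cases "q_prob G v = 0")
  case False
  let ?k = "nat \<lceil>R\<rceil>"
  have q: "0 < q_prob G v" using False q_prob_bounds[OF v] by simp
  have k: "real ?k \<le> 2 * R" "1 \<le> ?k" using R by linarith+
  have "2 * CV * sqrt (real (1 - 1)) \<le> real ?k * q_prob G v / (8 * (2 * AA)\<^sup>2)" using q by simp
  from pcount_limit'[OF v k(2) order_refl q this] obtain U0 E0 where U: "{F. 1 \<le> pcount U0 E0 v {?k..2 * ?k} F} \<in> sets borel"
    and le: "\<kappa> * q_prob G v / real ?k \<le> measure \<mu> {F. 1 \<le> pcount U0 E0 v {?k..2 * ?k} F}" by blast
  have "\<kappa> / 2 * q_prob G v / R = \<kappa> * q_prob G v / (2 * R)" by simp
  also have "\<dots> \<le> \<kappa> * q_prob G v / real ?k" using k R q \<kappa>_pos by (intro divide_left_mono mult_pos_pos) auto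
  also note le
  also have "measure \<mu> {F. 1 \<le> pcount U0 E0 v {?k..2 * ?k} F} \<le> measure \<mu> {F. enat ?k \<le> graph_diam (past G F v)}"
    using pred_diam[OF v k(2)] by (intro null_mono[OF v U] pcount_diam[OF _ k(2)]) (auto simp: pred_def)
  finally show ?thesis unfolding le_ereal_of_enat_iff .
qed simp

lemma volume_lower:
  assumes v: "v \<in> V" and R: "1 \<le> R"
  shows "\<kappa> / (\<Lambda> + 1) * (q_prob G v)\<^sup>2 / sqrt R \<le> measure \<mu> {F. ereal R \<le> ereal_of_enat (num_verts (past G F v))}"
proof (cases "q_prob G v = 0")
  case False
  let ?q = "q_prob G v" and ?s = "nat \<lceil>R\<rceil>"
  \<comment> \<open>The mean count between levels \<open>r\<close> and \<open>2 * r\<close> is of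
    order \<open>r * ?q\<close>. This \<open>r\<close> makes it exceed the total contribution of
    counts below \<open>R\<close>, which is of order \<open>sqrt R\<close>; the probability
    \<open>?q / r\<close> then becomes \<open>?q\<^sup>2 / sqrt R\<close>.\<close>
  define r where "r = nat \<lceil>\<Lambda> * sqrt R / ?q\<rceil>"
  have q: "0 < ?q" "?q \<le> 1" using False q_prob_bounds[OF v] by auto
  have s: "1 \<le> ?s" "real (?s - 1) \<le> R" using R by linarith+
  have sR: "1 \<le> sqrt R" using R by simp
  have t: "0 < \<Lambda> * sqrt R / ?q" using \<Lambda>_pos q sR by (intro divide_pos_pos mult_pos_pos) auto
  then have r: "1 \<le> r" "\<Lambda> * sqrt R / ?q \<le> real r" "real r \<le> \<Lambda> * sqrt R / ?q + 1" unfolding r_def by linarith+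
  have r_le: "real r \<le> (\<Lambda> + 1) * sqrt R / ?q"
  proof -
    have "1 \<le> sqrt R / ?q" using order_trans[OF q(2) sR] q by (simp add: le_divide_eq)
    then show ?thesis using r(3) by (simp add: distrib_right add_divide_distrib)
  qed
  have "2 * CV * sqrt (real (?s - 1)) \<le> real r * ?q / (8 * (2 * AA)\<^sup>2)"
  proof -
    have A0: "0 < (2 * AA)\<^sup>2" using AA(1) by simp
    have "2 * CV * sqrt (real (?s - 1)) \<le> 2 * CV * sqrt R" using s CV_pos by (intro mult_left_mono) auto
    also have "\<dots> = \<Lambda> * sqrt R / (8 * (2 * AA)\<^sup>2)" using A0 by (simp add: \<Lambda>_def)
    also have "\<dots> \<le> real r * ?q / (8 * (2 * AA)\<^sup>2)" using r(2) q A0 by (intro divide_right_mono) (auto simp: divide_le_eq)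
    finally show ?thesis .
  qed
  from pcount_limit'[OF v r(1) s(1) q(1) this] obtain U0 E0 where U: "{F. ?s \<le> pcount U0 E0 v {r..2 * r} F} \<in> sets borel"
    and le: "\<kappa> * ?q / real r \<le> measure \<mu> {F. ?s \<le> pcount U0 E0 v {r..2 * r} F}" by blast
  have "\<kappa> / (\<Lambda> + 1) * ?q\<^sup>2 / sqrt R = \<kappa> * ?q / ((\<Lambda> + 1) * sqrt R / ?q)" by (simp add: power2_eq_square)
  also have "\<dots> \<le> \<kappa> * ?q / real r" using r_le r(1) q \<kappa>_pos \<Lambda>_pos sR by (intro divide_left_mono mult_pos_pos divide_pos_pos) auto
  also note le
  also have "measure \<mu> {F. ?s \<le> pcount U0 E0 v {r..2 * r} F} \<le> measure \<mu> {F. large_past v ?s F}"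
    using pred_finitary[OF finitary_large_past[of v ?s]] by (intro null_mono[OF v U] pcount_large) (auto simp: pred_def)
  finally show ?thesis unfolding le_ereal_of_enat_iff num_verts_past_iff .
qed simp

end

theorem theorem1p2:
  fixes G :: "('v, 'e) network"
  assumes "is_network G"
    and "controlled_stationary_measure G"
    and "bubble_norm G < \<infinity>"
  shows "\<exists>c C :: real. 0 < c \<and> c \<le> C \<and>
    (\<forall>\<mu>. is_oriented_wusf G \<mu> \<longrightarrow>
      (\<forall>v\<in>verts G. \<forall>R::real. 1 \<le> R \<longrightarrow>
        c * q_prob G v * R powr (- 1)
          \<le> \<P>(F in \<mu>. ereal R \<le> ereal_of_enat (graph_diam (past G F v))) \<and>
        \<P>(F in \<mu>. ereal R \<le> ereal_of_enat (graph_diam (past G F v)))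
          \<le> C * R powr (- 1) \<and>
        c * q_prob G v powr (5 / 2) * R powr (- 1 / 2)
          \<le> \<P>(F in \<mu>. ereal R \<le> ereal_of_enat (num_verts (past G F v))) \<and>
        \<P>(F in \<mu>. ereal R \<le> ereal_of_enat (num_verts (past G F v)))
          \<le> C * R powr (- 1 / 2)))"
proof -
  interpret net G by (rule net.intro[OF assms])
  define c where "c = min (\<kappa> / 2) (\<kappa> / (\<Lambda> + 1))"
  define C where "C = max c (max (8 * BW.CD) CV)"
  have c1: "c \<le> \<kappa> / 2" "c \<le> \<kappa> / (\<Lambda> + 1)" unfolding c_def by (rule min.cobounded1, rule min.cobounded2)
  have C1: "8 * BW.CD \<le> C" "CV \<le> C" unfolding C_def by (simp_all add: le_max_iff_disj)
  have c0: "0 < c" using \<kappa>_pos \<Lambda>_pos by (simp add: c_def)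
  show ?thesis
  proof (rule exI[of _ c], rule exI[of _ C], intro conjI allI impI ballI)
    show "0 < c" by (rule c0)
    show "c \<le> C" by (simp add: C_def)
    fix \<mu> and v and R :: real assume \<mu>: "is_oriented_wusf G \<mu>" and v: "v \<in> V" and R: "1 \<le> R"
    have \<mu>': "prob_space \<mu>" "sets \<mu> = sets borel" "\<exists>W. exhaustion G W \<and> weakly_converges (\<lambda>n. wired_ust_law G (W n)) \<mu>"
      by (simp_all only: \<mu>[unfolded is_oriented_wusf_def])
    then obtain Wn where Wn: "exhaustion G Wn" "weakly_converges (\<lambda>n. wired_ust_law G (Wn n)) \<mu>" by (elim exE conjE)
    interpret L: wusf_limit G \<mu> Wn
      by (rule wusf_limit.intro[OF net_axioms wusf_limit_axioms.intro[OF \<mu>'(1,2) Wn]])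
    have R1: "R powr (- 1) = 1 / R" and R2: "R powr (- 1 / 2) = 1 / sqrt R"
      using R by (simp_all add: powr_minus_divide powr_half_sqrt[symmetric])
    have q: "0 \<le> q_prob G v" "q_prob G v \<le> 1" using q_prob_bounds[OF v] by auto
    have P: "\<P>(F in \<mu>. \<Psi> F) = measure \<mu> {F. \<Psi> F}" for \<Psi> by (simp add: L.space_mu)
    have "c * q_prob G v * R powr (- 1) \<le> \<kappa> / 2 * q_prob G v / R"
      unfolding R1 mult_1_right times_divide_eq_right using R q by (intro divide_right_mono mult_right_mono c1) auto
    also note L.diam_lower[OF v R]
    finally show "c * q_prob G v * R powr (- 1) \<le> \<P>(F in \<mu>. ereal R \<le> ereal_of_enat (graph_diam (past G F v)))" unfolding P .
    have "8 * BW.CD / R \<le> C * R powr (- 1)" unfolding R1 mult_1_right times_divide_eq_right using R by (intro divide_right_mono C1) auto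
    then show "\<P>(F in \<mu>. ereal R \<le> ereal_of_enat (graph_diam (past G F v))) \<le> C * R powr (- 1)"
      unfolding P using L.diam_upper[OF v R] by linarith
    \<comment> \<open>For a number in the unit interval the smaller exponent gives the larger power,
      so the quadratic bound implies the stated one.\<close>
    have "q_prob G v powr (5 / 2) \<le> (q_prob G v)\<^sup>2"
    proof (cases "q_prob G v = 0")
      case False
      then have "q_prob G v powr (5 / 2) \<le> q_prob G v powr 2" using q by (intro powr_mono') auto
      then show ?thesis using False q by (simp add: powr_numeral)
    qed simp
    then have "c * q_prob G v powr (5 / 2) \<le> \<kappa> / (\<Lambda> + 1) * (q_prob G v)\<^sup>2"
      using c1(2) c0 \<kappa>_pos \<Lambda>_pos by (intro mult_mono) auto
    then have "c * q_prob G v powr (5 / 2) * R powr (- 1 / 2) \<le> \<kappa> / (\<Lambda> + 1) * (q_prob G v)\<^sup>2 / sqrt R"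
      unfolding R2 mult_1_right times_divide_eq_right using R by (intro divide_right_mono) auto
    also note L.volume_lower[OF v R]
    finally show "c * q_prob G v powr (5 / 2) * R powr (- 1 / 2) \<le> \<P>(F in \<mu>. ereal R \<le> ereal_of_enat (num_verts (past G F v)))" unfolding P .
    have "CV / sqrt R \<le> C * R powr (- 1 / 2)" unfolding R2 mult_1_right times_divide_eq_right using R by (intro divide_right_mono C1) auto
    then show "\<P>(F in \<mu>. ereal R \<le> ereal_of_enat (num_verts (past G F v))) \<le> C * R powr (- 1 / 2)"
      unfolding P using L.volume_upper[OF v R] by linarith
  qed
qed

end
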